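(* Let $\mathcal{G}$ be a finite 2-group. The auto-equivalence 2-group $\mathrm{Aut}^{\mathrm{E}_3}_{\mathcal{G}}(\mathcal{F}_l(\mathcal{G}))$ is equivalent to $\mathcal{G}$, where $\mathcal{G}$ acts on $\mathcal{F}_l(\mathcal{G})$ by right translation; that is, the monoidal functor $\mathcal{G} \to \mathrm{Aut}^{\mathrm{E}_3}_{\mathcal{G}}(\mathcal{F}_l(\mathcal{G}))$, $g \mapsto (g \odot^r -)$, is an equivalence. Similarly, $\mathrm{Aut}^{\mathrm{E}_3}_{\mathcal{G}}(\mathcal{F}_r(\mathcal{G}))$ is equivalent to $\mathcal{G}$, acting on $\mathcal{F}_r(\mathcal{G})$ by left translation $g \mapsto (g \odot^l -)$.
   Context: Throughout, $k$ is an algebraically closed field of characteristic zero, and $\mathrm{Vec}$ is the category of finite-dimensional $k$-vector spaces. A 2-group is a monoidal category in which every object is invertible with respect to $\otimes$ and every morphism is an isomorphism; equivalence of 2-groups means monoidal equivalence. A 2-group $\mathcal{G}$ is finite if the group $\pi_1(\mathcal{G})$ of isomorphism classes of objects and the abelian group $\pi_2(\mathcal{G}) = \mathrm{End}_{\mathcal{G}}(\mathbf{1})$ are finite. Every 2-group is assumed equipped with an inverse functor $(-)^* \colon \mathcal{G} \to \mathcal{G}^{\mathrm{rev}}$ (where $\mathrm{rev}$ denotes the reversed tensor product), given on objects by a chosen left dual $g^* = g^L$ and on morphisms by $a^* = (a^L)^{-1}$. $2\mathrm{Rep}(\mathcal{G})$ is the 2-category of finite semisimple $k$-linear categories with a left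 $\mathcal{G}$-action (a monoidal functor $\mathcal{G} \to \mathrm{End}_k(\mathcal{V})$), $k$-linear left $\mathcal{G}$-module functors and left $\mathcal{G}$-module natural transformations, with tensor product $\mathcal{V}\boxtimes\mathcal{W}$ (Deligne) and diagonal action. Let $\mathrm{Fun}(\mathcal{G}, \mathrm{Vec})$ be the (finite semisimple) category of functors $\mathcal{G} \to \mathrm{Vec}$. It carries two left $\mathcal{G}$-actions: right translation $(g \odot^r F)(h) := F(h \otimes g)$ and left translation $(g \odot^l F)(h) := F(g^* \otimes h)$. The resulting 2-representations are $\mathcal{F}_r(\mathcal{G})$ (right translation action) and $\mathcal{F}_l(\mathcal{G})$ (left translation action). With the point-wise tensor product $(F \otimes F')(g) = F(g) \otimes F'(g)$ and the symmetry of $\mathrm{Vec}$, $\mathrm{Fun}(\mathcal{G},\mathrm{Vec})$ is a symmetric multi-fusion category, and since this structure is $\mathcal{G}$-equivariant, $\mathcal{F}_l(\mathcal{G})$ and $\mathcal{F}_r(\mathcal{G})$ are symmetric algebras in $2\mathrm{Rep}(\mathcal{G})$, called the left and right regular algebras. For such a symmetric algebra $\mathcal{F}$, $\mathrm{Aut}^{\mathrm{E}_3}_{\mathcal{G}}(\mathcal{F})$ is the 2-group whose objects are the auto-equivalences of $\mathcal{F}$ as a symmetric algebra in $2\mathrm{Rep}(\mathcal{G})$, i.e. $k$-linear auto-equivalences with compatible symmetric monoidal functor and left $\mathcal{G}$-module functor structures, whose morphisms are natural isomorphisms that are both monoidal and left $\mathcal{G}$-module natural transformations, and whose tensor product is composition.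 *)

theory Defs
  imports "Jordan_Normal_Form.VS_Connect"
begin

section \<open>Categories and functors\<close>

record ('o, 'm) precat =
  Obj :: "'o set"
  Arr :: "'m set"
  Src :: "'m \<Rightarrow> 'o"
  Tgt :: "'m \<Rightarrow> 'o"
  Idn :: "'o \<Rightarrow> 'm"
  Cmp :: "'m \<Rightarrow> 'm \<Rightarrow> 'm"  (infixl \<open>\<diamondop>\<index>\<close> 68)

definition homs :: "('o, 'm, 'x) precat_scheme \<Rightarrow> 'o \<Rightarrow> 'o \<Rightarrow> 'm set" where
  "homs C x y = {f \<in> Arr C. Src C f = x \<and> Tgt C f = y}"

locale category =
  fixes C :: "('o, 'm, 'x) precat_scheme" (structure)
  assumes src_obj: "f \<in> Arr C \<Longrightarrow> Src C f \<in> Obj C"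
    and tgt_obj: "f \<in> Arr C \<Longrightarrow> Tgt C f \<in> Obj C"
    and idn_hom: "x \<in> Obj C \<Longrightarrow> Idn C x \<in> homs C x x"
    and cmp_hom: "f \<in> homs C x y \<Longrightarrow> g \<in> homs C y z \<Longrightarrow> g \<diamondop> f \<in> homs C x z"
    and cmp_idn_right: "f \<in> homs C x y \<Longrightarrow> f \<diamondop> Idn C x = f"
    and cmp_idn_left: "f \<in> homs C x y \<Longrightarrow> Idn C y \<diamondop> f = f"
    and cmp_assoc: "f \<in> homs C w x \<Longrightarrow> g \<in> homs C x y \<Longrightarrow> h \<in> homs C y z \<Longrightarrow>
      (h \<diamondop> g) \<diamondop> f = h \<diamondop> (g \<diamondop> f)"

definition inverse_arrows ::
  "('o, 'm, 'x) precat_scheme \<Rightarrow> 'm \<Rightarrow> 'm \<Rightarrow> bool" where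
  "inverse_arrows C f g \<longleftrightarrow> f \<in> Arr C \<and> g \<in> homs C (Tgt C f) (Src C f) \<and>
     g \<diamondop>\<^bsub>C\<^esub> f = Idn C (Src C f) \<and> f \<diamondop>\<^bsub>C\<^esub> g = Idn C (Tgt C f)"

definition is_iso :: "('o, 'm, 'x) precat_scheme \<Rightarrow> 'm \<Rightarrow> bool" where
  "is_iso C f \<longleftrightarrow> (\<exists>g. inverse_arrows C f g)"

definition isos :: "('o, 'm, 'x) precat_scheme \<Rightarrow> 'o \<Rightarrow> 'o \<Rightarrow> 'm set" where
  "isos C x y = {f \<in> homs C x y. is_iso C f}"

definition inv_arr :: "('o, 'm, 'x) precat_scheme \<Rightarrow> 'm \<Rightarrow> 'm" where
  "inv_arr C f = (THE g. inverse_arrows C f g)"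

definition iso_rel :: "('o, 'm, 'x) precat_scheme \<Rightarrow> ('o \<times> 'o) set" where
  "iso_rel C = {(x, y). x \<in> Obj C \<and> y \<in> Obj C \<and> isos C x y \<noteq> {}}"

record ('o1, 'm1, 'o2, 'm2) func =
  FO :: "'o1 \<Rightarrow> 'o2"
  FA :: "'m1 \<Rightarrow> 'm2"

text \<open>
  Functors, natural transformations and the structure maps below are total functions that are
  required to be undefined outside the relevant carrier sets, so that equality of such data is
  equality in the mathematical sense.
\<close>

definition extensional2 :: "'a set \<Rightarrow> 'b set \<Rightarrow> ('a \<Rightarrow> 'b \<Rightarrow> 'c) \<Rightarrow> bool" where
  "extensional2 A B f \<longleftrightarrow> (\<lambda>(x, y). f x y) \<in> extensional (A \<times> B)"

definition restrict2 :: "'a set \<Rightarrow> 'b set \<Rightarrow> ('a \<Rightarrow> 'b \<Rightarrow> 'c) \<Rightarrow> 'a \<Rightarrow> 'b \<Rightarrow> 'c" where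
  "restrict2 A B f = (\<lambda>x y. if x \<in> A \<and> y \<in> B then f x y else undefined)"

definition is_functor ::
  "('o1, 'm1, 'x) precat_scheme \<Rightarrow> ('o2, 'm2, 'y) precat_scheme \<Rightarrow>
   ('o1, 'm1, 'o2, 'm2, 'z) func_scheme \<Rightarrow> bool" where
  "is_functor C D F \<longleftrightarrow>
     FO F \<in> Obj C \<rightarrow>\<^sub>E Obj D \<and> FA F \<in> extensional (Arr C) \<and>
     (\<forall>x y. \<forall>f \<in> homs C x y. FA F f \<in> homs D (FO F x) (FO F y)) \<and>
     (\<forall>x \<in> Obj C. FA F (Idn C x) = Idn D (FO F x)) \<and>
     (\<forall>x y z. \<forall>f \<in> homs C x y. \<forall>g \<in> homs C y z. FA F (g \<diamondop>\<^bsub>C\<^esub> f) = FA F g \<diamondop>\<^bsub>D\<^esub> FA F f)"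

definition id_func :: "('o, 'm, 'x) precat_scheme \<Rightarrow> ('o, 'm, 'o, 'm) func" where
  "id_func C = \<lparr>FO = (\<lambda>x \<in> Obj C. x), FA = (\<lambda>f \<in> Arr C. f)\<rparr>"

definition comp_func ::
  "('o1, 'm1, 'x) precat_scheme \<Rightarrow> ('o2, 'm2, 'o3, 'm3, 'y) func_scheme \<Rightarrow>
   ('o1, 'm1, 'o2, 'm2, 'z) func_scheme \<Rightarrow> ('o1, 'm1, 'o3, 'm3) func" where
  "comp_func C F' F =
     \<lparr>FO = (\<lambda>x \<in> Obj C. FO F' (FO F x)), FA = (\<lambda>f \<in> Arr C. FA F' (FA F f))\<rparr>"

definition nat_trans ::
  "('o1, 'm1, 'x) precat_scheme \<Rightarrow> ('o2, 'm2, 'y) precat_scheme \<Rightarrow>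
   ('o1, 'm1, 'o2, 'm2, 'z) func_scheme \<Rightarrow> ('o1, 'm1, 'o2, 'm2, 'w) func_scheme \<Rightarrow>
   ('o1 \<Rightarrow> 'm2) \<Rightarrow> bool" where
  "nat_trans C D F F' \<eta> \<longleftrightarrow>
     \<eta> \<in> extensional (Obj C) \<and>
     (\<forall>x \<in> Obj C. \<eta> x \<in> homs D (FO F x) (FO F' x)) \<and>
     (\<forall>x y. \<forall>f \<in> homs C x y. FA F' f \<diamondop>\<^bsub>D\<^esub> \<eta> x = \<eta> y \<diamondop>\<^bsub>D\<^esub> FA F f)"

definition nat_iso ::
  "('o1, 'm1, 'x) precat_scheme \<Rightarrow> ('o2, 'm2, 'y) precat_scheme \<Rightarrow>
   ('o1, 'm1, 'o2, 'm2, 'z) func_scheme \<Rightarrow> ('o1, 'm1, 'o2, 'm2, 'w) func_scheme \<Rightarrow>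
   ('o1 \<Rightarrow> 'm2) \<Rightarrow> bool" where
  "nat_iso C D F F' \<eta> \<longleftrightarrow> nat_trans C D F F' \<eta> \<and> (\<forall>x \<in> Obj C. is_iso D (\<eta> x))"

definition category_equivalence ::
  "('o1, 'm1, 'x) precat_scheme \<Rightarrow> ('o2, 'm2, 'y) precat_scheme \<Rightarrow>
   ('o1, 'm1, 'o2, 'm2, 'z) func_scheme \<Rightarrow> bool" where
  "category_equivalence C D F \<longleftrightarrow>
     is_functor C D F \<and>
     (\<exists>H :: ('o2, 'm2, 'o1, 'm1) func. is_functor D C H \<and>
        (\<exists>\<eta>. nat_iso C C (id_func C) (comp_func C H F) \<eta>) \<and>
        (\<exists>\<epsilon>. nat_iso D D (comp_func D F H) (id_func D) \<epsilon>))"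


section \<open>Monoidal categories and monoidal functors\<close>

text \<open>
  \<open>Asc x y z : (x \<otimes> y) \<otimes> z \<rightarrow> x \<otimes> (y \<otimes> z)\<close>, \<open>Lun x : 1 \<otimes> x \<rightarrow> x\<close>, \<open>Run x : x \<otimes> 1 \<rightarrow> x\<close>.
\<close>

record ('o, 'm) moncat = "('o, 'm) precat" +
  TenO :: "'o \<Rightarrow> 'o \<Rightarrow> 'o"  (infixr \<open>\<otimes>\<^sub>o\<index>\<close> 72)
  TenA :: "'m \<Rightarrow> 'm \<Rightarrow> 'm"  (infixr \<open>\<otimes>\<^sub>a\<index>\<close> 72)
  Unt :: "'o"
  Asc :: "'o \<Rightarrow> 'o \<Rightarrow> 'o \<Rightarrow> 'm"
  Lun :: "'o \<Rightarrow> 'm"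
  Run :: "'o \<Rightarrow> 'm"

locale monoidal_category = category C
  for C :: "('o, 'm, 'x) moncat_scheme" (structure) +
  assumes unt_obj: "Unt C \<in> Obj C"
    and tenO_obj: "x \<in> Obj C \<Longrightarrow> y \<in> Obj C \<Longrightarrow> x \<otimes>\<^sub>o y \<in> Obj C"
    and tenA_hom: "f \<in> homs C x x' \<Longrightarrow> g \<in> homs C y y' \<Longrightarrow>
      f \<otimes>\<^sub>a g \<in> homs C (x \<otimes>\<^sub>o y) (x' \<otimes>\<^sub>o y')"
    and tenA_idn: "x \<in> Obj C \<Longrightarrow> y \<in> Obj C \<Longrightarrow> Idn C x \<otimes>\<^sub>a Idn C y = Idn C (x \<otimes>\<^sub>o y)"
    and tenA_cmp: "f \<in> homs C x x' \<Longrightarrow> f' \<in> homs C x' x'' \<Longrightarrow>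
      g \<in> homs C y y' \<Longrightarrow> g' \<in> homs C y' y'' \<Longrightarrow>
      (f' \<diamondop> f) \<otimes>\<^sub>a (g' \<diamondop> g) = (f' \<otimes>\<^sub>a g') \<diamondop> (f \<otimes>\<^sub>a g)"
    and asc_iso: "x \<in> Obj C \<Longrightarrow> y \<in> Obj C \<Longrightarrow> z \<in> Obj C \<Longrightarrow>
      Asc C x y z \<in> isos C ((x \<otimes>\<^sub>o y) \<otimes>\<^sub>o z) (x \<otimes>\<^sub>o (y \<otimes>\<^sub>o z))"
    and asc_nat: "f \<in> homs C x x' \<Longrightarrow> g \<in> homs C y y' \<Longrightarrow> h \<in> homs C z z' \<Longrightarrow>
      Asc C x' y' z' \<diamondop> ((f \<otimes>\<^sub>a g) \<otimes>\<^sub>a h) = (f \<otimes>\<^sub>a (g \<otimes>\<^sub>a h)) \<diamondop> Asc C x y z"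
    and lun_iso: "x \<in> Obj C \<Longrightarrow> Lun C x \<in> isos C (Unt C \<otimes>\<^sub>o x) x"
    and lun_nat: "f \<in> homs C x x' \<Longrightarrow>
      Lun C x' \<diamondop> (Idn C (Unt C) \<otimes>\<^sub>a f) = f \<diamondop> Lun C x"
    and run_iso: "x \<in> Obj C \<Longrightarrow> Run C x \<in> isos C (x \<otimes>\<^sub>o Unt C) x"
    and run_nat: "f \<in> homs C x x' \<Longrightarrow>
      Run C x' \<diamondop> (f \<otimes>\<^sub>a Idn C (Unt C)) = f \<diamondop> Run C x"
    and pentagon: "w \<in> Obj C \<Longrightarrow> x \<in> Obj C \<Longrightarrow> y \<in> Obj C \<Longrightarrow> z \<in> Obj C \<Longrightarrow>
      Asc C w x (y \<otimes>\<^sub>o z) \<diamondop> Asc C (w \<otimes>\<^sub>o x) y z =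
      (Idn C w \<otimes>\<^sub>a Asc C x y z) \<diamondop> Asc C w (x \<otimes>\<^sub>o y) z \<diamondop> (Asc C w x y \<otimes>\<^sub>a Idn C z)"
    and triangle: "x \<in> Obj C \<Longrightarrow> y \<in> Obj C \<Longrightarrow>
      (Idn C x \<otimes>\<^sub>a Lun C y) \<diamondop> Asc C x (Unt C) y = Run C x \<otimes>\<^sub>a Idn C y"

text \<open>\<open>Mu x y : F x \<otimes> F y \<rightarrow> F (x \<otimes> y)\<close> and \<open>Iota : 1 \<rightarrow> F 1\<close>.\<close>

record ('o1, 'm1, 'o2, 'm2) monfunc = "('o1, 'm1, 'o2, 'm2) func" +
  Mu :: "'o1 \<Rightarrow> 'o1 \<Rightarrow> 'm2"
  Iota :: "'m2"

definition monoidal_functor ::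
  "('o1, 'm1, 'x) moncat_scheme \<Rightarrow> ('o2, 'm2, 'y) moncat_scheme \<Rightarrow>
   ('o1, 'm1, 'o2, 'm2, 'z) monfunc_scheme \<Rightarrow> bool" where
  "monoidal_functor C D F \<longleftrightarrow>
     is_functor C D F \<and>
     extensional2 (Obj C) (Obj C) (Mu F) \<and>
     (\<forall>x \<in> Obj C. \<forall>y \<in> Obj C.
        Mu F x y \<in> isos D (FO F x \<otimes>\<^sub>o\<^bsub>D\<^esub> FO F y) (FO F (x \<otimes>\<^sub>o\<^bsub>C\<^esub> y))) \<and>
     Iota F \<in> isos D (Unt D) (FO F (Unt C)) \<and>
     (\<forall>x x' y y'. \<forall>f \<in> homs C x x'. \<forall>g \<in> homs C y y'.
        FA F (f \<otimes>\<^sub>a\<^bsub>C\<^esub> g) \<diamondop>\<^bsub>D\<^esub> Mu F x y = Mu F x' y' \<diamondop>\<^bsub>D\<^esub> (FA F f \<otimes>\<^sub>a\<^bsub>D\<^esub> FA F g)) \<and>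
     (\<forall>x \<in> Obj C. \<forall>y \<in> Obj C. \<forall>z \<in> Obj C.
        Mu F x (y \<otimes>\<^sub>o\<^bsub>C\<^esub> z) \<diamondop>\<^bsub>D\<^esub> (Idn D (FO F x) \<otimes>\<^sub>a\<^bsub>D\<^esub> Mu F y z) \<diamondop>\<^bsub>D\<^esub>
          Asc D (FO F x) (FO F y) (FO F z) =
        FA F (Asc C x y z) \<diamondop>\<^bsub>D\<^esub> Mu F (x \<otimes>\<^sub>o\<^bsub>C\<^esub> y) z \<diamondop>\<^bsub>D\<^esub>
          (Mu F x y \<otimes>\<^sub>a\<^bsub>D\<^esub> Idn D (FO F z))) \<and>
     (\<forall>x \<in> Obj C. Lun D (FO F x) =
        FA F (Lun C x) \<diamondop>\<^bsub>D\<^esub> Mu F (Unt C) x \<diamondop>\<^bsub>D\<^esub> (Iota F \<otimes>\<^sub>a\<^bsub>D\<^esub> Idn D (FO F x))) \<and>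
     (\<forall>x \<in> Obj C. Run D (FO F x) =
        FA F (Run C x) \<diamondop>\<^bsub>D\<^esub> Mu F x (Unt C) \<diamondop>\<^bsub>D\<^esub> (Idn D (FO F x) \<otimes>\<^sub>a\<^bsub>D\<^esub> Iota F))"

definition monoidal_nat_trans ::
  "('o1, 'm1, 'x) moncat_scheme \<Rightarrow> ('o2, 'm2, 'y) moncat_scheme \<Rightarrow>
   ('o1, 'm1, 'o2, 'm2, 'z) monfunc_scheme \<Rightarrow> ('o1, 'm1, 'o2, 'm2, 'w) monfunc_scheme \<Rightarrow>
   ('o1 \<Rightarrow> 'm2) \<Rightarrow> bool" where
  "monoidal_nat_trans C D F F' \<eta> \<longleftrightarrow>
     nat_trans C D F F' \<eta> \<and>
     (\<forall>x \<in> Obj C. \<forall>y \<in> Obj C.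
        \<eta> (x \<otimes>\<^sub>o\<^bsub>C\<^esub> y) \<diamondop>\<^bsub>D\<^esub> Mu F x y = Mu F' x y \<diamondop>\<^bsub>D\<^esub> (\<eta> x \<otimes>\<^sub>a\<^bsub>D\<^esub> \<eta> y)) \<and>
     \<eta> (Unt C) \<diamondop>\<^bsub>D\<^esub> Iota F = Iota F'"


section \<open>2-groups\<close>

locale two_group = monoidal_category G
  for G :: "('g, 'a, 'x) moncat_scheme" (structure) +
  assumes arr_iso: "f \<in> Arr G \<Longrightarrow> is_iso G f"
    and obj_invertible: "x \<in> Obj G \<Longrightarrow>
      \<exists>y \<in> Obj G. (x \<otimes>\<^sub>o y, Unt G) \<in> iso_rel G \<and> (y \<otimes>\<^sub>o x, Unt G) \<in> iso_rel G"

locale finite_two_group = two_group G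
  for G :: "('g, 'a, 'x) moncat_scheme" (structure) +
  assumes finite_pi1: "finite (Obj G // iso_rel G)"
    and finite_pi2: "finite (homs G (Unt G) (Unt G))"

definition two_group_equivalence ::
  "('g, 'a, 'x) moncat_scheme \<Rightarrow> ('h, 'b, 'y) moncat_scheme \<Rightarrow>
   ('g, 'a, 'h, 'b, 'z) monfunc_scheme \<Rightarrow> bool" where
  "two_group_equivalence G H F \<longleftrightarrow>
     two_group G \<and> two_group H \<and> monoidal_functor G H F \<and> category_equivalence G H F"

text \<open>
  A choice of left duals \<open>g\<^sup>*\<close>, with \<open>Ev g : g\<^sup>* \<otimes> g \<rightarrow> 1\<close> and \<open>Coev g : 1 \<rightarrow> g \<otimes> g\<^sup>*\<close>.
\<close>

record ('g, 'a) duality =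
  Dual :: "'g \<Rightarrow> 'g"
  Ev :: "'g \<Rightarrow> 'a"
  Coev :: "'g \<Rightarrow> 'a"

definition left_duality :: "('g, 'a, 'x) moncat_scheme \<Rightarrow> ('g, 'a) duality \<Rightarrow> bool" where
  "left_duality G d \<longleftrightarrow> (\<forall>g \<in> Obj G.
     Dual d g \<in> Obj G \<and>
     Ev d g \<in> homs G (Dual d g \<otimes>\<^sub>o\<^bsub>G\<^esub> g) (Unt G) \<and>
     Coev d g \<in> homs G (Unt G) (g \<otimes>\<^sub>o\<^bsub>G\<^esub> Dual d g) \<and>
     Run G g \<diamondop>\<^bsub>G\<^esub> (Idn G g \<otimes>\<^sub>a\<^bsub>G\<^esub> Ev d g) \<diamondop>\<^bsub>G\<^esub> Asc G g (Dual d g) g \<diamondop>\<^bsub>G\<^esub>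
       (Coev d g \<otimes>\<^sub>a\<^bsub>G\<^esub> Idn G g) \<diamondop>\<^bsub>G\<^esub> inv_arr G (Lun G g) = Idn G g \<and>
     Lun G (Dual d g) \<diamondop>\<^bsub>G\<^esub> (Ev d g \<otimes>\<^sub>a\<^bsub>G\<^esub> Idn G (Dual d g)) \<diamondop>\<^bsub>G\<^esub>
       inv_arr G (Asc G (Dual d g) g (Dual d g)) \<diamondop>\<^bsub>G\<^esub>
       (Idn G (Dual d g) \<otimes>\<^sub>a\<^bsub>G\<^esub> Coev d g) \<diamondop>\<^bsub>G\<^esub> inv_arr G (Run G (Dual d g)) = Idn G (Dual d g))"

text \<open>The arrow \<open>y \<rightarrow> g\<^sup>*\<close> corresponding to \<open>e : y \<otimes> g \<rightarrow> 1\<close>.\<close>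

definition to_dual ::
  "('g, 'a, 'x) moncat_scheme \<Rightarrow> ('g, 'a) duality \<Rightarrow> 'g \<Rightarrow> 'g \<Rightarrow> 'a \<Rightarrow> 'a" where
  "to_dual G d y g e =
     Lun G (Dual d g) \<diamondop>\<^bsub>G\<^esub> (e \<otimes>\<^sub>a\<^bsub>G\<^esub> Idn G (Dual d g)) \<diamondop>\<^bsub>G\<^esub> inv_arr G (Asc G y g (Dual d g)) \<diamondop>\<^bsub>G\<^esub>
       (Idn G y \<otimes>\<^sub>a\<^bsub>G\<^esub> Coev d g) \<diamondop>\<^bsub>G\<^esub> inv_arr G (Run G y)"

text \<open>For \<open>a : g \<rightarrow> h\<close> the dual arrow is \<open>a\<^sup>L : h\<^sup>* \<rightarrow> g\<^sup>*\<close>, and \<open>a\<^sup>* = (a\<^sup>L)\<^sup>-\<^sup>1 : g\<^sup>* \<rightarrow> h\<^sup>*\<close>.\<close>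

definition dual_arr :: "('g, 'a, 'x) moncat_scheme \<Rightarrow> ('g, 'a) duality \<Rightarrow> 'a \<Rightarrow> 'a" where
  "dual_arr G d a =
     to_dual G d (Dual d (Tgt G a)) (Src G a)
       (Ev d (Tgt G a) \<diamondop>\<^bsub>G\<^esub> (Idn G (Dual d (Tgt G a)) \<otimes>\<^sub>a\<^bsub>G\<^esub> a))"

definition star_arr :: "('g, 'a, 'x) moncat_scheme \<Rightarrow> ('g, 'a) duality \<Rightarrow> 'a \<Rightarrow> 'a" where
  "star_arr G d a = inv_arr G (dual_arr G d a)"

text \<open>
  The canonical isomorphisms \<open>h\<^sup>* \<otimes> g\<^sup>* \<rightarrow> (g \<otimes> h)\<^sup>*\<close> and \<open>1 \<rightarrow> 1\<^sup>*\<close>, which make \<open>(-)\<^sup>*\<close> a monoidal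
  functor to \<open>G\<close> with the reversed tensor product.
\<close>

definition star_mu :: "('g, 'a, 'x) moncat_scheme \<Rightarrow> ('g, 'a) duality \<Rightarrow> 'g \<Rightarrow> 'g \<Rightarrow> 'a" where
  "star_mu G d g h =
     to_dual G d (Dual d h \<otimes>\<^sub>o\<^bsub>G\<^esub> Dual d g) (g \<otimes>\<^sub>o\<^bsub>G\<^esub> h)
       (Ev d h \<diamondop>\<^bsub>G\<^esub>
        (Idn G (Dual d h) \<otimes>\<^sub>a\<^bsub>G\<^esub>
           (Lun G h \<diamondop>\<^bsub>G\<^esub> (Ev d g \<otimes>\<^sub>a\<^bsub>G\<^esub> Idn G h) \<diamondop>\<^bsub>G\<^esub> inv_arr G (Asc G (Dual d g) g h))) \<diamondop>\<^bsub>G\<^esub>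
        Asc G (Dual d h) (Dual d g) (g \<otimes>\<^sub>o\<^bsub>G\<^esub> h))"

definition star_iota :: "('g, 'a, 'x) moncat_scheme \<Rightarrow> ('g, 'a) duality \<Rightarrow> 'a" where
  "star_iota G d = to_dual G d (Unt G) (Unt G) (Lun G (Unt G))"


section \<open>Linear symmetric monoidal categories with an action of a 2-group\<close>

text \<open>\<open>Brd x y : x \<otimes> y \<rightarrow> y \<otimes> x\<close>; \<open>Add\<close> and \<open>Scl\<close> are the vector space operations on hom sets.\<close>

record ('o, 'm, 'k) lsmcat = "('o, 'm) moncat" +
  Brd :: "'o \<Rightarrow> 'o \<Rightarrow> 'm"
  Add :: "'m \<Rightarrow> 'm \<Rightarrow> 'm"
  Scl :: "'k \<Rightarrow> 'm \<Rightarrow> 'm"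

text \<open>
  The data of a symmetric algebra in \<open>2Rep(G)\<close>, with its multiplication \<open>A \<boxtimes> A \<rightarrow> A\<close> written as a
  bilinear tensor product functor on \<open>A\<close>: an action bifunctor with coherence isomorphisms
  \<open>ActAsc g h x : (g \<otimes> h) \<odot> x \<rightarrow> g \<odot> (h \<odot> x)\<close> and \<open>ActUnt x : 1 \<odot> x \<rightarrow> x\<close>, and the
  \<open>G\<close>-equivariance of tensor product and unit,
  \<open>ActMu g x y : (g \<odot> x) \<otimes> (g \<odot> y) \<rightarrow> g \<odot> (x \<otimes> y)\<close> and \<open>ActIota g : 1 \<rightarrow> g \<odot> 1\<close>.
\<close>

record ('o, 'm, 'k, 'g, 'a) galgebra = "('o, 'm, 'k) lsmcat" +
  ActO :: "'g \<Rightarrow> 'o \<Rightarrow> 'o"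
  ActA :: "'a \<Rightarrow> 'm \<Rightarrow> 'm"
  ActAsc :: "'g \<Rightarrow> 'g \<Rightarrow> 'o \<Rightarrow> 'm"
  ActUnt :: "'o \<Rightarrow> 'm"
  ActMu :: "'g \<Rightarrow> 'o \<Rightarrow> 'o \<Rightarrow> 'm"
  ActIota :: "'g \<Rightarrow> 'm"

definition braided_functor ::
  "('o1, 'm1, 'k, 'x) lsmcat_scheme \<Rightarrow> ('o2, 'm2, 'k, 'y) lsmcat_scheme \<Rightarrow>
   ('o1, 'm1, 'o2, 'm2, 'z) monfunc_scheme \<Rightarrow> bool" where
  "braided_functor C D F \<longleftrightarrow>
     (\<forall>x \<in> Obj C. \<forall>y \<in> Obj C.
        FA F (Brd C x y) \<diamondop>\<^bsub>D\<^esub> Mu F x y = Mu F y x \<diamondop>\<^bsub>D\<^esub> Brd D (FO F x) (FO F y))"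

definition linear_functor ::
  "('o1, 'm1, 'k, 'x) lsmcat_scheme \<Rightarrow> ('o2, 'm2, 'k, 'y) lsmcat_scheme \<Rightarrow>
   ('o1, 'm1, 'o2, 'm2, 'z) func_scheme \<Rightarrow> bool" where
  "linear_functor C D F \<longleftrightarrow>
     (\<forall>x y. \<forall>f \<in> homs C x y. \<forall>f' \<in> homs C x y. FA F (Add C f f') = Add D (FA F f) (FA F f')) \<and>
     (\<forall>c. \<forall>f \<in> Arr C. FA F (Scl C c f) = Scl D c (FA F f))"

text \<open>\<open>Str g x : F (g \<odot> x) \<rightarrow> g \<odot> F x\<close> is the left \<open>G\<close>-module functor structure.\<close>

record ('o, 'm, 'g) algauto = "('o, 'm, 'o, 'm) monfunc" +
  Str :: "'g \<Rightarrow> 'o \<Rightarrow> 'm"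

definition module_functor ::
  "('g, 'a, 'x) moncat_scheme \<Rightarrow> ('o, 'm, 'k, 'g, 'a, 'y) galgebra_scheme \<Rightarrow>
   ('o, 'm, 'g, 'z) algauto_scheme \<Rightarrow> bool" where
  "module_functor G A F \<longleftrightarrow>
     extensional2 (Obj G) (Obj A) (Str F) \<and>
     (\<forall>g \<in> Obj G. \<forall>x \<in> Obj A. Str F g x \<in> isos A (FO F (ActO A g x)) (ActO A g (FO F x))) \<and>
     (\<forall>g h x y. \<forall>a \<in> homs G g h. \<forall>f \<in> homs A x y.
        ActA A a (FA F f) \<diamondop>\<^bsub>A\<^esub> Str F g x = Str F h y \<diamondop>\<^bsub>A\<^esub> FA F (ActA A a f)) \<and>
     (\<forall>g \<in> Obj G. \<forall>h \<in> Obj G. \<forall>x \<in> Obj A.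
        ActA A (Idn G g) (Str F h x) \<diamondop>\<^bsub>A\<^esub> Str F g (ActO A h x) \<diamondop>\<^bsub>A\<^esub> FA F (ActAsc A g h x) =
        ActAsc A g h (FO F x) \<diamondop>\<^bsub>A\<^esub> Str F (g \<otimes>\<^sub>o\<^bsub>G\<^esub> h) x) \<and>
     (\<forall>x \<in> Obj A. ActUnt A (FO F x) \<diamondop>\<^bsub>A\<^esub> Str F (Unt G) x = FA F (ActUnt A x))"

text \<open>\<open>Mu\<close> and \<open>Iota\<close> are 2-morphisms of \<open>2Rep(G)\<close>, i.e. module natural transformations.\<close>

definition structures_compatible ::
  "('g, 'a, 'x) moncat_scheme \<Rightarrow> ('o, 'm, 'k, 'g, 'a, 'y) galgebra_scheme \<Rightarrow>
   ('o, 'm, 'g, 'z) algauto_scheme \<Rightarrow> bool" where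
  "structures_compatible G A F \<longleftrightarrow>
     (\<forall>g \<in> Obj G. \<forall>x \<in> Obj A. \<forall>y \<in> Obj A.
        Str F g (x \<otimes>\<^sub>o\<^bsub>A\<^esub> y) \<diamondop>\<^bsub>A\<^esub> FA F (ActMu A g x y) \<diamondop>\<^bsub>A\<^esub> Mu F (ActO A g x) (ActO A g y) =
        ActA A (Idn G g) (Mu F x y) \<diamondop>\<^bsub>A\<^esub> ActMu A g (FO F x) (FO F y) \<diamondop>\<^bsub>A\<^esub>
          (Str F g x \<otimes>\<^sub>a\<^bsub>A\<^esub> Str F g y)) \<and>
     (\<forall>g \<in> Obj G.
        Str F g (Unt A) \<diamondop>\<^bsub>A\<^esub> FA F (ActIota A g) \<diamondop>\<^bsub>A\<^esub> Iota F =
        ActA A (Idn G g) (Iota F) \<diamondop>\<^bsub>A\<^esub> ActIota A g)"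

definition algebra_auto_equivalence ::
  "('g, 'a, 'x) moncat_scheme \<Rightarrow> ('o, 'm, 'k, 'g, 'a, 'y) galgebra_scheme \<Rightarrow>
   ('o, 'm, 'g, 'z) algauto_scheme \<Rightarrow> bool" where
  "algebra_auto_equivalence G A F \<longleftrightarrow>
     category_equivalence A A F \<and> linear_functor A A F \<and>
     monoidal_functor A A F \<and> braided_functor A A F \<and>
     module_functor G A F \<and> structures_compatible G A F"

definition module_nat_trans ::
  "('g, 'a, 'x) moncat_scheme \<Rightarrow> ('o, 'm, 'k, 'g, 'a, 'y) galgebra_scheme \<Rightarrow>
   ('o, 'm, 'g, 'z) algauto_scheme \<Rightarrow> ('o, 'm, 'g, 'w) algauto_scheme \<Rightarrow> ('o \<Rightarrow> 'm) \<Rightarrow> bool" where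
  "module_nat_trans G A F F' \<eta> \<longleftrightarrow>
     nat_trans A A F F' \<eta> \<and>
     (\<forall>g \<in> Obj G. \<forall>x \<in> Obj A.
        ActA A (Idn G g) (\<eta> x) \<diamondop>\<^bsub>A\<^esub> Str F g x = Str F' g x \<diamondop>\<^bsub>A\<^esub> \<eta> (ActO A g x))"

record ('o, 't) arrow =
  asrc :: "'o"
  atgt :: "'o"
  amap :: "'t"

definition id_auto ::
  "('g, 'a, 'x) moncat_scheme \<Rightarrow> ('o, 'm, 'k, 'g, 'a, 'y) galgebra_scheme \<Rightarrow>
   ('o, 'm, 'g) algauto" where
  "id_auto G A =
     \<lparr>FO = (\<lambda>x \<in> Obj A. x), FA = (\<lambda>f \<in> Arr A. f),
      Mu = restrict2 (Obj A) (Obj A) (\<lambda>x y. Idn A (x \<otimes>\<^sub>o\<^bsub>A\<^esub> y)),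
      Iota = Idn A (Unt A),
      Str = restrict2 (Obj G) (Obj A) (\<lambda>g x. Idn A (ActO A g x))\<rparr>"

definition comp_auto ::
  "('g, 'a, 'x) moncat_scheme \<Rightarrow> ('o, 'm, 'k, 'g, 'a, 'y) galgebra_scheme \<Rightarrow>
   ('o, 'm, 'g) algauto \<Rightarrow> ('o, 'm, 'g) algauto \<Rightarrow> ('o, 'm, 'g) algauto" where
  "comp_auto G A F F' =
     \<lparr>FO = (\<lambda>x \<in> Obj A. FO F (FO F' x)), FA = (\<lambda>f \<in> Arr A. FA F (FA F' f)),
      Mu = restrict2 (Obj A) (Obj A)
             (\<lambda>x y. FA F (Mu F' x y) \<diamondop>\<^bsub>A\<^esub> Mu F (FO F' x) (FO F' y)),
      Iota = FA F (Iota F') \<diamondop>\<^bsub>A\<^esub> Iota F,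
      Str = restrict2 (Obj G) (Obj A)
              (\<lambda>g x. Str F g (FO F' x) \<diamondop>\<^bsub>A\<^esub> FA F (Str F' g x))\<rparr>"

text \<open>
  Composition of auto-equivalences is strictly associative and unital, so the coherence
  isomorphisms have identity components.
\<close>

definition Aut_E3 ::
  "('g, 'a, 'x) moncat_scheme \<Rightarrow> ('o, 'm, 'k, 'g, 'a, 'y) galgebra_scheme \<Rightarrow>
   (('o, 'm, 'g) algauto, (('o, 'm, 'g) algauto, 'o \<Rightarrow> 'm) arrow) moncat" where
  "Aut_E3 G A =
     \<lparr>Obj = {F. algebra_auto_equivalence G A F},
      Arr = {\<alpha>. algebra_auto_equivalence G A (asrc \<alpha>) \<and> algebra_auto_equivalence G A (atgt \<alpha>) \<and>
               nat_iso A A (asrc \<alpha>) (atgt \<alpha>) (amap \<alpha>) \<and>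
               monoidal_nat_trans A A (asrc \<alpha>) (atgt \<alpha>) (amap \<alpha>) \<and>
               module_nat_trans G A (asrc \<alpha>) (atgt \<alpha>) (amap \<alpha>)},
      Src = asrc,
      Tgt = atgt,
      Idn = (\<lambda>F. \<lparr>asrc = F, atgt = F, amap = (\<lambda>x \<in> Obj A. Idn A (FO F x))\<rparr>),
      Cmp = (\<lambda>\<beta> \<alpha>. \<lparr>asrc = asrc \<alpha>, atgt = atgt \<beta>,
               amap = (\<lambda>x \<in> Obj A. amap \<beta> x \<diamondop>\<^bsub>A\<^esub> amap \<alpha> x)\<rparr>),
      TenO = comp_auto G A,
      TenA = (\<lambda>\<alpha> \<beta>. \<lparr>asrc = comp_auto G A (asrc \<alpha>) (asrc \<beta>),
               atgt = comp_auto G A (atgt \<alpha>) (atgt \<beta>),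
               amap = (\<lambda>x \<in> Obj A. amap \<alpha> (FO (atgt \<beta>) x) \<diamondop>\<^bsub>A\<^esub> FA (asrc \<alpha>) (amap \<beta> x))\<rparr>),
      Unt = id_auto G A,
      Asc = (\<lambda>F F' F''. \<lparr>asrc = comp_auto G A (comp_auto G A F F') F'',
               atgt = comp_auto G A F (comp_auto G A F' F''),
               amap = (\<lambda>x \<in> Obj A. Idn A (FO F (FO F' (FO F'' x))))\<rparr>),
      Lun = (\<lambda>F. \<lparr>asrc = comp_auto G A (id_auto G A) F, atgt = F,
               amap = (\<lambda>x \<in> Obj A. Idn A (FO F x))\<rparr>),
      Run = (\<lambda>F. \<lparr>asrc = comp_auto G A F (id_auto G A), atgt = F,
               amap = (\<lambda>x \<in> Obj A. Idn A (FO F x))\<rparr>)\<rparr>"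

text \<open>
  Given a second action \<open>B\<close> on the linear symmetric monoidal category underlying \<open>A\<close> and
  isomorphisms \<open>s g h x : g \<odot>\<^sub>B (h \<odot>\<^sub>A x) \<rightarrow> h \<odot>\<^sub>A (g \<odot>\<^sub>B x)\<close>, the monoidal functor
  \<open>g \<mapsto> (g \<odot>\<^sub>B -)\<close> to the auto-equivalences of \<open>A\<close>.
\<close>

definition translation_functor ::
  "('g, 'a, 'x) moncat_scheme \<Rightarrow> ('o, 'm, 'k, 'g, 'a, 'y) galgebra_scheme \<Rightarrow>
   ('o, 'm, 'k, 'g, 'a, 'z) galgebra_scheme \<Rightarrow> ('g \<Rightarrow> 'g \<Rightarrow> 'o \<Rightarrow> 'm) \<Rightarrow>
   ('g, 'a, ('o, 'm, 'g) algauto, (('o, 'm, 'g) algauto, 'o \<Rightarrow> 'm) arrow) monfunc" where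
  "translation_functor G A B s =
    (let \<Phi> = (\<lambda>g. \<lparr>FO = (\<lambda>x \<in> Obj A. ActO B g x),
                     FA = (\<lambda>f \<in> Arr A. ActA B (Idn G g) f),
                     Mu = restrict2 (Obj A) (Obj A) (ActMu B g),
                     Iota = ActIota B g,
                     Str = restrict2 (Obj G) (Obj A) (s g)\<rparr>)
     in \<lparr>FO = (\<lambda>g \<in> Obj G. \<Phi> g),
         FA = (\<lambda>a \<in> Arr G. \<lparr>asrc = \<Phi> (Src G a), atgt = \<Phi> (Tgt G a),
                             amap = (\<lambda>x \<in> Obj A. ActA B a (Idn A x))\<rparr>),
         Mu = restrict2 (Obj G) (Obj G)
                (\<lambda>g h. \<lparr>asrc = comp_auto G A (\<Phi> g) (\<Phi> h), atgt = \<Phi> (g \<otimes>\<^sub>o\<^bsub>G\<^esub> h),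
                         amap = (\<lambda>x \<in> Obj A. inv_arr A (ActAsc B g h x))\<rparr>),
         Iota = \<lparr>asrc = id_auto G A, atgt = \<Phi> (Unt G),
                 amap = (\<lambda>x \<in> Obj A. inv_arr A (ActUnt B x))\<rparr>\<rparr>)"


section \<open>Finite-dimensional vector spaces\<close>

text \<open>
  The objects of \<open>Vec\<close> are all finite-dimensional vector spaces over \<open>'k\<close> whose underlying set
  consists of elements of the type \<open>'v\<close>, which plays the role of a universe.
\<close>

definition fd_spaces :: "('k::field, 'v) module set" where
  "fd_spaces = {V. vectorspace class_ring V \<and> vectorspace.fin_dim class_ring V}"

definition lin_maps ::
  "('k::field, 'v) module \<Rightarrow> ('k, 'v) module \<Rightarrow> ('v \<Rightarrow> 'v) set" where
  "lin_maps V W = LinearCombinations.module_hom class_ring V W \<inter> extensional (carrier V)"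

definition bilinear_map ::
  "('k::field, 'v) module \<Rightarrow> ('k, 'v) module \<Rightarrow> ('k, 'v) module \<Rightarrow> ('v \<Rightarrow> 'v \<Rightarrow> 'v) \<Rightarrow> bool" where
  "bilinear_map V W X b \<longleftrightarrow>
     (\<forall>v \<in> carrier V. (\<lambda>w. b v w) \<in> LinearCombinations.module_hom class_ring W X) \<and>
     (\<forall>w \<in> carrier W. (\<lambda>v. b v w) \<in> LinearCombinations.module_hom class_ring V X)"

text \<open>
  A choice of tensor products of vector spaces, with \<open>Pure V W v w\<close> the element \<open>v \<otimes> w\<close>, and a
  copy \<open>Ground\<close> of the ground field with unit element \<open>GUnit\<close>. For an infinite field such a
  choice exists precisely if \<open>'k\<close> embeds into \<open>'v\<close>, and then vector spaces of every finite
  dimension occur among the \<open>fd_spaces\<close>.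
\<close>

record ('k, 'v) vec_tensor =
  Tensor :: "('k, 'v) module \<Rightarrow> ('k, 'v) module \<Rightarrow> ('k, 'v) module"
  Pure :: "('k, 'v) module \<Rightarrow> ('k, 'v) module \<Rightarrow> 'v \<Rightarrow> 'v \<Rightarrow> 'v"
  Ground :: "('k, 'v) module"
  GUnit :: "'v"

definition is_vec_tensor :: "('k::field, 'v) vec_tensor \<Rightarrow> bool" where
  "is_vec_tensor T \<longleftrightarrow>
     Ground T \<in> fd_spaces \<and> GUnit T \<in> carrier (Ground T) \<and>
     bij_betw (\<lambda>c. c \<odot>\<^bsub>Ground T\<^esub> GUnit T) UNIV (carrier (Ground T)) \<and>
     (\<forall>V \<in> fd_spaces. \<forall>W \<in> fd_spaces.
        Tensor T V W \<in> fd_spaces \<and>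
        bilinear_map V W (Tensor T V W) (Pure T V W) \<and>
        (\<forall>X \<in> fd_spaces. \<forall>b. bilinear_map V W X b \<longrightarrow>
           (\<exists>!h. h \<in> lin_maps (Tensor T V W) X \<and>
              (\<forall>v \<in> carrier V. \<forall>w \<in> carrier W. h (Pure T V W v w) = b v w))))"

definition Vec ::
  "('k::field, 'v) vec_tensor \<Rightarrow>
   (('k, 'v) module, (('k, 'v) module, 'v \<Rightarrow> 'v) arrow, 'k) lsmcat" where
  "Vec T =
     \<lparr>Obj = fd_spaces,
      Arr = {f. asrc f \<in> fd_spaces \<and> atgt f \<in> fd_spaces \<and> amap f \<in> lin_maps (asrc f) (atgt f)},
      Src = asrc,
      Tgt = atgt,
      Idn = (\<lambda>V. \<lparr>asrc = V, atgt = V, amap = (\<lambda>v \<in> carrier V. v)\<rparr>),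
      Cmp = (\<lambda>g f. \<lparr>asrc = asrc f, atgt = atgt g,
               amap = (\<lambda>v \<in> carrier (asrc f). amap g (amap f v))\<rparr>),
      TenO = Tensor T,
      TenA = (\<lambda>f g. \<lparr>asrc = Tensor T (asrc f) (asrc g), atgt = Tensor T (atgt f) (atgt g),
               amap = (THE h. h \<in> lin_maps (Tensor T (asrc f) (asrc g)) (Tensor T (atgt f) (atgt g)) \<and>
                 (\<forall>v \<in> carrier (asrc f). \<forall>w \<in> carrier (asrc g).
                    h (Pure T (asrc f) (asrc g) v w) =
                    Pure T (atgt f) (atgt g) (amap f v) (amap g w)))\<rparr>),
      Unt = Ground T,
      Asc = (\<lambda>U V W. \<lparr>asrc = Tensor T (Tensor T U V) W, atgt = Tensor T U (Tensor T V W),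
               amap = (THE h. h \<in> lin_maps (Tensor T (Tensor T U V) W) (Tensor T U (Tensor T V W)) \<and>
                 (\<forall>u \<in> carrier U. \<forall>v \<in> carrier V. \<forall>w \<in> carrier W.
                    h (Pure T (Tensor T U V) W (Pure T U V u v) w) =
                    Pure T U (Tensor T V W) u (Pure T V W v w)))\<rparr>),
      Lun = (\<lambda>V. \<lparr>asrc = Tensor T (Ground T) V, atgt = V,
               amap = (THE h. h \<in> lin_maps (Tensor T (Ground T) V) V \<and>
                 (\<forall>v \<in> carrier V. h (Pure T (Ground T) V (GUnit T) v) = v))\<rparr>),
      Run = (\<lambda>V. \<lparr>asrc = Tensor T V (Ground T), atgt = V,
               amap = (THE h. h \<in> lin_maps (Tensor T V (Ground T)) V \<and>
                 (\<forall>v \<in> carrier V. h (Pure T V (Ground T) v (GUnit T)) = v))\<rparr>),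
      Brd = (\<lambda>V W. \<lparr>asrc = Tensor T V W, atgt = Tensor T W V,
               amap = (THE h. h \<in> lin_maps (Tensor T V W) (Tensor T W V) \<and>
                 (\<forall>v \<in> carrier V. \<forall>w \<in> carrier W. h (Pure T V W v w) = Pure T W V w v))\<rparr>),
      Add = (\<lambda>f g. \<lparr>asrc = asrc f, atgt = atgt f,
               amap = (\<lambda>v \<in> carrier (asrc f). amap f v \<oplus>\<^bsub>atgt f\<^esub> amap g v)\<rparr>),
      Scl = (\<lambda>c f. \<lparr>asrc = asrc f, atgt = atgt f,
               amap = (\<lambda>v \<in> carrier (asrc f). c \<odot>\<^bsub>atgt f\<^esub> amap f v)\<rparr>)\<rparr>"


section \<open>The functor category with its translation actions\<close>

definition tensor_func ::
  "('g, 'a, 'x) precat_scheme \<Rightarrow> ('o, 'm, 'y) moncat_scheme \<Rightarrow>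
   ('g, 'a, 'o, 'm) func \<Rightarrow> ('g, 'a, 'o, 'm) func \<Rightarrow> ('g, 'a, 'o, 'm) func" where
  "tensor_func G D F F' =
     \<lparr>FO = (\<lambda>x \<in> Obj G. FO F x \<otimes>\<^sub>o\<^bsub>D\<^esub> FO F' x), FA = (\<lambda>a \<in> Arr G. FA F a \<otimes>\<^sub>a\<^bsub>D\<^esub> FA F' a)\<rparr>"

definition unit_func ::
  "('g, 'a, 'x) precat_scheme \<Rightarrow> ('o, 'm, 'y) moncat_scheme \<Rightarrow> ('g, 'a, 'o, 'm) func" where
  "unit_func G D = \<lparr>FO = (\<lambda>x \<in> Obj G. Unt D), FA = (\<lambda>a \<in> Arr G. Idn D (Unt D))\<rparr>"

definition Fun_cat ::
  "('g, 'a, 'x) precat_scheme \<Rightarrow> ('o, 'm, 'k, 'y) lsmcat_scheme \<Rightarrow>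
   (('g, 'a, 'o, 'm) func, (('g, 'a, 'o, 'm) func, 'g \<Rightarrow> 'm) arrow, 'k) lsmcat" where
  "Fun_cat G D =
     \<lparr>Obj = {F. is_functor G D F},
      Arr = {\<phi>. is_functor G D (asrc \<phi>) \<and> is_functor G D (atgt \<phi>) \<and>
               nat_trans G D (asrc \<phi>) (atgt \<phi>) (amap \<phi>)},
      Src = asrc,
      Tgt = atgt,
      Idn = (\<lambda>F. \<lparr>asrc = F, atgt = F, amap = (\<lambda>x \<in> Obj G. Idn D (FO F x))\<rparr>),
      Cmp = (\<lambda>\<psi> \<phi>. \<lparr>asrc = asrc \<phi>, atgt = atgt \<psi>,
               amap = (\<lambda>x \<in> Obj G. amap \<psi> x \<diamondop>\<^bsub>D\<^esub> amap \<phi> x)\<rparr>),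
      TenO = tensor_func G D,
      TenA = (\<lambda>\<phi> \<psi>. \<lparr>asrc = tensor_func G D (asrc \<phi>) (asrc \<psi>),
               atgt = tensor_func G D (atgt \<phi>) (atgt \<psi>),
               amap = (\<lambda>x \<in> Obj G. amap \<phi> x \<otimes>\<^sub>a\<^bsub>D\<^esub> amap \<psi> x)\<rparr>),
      Unt = unit_func G D,
      Asc = (\<lambda>F F' F''. \<lparr>asrc = tensor_func G D (tensor_func G D F F') F'',
               atgt = tensor_func G D F (tensor_func G D F' F''),
               amap = (\<lambda>x \<in> Obj G. Asc D (FO F x) (FO F' x) (FO F'' x))\<rparr>),
      Lun = (\<lambda>F. \<lparr>asrc = tensor_func G D (unit_func G D) F, atgt = F,
               amap = (\<lambda>x \<in> Obj G. Lun D (FO F x))\<rparr>),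
      Run = (\<lambda>F. \<lparr>asrc = tensor_func G D F (unit_func G D), atgt = F,
               amap = (\<lambda>x \<in> Obj G. Run D (FO F x))\<rparr>),
      Brd = (\<lambda>F F'. \<lparr>asrc = tensor_func G D F F', atgt = tensor_func G D F' F,
               amap = (\<lambda>x \<in> Obj G. Brd D (FO F x) (FO F' x))\<rparr>),
      Add = (\<lambda>\<phi> \<psi>. \<lparr>asrc = asrc \<phi>, atgt = atgt \<phi>,
               amap = (\<lambda>x \<in> Obj G. Add D (amap \<phi> x) (amap \<psi> x))\<rparr>),
      Scl = (\<lambda>c \<phi>. \<lparr>asrc = asrc \<phi>, atgt = atgt \<phi>,
               amap = (\<lambda>x \<in> Obj G. Scl D c (amap \<phi> x))\<rparr>)\<rparr>"

text \<open>\<open>(g \<odot>\<^sup>r F)(x) = F(x \<otimes> g)\<close> and \<open>(g \<odot>\<^sup>l F)(x) = F(g\<^sup>* \<otimes> x)\<close>.\<close>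

definition rtransO ::
  "('g, 'a, 'x) moncat_scheme \<Rightarrow> 'g \<Rightarrow> ('g, 'a, 'o, 'm) func \<Rightarrow> ('g, 'a, 'o, 'm) func" where
  "rtransO G g F =
     \<lparr>FO = (\<lambda>x \<in> Obj G. FO F (x \<otimes>\<^sub>o\<^bsub>G\<^esub> g)), FA = (\<lambda>b \<in> Arr G. FA F (b \<otimes>\<^sub>a\<^bsub>G\<^esub> Idn G g))\<rparr>"

definition rtransA ::
  "('g, 'a, 'x) moncat_scheme \<Rightarrow> ('o, 'm, 'y) precat_scheme \<Rightarrow> 'a \<Rightarrow>
   (('g, 'a, 'o, 'm) func, 'g \<Rightarrow> 'm) arrow \<Rightarrow> (('g, 'a, 'o, 'm) func, 'g \<Rightarrow> 'm) arrow" where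
  "rtransA G D a \<phi> =
     \<lparr>asrc = rtransO G (Src G a) (asrc \<phi>), atgt = rtransO G (Tgt G a) (atgt \<phi>),
      amap = (\<lambda>x \<in> Obj G. amap \<phi> (x \<otimes>\<^sub>o\<^bsub>G\<^esub> Tgt G a) \<diamondop>\<^bsub>D\<^esub> FA (asrc \<phi>) (Idn G x \<otimes>\<^sub>a\<^bsub>G\<^esub> a))\<rparr>"

definition ltransO ::
  "('g, 'a, 'x) moncat_scheme \<Rightarrow> ('g, 'a) duality \<Rightarrow> 'g \<Rightarrow>
   ('g, 'a, 'o, 'm) func \<Rightarrow> ('g, 'a, 'o, 'm) func" where
  "ltransO G d g F =
     \<lparr>FO = (\<lambda>x \<in> Obj G. FO F (Dual d g \<otimes>\<^sub>o\<^bsub>G\<^esub> x)),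
      FA = (\<lambda>b \<in> Arr G. FA F (Idn G (Dual d g) \<otimes>\<^sub>a\<^bsub>G\<^esub> b))\<rparr>"

definition ltransA ::
  "('g, 'a, 'x) moncat_scheme \<Rightarrow> ('g, 'a) duality \<Rightarrow> ('o, 'm, 'y) precat_scheme \<Rightarrow> 'a \<Rightarrow>
   (('g, 'a, 'o, 'm) func, 'g \<Rightarrow> 'm) arrow \<Rightarrow> (('g, 'a, 'o, 'm) func, 'g \<Rightarrow> 'm) arrow" where
  "ltransA G d D a \<phi> =
     \<lparr>asrc = ltransO G d (Src G a) (asrc \<phi>), atgt = ltransO G d (Tgt G a) (atgt \<phi>),
      amap = (\<lambda>x \<in> Obj G. amap \<phi> (Dual d (Tgt G a) \<otimes>\<^sub>o\<^bsub>G\<^esub> x) \<diamondop>\<^bsub>D\<^esub>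
                FA (asrc \<phi>) (star_arr G d a \<otimes>\<^sub>a\<^bsub>G\<^esub> Idn G x))\<rparr>"

text \<open>
  The coherence isomorphisms of the translation actions have components \<open>F (p x)\<close> for coherence
  isomorphisms \<open>p x\<close> of \<open>G\<close>; the following is such an arrow between functors \<open>P\<close> and \<open>Q\<close>.
\<close>

definition coherence_arrow ::
  "('g, 'a, 'x) precat_scheme \<Rightarrow> ('g, 'a, 'o, 'm) func \<Rightarrow> ('g, 'a, 'o, 'm) func \<Rightarrow>
   ('g, 'a, 'o, 'm) func \<Rightarrow> ('g \<Rightarrow> 'a) \<Rightarrow> (('g, 'a, 'o, 'm) func, 'g \<Rightarrow> 'm) arrow" where
  "coherence_arrow G P Q F p = \<lparr>asrc = P, atgt = Q, amap = (\<lambda>x \<in> Obj G. FA F (p x))\<rparr>"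

text \<open>
  The tensor product and unit of functors are strictly invariant under translation: the functors
  \<open>(g \<odot> F) \<otimes> (g \<odot> F')\<close> and \<open>g \<odot> (F \<otimes> F')\<close> are equal, and so are \<open>1\<close> and \<open>g \<odot> 1\<close>. Hence the
  equivariance constraints are identities.
\<close>

definition right_regular ::
  "('g, 'a, 'x) moncat_scheme \<Rightarrow> ('o, 'm, 'k, 'y) lsmcat_scheme \<Rightarrow>
   (('g, 'a, 'o, 'm) func, (('g, 'a, 'o, 'm) func, 'g \<Rightarrow> 'm) arrow, 'k, 'g, 'a) galgebra" where
  "right_regular G D = lsmcat.extend (Fun_cat G D)
     (galgebra.fields
        (rtransO G)
        (rtransA G D)
        (\<lambda>g h F. coherence_arrow G (rtransO G (g \<otimes>\<^sub>o\<^bsub>G\<^esub> h) F) (rtransO G g (rtransO G h F)) F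
           (\<lambda>x. inv_arr G (Asc G x g h)))
        (\<lambda>F. coherence_arrow G (rtransO G (Unt G) F) F F (Run G))
        (\<lambda>g F F'. Idn (Fun_cat G D) (rtransO G g (tensor_func G D F F')))
        (\<lambda>g. Idn (Fun_cat G D) (unit_func G D)))"

definition left_regular ::
  "('g, 'a, 'x) moncat_scheme \<Rightarrow> ('g, 'a) duality \<Rightarrow> ('o, 'm, 'k, 'y) lsmcat_scheme \<Rightarrow>
   (('g, 'a, 'o, 'm) func, (('g, 'a, 'o, 'm) func, 'g \<Rightarrow> 'm) arrow, 'k, 'g, 'a) galgebra" where
  "left_regular G d D = lsmcat.extend (Fun_cat G D)
     (galgebra.fields
        (ltransO G d)
        (ltransA G d D)
        (\<lambda>g h F. coherence_arrow G (ltransO G d (g \<otimes>\<^sub>o\<^bsub>G\<^esub> h) F) (ltransO G d g (ltransO G d h F)) F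
           (\<lambda>x. Asc G (Dual d h) (Dual d g) x \<diamondop>\<^bsub>G\<^esub> (inv_arr G (star_mu G d g h) \<otimes>\<^sub>a\<^bsub>G\<^esub> Idn G x)))
        (\<lambda>F. coherence_arrow G (ltransO G d (Unt G) F) F F
           (\<lambda>x. Lun G x \<diamondop>\<^bsub>G\<^esub> (inv_arr G (star_iota G d) \<otimes>\<^sub>a\<^bsub>G\<^esub> Idn G x)))
        (\<lambda>g F F'. Idn (Fun_cat G D) (ltransO G d g (tensor_func G D F F')))
        (\<lambda>g. Idn (Fun_cat G D) (unit_func G D)))"

text \<open>
  \<open>g \<mapsto> (g \<odot>\<^sup>r -)\<close> on the left regular algebra, with module structure
  \<open>F(h\<^sup>* \<otimes> (x \<otimes> g)) \<rightarrow> F((h\<^sup>* \<otimes> x) \<otimes> g)\<close>, and \<open>g \<mapsto> (g \<odot>\<^sup>l -)\<close> on the right regular algebra, with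
  module structure \<open>F((g\<^sup>* \<otimes> x) \<otimes> h) \<rightarrow> F(g\<^sup>* \<otimes> (x \<otimes> h))\<close>.
\<close>

definition right_translation ::
  "('g, 'a, 'x) moncat_scheme \<Rightarrow> ('g, 'a) duality \<Rightarrow> ('o, 'm, 'k, 'y) lsmcat_scheme \<Rightarrow>
   ('g, 'a, (('g, 'a, 'o, 'm) func, (('g, 'a, 'o, 'm) func, 'g \<Rightarrow> 'm) arrow, 'g) algauto,
     ((('g, 'a, 'o, 'm) func, (('g, 'a, 'o, 'm) func, 'g \<Rightarrow> 'm) arrow, 'g) algauto,
      ('g, 'a, 'o, 'm) func \<Rightarrow> (('g, 'a, 'o, 'm) func, 'g \<Rightarrow> 'm) arrow) arrow) monfunc" where
  "right_translation G d D =
     translation_functor G (left_regular G d D) (right_regular G D)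
       (\<lambda>g h F. coherence_arrow G (rtransO G g (ltransO G d h F)) (ltransO G d h (rtransO G g F)) F
          (\<lambda>x. inv_arr G (Asc G (Dual d h) x g)))"

definition left_translation ::
  "('g, 'a, 'x) moncat_scheme \<Rightarrow> ('g, 'a) duality \<Rightarrow> ('o, 'm, 'k, 'y) lsmcat_scheme \<Rightarrow>
   ('g, 'a, (('g, 'a, 'o, 'm) func, (('g, 'a, 'o, 'm) func, 'g \<Rightarrow> 'm) arrow, 'g) algauto,
     ((('g, 'a, 'o, 'm) func, (('g, 'a, 'o, 'm) func, 'g \<Rightarrow> 'm) arrow, 'g) algauto,
      ('g, 'a, 'o, 'm) func \<Rightarrow> (('g, 'a, 'o, 'm) func, 'g \<Rightarrow> 'm) arrow) arrow) monfunc" where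
  "left_translation G d D =
     translation_functor G (right_regular G D) (left_regular G d D)
       (\<lambda>g h F. coherence_arrow G (ltransO G d g (rtransO G h F)) (rtransO G h (ltransO G d g F)) F
          (\<lambda>x. Asc G (Dual d g) x h))"

end

theory Submission
  imports Defs
begin

text \<open>
 The objects of both regular algebras are functors on the 2-group \<open>G\<close>, and both actions are
 precomposition with a translation of the underlying groupoid, \<open>x \<mapsto> x \<otimes> g\<close> or \<open>x \<mapsto> g\<^sup>* \<otimes> x\<close>.
 The two translations commute up to associators, so precomposition with one of them respects the
 algebra given by the other (\<open>aut_phi\<close>) and defines a monoidal functor from \<open>G\<close> to the 2-group of
 auto-equivalences (\<open>monoidal_functor_trf\<close>). The two statements of the theorem differ only in the
 roles of the two translations \<open>s\<close> (the action) and \<open>t\<close>, and what is used about these is that they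
 commute coherently and that each makes the groupoid a torsor: moving the unit object by objects of
 \<open>G\<close> is an equivalence from \<open>G\<close> to the groupoid.

 That the functor is an equivalence is a Tannaka-type argument. Let \<open>E\<close> be an auto-equivalence.
 Taking the value of \<open>E F\<close> at the unit object is a linear symmetric monoidal functor from
 \<open>Fun(G, Vec)\<close> to \<open>Vec\<close>, a fibre functor, and every fibre functor is evaluation at some object \<open>x\<close>
 (\<open>fibre_functor_evaluation\<close>). To find \<open>x\<close>, linearised representable functors are used. In
 characteristic zero the unit functor is a direct summand of a sum of these, so the fibre functor
 does not vanish on all of them (\<open>ex_nonzero\<close>). Functions on arrows multiply pointwise, which makes
 \<open>rep x\<close> a commutative algebra; its basis of point functions makes it a coalgebra, and the two
 structures satisfy the Frobenius relation. If the fibre functor is nonzero at \<open>rep x\<close>, its value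
 there is a commutative algebra, which has a character because \<open>k\<close> is algebraically closed, and the
 idempotent belonging to the character is group-like (\<open>ex_grouplike\<close>). By the Yoneda lemma a
 group-like element is a monoidal transformation from evaluation at \<open>x\<close> to the fibre functor, and
 such a transformation is invertible.

 Hence \<open>E F\<close> at the unit object is \<open>F\<close> at an object of the form \<open>TO t g 1\<close>. Compatibility with the
 action moves this identification from the unit object to all its translates under \<open>s\<close>, that is, up
 to isomorphism to all objects, and shows that \<open>E\<close> is translation by \<open>g\<close> (\<open>aut_is_translation\<close>).
 Transformations between translations are treated in the same way: at the unit object such a
 transformation is one between two evaluation functors, hence given by a group-like element of a
 representable functor, and the only group-like elements are arrows (\<open>grouplike_del\<close>). So it comes
 from a unique arrow of the groupoid, and therefore from a unique arrow of \<open>G\<close>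
 (\<open>transf_is_translation\<close>).

 For left translation one has to know that \<open>g \<mapsto> g\<^sup>*\<close>, with the structure maps obtained from the chosen
 duals, is a monoidal functor reversing the tensor product. Each of these coherence conditions
 is an equation between arrows into a dual, and such arrows are determined by their evaluations
 (\<open>ev_inj\<close>).

 Membership \<open>x \<in> S\<close> is written \<open>x : S\<close>, and composition and tensor product are written \<open>\<cdot>\<close> and \<open>\<otimes>\<close>,
 with the category as a subscript unless it is the one fixed by the context.
\<close>

syntax "_index" :: "logic => index" (\<open>\<^sub>_\<close> [1000])
no_notation monoid.mult (infixl \<open>\<otimes>\<index>\<close> 70)
notation Cmp (infixl \<open>\<cdot>\<index>\<close> 68)
notation TenA (infixr \<open>\<otimes>\<index>\<close> 72)

section \<open>Categories and equivalences\<close>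

lemma homs_iff: "f : homs C x y \<longleftrightarrow> f : Arr C \<and> Src C f = x \<and> Tgt C f = y"
 by (auto simp: homs_def)

lemma isos_iff: "f : isos C x y \<longleftrightarrow> f : Arr C \<and> Src C f = x \<and> Tgt C f = y \<and> is_iso C f"
 by (auto simp: isos_def homs_iff)

lemma iso_arr: "is_iso C f ==> f : Arr C"
 by (auto simp: is_iso_def inverse_arrows_def)

context category
begin

lemma src_in [simp]: "f : Arr C ==> Src C f : Obj C"
 and tgt_in [simp]: "f : Arr C ==> Tgt C f : Obj C"
 by (rule src_obj tgt_obj; assumption)+

lemma idn_simps [simp]:
 assumes "x : Obj C"
 shows "Idn C x : Arr C" "Src C (Idn C x) = x" "Tgt C (Idn C x) = x"
 using idn_hom[OF assms] by (auto simp: homs_iff)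

lemma cmp_simps [simp]:
 assumes "f : Arr C" "g : Arr C" "Src C g = Tgt C f"
 shows "g \<cdot> f : Arr C" "Src C (g \<cdot> f) = Src C f" "Tgt C (g \<cdot> f) = Tgt C g"
 using cmp_hom[of f "Src C f" "Tgt C f" g "Tgt C g"] assms by (auto simp: homs_iff)

lemma idr [simp]: "f : Arr C ==> Src C f = x ==> f \<cdot> Idn C x = f"
 using cmp_idn_right[of f x "Tgt C f"] by (auto simp: homs_iff)

lemma idl [simp]: "f : Arr C ==> Tgt C f = x ==> Idn C x \<cdot> f = f"
 using cmp_idn_left[of f "Src C f" x] by (auto simp: homs_iff)

lemma assoc:
 "f : Arr C ==> g : Arr C ==> h : Arr C ==> Src C g = Tgt C f ==> Src C h = Tgt C g ==>
  (h \<cdot> g) \<cdot> f = h \<cdot> (g \<cdot> f)"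
 using cmp_assoc[of f "Src C f" "Tgt C f" g "Tgt C g" h "Tgt C h"] by (auto simp: homs_iff)

text \<open>
 Composites are normalised by bracketing to the right. An equation between two composites is
 then applied inside a longer one in the following form.
\<close>

lemma ext1:
 assumes "g \<cdot> f = h" "f : Arr C" "g : Arr C" "Src C g = Tgt C f" "k : Arr C" "Tgt C k = Src C f"
 shows "g \<cdot> (f \<cdot> k) = h \<cdot> k"
 using assms assoc[of k f g] by simp

lemma ext2:
 assumes "g \<cdot> f = g' \<cdot> f'" "f : Arr C" "g : Arr C" "Src C g = Tgt C f"
  "f' : Arr C" "g' : Arr C" "Src C g' = Tgt C f'" "k : Arr C" "Tgt C k = Src C f"
 shows "g \<cdot> (f \<cdot> k) = g' \<cdot> (f' \<cdot> k)"
proof -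
 have "Src C (g \<cdot> f) = Src C (g' \<cdot> f')" using assms(1) by simp
 then have "Src C f = Src C f'" using assms(2-) by simp
 then show ?thesis using assms assoc[of k f g] assoc[of k f' g'] by simp
qed

lemma inverse_arrows_unique:
 assumes "inverse_arrows C f g" "inverse_arrows C f h"
 shows "g = h"
proof -
 have "g = g \<cdot> (f \<cdot> h)" using assms by (auto simp: inverse_arrows_def homs_iff)
 also have "... = (g \<cdot> f) \<cdot> h" using assms by (subst assoc) (auto simp: inverse_arrows_def homs_iff)
 also have "... = h" using assms by (auto simp: inverse_arrows_def homs_iff)
 finally show ?thesis .
qed

lemma inv_arr_eq: "inverse_arrows C f g ==> inv_arr C f = g"
 unfolding inv_arr_def using inverse_arrows_unique by blast

lemma inverse_arrows_inv: "is_iso C f ==> inverse_arrows C f (inv_arr C f)"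
 using inv_arr_eq by (metis is_iso_def)

lemma inv_simps [simp]:
 assumes "is_iso C f"
 shows "inv_arr C f : Arr C" "Src C (inv_arr C f) = Tgt C f" "Tgt C (inv_arr C f) = Src C f"
  "inv_arr C f \<cdot> f = Idn C (Src C f)" "f \<cdot> inv_arr C f = Idn C (Tgt C f)"
 using inverse_arrows_inv[OF assms] by (auto simp: inverse_arrows_def homs_iff)

lemma inv_cancel [simp]:
 assumes "is_iso C f" "k : Arr C"
 shows "Tgt C k = Src C f ==> inv_arr C f \<cdot> (f \<cdot> k) = k"
  "Tgt C k = Tgt C f ==> f \<cdot> (inv_arr C f \<cdot> k) = k"
 using assms iso_arr[OF assms(1)] by (simp_all flip: assoc)

lemma inverse_arrowsI:
 assumes "f : Arr C" "g : Arr C" "Src C g = Tgt C f" "Tgt C g = Src C f"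
  "g \<cdot> f = Idn C (Src C f)" "f \<cdot> g = Idn C (Tgt C f)"
 shows "inverse_arrows C f g"
 using assms by (auto simp: inverse_arrows_def homs_iff)

lemma is_isoI:
 assumes "f : Arr C" "g : Arr C" "Src C g = Tgt C f" "Tgt C g = Src C f"
  "g \<cdot> f = Idn C (Src C f)" "f \<cdot> g = Idn C (Tgt C f)"
 shows "is_iso C f"
 using inverse_arrowsI[OF assms] by (auto simp: is_iso_def)

lemma is_iso_idn [simp]: "x : Obj C ==> is_iso C (Idn C x)"
 by (rule is_isoI[where g = "Idn C x"]) auto

lemma inv_idn [simp]: "x : Obj C ==> inv_arr C (Idn C x) = Idn C x"
 by (rule inv_arr_eq, rule inverse_arrowsI) auto

lemma is_iso_inv [simp]: "is_iso C f ==> is_iso C (inv_arr C f)"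
 by (rule is_isoI[where g = f]) (auto simp: iso_arr)

lemma inv_inv [simp]: "is_iso C f ==> inv_arr C (inv_arr C f) = f"
 by (rule inv_arr_eq, rule inverse_arrowsI) (auto simp: iso_arr)

lemma inverse_arrows_cmp:
 assumes "is_iso C f" "is_iso C g" "Src C g = Tgt C f"
 shows "inverse_arrows C (g \<cdot> f) (inv_arr C f \<cdot> inv_arr C g)"
 using assms iso_arr[OF assms(1)] iso_arr[OF assms(2)]
 by (intro inverse_arrowsI) (auto simp: assoc)

lemma is_iso_cmp [simp]:
 "is_iso C f ==> is_iso C g ==> Src C g = Tgt C f ==> is_iso C (g \<cdot> f)"
 using inverse_arrows_cmp by (auto simp: is_iso_def)

lemma inv_cmp:
 "is_iso C f ==> is_iso C g ==> Src C g = Tgt C f ==>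
  inv_arr C (g \<cdot> f) = inv_arr C f \<cdot> inv_arr C g"
 by (rule inv_arr_eq, rule inverse_arrows_cmp)

lemma iso_cancel_left:
 assumes "f \<cdot> g = f \<cdot> h" "is_iso C f" "g : Arr C" "h : Arr C" "Tgt C g = Src C f" "Tgt C h = Src C f"
 shows "g = h"
proof -
 have "inv_arr C f \<cdot> (f \<cdot> g) = inv_arr C f \<cdot> (f \<cdot> h)" using assms(1) by simp
 then show ?thesis using assms(2-) by simp
qed

lemma iso_cancel_right:
 assumes "g \<cdot> f = h \<cdot> f" "is_iso C f" "g : Arr C" "h : Arr C" "Src C g = Tgt C f" "Src C h = Tgt C f"
 shows "g = h"
proof -
 have "(g \<cdot> f) \<cdot> inv_arr C f = (h \<cdot> f) \<cdot> inv_arr C f" using assms(1) by simp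
 then show ?thesis using assms(2-) iso_arr[OF assms(2)] by (simp add: assoc)
qed

lemma iso_square:
 assumes "f \<cdot> a = b \<cdot> f'" "is_iso C f" "is_iso C f'" "a : Arr C" "b : Arr C"
  "Src C f = Tgt C a" "Src C b = Tgt C f'" "Src C a = Src C f'" "Tgt C b = Tgt C f"
 shows "inv_arr C f \<cdot> b = a \<cdot> inv_arr C f'"
proof -
 have "inv_arr C f \<cdot> ((f \<cdot> a) \<cdot> inv_arr C f') = inv_arr C f \<cdot> ((b \<cdot> f') \<cdot> inv_arr C f')"
  using assms(1) by simp
 then show ?thesis
  using assms(2-) iso_arr[OF assms(2)] iso_arr[OF assms(3)] by (simp add: assoc)
qed

end

lemma functor_simps:
 assumes "is_functor C D F"
 shows functor_obj: "\<And>x. x : Obj C ==> FO F x : Obj D"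
  and functor_arr: "\<And>f. f : Arr C ==> FA F f : Arr D"
  and functor_src: "\<And>f. f : Arr C ==> Src D (FA F f) = FO F (Src C f)"
  and functor_tgt: "\<And>f. f : Arr C ==> Tgt D (FA F f) = FO F (Tgt C f)"
  and functor_idn: "\<And>x. x : Obj C ==> FA F (Idn C x) = Idn D (FO F x)"
  and functor_cmp: "\<And>f g. f : Arr C ==> g : Arr C ==> Src C g = Tgt C f ==>
   FA F (g \<cdot>\<^sub>C f) = FA F g \<cdot>\<^sub>D FA F f"
 using assms by (auto simp: is_functor_def homs_iff)

lemma functor_inverse_arrows:
 assumes "category C" "is_functor C D F" "inverse_arrows C f g"
 shows "inverse_arrows D (FA F f) (FA F g)"
proof -
 interpret category C by fact
 have "f : Arr C" "g : Arr C" "Src C g = Tgt C f" "Tgt C g = Src C f"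
  "g \<cdot>\<^sub>C f = Idn C (Src C f)" "f \<cdot>\<^sub>C g = Idn C (Tgt C f)"
  using assms(3) by (auto simp: inverse_arrows_def homs_iff)
 then show ?thesis
  unfolding inverse_arrows_def homs_iff
  by (simp add: functor_simps[OF assms(2)] flip: functor_cmp[OF assms(2)])
qed

lemma functor_is_iso: "category C ==> is_functor C D F ==> is_iso C f ==> is_iso D (FA F f)"
 unfolding is_iso_def by (metis functor_inverse_arrows)

lemma functor_inv:
 "category C ==> category D ==> is_functor C D F ==> is_iso C f ==>
  inv_arr D (FA F f) = FA F (inv_arr C f)"
 by (meson category.inv_arr_eq category.inverse_arrows_inv functor_inverse_arrows)

definition fully_faithful ::
 "('o1, 'm1, 'x) precat_scheme => ('o2, 'm2, 'y) precat_scheme =>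
  ('o1, 'm1, 'o2, 'm2, 'z) func_scheme => bool" where
 "fully_faithful C D F \<longleftrightarrow>
   (\<forall>x \<in> Obj C. \<forall>y \<in> Obj C. bij_betw (FA F) (homs C x y) (homs D (FO F x) (FO F y)))"

definition essentially_surjective ::
 "('o1, 'm1, 'x) precat_scheme => ('o2, 'm2, 'y) precat_scheme =>
  ('o1, 'm1, 'o2, 'm2, 'z) func_scheme => bool" where
 "essentially_surjective C D F \<longleftrightarrow> (\<forall>y \<in> Obj D. \<exists>x \<in> Obj C. isos D (FO F x) y \<noteq> {})"

lemma fully_faithful_inj:
 "fully_faithful C D F ==> FA F f = FA F g ==> f : Arr C ==> g : Arr C ==>
  Src C f = Src C g ==> Tgt C f = Tgt C g ==> category C ==> f = g"
 unfolding fully_faithful_def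
 by (metis bij_betw_imp_inj_on category.src_obj category.tgt_obj homs_iff inj_on_eq_iff)

lemma fully_faithful_surj:
 assumes "fully_faithful C D F" "h : Arr D" "Src D h = FO F x" "Tgt D h = FO F y" "x : Obj C" "y : Obj C"
 obtains f where "f : Arr C" "Src C f = x" "Tgt C f = y" "FA F f = h"
proof -
 have "h : FA F ` homs C x y"
  using assms by (auto simp: fully_faithful_def bij_betw_def homs_iff)
 then show ?thesis using that by (auto simp: homs_iff)
qed

lemma nat_transD:
 assumes "nat_trans C D F F' \<eta>"
 shows "\<And>x. x : Obj C ==> \<eta> x : Arr D" "\<And>x. x : Obj C ==> Src D (\<eta> x) = FO F x"
  "\<And>x. x : Obj C ==> Tgt D (\<eta> x) = FO F' x"
  "\<And>f. f : Arr C ==> FA F' f \<cdot>\<^sub>D \<eta> (Src C f) = \<eta> (Tgt C f) \<cdot>\<^sub>D FA F f"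
  "\<eta> : extensional (Obj C)"
 using assms by (auto simp: nat_trans_def homs_iff)

lemma nat_transI:
 assumes "\<eta> : extensional (Obj C)"
  "\<And>x. x : Obj C ==> \<eta> x : Arr D" "\<And>x. x : Obj C ==> Src D (\<eta> x) = FO F x"
  "\<And>x. x : Obj C ==> Tgt D (\<eta> x) = FO F' x"
  "\<And>f. f : Arr C ==> FA F' f \<cdot>\<^sub>D \<eta> (Src C f) = \<eta> (Tgt C f) \<cdot>\<^sub>D FA F f"
 shows "nat_trans C D F F' \<eta>"
 using assms by (auto simp: nat_trans_def homs_iff)

text \<open>
 Naturality of the unit isomorphism makes \<open>F\<close> faithful and yields the candidate preimage \<open>f\<close> of an
 arrow \<open>g\<close>, with \<open>H (F f) = H g\<close>; naturality of the counit then gives \<open>F f = g\<close>.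
\<close>

lemma equivalence_fully_faithful:
 fixes C :: "('o1, 'm1, 'x) precat_scheme" and D :: "('o2, 'm2, 'y) precat_scheme"
 assumes C: "category C" and D: "category D" and E: "category_equivalence C D F"
 shows "is_functor C D F" "fully_faithful C D F" "essentially_surjective C D F"
proof -
 interpret C: category C by fact
 interpret D: category D by fact
 obtain H :: "('o2, 'm2, 'o1, 'm1) func" and \<eta> \<epsilon> where
  F: "is_functor C D F" and H: "is_functor D C H"
  and \<eta>: "nat_iso C C (id_func C) (comp_func C H F) \<eta>"
  and \<epsilon>: "nat_iso D D (comp_func D F H) (id_func D) \<epsilon>"
  using E unfolding category_equivalence_def by blast
 note [simp] = functor_simps[OF F] functor_simps[OF H]
 have \<eta>' [simp]: "is_iso C (\<eta> x)" "\<eta> x : Arr C" "Src C (\<eta> x) = x" "Tgt C (\<eta> x) = FO H (FO F x)"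
  if "x : Obj C" for x
  using \<eta> that nat_transD[of C C "id_func C" "comp_func C H F" \<eta>]
  by (auto simp: nat_iso_def id_func_def comp_func_def)
 have \<epsilon>' [simp]: "is_iso D (\<epsilon> x)" "\<epsilon> x : Arr D" "Src D (\<epsilon> x) = FO F (FO H x)" "Tgt D (\<epsilon> x) = x"
  if "x : Obj D" for x
  using \<epsilon> that nat_transD[of D D "comp_func D F H" "id_func D" \<epsilon>]
  by (auto simp: nat_iso_def id_func_def comp_func_def)
 have \<eta>n: "FA H (FA F f) \<cdot>\<^sub>C \<eta> (Src C f) = \<eta> (Tgt C f) \<cdot>\<^sub>C f" if "f : Arr C" for f
  using \<eta> that nat_transD(4)[of C C "id_func C" "comp_func C H F" \<eta> f]
  by (auto simp: nat_iso_def id_func_def comp_func_def)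
 have \<epsilon>n: "f \<cdot>\<^sub>D \<epsilon> (Src D f) = \<epsilon> (Tgt D f) \<cdot>\<^sub>D FA F (FA H f)" if "f : Arr D" for f
  using \<epsilon> that nat_transD(4)[of D D "comp_func D F H" "id_func D" \<epsilon> f]
  by (auto simp: nat_iso_def id_func_def comp_func_def)
 show "is_functor C D F" by fact
 show "essentially_surjective C D F"
  unfolding essentially_surjective_def
 proof
  fix y assume "y : Obj D"
  then have "\<epsilon> y : isos D (FO F (FO H y)) y" by (simp add: isos_iff)
  then show "\<exists>x\<in>Obj C. isos D (FO F x) y \<noteq> {}" using \<open>y : Obj D\<close> functor_obj[OF H] by blast
 qed
 show "fully_faithful C D F"
  unfolding fully_faithful_def bij_betw_def
 proof (intro ballI conjI equalityI subsetI inj_onI)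
  fix x y f g assume *: "x : Obj C" "y : Obj C" "f : homs C x y" "g : homs C x y" "FA F f = FA F g"
  then have "\<eta> y \<cdot>\<^sub>C f = \<eta> y \<cdot>\<^sub>C g"
   using \<eta>n[of f] \<eta>n[of g] by (auto simp: homs_iff)
  then show "f = g" by (rule C.iso_cancel_left) (use * in "auto simp: homs_iff")
 next
  fix x y h assume "h : FA F ` homs C x y"
  then show "h : homs D (FO F x) (FO F y)" by (auto simp: homs_iff)
 next
  fix x y g assume *: "x : Obj C" "y : Obj C" "g : homs D (FO F x) (FO F y)"
  define f where "f = inv_arr C (\<eta> y) \<cdot>\<^sub>C FA H g \<cdot>\<^sub>C \<eta> x"
  have f: "f : homs C x y" using * by (auto simp: f_def homs_iff)
  have "FA H (FA F f) \<cdot>\<^sub>C \<eta> x = \<eta> y \<cdot>\<^sub>C f" using f \<eta>n[of f] by (auto simp: homs_iff)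
  also have "... = FA H g \<cdot>\<^sub>C \<eta> x" using * by (simp add: f_def homs_iff C.assoc)
  finally have "FA H (FA F f) = FA H g"
   by (rule C.iso_cancel_right) (use * f in "auto simp: homs_iff")
  then have "FA F f \<cdot>\<^sub>D \<epsilon> (FO F x) = g \<cdot>\<^sub>D \<epsilon> (FO F x)"
   using \<epsilon>n[of g] \<epsilon>n[of "FA F f"] * f by (auto simp: homs_iff)
  then have "FA F f = g"
   by (rule D.iso_cancel_right) (use * f in "auto simp: homs_iff")
  with f show "g : FA F ` homs C x y" by blast
 qed
qed

text \<open>
 A quasi-inverse sends \<open>y\<close> to a chosen object \<open>X y\<close> whose image is isomorphic to \<open>y\<close>, and an arrow to
 the preimage of its conjugate by the chosen isomorphisms \<open>e y\<close>.
\<close>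

lemma fully_faithful_equivalence:
 fixes F :: "('o1, 'm1, 'o2, 'm2, 'z) func_scheme"
 assumes C: "category C" and D: "category D" and F: "is_functor C D F"
  and FF: "fully_faithful C D F" and ES: "essentially_surjective C D F"
 shows "category_equivalence C D F"
proof -
 interpret C: category C by fact
 interpret D: category D by fact
 note [simp] = functor_simps[OF F]
 have inj: "f = g" if "FA F f = FA F g" "f : Arr C" "g : Arr C" "Src C f = Src C g" "Tgt C f = Tgt C g" for f g
  using fully_faithful_inj[OF FF that C] .
 obtain X e where X [simp]: "\<And>y. y : Obj D ==> X y : Obj C"
  and e: "\<And>y. y : Obj D ==> e y : isos D (FO F (X y)) y"
  using ES unfolding essentially_surjective_def ex_in_conv[symmetric] Bex_def by metis
 then have [simp]: "is_iso D (e y)" "e y : Arr D" "Src D (e y) = FO F (X y)" "Tgt D (e y) = y"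
  if "y : Obj D" for y using that by (auto simp: isos_iff)
 have "\<exists>f. f : Arr C \<and> Src C f = x \<and> Tgt C f = y \<and> FA F f = h"
  if "h : Arr D" "Src D h = FO F x" "Tgt D h = FO F y" "x : Obj C" "y : Obj C" for h x y
  using fully_faithful_surj[OF FF that] by metis
 then obtain L where L: "\<And>h x y. h : Arr D ==> Src D h = FO F x ==> Tgt D h = FO F y ==> x : Obj C ==>
   y : Obj C ==> L h x y : Arr C \<and> Src C (L h x y) = x \<and> Tgt C (L h x y) = y \<and> FA F (L h x y) = h"
  by metis
 define Hm where "Hm g = L (inv_arr D (e (Tgt D g)) \<cdot>\<^sub>D g \<cdot>\<^sub>D e (Src D g)) (X (Src D g)) (X (Tgt D g))" for g
 have Hm [simp]: "Hm g : Arr C" "Src C (Hm g) = X (Src D g)" "Tgt C (Hm g) = X (Tgt D g)"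
  "FA F (Hm g) = inv_arr D (e (Tgt D g)) \<cdot>\<^sub>D g \<cdot>\<^sub>D e (Src D g)" if "g : Arr D" for g
  unfolding Hm_def using L that by simp_all
 define H :: "('o2, 'm2, 'o1, 'm1) func" where "H = \<lparr>FO = (\<lambda>y \<in> Obj D. X y), FA = (\<lambda>g \<in> Arr D. Hm g)\<rparr>"
 have H: "is_functor D C H"
  unfolding is_functor_def
 proof (intro conjI ballI allI)
  fix y assume "y : Obj D" then show "FA H (Idn D y) = Idn C (FO H y)"
   by (auto simp: H_def intro!: inj)
 next
  fix x y z f g assume "f : homs D x y" "g : homs D y z"
  then show "FA H (g \<cdot>\<^sub>D f) = FA H g \<cdot>\<^sub>C FA H f"
   by (auto simp: H_def homs_iff D.assoc intro!: inj)
 qed (auto simp: H_def homs_iff)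
 define \<eta> where "\<eta> = (\<lambda>x \<in> Obj C. L (inv_arr D (e (FO F x))) x (X (FO F x)))"
 have \<eta>': "\<eta> x : Arr C \<and> Src C (\<eta> x) = x \<and> Tgt C (\<eta> x) = X (FO F x) \<and> FA F (\<eta> x) = inv_arr D (e (FO F x))"
  if "x : Obj C" for x unfolding \<eta>_def using that L by simp
 note [simp] = conjunct1[OF \<eta>'] conjunct1[OF conjunct2[OF \<eta>']] conjunct1[OF conjunct2[OF conjunct2[OF \<eta>']]]
  conjunct2[OF conjunct2[OF conjunct2[OF \<eta>']]]
 have \<eta>iso: "is_iso C (\<eta> x)" if x: "x : Obj C" for x
 proof -
  define k where "k = L (e (FO F x)) (X (FO F x)) x"
  have k: "k : Arr C" "Src C k = X (FO F x)" "Tgt C k = x" "FA F k = e (FO F x)"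
   unfolding k_def using x L by simp_all
  show ?thesis by (rule C.is_isoI[where g = k]) (use x k in "auto intro!: inj")
 qed
 have 1: "nat_iso C C (id_func C) (comp_func C H F) \<eta>"
  unfolding nat_iso_def
 proof (intro conjI ballI nat_transI)
  fix f assume f: "f : Arr C"
  have "Hm (FA F f) \<cdot>\<^sub>C \<eta> (Src C f) = \<eta> (Tgt C f) \<cdot>\<^sub>C f"
   using f by (auto simp: D.assoc intro!: inj)
  then show "FA (comp_func C H F) f \<cdot>\<^sub>C \<eta> (Src C f) = \<eta> (Tgt C f) \<cdot>\<^sub>C FA (id_func C) f"
   using f by (simp add: comp_func_def H_def id_func_def)
 qed (auto simp: \<eta>iso comp_func_def H_def id_func_def, simp add: \<eta>_def)
 have 2: "nat_iso D D (comp_func D F H) (id_func D) (\<lambda>y \<in> Obj D. e y)"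
  unfolding nat_iso_def
  by (intro conjI ballI nat_transI) (auto simp: comp_func_def H_def id_func_def D.assoc)
 show ?thesis unfolding category_equivalence_def using F H 1 2 by blast
qed

section \<open>Monoidal categories and 2-groups\<close>

context monoidal_category
begin

lemma unt_in [simp]: "Unt C : Obj C" by (rule unt_obj)

lemma tenO_in [simp]: "x : Obj C ==> y : Obj C ==> x \<otimes>\<^sub>o y : Obj C" by (rule tenO_obj)

lemma tenA_simps [simp]:
 assumes "f : Arr C" "g : Arr C"
 shows "f \<otimes> g : Arr C" "Src C (f \<otimes> g) = Src C f \<otimes>\<^sub>o Src C g" "Tgt C (f \<otimes> g) = Tgt C f \<otimes>\<^sub>o Tgt C g"
 using tenA_hom[of f "Src C f" "Tgt C f" g "Src C g" "Tgt C g"] assms by (auto simp: homs_iff)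

lemma tenA_idn' [simp]: "x : Obj C ==> y : Obj C ==> Idn C x \<otimes> Idn C y = Idn C (x \<otimes>\<^sub>o y)"
 by (rule tenA_idn)

lemma interchange:
 assumes "f : Arr C" "f' : Arr C" "g : Arr C" "g' : Arr C" "Src C f' = Tgt C f" "Src C g' = Tgt C g"
 shows "(f' \<otimes> g') \<cdot> (f \<otimes> g) = (f' \<cdot> f) \<otimes> (g' \<cdot> g)"
 using tenA_cmp[of f "Src C f" "Tgt C f" f' "Tgt C f'" g "Src C g" "Tgt C g" g' "Tgt C g'"] assms
 by (auto simp: homs_iff)

lemma interchange_ext:
 assumes "f : Arr C" "f' : Arr C" "g : Arr C" "g' : Arr C" "Src C f' = Tgt C f" "Src C g' = Tgt C g"
  "k : Arr C" "Tgt C k = Src C f \<otimes>\<^sub>o Src C g"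
 shows "(f' \<otimes> g') \<cdot> ((f \<otimes> g) \<cdot> k) = ((f' \<cdot> f) \<otimes> (g' \<cdot> g)) \<cdot> k"
 by (rule ext1[OF interchange]) (use assms in auto)

lemma is_iso_ten [simp]:
 assumes "is_iso C f" "is_iso C g"
 shows "is_iso C (f \<otimes> g)"
 using assms iso_arr[OF assms(1)] iso_arr[OF assms(2)]
 by (intro is_isoI[where g = "inv_arr C f \<otimes> inv_arr C g"]) (auto simp: interchange)

lemma inv_ten:
 assumes "is_iso C f" "is_iso C g"
 shows "inv_arr C (f \<otimes> g) = inv_arr C f \<otimes> inv_arr C g"
 using assms iso_arr[OF assms(1)] iso_arr[OF assms(2)]
 by (intro inv_arr_eq inverse_arrowsI) (auto simp: interchange)

lemma asc_simps [simp]: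
 assumes "x : Obj C" "y : Obj C" "z : Obj C"
 shows "Asc C x y z : Arr C" "Src C (Asc C x y z) = (x \<otimes>\<^sub>o y) \<otimes>\<^sub>o z"
  "Tgt C (Asc C x y z) = x \<otimes>\<^sub>o (y \<otimes>\<^sub>o z)" "is_iso C (Asc C x y z)"
 using asc_iso[OF assms] by (auto simp: isos_iff)

lemma lun_simps [simp]:
 assumes "x : Obj C"
 shows "Lun C x : Arr C" "Src C (Lun C x) = Unt C \<otimes>\<^sub>o x" "Tgt C (Lun C x) = x" "is_iso C (Lun C x)"
 using lun_iso[OF assms] by (auto simp: isos_iff)

lemma run_simps [simp]:
 assumes "x : Obj C"
 shows "Run C x : Arr C" "Src C (Run C x) = x \<otimes>\<^sub>o Unt C" "Tgt C (Run C x) = x" "is_iso C (Run C x)"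
 using run_iso[OF assms] by (auto simp: isos_iff)

lemma asc_nat':
 assumes "f : Arr C" "g : Arr C" "h : Arr C"
  "Tgt C f = x" "Tgt C g = y" "Tgt C h = z"
 shows "Asc C x y z \<cdot> ((f \<otimes> g) \<otimes> h) =
  (f \<otimes> (g \<otimes> h)) \<cdot> Asc C (Src C f) (Src C g) (Src C h)"
 using asc_nat[of f "Src C f" x g "Src C g" y h "Src C h" z] assms by (auto simp: homs_iff)

lemma inv_asc_nat:
 assumes "f : Arr C" "g : Arr C" "h : Arr C"
  "Tgt C f = x" "Tgt C g = y" "Tgt C h = z"
 shows "inv_arr C (Asc C x y z) \<cdot> (f \<otimes> (g \<otimes> h)) =
  ((f \<otimes> g) \<otimes> h) \<cdot> inv_arr C (Asc C (Src C f) (Src C g) (Src C h))"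
 by (rule iso_square[OF asc_nat'[OF assms]]) (use assms in auto)

lemma lun_nat': "f : Arr C ==> Tgt C f = x ==>
  Lun C x \<cdot> (Idn C (Unt C) \<otimes> f) = f \<cdot> Lun C (Src C f)"
 using lun_nat[of f "Src C f" x] by (auto simp: homs_iff)

lemma run_nat': "f : Arr C ==> Tgt C f = x ==>
  Run C x \<cdot> (f \<otimes> Idn C (Unt C)) = f \<cdot> Run C (Src C f)"
 using run_nat[of f "Src C f" x] by (auto simp: homs_iff)

text \<open>Tensoring with the unit object on either side is faithful, being isomorphic to the identity.\<close>

lemma unt_ten_inj:
 assumes "Idn C (Unt C) \<otimes> f = Idn C (Unt C) \<otimes> g" "f : Arr C" "g : Arr C"
  "Src C f = Src C g" "Tgt C f = Tgt C g"
 shows "f = g"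
proof (rule iso_cancel_right[where f = "Lun C (Src C f)"])
 show "f \<cdot> Lun C (Src C f) = g \<cdot> Lun C (Src C f)"
  using lun_nat'[of f "Tgt C f"] lun_nat'[of g "Tgt C g"] assms by simp
qed (use assms in auto)

lemma ten_unt_inj:
 assumes "f \<otimes> Idn C (Unt C) = g \<otimes> Idn C (Unt C)" "f : Arr C" "g : Arr C"
  "Src C f = Src C g" "Tgt C f = Tgt C g"
 shows "f = g"
proof (rule iso_cancel_right[where f = "Run C (Src C f)"])
 show "f \<cdot> Run C (Src C f) = g \<cdot> Run C (Src C f)"
  using run_nat'[of f "Tgt C f"] run_nat'[of g "Tgt C g"] assms by simp
qed (use assms in auto)

text \<open>Kelly's consequences of the pentagon and triangle axioms.\<close>

lemma lun_asc:
 assumes [simp]: "x : Obj C" "y : Obj C"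
 shows "Lun C (x \<otimes>\<^sub>o y) \<cdot> Asc C (Unt C) x y = Lun C x \<otimes> Idn C y"
proof -
 let ?I = "Unt C"
 let ?Z = "Asc C ?I (?I \<otimes>\<^sub>o x) y \<cdot> (Asc C ?I ?I x \<otimes> Idn C y)"
 have t1: "(Idn C ?I \<otimes> Lun C (x \<otimes>\<^sub>o y)) \<cdot> Asc C ?I ?I (x \<otimes>\<^sub>o y) = Run C ?I \<otimes> Idn C (x \<otimes>\<^sub>o y)"
  by (rule triangle) auto
 have t2: "(Idn C ?I \<otimes> Lun C x) \<cdot> Asc C ?I ?I x = Run C ?I \<otimes> Idn C x"
  by (rule triangle) auto
 have p: "Asc C ?I ?I (x \<otimes>\<^sub>o y) \<cdot> Asc C (?I \<otimes>\<^sub>o ?I) x y = (Idn C ?I \<otimes> Asc C ?I x y) \<cdot> ?Z"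
  by (subst pentagon) (auto simp: assoc)
 have "(Idn C ?I \<otimes> (Lun C (x \<otimes>\<^sub>o y) \<cdot> Asc C ?I x y)) \<cdot> ?Z
  = (Idn C ?I \<otimes> Lun C (x \<otimes>\<^sub>o y)) \<cdot> ((Idn C ?I \<otimes> Asc C ?I x y) \<cdot> ?Z)"
  by (simp add: interchange_ext)
 also have "... = (Run C ?I \<otimes> Idn C (x \<otimes>\<^sub>o y)) \<cdot> Asc C (?I \<otimes>\<^sub>o ?I) x y"
  unfolding p[symmetric] by (subst ext1[OF t1]) auto
 also have "... = Asc C ?I x y \<cdot> ((Run C ?I \<otimes> Idn C x) \<otimes> Idn C y)"
  by (subst asc_nat') auto
 also have "... = Asc C ?I x y \<cdot> (((Idn C ?I \<otimes> Lun C x) \<otimes> Idn C y) \<cdot> (Asc C ?I ?I x \<otimes> Idn C y))"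
  by (simp add: interchange t2)
 also have "... = (Idn C ?I \<otimes> (Lun C x \<otimes> Idn C y)) \<cdot> ?Z"
  by (subst ext2[OF asc_nat']) auto
 finally have "Idn C ?I \<otimes> (Lun C (x \<otimes>\<^sub>o y) \<cdot> Asc C ?I x y) = Idn C ?I \<otimes> (Lun C x \<otimes> Idn C y)"
  by (rule iso_cancel_right) auto
 then show ?thesis by (rule unt_ten_inj) auto
qed

lemma run_asc:
 assumes [simp]: "x : Obj C" "y : Obj C"
 shows "(Idn C x \<otimes> Run C y) \<cdot> Asc C x y (Unt C) = Run C (x \<otimes>\<^sub>o y)"
proof -
 let ?I = "Unt C"
 have t1: "(Idn C (x \<otimes>\<^sub>o y) \<otimes> Lun C ?I) \<cdot> Asc C (x \<otimes>\<^sub>o y) ?I ?I = Run C (x \<otimes>\<^sub>o y) \<otimes> Idn C ?I"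
  by (rule triangle) auto
 have t2: "(Idn C y \<otimes> Lun C ?I) \<cdot> Asc C y ?I ?I = Run C y \<otimes> Idn C ?I"
  by (rule triangle) auto
 have p: "Asc C x y (?I \<otimes>\<^sub>o ?I) \<cdot> Asc C (x \<otimes>\<^sub>o y) ?I ?I =
   (Idn C x \<otimes> Asc C y ?I ?I) \<cdot> (Asc C x (y \<otimes>\<^sub>o ?I) ?I \<cdot> (Asc C x y ?I \<otimes> Idn C ?I))"
  by (subst pentagon) (auto simp: assoc)
 have n1: "Asc C x y ?I \<cdot> ((Idn C x \<otimes> Idn C y) \<otimes> Lun C ?I)
   = (Idn C x \<otimes> (Idn C y \<otimes> Lun C ?I)) \<cdot> Asc C x y (?I \<otimes>\<^sub>o ?I)"
  by (subst asc_nat') auto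
 have n2: "Asc C x y ?I \<cdot> ((Idn C x \<otimes> Run C y) \<otimes> Idn C ?I)
   = (Idn C x \<otimes> (Run C y \<otimes> Idn C ?I)) \<cdot> Asc C x (y \<otimes>\<^sub>o ?I) ?I"
  by (subst asc_nat') auto
 have "Asc C x y ?I \<cdot> (Run C (x \<otimes>\<^sub>o y) \<otimes> Idn C ?I)
  = Asc C x y ?I \<cdot> (((Idn C x \<otimes> Idn C y) \<otimes> Lun C ?I) \<cdot> Asc C (x \<otimes>\<^sub>o y) ?I ?I)"
  by (simp add: t1)
 also have "... = (Idn C x \<otimes> (Idn C y \<otimes> Lun C ?I)) \<cdot> (Asc C x y (?I \<otimes>\<^sub>o ?I) \<cdot> Asc C (x \<otimes>\<^sub>o y) ?I ?I)"
  by (subst ext2[OF n1]) auto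
 also have "... = (Idn C x \<otimes> (Run C y \<otimes> Idn C ?I)) \<cdot> (Asc C x (y \<otimes>\<^sub>o ?I) ?I \<cdot> (Asc C x y ?I \<otimes> Idn C ?I))"
  unfolding p by (simp add: interchange_ext t2)
 also have "... = Asc C x y ?I \<cdot> (((Idn C x \<otimes> Run C y) \<otimes> Idn C ?I) \<cdot> (Asc C x y ?I \<otimes> Idn C ?I))"
  by (subst ext2[OF n2]) auto
 also have "... = Asc C x y ?I \<cdot> (((Idn C x \<otimes> Run C y) \<cdot> Asc C x y ?I) \<otimes> Idn C ?I)"
  by (simp add: interchange)
 finally have "Run C (x \<otimes>\<^sub>o y) \<otimes> Idn C ?I = ((Idn C x \<otimes> Run C y) \<cdot> Asc C x y ?I) \<otimes> Idn C ?I"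
  by (rule iso_cancel_left) auto
 then show ?thesis by (rule ten_unt_inj[symmetric]) auto
qed

text \<open>
 If \<open>x \<otimes> x'\<close> is isomorphic to the unit, then tensoring with \<open>x\<close> and \<open>x'\<close> in turn is isomorphic
 to the identity functor, by the following natural isomorphisms.
\<close>

lemma ten_ten_iso:
 assumes "x : Obj C" "x' : Obj C" "w : isos C (x \<otimes>\<^sub>o x') (Unt C)"
 obtains \<kappa> where "\<And>y. y : Obj C ==> \<kappa> y : isos C ((y \<otimes>\<^sub>o x) \<otimes>\<^sub>o x') y"
  "\<And>t. t : Arr C ==> t \<cdot> \<kappa> (Src C t) = \<kappa> (Tgt C t) \<cdot> ((t \<otimes> Idn C x) \<otimes> Idn C x')"
proof -
 have w [simp]: "w : Arr C" "is_iso C w" "Src C w = x \<otimes>\<^sub>o x'" "Tgt C w = Unt C"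
  using assms(3) by (auto simp: isos_iff)
 note [simp] = assms(1,2)
 define \<kappa> where "\<kappa> y = Run C y \<cdot> ((Idn C y \<otimes> w) \<cdot> Asc C y x x')" for y
 show ?thesis
 proof (rule that[of \<kappa>])
  fix t assume [simp]: "t : Arr C"
  have "t \<cdot> \<kappa> (Src C t) = Run C (Tgt C t) \<cdot> ((t \<otimes> Idn C (Unt C)) \<cdot> ((Idn C (Src C t) \<otimes> w) \<cdot> Asc C (Src C t) x x'))"
   unfolding \<kappa>_def by (subst ext2[OF run_nat']) auto
  also have "... = Run C (Tgt C t) \<cdot> ((Idn C (Tgt C t) \<otimes> w) \<cdot> ((t \<otimes> (Idn C x \<otimes> Idn C x')) \<cdot> Asc C (Src C t) x x'))"
   by (simp add: interchange_ext)
  also have "... = Run C (Tgt C t) \<cdot> ((Idn C (Tgt C t) \<otimes> w) \<cdot> (Asc C (Tgt C t) x x' \<cdot> ((t \<otimes> Idn C x) \<otimes> Idn C x')))"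
   by (subst asc_nat') auto
  also have "... = \<kappa> (Tgt C t) \<cdot> ((t \<otimes> Idn C x) \<otimes> Idn C x')"
   by (simp add: \<kappa>_def assoc)
  finally show "t \<cdot> \<kappa> (Src C t) = \<kappa> (Tgt C t) \<cdot> ((t \<otimes> Idn C x) \<otimes> Idn C x')" .
 qed (auto simp: \<kappa>_def isos_iff)
qed

lemma ten_ten_iso':
 assumes "x : Obj C" "x' : Obj C" "w : isos C (x' \<otimes>\<^sub>o x) (Unt C)"
 obtains \<kappa> where "\<And>y. y : Obj C ==> \<kappa> y : isos C (x' \<otimes>\<^sub>o (x \<otimes>\<^sub>o y)) y"
  "\<And>t. t : Arr C ==> t \<cdot> \<kappa> (Src C t) = \<kappa> (Tgt C t) \<cdot> (Idn C x' \<otimes> (Idn C x \<otimes> t))"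
proof -
 have w [simp]: "w : Arr C" "is_iso C w" "Src C w = x' \<otimes>\<^sub>o x" "Tgt C w = Unt C"
  using assms(3) by (auto simp: isos_iff)
 note [simp] = assms(1,2)
 define \<kappa> where "\<kappa> y = Lun C y \<cdot> ((w \<otimes> Idn C y) \<cdot> inv_arr C (Asc C x' x y))" for y
 show ?thesis
 proof (rule that[of \<kappa>])
  fix t assume [simp]: "t : Arr C"
  have "t \<cdot> \<kappa> (Src C t) = Lun C (Tgt C t) \<cdot> ((Idn C (Unt C) \<otimes> t) \<cdot> ((w \<otimes> Idn C (Src C t)) \<cdot> inv_arr C (Asc C x' x (Src C t))))"
   unfolding \<kappa>_def by (subst ext2[OF lun_nat']) auto
  also have "... = Lun C (Tgt C t) \<cdot> ((w \<otimes> Idn C (Tgt C t)) \<cdot> (((Idn C x' \<otimes> Idn C x) \<otimes> t) \<cdot> inv_arr C (Asc C x' x (Src C t))))"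
   by (simp add: interchange_ext)
  also have "... = Lun C (Tgt C t) \<cdot> ((w \<otimes> Idn C (Tgt C t)) \<cdot> (inv_arr C (Asc C x' x (Tgt C t)) \<cdot> (Idn C x' \<otimes> (Idn C x \<otimes> t))))"
   by (subst inv_asc_nat) auto
  also have "... = \<kappa> (Tgt C t) \<cdot> (Idn C x' \<otimes> (Idn C x \<otimes> t))"
   by (simp add: \<kappa>_def assoc)
  finally show "t \<cdot> \<kappa> (Src C t) = \<kappa> (Tgt C t) \<cdot> (Idn C x' \<otimes> (Idn C x \<otimes> t))" .
 qed (auto simp: \<kappa>_def isos_iff)
qed

end

context two_group
begin

lemma arr_iso' [simp]: "f : Arr G ==> is_iso G f" by (rule arr_iso)

lemma obtain_inverse:
 assumes "x : Obj G"
 obtains x' v w where "x' : Obj G" "v : isos G (x \<otimes>\<^sub>o x') (Unt G)" "w : isos G (x' \<otimes>\<^sub>o x) (Unt G)"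
 using obj_invertible[OF assms] by (auto simp: iso_rel_def)

lemma ten_right_inj:
 assumes "f \<otimes> Idn G x = g \<otimes> Idn G x" "f : Arr G" "g : Arr G"
  "Src G f = Src G g" "Tgt G f = Tgt G g" "x : Obj G"
 shows "f = g"
proof -
 obtain x' v where x': "x' : Obj G" "v : isos G (x \<otimes>\<^sub>o x') (Unt G)" using obtain_inverse[OF assms(6)] .
 obtain \<kappa> where \<kappa>: "\<And>y. y : Obj G ==> \<kappa> y : isos G ((y \<otimes>\<^sub>o x) \<otimes>\<^sub>o x') y"
  "\<And>t. t : Arr G ==> t \<cdot> \<kappa> (Src G t) = \<kappa> (Tgt G t) \<cdot> ((t \<otimes> Idn G x) \<otimes> Idn G x')"
  using ten_ten_iso[OF assms(6) x'] by blast
 show ?thesis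
  by (rule iso_cancel_right[where f = "\<kappa> (Src G f)"])
   (use \<kappa>(2)[of f] \<kappa>(2)[of g] \<kappa>(1)[of "Src G f"] assms in "auto simp: isos_iff")
qed

lemma ten_left_inj:
 assumes "Idn G x \<otimes> f = Idn G x \<otimes> g" "f : Arr G" "g : Arr G"
  "Src G f = Src G g" "Tgt G f = Tgt G g" "x : Obj G"
 shows "f = g"
proof -
 obtain x' v w where x': "x' : Obj G" "v : isos G (x \<otimes>\<^sub>o x') (Unt G)" "w : isos G (x' \<otimes>\<^sub>o x) (Unt G)"
  using obtain_inverse[OF assms(6)] .
 obtain \<kappa> where \<kappa>: "\<And>y. y : Obj G ==> \<kappa> y : isos G (x' \<otimes>\<^sub>o (x \<otimes>\<^sub>o y)) y"
  "\<And>t. t : Arr G ==> t \<cdot> \<kappa> (Src G t) = \<kappa> (Tgt G t) \<cdot> (Idn G x' \<otimes> (Idn G x \<otimes> t))"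
  using ten_ten_iso'[OF assms(6) x'(1,3)] by blast
 show ?thesis
  by (rule iso_cancel_right[where f = "\<kappa> (Src G f)"])
   (use \<kappa>(2)[of f] \<kappa>(2)[of g] \<kappa>(1)[of "Src G f"] assms in "auto simp: isos_iff")
qed

text \<open>
 Tensoring with an invertible object is also full: a preimage is produced by tensoring with an
 inverse object, and that it is one may be tested after tensoring with that inverse.
\<close>

lemma ten_right_surj:
 assumes "e : Arr G" "Src G e = y \<otimes>\<^sub>o x" "Tgt G e = z \<otimes>\<^sub>o x" "x : Obj G" "y : Obj G" "z : Obj G"
 obtains t where "t : Arr G" "Src G t = y" "Tgt G t = z" "t \<otimes> Idn G x = e"
proof -
 obtain x' v where x': "x' : Obj G" "v : isos G (x \<otimes>\<^sub>o x') (Unt G)" using obtain_inverse[OF assms(4)] .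
 obtain \<kappa> where \<kappa>: "\<And>y. y : Obj G ==> \<kappa> y : isos G ((y \<otimes>\<^sub>o x) \<otimes>\<^sub>o x') y"
  "\<And>t. t : Arr G ==> t \<cdot> \<kappa> (Src G t) = \<kappa> (Tgt G t) \<cdot> ((t \<otimes> Idn G x) \<otimes> Idn G x')"
  using ten_ten_iso[OF assms(4) x'] by blast
 have \<kappa>' [simp]: "\<kappa> y : Arr G" "Src G (\<kappa> y) = (y \<otimes>\<^sub>o x) \<otimes>\<^sub>o x'" "Tgt G (\<kappa> y) = y" if "y : Obj G" for y
  using \<kappa>(1)[OF that] by (auto simp: isos_iff)
 note [simp] = assms x'(1)
 define t where "t = \<kappa> z \<cdot> ((e \<otimes> Idn G x') \<cdot> inv_arr G (\<kappa> y))"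
 have t [simp]: "t : Arr G" "Src G t = y" "Tgt G t = z" by (simp_all add: t_def)
 have "\<kappa> z \<cdot> ((t \<otimes> Idn G x) \<otimes> Idn G x') = t \<cdot> \<kappa> y" using \<kappa>(2)[of t] by simp
 also have "... = \<kappa> z \<cdot> (e \<otimes> Idn G x')" by (simp add: t_def assoc)
 finally have "(t \<otimes> Idn G x) \<otimes> Idn G x' = e \<otimes> Idn G x'" by (rule iso_cancel_left) auto
 then have "t \<otimes> Idn G x = e" by (rule ten_right_inj) auto
 then show ?thesis using that[of t] by simp
qed

lemma ten_left_surj:
 assumes "e : Arr G" "Src G e = x \<otimes>\<^sub>o y" "Tgt G e = x \<otimes>\<^sub>o z" "x : Obj G" "y : Obj G" "z : Obj G"
 obtains t where "t : Arr G" "Src G t = y" "Tgt G t = z" "Idn G x \<otimes> t = e"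
proof -
 obtain x' v w where x': "x' : Obj G" "v : isos G (x \<otimes>\<^sub>o x') (Unt G)" "w : isos G (x' \<otimes>\<^sub>o x) (Unt G)"
  using obtain_inverse[OF assms(4)] .
 obtain \<kappa> where \<kappa>: "\<And>y. y : Obj G ==> \<kappa> y : isos G (x' \<otimes>\<^sub>o (x \<otimes>\<^sub>o y)) y"
  "\<And>t. t : Arr G ==> t \<cdot> \<kappa> (Src G t) = \<kappa> (Tgt G t) \<cdot> (Idn G x' \<otimes> (Idn G x \<otimes> t))"
  using ten_ten_iso'[OF assms(4) x'(1,3)] by blast
 have \<kappa>' [simp]: "\<kappa> y : Arr G" "Src G (\<kappa> y) = x' \<otimes>\<^sub>o (x \<otimes>\<^sub>o y)" "Tgt G (\<kappa> y) = y" if "y : Obj G" for y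
  using \<kappa>(1)[OF that] by (auto simp: isos_iff)
 note [simp] = assms x'(1)
 define t where "t = \<kappa> z \<cdot> ((Idn G x' \<otimes> e) \<cdot> inv_arr G (\<kappa> y))"
 have t [simp]: "t : Arr G" "Src G t = y" "Tgt G t = z" by (simp_all add: t_def)
 have "\<kappa> z \<cdot> (Idn G x' \<otimes> (Idn G x \<otimes> t)) = t \<cdot> \<kappa> y" using \<kappa>(2)[of t] by simp
 also have "... = \<kappa> z \<cdot> (Idn G x' \<otimes> e)" by (simp add: t_def assoc)
 finally have "Idn G x' \<otimes> (Idn G x \<otimes> t) = Idn G x' \<otimes> e" by (rule iso_cancel_left) auto
 then have "Idn G x \<otimes> t = e" by (rule ten_left_inj) auto
 then show ?thesis using that[of t] by simp
qed

end

context finite_two_group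
begin

text \<open>
 Finiteness is given for the endomorphisms of the unit. Composing with a fixed arrow back to \<open>x\<close> and
 tensoring with an inverse of \<open>x\<close> embeds every set of arrows into these.
\<close>

lemma finite_homs: "finite (homs G x y)"
proof (cases "homs G x y = {}")
 case False
 then obtain b where "b : homs G x y" by blast
 then have b: "b : Arr G" "Src G b = x" "Tgt G b = y" by (auto simp: homs_iff)
 then have [simp]: "x : Obj G" "y : Obj G" by auto
 obtain x' v w where x' [simp]: "x' : Obj G" and v: "v : isos G (x \<otimes>\<^sub>o x') (Unt G)"
  and "w : isos G (x' \<otimes>\<^sub>o x) (Unt G)"
  by (rule obtain_inverse[OF \<open>x : Obj G\<close>])
 note [simp] = v[unfolded isos_iff] b
 define \<Theta> where "\<Theta> f = v \<cdot> (((inv_arr G b \<cdot> f) \<otimes> Idn G x') \<cdot> inv_arr G v)" for f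
 have "inj_on \<Theta> (homs G x y)"
 proof (rule inj_onI)
  fix f g assume f: "f : homs G x y" and g: "g : homs G x y" and e: "\<Theta> f = \<Theta> g"
  note fg [simp] = f[unfolded homs_iff] g[unfolded homs_iff]
  have "((inv_arr G b \<cdot> f) \<otimes> Idn G x') \<cdot> inv_arr G v = ((inv_arr G b \<cdot> g) \<otimes> Idn G x') \<cdot> inv_arr G v"
   by (rule iso_cancel_left[where f = v]) (use e in \<open>auto simp: \<Theta>_def\<close>)
  then have "(inv_arr G b \<cdot> f) \<otimes> Idn G x' = (inv_arr G b \<cdot> g) \<otimes> Idn G x'"
   by (rule iso_cancel_right) auto
  then have "inv_arr G b \<cdot> f = inv_arr G b \<cdot> g" by (rule ten_right_inj) auto
  then show "f = g" by (rule iso_cancel_left) auto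
 qed
 moreover have "\<Theta> ` homs G x y \<subseteq> homs G (Unt G) (Unt G)"
  by (auto simp: \<Theta>_def homs_iff)
 ultimately show ?thesis using finite_pi2 by (meson finite_imageD finite_subset)
qed simp

end

section \<open>The 2-group of auto-equivalences\<close>

text \<open>
 An algebra whose structure maps are well-typed, functorial and invertible. Auto-equivalences can be
 composed under these assumptions; the coherence equations that are transported along a composite
 are those satisfied by its two factors.
\<close>

locale galg = G: monoidal_category G + A: monoidal_category A
 for G :: "('g, 'a, 'x) moncat_scheme" and A :: "('o, 'm, 'k, 'g, 'a, 'y) galgebra_scheme" (structure) +
 assumes brd_hom: "x : Obj A ==> y : Obj A ==> Brd A x y : homs A (x \<otimes>\<^sub>o\<^sub>A y) (y \<otimes>\<^sub>o\<^sub>A x)"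
  and add_hom: "f : homs A x y ==> f' : homs A x y ==> Add A f f' : homs A x y"
  and scl_hom: "f : homs A x y ==> Scl A c f : homs A x y"
  and actO_obj: "g : Obj G ==> x : Obj A ==> ActO A g x : Obj A"
  and actA_hom: "a : homs G g h ==> f : homs A x y ==> ActA A a f : homs A (ActO A g x) (ActO A h y)"
  and actA_idn: "g : Obj G ==> x : Obj A ==> ActA A (Idn G g) (Idn A x) = Idn A (ActO A g x)"
  and actA_cmp: "a : homs G g h ==> a' : homs G h k ==> f : homs A x y ==> f' : homs A y z ==>
   ActA A (a' \<cdot>\<^sub>G a) (f' \<cdot> f) = ActA A a' f' \<cdot> ActA A a f"
  and actAsc_iso: "g : Obj G ==> h : Obj G ==> x : Obj A ==>
   ActAsc A g h x : isos A (ActO A (g \<otimes>\<^sub>o\<^sub>G h) x) (ActO A g (ActO A h x))"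
  and actUnt_iso: "x : Obj A ==> ActUnt A x : isos A (ActO A (Unt G) x) x"
  and actMu_iso: "g : Obj G ==> x : Obj A ==> y : Obj A ==>
   ActMu A g x y : isos A (ActO A g x \<otimes>\<^sub>o\<^sub>A ActO A g y) (ActO A g (x \<otimes>\<^sub>o\<^sub>A y))"
  and actIota_iso: "g : Obj G ==> ActIota A g : isos A (Unt A) (ActO A g (Unt A))"
begin

abbreviation tenAA  (infixr \<open>\<boxtimes>\<close> 72) where "f \<boxtimes> g \<equiv> f \<otimes> g"
abbreviation tenOA  (infixr \<open>\<boxdot>\<close> 72) where "x \<boxdot> y \<equiv> x \<otimes>\<^sub>o\<^sub>A y"
abbreviation aut where "aut F \<equiv> algebra_auto_equivalence G A F"
abbreviation comp where "comp \<equiv> comp_auto G A"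
abbreviation act where "act g \<equiv> ActA A (Idn G g)"
abbreviation ident where "ident \<equiv> id_auto G A"

lemma brd_simps [simp]:
 "x : Obj A ==> y : Obj A ==> Brd A x y : Arr A"
 "x : Obj A ==> y : Obj A ==> Src A (Brd A x y) = x \<boxdot> y"
 "x : Obj A ==> y : Obj A ==> Tgt A (Brd A x y) = y \<boxdot> x"
 using brd_hom by (auto simp: homs_iff)

lemma actO_in [simp]: "g : Obj G ==> x : Obj A ==> ActO A g x : Obj A" by (rule actO_obj)

lemma actA_simps [simp]:
 assumes "a : Arr G" "f : Arr A"
 shows "ActA A a f : Arr A" "Src A (ActA A a f) = ActO A (Src G a) (Src A f)"
  "Tgt A (ActA A a f) = ActO A (Tgt G a) (Tgt A f)"
 using actA_hom[of a "Src G a" "Tgt G a" f "Src A f" "Tgt A f"] assms by (auto simp: homs_iff)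

lemma actA_idn' [simp]: "g : Obj G ==> x : Obj A ==> act g (Idn A x) = Idn A (ActO A g x)"
 by (rule actA_idn)

lemma actA_merge:
 assumes "g : Obj G" "f : Arr A" "f' : Arr A" "Src A f' = Tgt A f"
 shows "act g f' \<cdot> act g f = act g (f' \<cdot> f)"
 using actA_cmp[of "Idn G g" g g "Idn G g" g f "Src A f" "Tgt A f" f' "Tgt A f'"] assms
 by (auto simp: homs_iff)

lemma actA_merge_ext:
 assumes "g : Obj G" "f : Arr A" "f' : Arr A" "Src A f' = Tgt A f" "k : Arr A" "Tgt A k = ActO A g (Src A f)"
 shows "act g f' \<cdot> (act g f \<cdot> k) = act g (f' \<cdot> f) \<cdot> k"
 by (rule A.ext1[OF actA_merge]) (use assms in auto)

lemma act_iso_simps [simp]: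
 "g : Obj G ==> h : Obj G ==> x : Obj A ==> ActAsc A g h x : Arr A"
 "g : Obj G ==> h : Obj G ==> x : Obj A ==> Src A (ActAsc A g h x) = ActO A (g \<otimes>\<^sub>o\<^sub>G h) x"
 "g : Obj G ==> h : Obj G ==> x : Obj A ==> Tgt A (ActAsc A g h x) = ActO A g (ActO A h x)"
 "x : Obj A ==> ActUnt A x : Arr A"
 "x : Obj A ==> Src A (ActUnt A x) = ActO A (Unt G) x"
 "x : Obj A ==> Tgt A (ActUnt A x) = x"
 "g : Obj G ==> x : Obj A ==> y : Obj A ==> ActMu A g x y : Arr A"
 "g : Obj G ==> x : Obj A ==> y : Obj A ==> Src A (ActMu A g x y) = ActO A g x \<boxdot> ActO A g y"
 "g : Obj G ==> x : Obj A ==> y : Obj A ==> Tgt A (ActMu A g x y) = ActO A g (x \<boxdot> y)"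
 "g : Obj G ==> ActIota A g : Arr A"
 "g : Obj G ==> Src A (ActIota A g) = Unt A"
 "g : Obj G ==> Tgt A (ActIota A g) = ActO A g (Unt A)"
 using actAsc_iso actUnt_iso actMu_iso actIota_iso by (auto simp: isos_iff)

lemma autD:
 assumes "aut F"
 shows aut_equivalence: "category_equivalence A A F"
  and aut_functor: "is_functor A A F"
  and aut_ext: "extensional2 (Obj A) (Obj A) (Mu F)" "extensional2 (Obj G) (Obj A) (Str F)"
 using assms by (auto simp: algebra_auto_equivalence_def monoidal_functor_def module_functor_def)

lemma aut_simps [simp]:
 assumes "aut F"
 shows "x : Obj A ==> FO F x : Obj A" "f : Arr A ==> FA F f : Arr A"
  "f : Arr A ==> Src A (FA F f) = FO F (Src A f)" "f : Arr A ==> Tgt A (FA F f) = FO F (Tgt A f)"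
  "x : Obj A ==> FA F (Idn A x) = Idn A (FO F x)"
  "is_iso A f ==> is_iso A (FA F f)"
 using functor_simps[OF aut_functor[OF assms]]
  functor_is_iso[OF A.category_axioms aut_functor[OF assms]] by auto

lemma aut_mu_simps [simp]:
 assumes "aut F"
 shows "x : Obj A ==> y : Obj A ==> Mu F x y : Arr A"
  "x : Obj A ==> y : Obj A ==> Src A (Mu F x y) = FO F x \<boxdot> FO F y"
  "x : Obj A ==> y : Obj A ==> Tgt A (Mu F x y) = FO F (x \<boxdot> y)"
  "x : Obj A ==> y : Obj A ==> is_iso A (Mu F x y)"
  "Iota F : Arr A" "Src A (Iota F) = Unt A" "Tgt A (Iota F) = FO F (Unt A)" "is_iso A (Iota F)"
  "g : Obj G ==> x : Obj A ==> Str F g x : Arr A"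
  "g : Obj G ==> x : Obj A ==> Src A (Str F g x) = FO F (ActO A g x)"
  "g : Obj G ==> x : Obj A ==> Tgt A (Str F g x) = ActO A g (FO F x)"
  "g : Obj G ==> x : Obj A ==> is_iso A (Str F g x)"
 using assms
 by (auto simp: algebra_auto_equivalence_def monoidal_functor_def module_functor_def isos_iff)

lemma aut_cmp:
 "aut F ==> f : Arr A ==> g : Arr A ==> Src A g = Tgt A f ==> FA F g \<cdot> FA F f = FA F (g \<cdot> f)"
 by (rule functor_cmp[OF aut_functor, symmetric])

lemma aut_cmp_ext:
 assumes "aut F" "f : Arr A" "g : Arr A" "Src A g = Tgt A f" "k : Arr A" "Tgt A k = FO F (Src A f)"
 shows "FA F g \<cdot> (FA F f \<cdot> k) = FA F (g \<cdot> f) \<cdot> k"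
 by (rule A.ext1[OF aut_cmp]) (use assms in auto)

lemma aut_mu_nat:
 assumes "aut F" "f : Arr A" "g : Arr A" "Src A f = x" "Src A g = y"
 shows "FA F (f \<boxtimes> g) \<cdot> Mu F x y = Mu F (Tgt A f) (Tgt A g) \<cdot> (FA F f \<boxtimes> FA F g)"
 using assms by (auto simp: algebra_auto_equivalence_def monoidal_functor_def homs_iff)

lemma aut_mu_nat_ext:
 assumes "aut F" "f : Arr A" "g : Arr A" "Src A f = x" "Src A g = y" "k : Arr A" "Tgt A k = FO F x \<boxdot> FO F y"
 shows "FA F (f \<boxtimes> g) \<cdot> (Mu F x y \<cdot> k) = Mu F (Tgt A f) (Tgt A g) \<cdot> ((FA F f \<boxtimes> FA F g) \<cdot> k)"
 by (rule A.ext2[OF aut_mu_nat]) (use assms in auto)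

lemma aut_mu_asc:
 assumes "aut F" "x : Obj A" "y : Obj A" "z : Obj A"
 shows "Mu F x (y \<boxdot> z) \<cdot> ((Idn A (FO F x) \<boxtimes> Mu F y z) \<cdot> Asc A (FO F x) (FO F y) (FO F z)) =
  FA F (Asc A x y z) \<cdot> (Mu F (x \<boxdot> y) z \<cdot> (Mu F x y \<boxtimes> Idn A (FO F z)))"
 using assms(1) assms(2-) unfolding algebra_auto_equivalence_def monoidal_functor_def
 by (simp add: A.assoc assms(1))

lemma aut_lun:
 assumes "aut F" "x : Obj A"
 shows "FA F (Lun A x) \<cdot> (Mu F (Unt A) x \<cdot> (Iota F \<boxtimes> Idn A (FO F x))) = Lun A (FO F x)"
 using assms(1) assms(2-) unfolding algebra_auto_equivalence_def monoidal_functor_def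
 by (simp add: A.assoc assms(1))

lemma aut_run:
 assumes "aut F" "x : Obj A"
 shows "FA F (Run A x) \<cdot> (Mu F x (Unt A) \<cdot> (Idn A (FO F x) \<boxtimes> Iota F)) = Run A (FO F x)"
 using assms(1) assms(2-) unfolding algebra_auto_equivalence_def monoidal_functor_def
 by (simp add: A.assoc assms(1))

lemma aut_brd:
 assumes "aut F" "x : Obj A" "y : Obj A"
 shows "FA F (Brd A x y) \<cdot> Mu F x y = Mu F y x \<cdot> Brd A (FO F x) (FO F y)"
 using assms by (auto simp: algebra_auto_equivalence_def braided_functor_def)

lemma aut_linear:
 assumes "aut F"
 shows "f : homs A x y ==> f' : homs A x y ==> FA F (Add A f f') = Add A (FA F f) (FA F f')"
  "f : Arr A ==> FA F (Scl A c f) = Scl A c (FA F f)"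
 using assms unfolding algebra_auto_equivalence_def linear_functor_def by blast+

lemma aut_str_nat:
 assumes "aut F" "a : Arr G" "f : Arr A" "Src G a = g" "Src A f = x"
 shows "ActA A a (FA F f) \<cdot> Str F g x = Str F (Tgt G a) (Tgt A f) \<cdot> FA F (ActA A a f)"
 using assms by (auto simp: algebra_auto_equivalence_def module_functor_def homs_iff)

lemma aut_str_nat_ext:
 assumes "aut F" "a : Arr G" "f : Arr A" "Src G a = g" "Src A f = x" "k : Arr A" "Tgt A k = FO F (ActO A g x)"
 shows "ActA A a (FA F f) \<cdot> (Str F g x \<cdot> k) = Str F (Tgt G a) (Tgt A f) \<cdot> (FA F (ActA A a f) \<cdot> k)"
 by (rule A.ext2[OF aut_str_nat]) (use assms in auto)

lemma aut_str_asc: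
 assumes "aut F" "g : Obj G" "h : Obj G" "x : Obj A"
 shows "act g (Str F h x) \<cdot> (Str F g (ActO A h x) \<cdot> FA F (ActAsc A g h x)) =
  ActAsc A g h (FO F x) \<cdot> Str F (g \<otimes>\<^sub>o\<^sub>G h) x"
 using assms(1) assms(2-) unfolding algebra_auto_equivalence_def module_functor_def
 by (simp add: A.assoc assms(1))

lemma aut_str_unt:
 assumes "aut F" "x : Obj A"
 shows "ActUnt A (FO F x) \<cdot> Str F (Unt G) x = FA F (ActUnt A x)"
 using assms by (auto simp: algebra_auto_equivalence_def module_functor_def)

lemma aut_str_mu:
 assumes "aut F" "g : Obj G" "x : Obj A" "y : Obj A"
 shows "Str F g (x \<boxdot> y) \<cdot> (FA F (ActMu A g x y) \<cdot> Mu F (ActO A g x) (ActO A g y)) =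
  act g (Mu F x y) \<cdot> (ActMu A g (FO F x) (FO F y) \<cdot> (Str F g x \<boxtimes> Str F g y))"
 using assms(1) assms(2-) unfolding algebra_auto_equivalence_def structures_compatible_def
 by (simp add: A.assoc assms(1))

lemma aut_str_iota:
 assumes "aut F" "g : Obj G"
 shows "Str F g (Unt A) \<cdot> (FA F (ActIota A g) \<cdot> Iota F) = act g (Iota F) \<cdot> ActIota A g"
 using assms(1) assms(2-) unfolding algebra_auto_equivalence_def structures_compatible_def
 by (simp add: A.assoc assms(1))

text \<open>
 The conditions on an auto-equivalence with composites bracketed to the right, so that they can be
 verified by rewriting.
\<close>

lemma autI:
 assumes equiv: "category_equivalence A A F"
  and ext: "extensional2 (Obj A) (Obj A) (Mu F)" "extensional2 (Obj G) (Obj A) (Str F)"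
  and add: "\<And>x y f f'. f : homs A x y ==> f' : homs A x y ==> FA F (Add A f f') = Add A (FA F f) (FA F f')"
  and scl: "\<And>c f. f : Arr A ==> FA F (Scl A c f) = Scl A c (FA F f)"
  and mu: "\<And>x y. x : Obj A ==> y : Obj A ==> Mu F x y : isos A (FO F x \<boxdot> FO F y) (FO F (x \<boxdot> y))"
  and iota: "Iota F : isos A (Unt A) (FO F (Unt A))"
  and str: "\<And>g x. g : Obj G ==> x : Obj A ==> Str F g x : isos A (FO F (ActO A g x)) (ActO A g (FO F x))"
  and mu_nat: "\<And>f g. f : Arr A ==> g : Arr A ==>
   FA F (f \<boxtimes> g) \<cdot> Mu F (Src A f) (Src A g) = Mu F (Tgt A f) (Tgt A g) \<cdot> (FA F f \<boxtimes> FA F g)"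
  and mu_asc: "\<And>x y z. x : Obj A ==> y : Obj A ==> z : Obj A ==>
   Mu F x (y \<boxdot> z) \<cdot> ((Idn A (FO F x) \<boxtimes> Mu F y z) \<cdot> Asc A (FO F x) (FO F y) (FO F z)) =
   FA F (Asc A x y z) \<cdot> (Mu F (x \<boxdot> y) z \<cdot> (Mu F x y \<boxtimes> Idn A (FO F z)))"
  and lun: "\<And>x. x : Obj A ==>
   FA F (Lun A x) \<cdot> (Mu F (Unt A) x \<cdot> (Iota F \<boxtimes> Idn A (FO F x))) = Lun A (FO F x)"
  and run: "\<And>x. x : Obj A ==>
   FA F (Run A x) \<cdot> (Mu F x (Unt A) \<cdot> (Idn A (FO F x) \<boxtimes> Iota F)) = Run A (FO F x)"
  and brd: "\<And>x y. x : Obj A ==> y : Obj A ==>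
   FA F (Brd A x y) \<cdot> Mu F x y = Mu F y x \<cdot> Brd A (FO F x) (FO F y)"
  and str_nat: "\<And>a f. a : Arr G ==> f : Arr A ==>
   ActA A a (FA F f) \<cdot> Str F (Src G a) (Src A f) = Str F (Tgt G a) (Tgt A f) \<cdot> FA F (ActA A a f)"
  and str_asc: "\<And>g h x. g : Obj G ==> h : Obj G ==> x : Obj A ==>
   act g (Str F h x) \<cdot> (Str F g (ActO A h x) \<cdot> FA F (ActAsc A g h x)) =
   ActAsc A g h (FO F x) \<cdot> Str F (g \<otimes>\<^sub>o\<^sub>G h) x"
  and str_unt: "\<And>x. x : Obj A ==> ActUnt A (FO F x) \<cdot> Str F (Unt G) x = FA F (ActUnt A x)"
  and str_mu: "\<And>g x y. g : Obj G ==> x : Obj A ==> y : Obj A ==>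
   Str F g (x \<boxdot> y) \<cdot> (FA F (ActMu A g x y) \<cdot> Mu F (ActO A g x) (ActO A g y)) =
   act g (Mu F x y) \<cdot> (ActMu A g (FO F x) (FO F y) \<cdot> (Str F g x \<boxtimes> Str F g y))"
  and str_iota: "\<And>g. g : Obj G ==>
   Str F g (Unt A) \<cdot> (FA F (ActIota A g) \<cdot> Iota F) = act g (Iota F) \<cdot> ActIota A g"
 shows "aut F"
proof -
 have Fn: "is_functor A A F" using equiv by (auto simp: category_equivalence_def)
 note [simp] = functor_simps[OF Fn] mu[unfolded isos_iff] iota[unfolded isos_iff] str[unfolded isos_iff]
 have "linear_functor A A F" using add scl unfolding linear_functor_def by blast
 moreover have "monoidal_functor A A F"
  unfolding monoidal_functor_def
  using Fn ext(1) mu iota mu_nat mu_asc lun run by (auto simp: A.assoc homs_iff)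
 moreover have "braided_functor A A F" using brd by (auto simp: braided_functor_def)
 moreover have "module_functor G A F"
  unfolding module_functor_def
  using ext(2) str str_nat str_asc str_unt by (auto simp: A.assoc homs_iff)
 moreover have "structures_compatible G A F"
  unfolding structures_compatible_def
  using str_mu str_iota by (auto simp: A.assoc)
 ultimately show ?thesis using equiv by (auto simp: algebra_auto_equivalence_def)
qed

lemma comp_simps [simp]:
 "x : Obj A ==> FO (comp F F') x = FO F (FO F' x)"
 "f : Arr A ==> FA (comp F F') f = FA F (FA F' f)"
 "x : Obj A ==> y : Obj A ==> Mu (comp F F') x y = FA F (Mu F' x y) \<cdot> Mu F (FO F' x) (FO F' y)"
 "Iota (comp F F') = FA F (Iota F') \<cdot> Iota F"
 "g : Obj G ==> x : Obj A ==> Str (comp F F') g x = Str F g (FO F' x) \<cdot> FA F (Str F' g x)"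
 by (auto simp: comp_auto_def restrict2_def)

lemma ident_simps [simp]:
 "x : Obj A ==> FO ident x = x"
 "f : Arr A ==> FA ident f = f"
 "x : Obj A ==> y : Obj A ==> Mu ident x y = Idn A (x \<boxdot> y)"
 "Iota ident = Idn A (Unt A)"
 "g : Obj G ==> x : Obj A ==> Str ident g x = Idn A (ActO A g x)"
 by (auto simp: id_auto_def restrict2_def)

lemma aut_ident [simp]: "aut ident"
proof (rule autI)
 show "category_equivalence A A ident"
 proof (rule fully_faithful_equivalence[OF A.category_axioms A.category_axioms])
  show "is_functor A A ident"
   by (auto simp: is_functor_def id_auto_def homs_iff)
  show "fully_faithful A A ident"
   unfolding fully_faithful_def
  proof (intro ballI)
   fix x y assume "x : Obj A" "y : Obj A"
   then show "bij_betw (FA ident) (homs A x y) (homs A (FO ident x) (FO ident y))"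
    by (subst bij_betw_cong[where g = "\<lambda>f. f"]) (auto simp: homs_iff bij_betw_def)
  qed
  show "essentially_surjective A A ident"
   unfolding essentially_surjective_def
  proof
   fix y assume y: "y : Obj A"
   then have "Idn A y : isos A (FO ident y) y" by (simp add: isos_iff)
   with y show "\<exists>x\<in>Obj A. isos A (FO ident x) y \<noteq> {}" by blast
  qed
 qed
qed (use add_hom scl_hom in "auto simp: id_auto_def restrict2_def extensional2_def extensional_def isos_iff homs_iff")

lemma category_equivalence_comp:
 assumes F: "aut F" and F': "aut F'"
 shows "category_equivalence A A (comp F F')"
proof (rule fully_faithful_equivalence[OF A.category_axioms A.category_axioms])
 note ff = equivalence_fully_faithful(2,3)[OF A.category_axioms A.category_axioms aut_equivalence]
 show Fn: "is_functor A A (comp F F')"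
  unfolding is_functor_def
  using F F' by (auto simp: homs_iff aut_cmp) (auto simp: comp_auto_def)
 show "fully_faithful A A (comp F F')"
  unfolding fully_faithful_def
 proof (intro ballI)
  fix x y assume xy: "x : Obj A" "y : Obj A"
  have "bij_betw (FA F \<circ> FA F') (homs A x y) (homs A (FO F (FO F' x)) (FO F (FO F' y)))"
   using ff(1)[OF F] ff(1)[OF F'] xy F F' unfolding fully_faithful_def
   by (intro bij_betw_trans[of "FA F'"]) auto
  then show "bij_betw (FA (comp F F')) (homs A x y) (homs A (FO (comp F F') x) (FO (comp F F') y))"
   using xy by (subst bij_betw_cong[where g = "FA F \<circ> FA F'"]) (auto simp: homs_iff)
 qed
 show "essentially_surjective A A (comp F F')"
  unfolding essentially_surjective_def
 proof
  fix z assume "z : Obj A"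
  then obtain y e where y: "y : Obj A" "e : isos A (FO F y) z"
   using ff(2)[OF F] unfolding essentially_surjective_def by blast
  then obtain x e' where x: "x : Obj A" "e' : isos A (FO F' x) y"
   using ff(2)[OF F'] unfolding essentially_surjective_def by blast
  have "e \<cdot> FA F e' : isos A (FO (comp F F') x) z"
   using x y F F' by (auto simp: isos_iff)
  then show "\<exists>x\<in>Obj A. isos A (FO (comp F F') x) z \<noteq> {}" using x(1) by blast
 qed
qed

text \<open>
 Every coherence condition for \<open>comp F F'\<close> consists of the one for \<open>F\<close> at objects \<open>F' x\<close> and the image
 under \<open>F\<close> of the one for \<open>F'\<close>. Naturality of the structure isomorphisms of \<open>F\<close> brings the two
 into adjacent position.
\<close>

lemma aut_comp [simp]:
 assumes F [simp]: "aut F" and F' [simp]: "aut F'"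
 shows "aut (comp F F')"
proof (rule autI)
 show "category_equivalence A A (comp F F')" by (rule category_equivalence_comp[OF F F'])
 fix x y f f' assume f: "f : homs A x y" "f' : homs A x y"
 then have "FA F f : homs A (FO F x) (FO F y)" "FA F' f : homs A (FO F' x) (FO F' y)"
   "FA F f' : homs A (FO F x) (FO F y)" "FA F' f' : homs A (FO F' x) (FO F' y)" by (auto simp: homs_iff)
 then show "FA (comp F F') (Add A f f') = Add A (FA (comp F F') f) (FA (comp F F') f')"
  using f add_hom[OF f] aut_linear(1)[OF F'] aut_linear(1)[OF F] by (simp add: homs_iff)
next
 fix c f assume f: "f : Arr A"
 then have "Scl A c f : Arr A" using scl_hom[of f "Src A f" "Tgt A f"] by (auto simp: homs_iff)
 then show "FA (comp F F') (Scl A c f) = Scl A c (FA (comp F F') f)"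
  using f by (simp add: aut_linear(2)[OF F'] aut_linear(2)[OF F])
next
 fix f g assume [simp]: "f : Arr A" "g : Arr A"
 have "FA F (FA F' (f \<boxtimes> g)) \<cdot> (FA F (Mu F' (Src A f) (Src A g)) \<cdot> Mu F (FO F' (Src A f)) (FO F' (Src A g)))
  = FA F (Mu F' (Tgt A f) (Tgt A g) \<cdot> (FA F' f \<boxtimes> FA F' g)) \<cdot> Mu F (FO F' (Src A f)) (FO F' (Src A g))"
  by (simp add: aut_cmp_ext aut_mu_nat)
 also have "... = FA F (Mu F' (Tgt A f) (Tgt A g)) \<cdot> (FA F (FA F' f \<boxtimes> FA F' g) \<cdot> Mu F (FO F' (Src A f)) (FO F' (Src A g)))"
  by (simp add: A.assoc flip: aut_cmp)
 finally show "FA (comp F F') (f \<boxtimes> g) \<cdot> Mu (comp F F') (Src A f) (Src A g) =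
   Mu (comp F F') (Tgt A f) (Tgt A g) \<cdot> (FA (comp F F') f \<boxtimes> FA (comp F F') g)"
  by (simp add: aut_mu_nat A.assoc)
next
 fix x y z assume [simp]: "x : Obj A" "y : Obj A" "z : Obj A"
 let ?x = "FO F' x" and ?y = "FO F' y" and ?z = "FO F' z"
 have "Mu F ?x (FO F' (y \<boxdot> z)) \<cdot> ((Idn A (FO F ?x) \<boxtimes> (FA F (Mu F' y z) \<cdot> Mu F ?y ?z)) \<cdot> Asc A (FO F ?x) (FO F ?y) (FO F ?z))
  = Mu F ?x (FO F' (y \<boxdot> z)) \<cdot> ((FA F (Idn A ?x) \<boxtimes> FA F (Mu F' y z)) \<cdot> ((Idn A (FO F ?x) \<boxtimes> Mu F ?y ?z) \<cdot> Asc A (FO F ?x) (FO F ?y) (FO F ?z)))"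
  by (simp add: A.interchange_ext)
 also have "... = FA F (Idn A ?x \<boxtimes> Mu F' y z) \<cdot> (Mu F ?x (?y \<boxdot> ?z) \<cdot> ((Idn A (FO F ?x) \<boxtimes> Mu F ?y ?z) \<cdot> Asc A (FO F ?x) (FO F ?y) (FO F ?z)))"
  by (subst aut_mu_nat_ext) auto
 also have "... = FA F (Idn A ?x \<boxtimes> Mu F' y z) \<cdot> (FA F (Asc A ?x ?y ?z) \<cdot> (Mu F (?x \<boxdot> ?y) ?z \<cdot> (Mu F ?x ?y \<boxtimes> Idn A (FO F ?z))))"
  by (simp add: aut_mu_asc)
 finally have "FA F (Mu F' x (y \<boxdot> z)) \<cdot> (Mu F ?x (FO F' (y \<boxdot> z)) \<cdot> ((Idn A (FO F ?x) \<boxtimes> (FA F (Mu F' y z) \<cdot> Mu F ?y ?z)) \<cdot> Asc A (FO F ?x) (FO F ?y) (FO F ?z)))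
  = FA F (Mu F' x (y \<boxdot> z) \<cdot> ((Idn A ?x \<boxtimes> Mu F' y z) \<cdot> Asc A ?x ?y ?z)) \<cdot> (Mu F (?x \<boxdot> ?y) ?z \<cdot> (Mu F ?x ?y \<boxtimes> Idn A (FO F ?z)))"
  by (simp add: aut_cmp_ext A.assoc)
 also have "... = FA F (FA F' (Asc A x y z)) \<cdot> (FA F (Mu F' (x \<boxdot> y) z) \<cdot> (FA F (Mu F' x y \<boxtimes> Idn A ?z) \<cdot> (Mu F (?x \<boxdot> ?y) ?z \<cdot> (Mu F ?x ?y \<boxtimes> Idn A (FO F ?z)))))"
  unfolding aut_mu_asc[OF F' \<open>x : Obj A\<close> \<open>y : Obj A\<close> \<open>z : Obj A\<close>] by (simp add: aut_cmp_ext A.assoc)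
 also have "... = FA F (FA F' (Asc A x y z)) \<cdot> (FA F (Mu F' (x \<boxdot> y) z) \<cdot> (Mu F (FO F' (x \<boxdot> y)) ?z \<cdot> ((FA F (Mu F' x y) \<cdot> Mu F ?x ?y) \<boxtimes> Idn A (FO F ?z))))"
  by (simp add: aut_mu_nat_ext A.interchange)
 finally show "Mu (comp F F') x (y \<boxdot> z) \<cdot> ((Idn A (FO (comp F F') x) \<boxtimes> Mu (comp F F') y z) \<cdot>
    Asc A (FO (comp F F') x) (FO (comp F F') y) (FO (comp F F') z)) =
   FA (comp F F') (Asc A x y z) \<cdot> (Mu (comp F F') (x \<boxdot> y) z \<cdot> (Mu (comp F F') x y \<boxtimes> Idn A (FO (comp F F') z)))"
  by (simp add: A.assoc)
next
 fix x assume [simp]: "x : Obj A"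
 let ?x = "FO F' x" and ?u = "FO F' (Unt A)"
 have "FA F (FA F' (Lun A x)) \<cdot> (FA F (Mu F' (Unt A) x) \<cdot> (Mu F ?u ?x \<cdot> ((FA F (Iota F') \<cdot> Iota F) \<boxtimes> Idn A (FO F ?x))))
  = FA F (FA F' (Lun A x) \<cdot> Mu F' (Unt A) x) \<cdot> (Mu F ?u ?x \<cdot> ((FA F (Iota F') \<boxtimes> FA F (Idn A ?x)) \<cdot> (Iota F \<boxtimes> Idn A (FO F ?x))))"
  by (simp add: aut_cmp_ext A.interchange)
 also have "... = FA F (FA F' (Lun A x) \<cdot> Mu F' (Unt A) x) \<cdot> (FA F (Iota F' \<boxtimes> Idn A ?x) \<cdot> (Mu F (Unt A) ?x \<cdot> (Iota F \<boxtimes> Idn A (FO F ?x))))"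
  by (subst aut_mu_nat_ext) auto
 also have "... = FA F (FA F' (Lun A x) \<cdot> (Mu F' (Unt A) x \<cdot> (Iota F' \<boxtimes> Idn A ?x))) \<cdot> (Mu F (Unt A) ?x \<cdot> (Iota F \<boxtimes> Idn A (FO F ?x)))"
  by (simp add: aut_cmp_ext A.assoc)
 also have "... = Lun A (FO F ?x)" by (simp add: aut_lun)
 finally show "FA (comp F F') (Lun A x) \<cdot> (Mu (comp F F') (Unt A) x \<cdot> (Iota (comp F F') \<boxtimes> Idn A (FO (comp F F') x))) = Lun A (FO (comp F F') x)"
  by (simp add: A.assoc)
 have "FA F (FA F' (Run A x)) \<cdot> (FA F (Mu F' x (Unt A)) \<cdot> (Mu F ?x ?u \<cdot> (Idn A (FO F ?x) \<boxtimes> (FA F (Iota F') \<cdot> Iota F))))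
  = FA F (FA F' (Run A x) \<cdot> Mu F' x (Unt A)) \<cdot> (Mu F ?x ?u \<cdot> ((FA F (Idn A ?x) \<boxtimes> FA F (Iota F')) \<cdot> (Idn A (FO F ?x) \<boxtimes> Iota F)))"
  by (simp add: aut_cmp_ext A.interchange)
 also have "... = FA F (FA F' (Run A x) \<cdot> Mu F' x (Unt A)) \<cdot> (FA F (Idn A ?x \<boxtimes> Iota F') \<cdot> (Mu F ?x (Unt A) \<cdot> (Idn A (FO F ?x) \<boxtimes> Iota F)))"
  by (subst aut_mu_nat_ext) auto
 also have "... = FA F (FA F' (Run A x) \<cdot> (Mu F' x (Unt A) \<cdot> (Idn A ?x \<boxtimes> Iota F'))) \<cdot> (Mu F ?x (Unt A) \<cdot> (Idn A (FO F ?x) \<boxtimes> Iota F))"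
  by (simp add: aut_cmp_ext A.assoc)
 also have "... = Run A (FO F ?x)" by (simp add: aut_run)
 finally show "FA (comp F F') (Run A x) \<cdot> (Mu (comp F F') x (Unt A) \<cdot> (Idn A (FO (comp F F') x) \<boxtimes> Iota (comp F F'))) = Run A (FO (comp F F') x)"
  by (simp add: A.assoc)
next
 fix x y assume [simp]: "x : Obj A" "y : Obj A"
 have "FA F (FA F' (Brd A x y)) \<cdot> (FA F (Mu F' x y) \<cdot> Mu F (FO F' x) (FO F' y))
  = FA F (FA F' (Brd A x y) \<cdot> Mu F' x y) \<cdot> Mu F (FO F' x) (FO F' y)"
  by (simp add: aut_cmp_ext)
 also have "... = FA F (Mu F' y x) \<cdot> (FA F (Brd A (FO F' x) (FO F' y)) \<cdot> Mu F (FO F' x) (FO F' y))"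
  by (simp add: aut_brd[OF F'] A.assoc flip: aut_cmp)
 finally have "FA F (FA F' (Brd A x y)) \<cdot> (FA F (Mu F' x y) \<cdot> Mu F (FO F' x) (FO F' y))
  = FA F (Mu F' y x) \<cdot> (FA F (Brd A (FO F' x) (FO F' y)) \<cdot> Mu F (FO F' x) (FO F' y))" .
 then show "FA (comp F F') (Brd A x y) \<cdot> Mu (comp F F') x y = Mu (comp F F') y x \<cdot> Brd A (FO (comp F F') x) (FO (comp F F') y)"
  by (simp add: aut_brd A.assoc)
next
 fix a f assume [simp]: "a : Arr G" "f : Arr A"
 have "ActA A a (FA F (FA F' f)) \<cdot> (Str F (Src G a) (FO F' (Src A f)) \<cdot> FA F (Str F' (Src G a) (Src A f)))
  = Str F (Tgt G a) (FO F' (Tgt A f)) \<cdot> (FA F (ActA A a (FA F' f) \<cdot> Str F' (Src G a) (Src A f)))"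
  by (simp add: aut_str_nat_ext aut_cmp)
 then show "ActA A a (FA (comp F F') f) \<cdot> Str (comp F F') (Src G a) (Src A f) =
   Str (comp F F') (Tgt G a) (Tgt A f) \<cdot> FA (comp F F') (ActA A a f)"
  by (simp add: aut_str_nat A.assoc aut_cmp)
next
 fix g h x assume [simp]: "g : Obj G" "h : Obj G" "x : Obj A"
 let ?x = "FO F' x"
 have "act g (Str F h ?x \<cdot> FA F (Str F' h x)) \<cdot> (Str F g (FO F' (ActO A h x)) \<cdot> (FA F (Str F' g (ActO A h x)) \<cdot> FA F (FA F' (ActAsc A g h x))))
  = act g (Str F h ?x) \<cdot> (act g (FA F (Str F' h x)) \<cdot> (Str F g (FO F' (ActO A h x)) \<cdot> (FA F (Str F' g (ActO A h x)) \<cdot> FA F (FA F' (ActAsc A g h x)))))"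
  by (simp add: actA_merge_ext)
 also have "... = act g (Str F h ?x) \<cdot> (Str F g (ActO A h ?x) \<cdot>
   FA F (act g (Str F' h x) \<cdot> (Str F' g (ActO A h x) \<cdot> FA F' (ActAsc A g h x))))"
  by (simp add: aut_str_nat_ext aut_cmp A.assoc)
 also have "... = act g (Str F h ?x) \<cdot> (Str F g (ActO A h ?x) \<cdot> (FA F (ActAsc A g h ?x) \<cdot> FA F (Str F' (g \<otimes>\<^sub>o\<^sub>G h) x)))"
  by (simp add: aut_str_asc aut_cmp)
 also have "... = (act g (Str F h ?x) \<cdot> (Str F g (ActO A h ?x) \<cdot> FA F (ActAsc A g h ?x))) \<cdot> FA F (Str F' (g \<otimes>\<^sub>o\<^sub>G h) x)"
  by (simp add: A.assoc)
 also have "... = ActAsc A g h (FO F ?x) \<cdot> (Str F (g \<otimes>\<^sub>o\<^sub>G h) ?x \<cdot> FA F (Str F' (g \<otimes>\<^sub>o\<^sub>G h) x))"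
  by (simp add: aut_str_asc A.assoc)
 finally show "act g (Str (comp F F') h x) \<cdot> (Str (comp F F') g (ActO A h x) \<cdot> FA (comp F F') (ActAsc A g h x)) =
   ActAsc A g h (FO (comp F F') x) \<cdot> Str (comp F F') (g \<otimes>\<^sub>o\<^sub>G h) x"
  by (simp add: A.assoc)
next
 fix x assume [simp]: "x : Obj A"
 have "ActUnt A (FO F (FO F' x)) \<cdot> (Str F (Unt G) (FO F' x) \<cdot> FA F (Str F' (Unt G) x)) = FA F (ActUnt A (FO F' x)) \<cdot> FA F (Str F' (Unt G) x)"
  by (subst A.ext1[OF aut_str_unt]) auto
 then show "ActUnt A (FO (comp F F') x) \<cdot> Str (comp F F') (Unt G) x = FA (comp F F') (ActUnt A x)"
  by (simp add: aut_cmp aut_str_unt)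
next
 fix g x y assume [simp]: "g : Obj G" "x : Obj A" "y : Obj A"
 let ?x = "FO F' x" and ?y = "FO F' y"
 let ?M = "Mu F (FO F' (ActO A g x)) (FO F' (ActO A g y))"
 have "Str F g (FO F' (x \<boxdot> y)) \<cdot> (FA F (Str F' g (x \<boxdot> y)) \<cdot> (FA F (FA F' (ActMu A g x y)) \<cdot> (FA F (Mu F' (ActO A g x) (ActO A g y)) \<cdot> ?M)))
  = Str F g (FO F' (x \<boxdot> y)) \<cdot> (FA F (Str F' g (x \<boxdot> y) \<cdot> (FA F' (ActMu A g x y) \<cdot> Mu F' (ActO A g x) (ActO A g y))) \<cdot> ?M)"
  by (simp add: aut_cmp_ext A.assoc)
 also have "... = Str F g (FO F' (x \<boxdot> y)) \<cdot> (FA F (act g (Mu F' x y)) \<cdot> (FA F (ActMu A g ?x ?y) \<cdot> (FA F (Str F' g x \<boxtimes> Str F' g y) \<cdot> ?M)))"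
  by (simp add: aut_cmp_ext aut_str_mu A.assoc)
 also have "... = act g (FA F (Mu F' x y)) \<cdot> (Str F g (?x \<boxdot> ?y) \<cdot> (FA F (ActMu A g ?x ?y) \<cdot> (FA F (Str F' g x \<boxtimes> Str F' g y) \<cdot> ?M)))"
  by (subst aut_str_nat_ext) auto
 also have "... = act g (FA F (Mu F' x y)) \<cdot> ((Str F g (?x \<boxdot> ?y) \<cdot> (FA F (ActMu A g ?x ?y) \<cdot> Mu F (ActO A g ?x) (ActO A g ?y))) \<cdot> (FA F (Str F' g x) \<boxtimes> FA F (Str F' g y)))"
  by (simp add: aut_mu_nat A.assoc)
 also have "... = act g (FA F (Mu F' x y) \<cdot> Mu F ?x ?y) \<cdot> (ActMu A g (FO F ?x) (FO F ?y) \<cdot> ((Str F g ?x \<cdot> FA F (Str F' g x)) \<boxtimes> (Str F g ?y \<cdot> FA F (Str F' g y))))"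
  by (simp add: aut_str_mu A.assoc actA_merge_ext A.interchange)
 finally show "Str (comp F F') g (x \<boxdot> y) \<cdot> (FA (comp F F') (ActMu A g x y) \<cdot> Mu (comp F F') (ActO A g x) (ActO A g y)) =
   act g (Mu (comp F F') x y) \<cdot> (ActMu A g (FO (comp F F') x) (FO (comp F F') y) \<cdot> (Str (comp F F') g x \<boxtimes> Str (comp F F') g y))"
  by (simp add: A.assoc)
next
 fix g assume [simp]: "g : Obj G"
 have "Str F g (FO F' (Unt A)) \<cdot> (FA F (Str F' g (Unt A)) \<cdot> (FA F (FA F' (ActIota A g)) \<cdot> (FA F (Iota F') \<cdot> Iota F)))
  = Str F g (FO F' (Unt A)) \<cdot> (FA F (Str F' g (Unt A) \<cdot> (FA F' (ActIota A g) \<cdot> Iota F')) \<cdot> Iota F)"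
  by (simp add: aut_cmp_ext A.assoc)
 also have "... = Str F g (FO F' (Unt A)) \<cdot> (FA F (act g (Iota F')) \<cdot> (FA F (ActIota A g) \<cdot> Iota F))"
  by (simp add: aut_cmp_ext aut_str_iota)
 also have "... = act g (FA F (Iota F')) \<cdot> (Str F g (Unt A) \<cdot> (FA F (ActIota A g) \<cdot> Iota F))"
  by (subst aut_str_nat_ext) auto
 also have "... = act g (FA F (Iota F') \<cdot> Iota F) \<cdot> ActIota A g"
  by (simp add: aut_str_iota actA_merge_ext)
 finally show "Str (comp F F') g (Unt A) \<cdot> (FA (comp F F') (ActIota A g) \<cdot> Iota (comp F F')) = act g (Iota (comp F F')) \<cdot> ActIota A g"
  by (simp add: A.assoc)
qed (auto simp: isos_iff, auto simp: comp_auto_def restrict2_def extensional2_def extensional_def)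

lemma aut_eqI:
 fixes F F' :: "('o, 'm, 'g) algauto"
 assumes "aut F" "aut F'"
  "\<And>x. x : Obj A ==> FO F x = FO F' x" "\<And>f. f : Arr A ==> FA F f = FA F' f"
  "\<And>x y. x : Obj A ==> y : Obj A ==> Mu F x y = Mu F' x y" "Iota F = Iota F'"
  "\<And>g x. g : Obj G ==> x : Obj A ==> Str F g x = Str F' g x"
 shows "F = F'"
proof -
 have F: "\<And>x. x \<notin> Obj A ==> FO F x = undefined" "\<And>x. x \<notin> Arr A ==> FA F x = undefined"
  "\<And>x y. \<not> (x : Obj A \<and> y : Obj A) ==> Mu F x y = undefined"
  "\<And>g x. \<not> (g : Obj G \<and> x : Obj A) ==> Str F g x = undefined" if "aut F" for F :: "('o, 'm, 'g) algauto"
  using aut_functor[OF that] aut_ext[OF that]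
  by (auto simp: is_functor_def extensional2_def extensional_def)
 have "FO F = FO F'" using assms(3) F(1)[OF assms(1)] F(1)[OF assms(2)] by (intro ext) metis
 moreover have "FA F = FA F'" using assms(4) F(2)[OF assms(1)] F(2)[OF assms(2)] by (intro ext) metis
 moreover have "Mu F = Mu F'" using assms(5) F(3)[OF assms(1)] F(3)[OF assms(2)] by (intro ext) metis
 moreover have "Str F = Str F'" using assms(7) F(4)[OF assms(1)] F(4)[OF assms(2)] by (intro ext) metis
 ultimately show ?thesis using assms(6) by simp
qed

text \<open>Composition is strictly associative and unital because all data are extensional functions.\<close>

lemma comp_assoc:
 assumes [simp]: "aut F" "aut F'" "aut F''"
 shows "comp (comp F F') F'' = comp F (comp F' F'')"
 by (rule aut_eqI) (simp_all add: A.assoc flip: aut_cmp)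

lemma comp_ident_left: "aut F ==> comp ident F = F"
 by (rule aut_eqI) simp_all

lemma comp_ident_right: "aut F ==> comp F ident = F"
 by (rule aut_eqI) simp_all

text \<open>
 The arrows of the 2-group of auto-equivalences, described by their components: all naturality
 and compatibility conditions are equations between composites in \<open>A\<close>.
\<close>

definition transf where
 "transf F F' \<eta> \<longleftrightarrow> nat_iso A A F F' \<eta> \<and> monoidal_nat_trans A A F F' \<eta> \<and> module_nat_trans G A F F' \<eta>"

lemma transfD:
 assumes "transf F F' \<eta>"
 shows transf_ext: "\<eta> : extensional (Obj A)"
  and transf_simps: "\<And>x. x : Obj A ==> \<eta> x : Arr A" "\<And>x. x : Obj A ==> Src A (\<eta> x) = FO F x"
   "\<And>x. x : Obj A ==> Tgt A (\<eta> x) = FO F' x" "\<And>x. x : Obj A ==> is_iso A (\<eta> x)"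
  and transf_nat: "\<And>f. f : Arr A ==> FA F' f \<cdot> \<eta> (Src A f) = \<eta> (Tgt A f) \<cdot> FA F f"
  and transf_mu: "\<And>x y. x : Obj A ==> y : Obj A ==> \<eta> (x \<boxdot> y) \<cdot> Mu F x y = Mu F' x y \<cdot> (\<eta> x \<boxtimes> \<eta> y)"
  and transf_iota: "\<eta> (Unt A) \<cdot> Iota F = Iota F'"
  and transf_str: "\<And>g x. g : Obj G ==> x : Obj A ==>
   act g (\<eta> x) \<cdot> Str F g x = Str F' g x \<cdot> \<eta> (ActO A g x)"
proof -
 have *: "nat_iso A A F F' \<eta>" "nat_trans A A F F' \<eta>" "monoidal_nat_trans A A F F' \<eta>" "module_nat_trans G A F F' \<eta>"
  using assms by (auto simp: transf_def nat_iso_def)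
 show "\<eta> : extensional (Obj A)" "\<And>x. x : Obj A ==> \<eta> x : Arr A" "\<And>x. x : Obj A ==> Src A (\<eta> x) = FO F x"
   "\<And>x. x : Obj A ==> Tgt A (\<eta> x) = FO F' x" "\<And>x. x : Obj A ==> is_iso A (\<eta> x)"
  "\<And>f. f : Arr A ==> FA F' f \<cdot> \<eta> (Src A f) = \<eta> (Tgt A f) \<cdot> FA F f"
  using nat_transD[OF *(2)] *(1) by (auto simp: nat_iso_def)
qed (use assms in "auto simp: transf_def monoidal_nat_trans_def module_nat_trans_def")

lemma transfI:
 assumes "\<eta> : extensional (Obj A)"
  "\<And>x. x : Obj A ==> \<eta> x : isos A (FO F x) (FO F' x)"
  "\<And>f. f : Arr A ==> FA F' f \<cdot> \<eta> (Src A f) = \<eta> (Tgt A f) \<cdot> FA F f"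
  "\<And>x y. x : Obj A ==> y : Obj A ==> \<eta> (x \<boxdot> y) \<cdot> Mu F x y = Mu F' x y \<cdot> (\<eta> x \<boxtimes> \<eta> y)"
  "\<eta> (Unt A) \<cdot> Iota F = Iota F'"
  "\<And>g x. g : Obj G ==> x : Obj A ==>
   act g (\<eta> x) \<cdot> Str F g x = Str F' g x \<cdot> \<eta> (ActO A g x)"
 shows "transf F F' \<eta>"
 using assms
 by (auto simp: transf_def nat_iso_def monoidal_nat_trans_def module_nat_trans_def isos_iff intro!: nat_transI)

lemma transf_idn:
 assumes [simp]: "aut F"
 shows "transf F F (\<lambda>x \<in> Obj A. Idn A (FO F x))"
 by (rule transfI) (auto simp: isos_iff)

lemma transf_cmp:
 assumes [simp]: "aut F" "aut F'" "aut F''" and \<alpha>: "transf F F' \<alpha>" and \<beta>: "transf F' F'' \<beta>"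
 shows "transf F F'' (\<lambda>x \<in> Obj A. \<beta> x \<cdot> \<alpha> x)"
proof (rule transfI)
 note [simp] = transf_simps[OF \<alpha>] transf_simps[OF \<beta>]
 show "(\<lambda>x \<in> Obj A. \<beta> x \<cdot> \<alpha> x) : extensional (Obj A)" by simp
 show "(\<lambda>x \<in> Obj A. \<beta> x \<cdot> \<alpha> x) x : isos A (FO F x) (FO F'' x)" if "x : Obj A" for x
  using that by (simp add: isos_iff)
 fix f assume [simp]: "f : Arr A"
 have "FA F'' f \<cdot> (\<beta> (Src A f) \<cdot> \<alpha> (Src A f)) = \<beta> (Tgt A f) \<cdot> (FA F' f \<cdot> \<alpha> (Src A f))"
  by (rule A.ext2[OF transf_nat[OF \<beta>]]) auto
 then show "FA F'' f \<cdot> (\<lambda>x \<in> Obj A. \<beta> x \<cdot> \<alpha> x) (Src A f) = (\<lambda>x \<in> Obj A. \<beta> x \<cdot> \<alpha> x) (Tgt A f) \<cdot> FA F f"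
  by (simp add: transf_nat[OF \<alpha>] A.assoc)
next
 note [simp] = transf_simps[OF \<alpha>] transf_simps[OF \<beta>]
 fix x y assume [simp]: "x : Obj A" "y : Obj A"
 have "\<beta> (x \<boxdot> y) \<cdot> (Mu F' x y \<cdot> (\<alpha> x \<boxtimes> \<alpha> y)) = Mu F'' x y \<cdot> ((\<beta> x \<boxtimes> \<beta> y) \<cdot> (\<alpha> x \<boxtimes> \<alpha> y))"
  by (rule A.ext2[OF transf_mu[OF \<beta>]]) auto
 then show "(\<lambda>x \<in> Obj A. \<beta> x \<cdot> \<alpha> x) (x \<boxdot> y) \<cdot> Mu F x y = Mu F'' x y \<cdot> ((\<lambda>x \<in> Obj A. \<beta> x \<cdot> \<alpha> x) x \<boxtimes> (\<lambda>x \<in> Obj A. \<beta> x \<cdot> \<alpha> x) y)"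
  by (simp add: transf_mu[OF \<alpha>] A.assoc A.interchange)
next
 note [simp] = transf_simps[OF \<alpha>] transf_simps[OF \<beta>]
 show "(\<lambda>x \<in> Obj A. \<beta> x \<cdot> \<alpha> x) (Unt A) \<cdot> Iota F = Iota F''"
  by (simp add: transf_iota[OF \<alpha>] transf_iota[OF \<beta>] A.assoc)
 fix g x assume [simp]: "g : Obj G" "x : Obj A"
 have "act g (\<beta> x) \<cdot> (Str F' g x \<cdot> \<alpha> (ActO A g x)) = Str F'' g x \<cdot> (\<beta> (ActO A g x) \<cdot> \<alpha> (ActO A g x))"
  by (rule A.ext2[OF transf_str[OF \<beta>]]) auto
 then show "act g ((\<lambda>x \<in> Obj A. \<beta> x \<cdot> \<alpha> x) x) \<cdot> Str F g x = Str F'' g x \<cdot> (\<lambda>x \<in> Obj A. \<beta> x \<cdot> \<alpha> x) (ActO A g x)"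
  by (simp add: transf_str[OF \<alpha>] A.assoc flip: actA_merge)
qed

lemma transf_inv:
 assumes [simp]: "aut F" "aut F'" and \<alpha>: "transf F F' \<alpha>"
 shows "transf F' F (\<lambda>x \<in> Obj A. inv_arr A (\<alpha> x))"
proof (rule transfI)
 note [simp] = transf_simps[OF \<alpha>]
 show "(\<lambda>x \<in> Obj A. inv_arr A (\<alpha> x)) : extensional (Obj A)" by simp
 show "(\<lambda>x \<in> Obj A. inv_arr A (\<alpha> x)) x : isos A (FO F' x) (FO F x)" if "x : Obj A" for x
  using that by (simp add: isos_iff)
 fix f assume [simp]: "f : Arr A"
 show "FA F f \<cdot> (\<lambda>x \<in> Obj A. inv_arr A (\<alpha> x)) (Src A f) = (\<lambda>x \<in> Obj A. inv_arr A (\<alpha> x)) (Tgt A f) \<cdot> FA F' f"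
  using A.iso_square[OF transf_nat[OF \<alpha>, of f, symmetric]] by simp
next
 note [simp] = transf_simps[OF \<alpha>]
 fix x y assume [simp]: "x : Obj A" "y : Obj A"
 show "(\<lambda>x \<in> Obj A. inv_arr A (\<alpha> x)) (x \<boxdot> y) \<cdot> Mu F' x y = Mu F x y \<cdot> ((\<lambda>x \<in> Obj A. inv_arr A (\<alpha> x)) x \<boxtimes> (\<lambda>x \<in> Obj A. inv_arr A (\<alpha> x)) y)"
  using A.iso_square[OF transf_mu[OF \<alpha>, of x y]] by (simp add: A.inv_ten)
next
 note [simp] = transf_simps[OF \<alpha>]
 show "(\<lambda>x \<in> Obj A. inv_arr A (\<alpha> x)) (Unt A) \<cdot> Iota F' = Iota F"
  by (simp flip: transf_iota[OF \<alpha>])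
 fix g x assume [simp]: "g : Obj G" "x : Obj A"
 have i: "inverse_arrows A (act g (\<alpha> x)) (act g (inv_arr A (\<alpha> x)))"
  by (rule A.inverse_arrowsI) (auto simp: actA_merge)
 then have [simp]: "is_iso A (act g (\<alpha> x))" by (auto simp: is_iso_def)
 show "act g ((\<lambda>x \<in> Obj A. inv_arr A (\<alpha> x)) x) \<cdot> Str F' g x = Str F g x \<cdot> (\<lambda>x \<in> Obj A. inv_arr A (\<alpha> x)) (ActO A g x)"
  using A.iso_square[OF transf_str[OF \<alpha>, of g x]] A.inv_arr_eq[OF i] by simp
qed

text \<open>The horizontal composite, in the form whose second factor is applied first.\<close>

lemma transf_ten:
 assumes [simp]: "aut F" "aut F'" "aut H" "aut H'" and \<alpha>: "transf F F' \<alpha>" and \<beta>: "transf H H' \<beta>"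
 shows "transf (comp F H) (comp F' H') (\<lambda>x \<in> Obj A. \<alpha> (FO H' x) \<cdot> FA F (\<beta> x))"
proof (rule transfI)
 note [simp] = transf_simps[OF \<alpha>] transf_simps[OF \<beta>]
 let ?\<gamma> = "\<lambda>x \<in> Obj A. \<alpha> (FO H' x) \<cdot> FA F (\<beta> x)"
 show "?\<gamma> : extensional (Obj A)" by simp
 show "?\<gamma> x : isos A (FO (comp F H) x) (FO (comp F' H') x)" if "x : Obj A" for x
  using that by (simp add: isos_iff)
 fix f assume [simp]: "f : Arr A"
 have "FA F' (FA H' f) \<cdot> (\<alpha> (FO H' (Src A f)) \<cdot> FA F (\<beta> (Src A f))) = \<alpha> (FO H' (Tgt A f)) \<cdot> (FA F (FA H' f) \<cdot> FA F (\<beta> (Src A f)))"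
  by (rule A.ext2) (use transf_nat[OF \<alpha>, of "FA H' f"] in auto)
 then show "FA (comp F' H') f \<cdot> ?\<gamma> (Src A f) = ?\<gamma> (Tgt A f) \<cdot> FA (comp F H) f"
  by (simp add: transf_nat[OF \<beta>] A.assoc aut_cmp)
next
 note [simp] = transf_simps[OF \<alpha>] transf_simps[OF \<beta>]
 let ?\<gamma> = "\<lambda>x \<in> Obj A. \<alpha> (FO H' x) \<cdot> FA F (\<beta> x)"
 fix x y assume [simp]: "x : Obj A" "y : Obj A"
 have "\<alpha> (FO H' (x \<boxdot> y)) \<cdot> (FA F (\<beta> (x \<boxdot> y)) \<cdot> (FA F (Mu H x y) \<cdot> Mu F (FO H x) (FO H y)))
  = \<alpha> (FO H' (x \<boxdot> y)) \<cdot> (FA F (Mu H' x y) \<cdot> (FA F (\<beta> x \<boxtimes> \<beta> y) \<cdot> Mu F (FO H x) (FO H y)))"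
  by (simp add: aut_cmp_ext transf_mu[OF \<beta>])
 also have "... = FA F' (Mu H' x y) \<cdot> (\<alpha> (FO H' x \<boxdot> FO H' y) \<cdot> (FA F (\<beta> x \<boxtimes> \<beta> y) \<cdot> Mu F (FO H x) (FO H y)))"
  by (rule A.ext2[symmetric]) (use transf_nat[OF \<alpha>, of "Mu H' x y"] in auto)
 also have "... = FA F' (Mu H' x y) \<cdot> ((\<alpha> (FO H' x \<boxdot> FO H' y) \<cdot> Mu F (FO H' x) (FO H' y)) \<cdot> (FA F (\<beta> x) \<boxtimes> FA F (\<beta> y)))"
  by (simp add: aut_mu_nat A.assoc)
 also have "... = FA F' (Mu H' x y) \<cdot> (Mu F' (FO H' x) (FO H' y) \<cdot> ((\<alpha> (FO H' x) \<cdot> FA F (\<beta> x)) \<boxtimes> (\<alpha> (FO H' y) \<cdot> FA F (\<beta> y))))"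
  by (simp add: transf_mu[OF \<alpha>] A.assoc A.interchange)
 finally show "?\<gamma> (x \<boxdot> y) \<cdot> Mu (comp F H) x y = Mu (comp F' H') x y \<cdot> (?\<gamma> x \<boxtimes> ?\<gamma> y)"
  by (simp add: A.assoc)
next
 note [simp] = transf_simps[OF \<alpha>] transf_simps[OF \<beta>]
 let ?\<gamma> = "\<lambda>x \<in> Obj A. \<alpha> (FO H' x) \<cdot> FA F (\<beta> x)"
 have "\<alpha> (FO H' (Unt A)) \<cdot> (FA F (\<beta> (Unt A)) \<cdot> (FA F (Iota H) \<cdot> Iota F)) = \<alpha> (FO H' (Unt A)) \<cdot> (FA F (Iota H') \<cdot> Iota F)"
  by (simp add: aut_cmp_ext transf_iota[OF \<beta>])
 also have "... = FA F' (Iota H') \<cdot> (\<alpha> (Unt A) \<cdot> Iota F)"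
  by (rule A.ext2[symmetric]) (use transf_nat[OF \<alpha>, of "Iota H'"] in auto)
 finally show "?\<gamma> (Unt A) \<cdot> Iota (comp F H) = Iota (comp F' H')"
  by (simp add: A.assoc transf_iota[OF \<alpha>])
 fix g x assume [simp]: "g : Obj G" "x : Obj A"
 have "act g (\<alpha> (FO H' x)) \<cdot> (act g (FA F (\<beta> x)) \<cdot> (Str F g (FO H x) \<cdot> FA F (Str H g x)))
  = act g (\<alpha> (FO H' x)) \<cdot> (Str F g (FO H' x) \<cdot> (FA F (Str H' g x) \<cdot> FA F (\<beta> (ActO A g x))))"
  by (simp add: aut_str_nat_ext aut_cmp transf_str[OF \<beta>])
 also have "... = Str F' g (FO H' x) \<cdot> (\<alpha> (ActO A g (FO H' x)) \<cdot> (FA F (Str H' g x) \<cdot> FA F (\<beta> (ActO A g x))))"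
  by (rule A.ext2[OF transf_str[OF \<alpha>]]) auto
 also have "... = Str F' g (FO H' x) \<cdot> (FA F' (Str H' g x) \<cdot> (\<alpha> (FO H' (ActO A g x)) \<cdot> FA F (\<beta> (ActO A g x))))"
  by (subst A.ext2[symmetric]) (use transf_nat[OF \<alpha>, of "Str H' g x"] in auto)
 finally show "act g (?\<gamma> x) \<cdot> Str (comp F H) g x = Str (comp F' H') g x \<cdot> ?\<gamma> (ActO A g x)"
  by (simp add: A.assoc actA_merge_ext)
qed

lemma Aut_sel [simp]:
 "Obj (Aut_E3 G A) = {F. aut F}" "Src (Aut_E3 G A) = asrc" "Tgt (Aut_E3 G A) = atgt"
 "Idn (Aut_E3 G A) F = \<lparr>asrc = F, atgt = F, amap = (\<lambda>x \<in> Obj A. Idn A (FO F x))\<rparr>"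
 "\<beta> \<cdot>\<^bsub>Aut_E3 G A\<^esub> \<alpha> = \<lparr>asrc = asrc \<alpha>, atgt = atgt \<beta>, amap = (\<lambda>x \<in> Obj A. amap \<beta> x \<cdot> amap \<alpha> x)\<rparr>"
 "TenO (Aut_E3 G A) = comp" "Unt (Aut_E3 G A) = ident"
 "\<alpha> \<otimes>\<^bsub>Aut_E3 G A\<^esub> \<beta> = \<lparr>asrc = comp (asrc \<alpha>) (asrc \<beta>), atgt = comp (atgt \<alpha>) (atgt \<beta>),
   amap = (\<lambda>x \<in> Obj A. amap \<alpha> (FO (atgt \<beta>) x) \<cdot> FA (asrc \<alpha>) (amap \<beta> x))\<rparr>"
 by (auto simp: Aut_E3_def)

lemma Aut_Arr [simp]: "\<alpha> : Arr (Aut_E3 G A) \<longleftrightarrow> aut (asrc \<alpha>) \<and> aut (atgt \<alpha>) \<and> transf (asrc \<alpha>) (atgt \<alpha>) (amap \<alpha>)"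
 by (auto simp: Aut_E3_def transf_def)

lemma Aut_coherence:
 "aut F ==> aut F' ==> aut F'' ==> Asc (Aut_E3 G A) F F' F'' = Idn (Aut_E3 G A) (comp F (comp F' F''))"
 "aut F ==> Lun (Aut_E3 G A) F = Idn (Aut_E3 G A) F" "aut F ==> Run (Aut_E3 G A) F = Idn (Aut_E3 G A) F"
 by (auto simp: Aut_E3_def comp_assoc comp_ident_left comp_ident_right)

lemma arrow_eqI: "asrc \<alpha> = asrc \<beta> ==> atgt \<alpha> = atgt \<beta> ==> amap \<alpha> = amap \<beta> ==> \<alpha> = (\<beta> :: ('b, 'c) arrow)"
 by simp

lemma category_Aut: "category (Aut_E3 G A)"
proof
 fix f assume f: "f : Arr (Aut_E3 G A)"
 then show "Src (Aut_E3 G A) f : Obj (Aut_E3 G A)" "Tgt (Aut_E3 G A) f : Obj (Aut_E3 G A)" by auto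
next
 fix x assume "x : Obj (Aut_E3 G A)"
 then show "Idn (Aut_E3 G A) x : homs (Aut_E3 G A) x x" by (auto simp: homs_iff transf_idn)
next
 fix f x y assume f: "f : homs (Aut_E3 G A) x y"
 then have x: "transf x y (amap f)" "aut x" "aut y" "asrc f = x" "atgt f = y" by (auto simp: homs_iff)
 note [simp] = transf_simps[OF x(1)]
 show "f \<cdot>\<^bsub>Aut_E3 G A\<^esub> Idn (Aut_E3 G A) x = f" "Idn (Aut_E3 G A) y \<cdot>\<^bsub>Aut_E3 G A\<^esub> f = f"
  using x by (auto intro!: arrow_eqI extensionalityI[OF _ transf_ext[OF x(1)]])
 fix g z assume g: "g : homs (Aut_E3 G A) y z"
 then have y: "transf y z (amap g)" "aut y" "aut z" "asrc g = y" "atgt g = z" by (auto simp: homs_iff)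
 then show "g \<cdot>\<^bsub>Aut_E3 G A\<^esub> f : homs (Aut_E3 G A) x z"
  using x transf_cmp[OF x(2,3) y(3) x(1) y(1)] by (auto simp: homs_iff)
 fix h w assume h: "h : homs (Aut_E3 G A) z w"
 then have z: "transf z w (amap h)" "aut z" "aut w" "asrc h = z" "atgt h = w" by (auto simp: homs_iff)
 show "(h \<cdot>\<^bsub>Aut_E3 G A\<^esub> g) \<cdot>\<^bsub>Aut_E3 G A\<^esub> f = h \<cdot>\<^bsub>Aut_E3 G A\<^esub> (g \<cdot>\<^bsub>Aut_E3 G A\<^esub> f)"
  using x y z transf_simps[OF y(1)] transf_simps[OF z(1)] by (auto simp: A.assoc intro!: ext)
qed

lemma Aut_is_iso: "\<alpha> : Arr (Aut_E3 G A) ==> is_iso (Aut_E3 G A) \<alpha>"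
proof -
 interpret category "Aut_E3 G A" by (rule category_Aut)
 assume a: "\<alpha> : Arr (Aut_E3 G A)"
 then have t: "transf (asrc \<alpha>) (atgt \<alpha>) (amap \<alpha>)" "aut (asrc \<alpha>)" "aut (atgt \<alpha>)" by auto
 note [simp] = transf_simps[OF t(1)]
 show ?thesis
  by (rule is_isoI[where g = "\<lparr>asrc = atgt \<alpha>, atgt = asrc \<alpha>, amap = (\<lambda>x \<in> Obj A. inv_arr A (amap \<alpha> x))\<rparr>"])
   (use t a transf_inv[OF t(2,3,1)] in "auto intro!: ext")
qed

text \<open>
 Composition being strictly associative and unital, the associators and unitors are identities. What
 remains is the interchange law, which is naturality.
\<close>

lemma monoidal_category_Aut: "monoidal_category (Aut_E3 G A)"
proof -
 let ?U = "Aut_E3 G A"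
 interpret U: category ?U by (rule category_Aut)
 have iso: "\<alpha> : isos ?U F F' \<longleftrightarrow> \<alpha> : homs ?U F F'" for \<alpha> F F'
  using Aut_is_iso by (auto simp: isos_def homs_iff)
 have hom: "f : homs ?U x y \<longleftrightarrow> transf x y (amap f) \<and> aut x \<and> aut y \<and> asrc f = x \<and> atgt f = y" for f x y
  by (auto simp: homs_iff)
 have ten: "f \<otimes>\<^sub>?U g : homs ?U (comp x y) (comp x' y')" if "f : homs ?U x x'" "g : homs ?U y y'" for f g x x' y y'
  using that by (auto simp: hom intro!: transf_ten)
 have teni: "Idn ?U x \<otimes>\<^sub>?U Idn ?U y = Idn ?U (comp x y)" if "aut x" "aut y" for x y
  using that by (auto intro!: ext)
 have idn: "Idn ?U x : homs ?U x x" if "aut x" for x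
  using that U.idn_hom by simp
 have assoc: "(f \<otimes>\<^sub>?U g) \<otimes>\<^sub>?U h = f \<otimes>\<^sub>?U (g \<otimes>\<^sub>?U h)"
  if "f : homs ?U x x'" "g : homs ?U y y'" "h : homs ?U z z'" for f g h x x' y y' z z'
 proof -
  note t = that[unfolded hom]
  note [simp] = transf_simps[OF conjunct1[OF t(1)]] transf_simps[OF conjunct1[OF t(2)]] transf_simps[OF conjunct1[OF t(3)]]
  show ?thesis using t by (auto simp: comp_assoc A.assoc intro!: ext simp flip: aut_cmp)
 qed
 have lun: "Idn ?U ident \<otimes>\<^sub>?U f = f" "f \<otimes>\<^sub>?U Idn ?U ident = f" if "f : homs ?U x x'" for f x x'
 proof -
  note t = that[unfolded hom]
  note [simp] = transf_simps[OF conjunct1[OF t]]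
  show "Idn ?U ident \<otimes>\<^sub>?U f = f" "f \<otimes>\<^sub>?U Idn ?U ident = f" using t
   by (auto simp: comp_ident_left comp_ident_right intro!: arrow_eqI extensionalityI[OF _ transf_ext[OF conjunct1[OF t]]])
 qed
 show ?thesis
 proof
  fix f x x' f' x'' g y y' g' y''
  assume f: "f : homs ?U x x'" "f' : homs ?U x' x''" and g: "g : homs ?U y y'" "g' : homs ?U y' y''"
  note t = f[unfolded hom] g[unfolded hom]
  note [simp] = transf_simps[OF conjunct1[OF t(1)]] transf_simps[OF conjunct1[OF t(2)]]
   transf_simps[OF conjunct1[OF t(3)]] transf_simps[OF conjunct1[OF t(4)]]
  have "amap f' (FO y'' z) \<cdot> (amap f (FO y'' z) \<cdot> (FA x (amap g' z) \<cdot> FA x (amap g z)))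
   = amap f' (FO y'' z) \<cdot> (FA x' (amap g' z) \<cdot> (amap f (FO y' z) \<cdot> FA x (amap g z)))" if "z : Obj A" for z
   using t that transf_nat[OF conjunct1[OF t(1)], of "amap g' z"] by (subst A.ext2[symmetric]) auto
  then show "(f' \<cdot>\<^sub>?U f) \<otimes>\<^sub>?U (g' \<cdot>\<^sub>?U g) = (f' \<otimes>\<^sub>?U g') \<cdot>\<^sub>?U (f \<otimes>\<^sub>?U g)"
   using t by (auto simp: A.assoc intro!: ext simp flip: aut_cmp)
 next
  fix x y z assume "x : Obj ?U" "y : Obj ?U" "z : Obj ?U"
  then show "Asc ?U x y z : isos ?U ((x \<otimes>\<^sub>o\<^sub>?U y) \<otimes>\<^sub>o\<^sub>?U z) (x \<otimes>\<^sub>o\<^sub>?U y \<otimes>\<^sub>o\<^sub>?U z)"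
   using idn[of "comp x (comp y z)"] by (simp add: iso comp_assoc Aut_coherence(1) del: Aut_sel(4))
 next
  fix f x x' g y y' h z z'
  assume f: "f : homs ?U x x'" "g : homs ?U y y'" "h : homs ?U z z'"
  have o: "aut x" "aut y" "aut z" "aut x'" "aut y'" "aut z'" using f by (auto simp: hom)
  have "f \<otimes>\<^sub>?U (g \<otimes>\<^sub>?U h) : homs ?U (comp x (comp y z)) (comp x' (comp y' z'))"
   using f by (intro ten)
  then show "Asc ?U x' y' z' \<cdot>\<^sub>?U ((f \<otimes>\<^sub>?U g) \<otimes>\<^sub>?U h) = (f \<otimes>\<^sub>?U (g \<otimes>\<^sub>?U h)) \<cdot>\<^sub>?U Asc ?U x y z"
   using o by (simp only: assoc[OF f] Aut_coherence(1) U.cmp_idn_left U.cmp_idn_right)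
 next
  fix x assume "x : Obj ?U"
  then show "Lun ?U x : isos ?U (Unt ?U \<otimes>\<^sub>o\<^sub>?U x) x" "Run ?U x : isos ?U (x \<otimes>\<^sub>o\<^sub>?U Unt ?U) x"
   using idn[of x] by (simp_all add: iso comp_ident_left comp_ident_right Aut_coherence(2,3) del: Aut_sel(4))
 next
  fix f x x' assume f: "f : homs ?U x x'"
  then have "aut x" "aut x'" by (auto simp: hom)
  then show "Lun ?U x' \<cdot>\<^sub>?U (Idn ?U (Unt ?U) \<otimes>\<^sub>?U f) = f \<cdot>\<^sub>?U Lun ?U x"
   "Run ?U x' \<cdot>\<^sub>?U (f \<otimes>\<^sub>?U Idn ?U (Unt ?U)) = f \<cdot>\<^sub>?U Run ?U x"
   by (simp_all only: Aut_coherence(2,3) Aut_sel(7) lun[OF f] U.cmp_idn_left[OF f] U.cmp_idn_right[OF f])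
 next
  fix w x y z assume "w : Obj ?U" "x : Obj ?U" "y : Obj ?U" "z : Obj ?U"
  then have o: "aut w" "aut x" "aut y" "aut z" "aut (comp w x)" "aut (comp x y)" "aut (comp y z)"
   "aut (comp x (comp y z))" "aut (comp w (comp x y))" "aut (comp w (comp x (comp y z)))" by auto
  show "Asc ?U w x (y \<otimes>\<^sub>o\<^sub>?U z) \<cdot>\<^sub>?U Asc ?U (w \<otimes>\<^sub>o\<^sub>?U x) y z =
   (Idn ?U w \<otimes>\<^sub>?U Asc ?U x y z) \<cdot>\<^sub>?U Asc ?U w (x \<otimes>\<^sub>o\<^sub>?U y) z \<cdot>\<^sub>?U (Asc ?U w x y \<otimes>\<^sub>?U Idn ?U z)"
   using o by (simp only: Aut_coherence(1) Aut_sel(6) comp_assoc teni U.cmp_idn_left[OF idn])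
 next
  fix x y assume "x : Obj ?U" "y : Obj ?U"
  then have o: "aut x" "aut y" "aut (comp x y)" by auto
  show "(Idn ?U x \<otimes>\<^sub>?U Lun ?U y) \<cdot>\<^sub>?U Asc ?U x (Unt ?U) y = Run ?U x \<otimes>\<^sub>?U Idn ?U y"
   using o by (simp only: Aut_coherence Aut_sel(6,7) aut_ident comp_ident_left teni U.cmp_idn_left[OF idn])
 qed (use ten teni in "auto simp del: Aut_sel(4,8)")
qed

end

section \<open>Functor categories and translation actions\<close>

text \<open>A linear monoidal category with a natural braiding.\<close>

locale lsm = monoidal_category D for D :: "('o, 'm, 'k, 'y) lsmcat_scheme" +
 assumes brd_hom: "x : Obj D ==> y : Obj D ==> Brd D x y : homs D (x \<otimes>\<^sub>o\<^sub>D y) (y \<otimes>\<^sub>o\<^sub>D x)"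
  and brd_nat: "f : Arr D ==> g : Arr D ==>
   Brd D (Tgt D f) (Tgt D g) \<cdot>\<^sub>D (f \<otimes>\<^sub>D g) = (g \<otimes>\<^sub>D f) \<cdot>\<^sub>D Brd D (Src D f) (Src D g)"
  and add_hom: "f : homs D x y ==> f' : homs D x y ==> Add D f f' : homs D x y"
  and scl_hom: "f : homs D x y ==> Scl D c f : homs D x y"
  and add_cmp: "f : homs D x y ==> f' : homs D x y ==> g : homs D y z ==>
   g \<cdot>\<^sub>D Add D f f' = Add D (g \<cdot>\<^sub>D f) (g \<cdot>\<^sub>D f')"
  and cmp_add: "f : homs D x y ==> g : homs D y z ==> g' : homs D y z ==>
   Add D g g' \<cdot>\<^sub>D f = Add D (g \<cdot>\<^sub>D f) (g' \<cdot>\<^sub>D f)"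
  and scl_cmp: "f : homs D x y ==> g : homs D y z ==> g \<cdot>\<^sub>D Scl D c f = Scl D c (g \<cdot>\<^sub>D f)"
  and cmp_scl: "f : homs D x y ==> g : homs D y z ==> Scl D c g \<cdot>\<^sub>D f = Scl D c (g \<cdot>\<^sub>D f)"
begin

lemma lsm_simps [simp]:
 "x : Obj D ==> y : Obj D ==> Brd D x y : Arr D"
 "x : Obj D ==> y : Obj D ==> Src D (Brd D x y) = x \<otimes>\<^sub>o\<^sub>D y"
 "x : Obj D ==> y : Obj D ==> Tgt D (Brd D x y) = y \<otimes>\<^sub>o\<^sub>D x"
 "f : Arr D ==> f' : Arr D ==> Src D f = Src D f' ==> Tgt D f = Tgt D f' ==> Add D f f' : Arr D"
 "f : Arr D ==> f' : Arr D ==> Src D f = Src D f' ==> Tgt D f = Tgt D f' ==> Src D (Add D f f') = Src D f'"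
 "f : Arr D ==> f' : Arr D ==> Src D f = Src D f' ==> Tgt D f = Tgt D f' ==> Tgt D (Add D f f') = Tgt D f'"
 "f : Arr D ==> Scl D c f : Arr D"
 "f : Arr D ==> Src D (Scl D c f) = Src D f"
 "f : Arr D ==> Tgt D (Scl D c f) = Tgt D f"
 using brd_hom add_hom[of f "Src D f'" "Tgt D f'" f'] scl_hom[of f "Src D f" "Tgt D f" c] by (auto simp: homs_iff)

end

locale functor_category = G: two_group G + D: lsm D
 for G :: "('g, 'a, 'x) moncat_scheme" and D :: "('o, 'm, 'k, 'y) lsmcat_scheme"
begin

abbreviation cmpG  (infixl \<open>\<circ>\<^sub>G\<close> 68) where "g \<circ>\<^sub>G f \<equiv> g \<cdot>\<^sub>G f"
abbreviation cmpD  (infixl \<open>\<circ>\<^sub>D\<close> 68) where "g \<circ>\<^sub>D f \<equiv> g \<cdot>\<^sub>D f"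
abbreviation cmpW  (infixl \<open>\<ast>\<close> 68) where "\<psi> \<ast> \<phi> \<equiv> \<psi> \<cdot>\<^bsub>Fun_cat G D\<^esub> \<phi>"
abbreviation W where "W \<equiv> Fun_cat G D"
abbreviation func where "func \<equiv> is_functor G D"
abbreviation tens  (infixr \<open>\<boxtimes>\<close> 72) where "F \<boxtimes> F' \<equiv> tensor_func G D F F'"

lemma func_simps [simp]:
 assumes "func F"
 shows "x : Obj G ==> FO F x : Obj D" "b : Arr G ==> FA F b : Arr D"
  "b : Arr G ==> Src D (FA F b) = FO F (Src G b)" "b : Arr G ==> Tgt D (FA F b) = FO F (Tgt G b)"
  "x : Obj G ==> FA F (Idn G x) = Idn D (FO F x)" "b : Arr G ==> is_iso D (FA F b)"
 using functor_simps[OF assms] functor_is_iso[OF G.category_axioms assms, of b] by auto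

lemma func_cmp: "func F ==> b : Arr G ==> c : Arr G ==> Src G c = Tgt G b ==> FA F c \<circ>\<^sub>D FA F b = FA F (c \<circ>\<^sub>G b)"
 by (rule functor_cmp[symmetric])

lemma func_cmp_ext:
 assumes "func F" "b : Arr G" "c : Arr G" "Src G c = Tgt G b" "k : Arr D" "Tgt D k = FO F (Src G b)"
 shows "FA F c \<circ>\<^sub>D (FA F b \<circ>\<^sub>D k) = FA F (c \<circ>\<^sub>G b) \<circ>\<^sub>D k"
 by (rule D.ext1[OF func_cmp]) (use assms in auto)

lemma func_inv: "func F ==> b : Arr G ==> inv_arr D (FA F b) = FA F (inv_arr G b)"
 by (rule functor_inv[OF G.category_axioms D.category_axioms]) auto

lemma func_eqI:
 fixes F F' :: "('g, 'a, 'o, 'm) func"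
 assumes "func F" "func F'" "\<And>x. x : Obj G ==> FO F x = FO F' x" "\<And>b. b : Arr G ==> FA F b = FA F' b"
 shows "F = F'"
proof -
 have e: "FO F : extensional (Obj G)" "FA F : extensional (Arr G)" if "func F" for F :: "('g, 'a, 'o, 'm) func"
  using that unfolding is_functor_def PiE_def by blast+
 have "FO F = FO F'" by (rule extensionalityI[OF e(1)[OF assms(1)] e(1)[OF assms(2)] assms(3)])
 moreover have "FA F = FA F'" by (rule extensionalityI[OF e(2)[OF assms(1)] e(2)[OF assms(2)] assms(4)])
 ultimately show ?thesis by simp
qed

lemma funcI:
 assumes "FO F : extensional (Obj G)" "FA F : extensional (Arr G)"
  "\<And>x. x : Obj G ==> FO F x : Obj D" "\<And>b. b : Arr G ==> FA F b : homs D (FO F (Src G b)) (FO F (Tgt G b))"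
  "\<And>x. x : Obj G ==> FA F (Idn G x) = Idn D (FO F x)"
  "\<And>b c. b : Arr G ==> c : Arr G ==> Src G c = Tgt G b ==> FA F (c \<circ>\<^sub>G b) = FA F c \<circ>\<^sub>D FA F b"
 shows "func F"
 using assms unfolding is_functor_def PiE_def by (auto simp: homs_iff)

definition nt :: "(('g, 'a, 'o, 'm) func, 'g => 'm) arrow => bool" where
 "nt \<phi> \<longleftrightarrow> func (asrc \<phi>) \<and> func (atgt \<phi>) \<and> nat_trans G D (asrc \<phi>) (atgt \<phi>) (amap \<phi>)"

lemma nt_simps [simp]:
 assumes "nt \<phi>"
 shows "func (asrc \<phi>)" "func (atgt \<phi>)" "x : Obj G ==> amap \<phi> x : Arr D"
  "x : Obj G ==> Src D (amap \<phi> x) = FO (asrc \<phi>) x" "x : Obj G ==> Tgt D (amap \<phi> x) = FO (atgt \<phi>) x"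
proof -
 have n: "func (asrc \<phi>)" "func (atgt \<phi>)" "nat_trans G D (asrc \<phi>) (atgt \<phi>) (amap \<phi>)"
  using assms unfolding nt_def by blast+
 show "func (asrc \<phi>)" "func (atgt \<phi>)" by fact+
 show "x : Obj G ==> amap \<phi> x : Arr D" "x : Obj G ==> Src D (amap \<phi> x) = FO (asrc \<phi>) x"
  "x : Obj G ==> Tgt D (amap \<phi> x) = FO (atgt \<phi>) x"
  by (rule nat_transD[OF n(3)], assumption)+
qed

lemma nt_nat:
 assumes "nt \<phi>" "b : Arr G" "Src G b = x" "F = atgt \<phi>"
 shows "FA F b \<circ>\<^sub>D amap \<phi> x = amap \<phi> (Tgt G b) \<circ>\<^sub>D FA (asrc \<phi>) b"
 using nat_transD(4)[of G D "asrc \<phi>" "atgt \<phi>" "amap \<phi>" b] assms unfolding nt_def by simp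

lemma nt_nat_ext:
 assumes "nt \<phi>" "b : Arr G" "Src G b = x" "F = atgt \<phi>" "k : Arr D" "Tgt D k = FO (asrc \<phi>) x"
 shows "FA F b \<circ>\<^sub>D (amap \<phi> x \<circ>\<^sub>D k) = amap \<phi> (Tgt G b) \<circ>\<^sub>D (FA (asrc \<phi>) b \<circ>\<^sub>D k)"
 by (rule D.ext2[OF nt_nat]) (use assms in auto)

lemma ntI:
 assumes "func (asrc \<phi>)" "func (atgt \<phi>)" "amap \<phi> : extensional (Obj G)"
  "\<And>x. x : Obj G ==> amap \<phi> x : homs D (FO (asrc \<phi>) x) (FO (atgt \<phi>) x)"
  "\<And>b. b : Arr G ==> FA (atgt \<phi>) b \<circ>\<^sub>D amap \<phi> (Src G b) = amap \<phi> (Tgt G b) \<circ>\<^sub>D FA (asrc \<phi>) b"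
 shows "nt \<phi>"
proof -
 have "nat_trans G D (asrc \<phi>) (atgt \<phi>) (amap \<phi>)"
  by (rule nat_transI[OF assms(3)]) (use assms(4,5) in "simp_all add: homs_iff")
 then show ?thesis using assms(1,2) unfolding nt_def by blast
qed

lemma nt_eqI:
 assumes "nt \<phi>" "nt \<psi>" "asrc \<phi> = asrc \<psi>" "atgt \<phi> = atgt \<psi>" "\<And>x. x : Obj G ==> amap \<phi> x = amap \<psi> x"
 shows "\<phi> = \<psi>"
proof -
 have e: "amap \<phi> : extensional (Obj G)" if "nt \<phi>" for \<phi>
  using that unfolding nt_def nat_trans_def by blast
 have "amap \<phi> = amap \<psi>" by (rule extensionalityI[OF e[OF assms(1)] e[OF assms(2)] assms(5)])
 then show ?thesis using assms by simp
qed

lemma tens_simps [simp]: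
 "x : Obj G ==> FO (F \<boxtimes> F') x = FO F x \<otimes>\<^sub>o\<^sub>D FO F' x"
 "b : Arr G ==> FA (F \<boxtimes> F') b = FA F b \<otimes>\<^sub>D FA F' b"
 "x : Obj G ==> FO (unit_func G D) x = Unt D"
 "b : Arr G ==> FA (unit_func G D) b = Idn D (Unt D)"
 by (auto simp: tensor_func_def unit_func_def)

lemma func_tens [simp]: "func F ==> func F' ==> func (F \<boxtimes> F')"
 by (rule funcI) (auto simp: homs_iff D.interchange simp flip: func_cmp, auto simp: tensor_func_def)

lemma func_unit [simp]: "func (unit_func G D)"
 by (rule funcI) (auto simp: homs_iff, auto simp: unit_func_def)

lemma W_sel [simp]:
 "Obj W = {F. func F}" "Src W = asrc" "Tgt W = atgt" "TenO W = tensor_func G D" "Unt W = unit_func G D"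
 "asrc (Idn W F) = F" "atgt (Idn W F) = F" "x : Obj G ==> amap (Idn W F) x = Idn D (FO F x)"
 "asrc (\<psi> \<ast> \<phi>) = asrc \<phi>" "atgt (\<psi> \<ast> \<phi>) = atgt \<psi>"
 "x : Obj G ==> amap (\<psi> \<ast> \<phi>) x = amap \<psi> x \<circ>\<^sub>D amap \<phi> x"
 "asrc (\<phi> \<otimes>\<^sub>W \<psi>) = asrc \<phi> \<boxtimes> asrc \<psi>" "atgt (\<phi> \<otimes>\<^sub>W \<psi>) = atgt \<phi> \<boxtimes> atgt \<psi>"
 "x : Obj G ==> amap (\<phi> \<otimes>\<^sub>W \<psi>) x = amap \<phi> x \<otimes>\<^sub>D amap \<psi> x"
 "asrc (Asc W F F' F'') = (F \<boxtimes> F') \<boxtimes> F''" "atgt (Asc W F F' F'') = F \<boxtimes> (F' \<boxtimes> F'')"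
 "x : Obj G ==> amap (Asc W F F' F'') x = Asc D (FO F x) (FO F' x) (FO F'' x)"
 "asrc (Lun W F) = unit_func G D \<boxtimes> F" "atgt (Lun W F) = F" "x : Obj G ==> amap (Lun W F) x = Lun D (FO F x)"
 "asrc (Run W F) = F \<boxtimes> unit_func G D" "atgt (Run W F) = F" "x : Obj G ==> amap (Run W F) x = Run D (FO F x)"
 "asrc (Brd W F F') = F \<boxtimes> F'" "atgt (Brd W F F') = F' \<boxtimes> F" "x : Obj G ==> amap (Brd W F F') x = Brd D (FO F x) (FO F' x)"
 "asrc (Add W \<phi> \<psi>) = asrc \<phi>" "atgt (Add W \<phi> \<psi>) = atgt \<phi>" "x : Obj G ==> amap (Add W \<phi> \<psi>) x = Add D (amap \<phi> x) (amap \<psi> x)"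
 "asrc (Scl W c \<phi>) = asrc \<phi>" "atgt (Scl W c \<phi>) = atgt \<phi>" "x : Obj G ==> amap (Scl W c \<phi>) x = Scl D c (amap \<phi> x)"
 by (auto simp: Fun_cat_def)

lemma W_Arr [simp]: "\<phi> : Arr W \<longleftrightarrow> nt \<phi>"
 unfolding nt_def Fun_cat_def by simp

lemma W_ext: "amap (Idn W F) : extensional (Obj G)" "amap (\<psi> \<ast> \<phi>) : extensional (Obj G)"
 "amap (\<phi> \<otimes>\<^sub>W \<psi>) : extensional (Obj G)" "amap (Asc W F F' F'') : extensional (Obj G)"
 "amap (Lun W F) : extensional (Obj G)" "amap (Run W F) : extensional (Obj G)" "amap (Brd W F F') : extensional (Obj G)"
 "amap (Add W \<phi> \<psi>) : extensional (Obj G)" "amap (Scl W c \<phi>) : extensional (Obj G)"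
 by (auto simp: Fun_cat_def)

lemma nt_idn [simp]: "func F ==> nt (Idn W F)"
 by (rule ntI) (auto simp: homs_iff W_ext)

lemma nt_cmp [simp]: "nt \<phi> ==> nt \<psi> ==> asrc \<psi> = atgt \<phi> ==> nt (\<psi> \<ast> \<phi>)"
 by (rule ntI) (auto simp: homs_iff W_ext nt_nat nt_nat_ext D.assoc)

lemma nt_ten [simp]: "nt \<phi> ==> nt \<psi> ==> nt (\<phi> \<otimes>\<^sub>W \<psi>)"
 by (rule ntI) (auto simp: homs_iff W_ext D.interchange nt_nat)

lemma nt_asc [simp]: "func F ==> func F' ==> func F'' ==> nt (Asc W F F' F'')"
 by (rule ntI) (auto simp: homs_iff W_ext D.asc_nat')

lemma nt_lun [simp]: "func F ==> nt (Lun W F)" and nt_run [simp]: "func F ==> nt (Run W F)"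
 by (rule ntI; auto simp: homs_iff W_ext D.lun_nat' D.run_nat')+

lemma nt_brd [simp]:
 assumes [simp]: "func F" "func F'"
 shows "nt (Brd W F F')"
proof (rule ntI)
 fix b assume b: "b : Arr G"
 then show "FA (atgt (Brd W F F')) b \<circ>\<^sub>D amap (Brd W F F') (Src G b) =
     amap (Brd W F F') (Tgt G b) \<circ>\<^sub>D FA (asrc (Brd W F F')) b"
  using D.brd_nat[of "FA F b" "FA F' b"] by simp
qed (auto simp: homs_iff W_ext)

lemma nt_add [simp]:
 assumes [simp]: "nt \<phi>" "nt \<psi>" "asrc \<psi> = asrc \<phi>" "atgt \<psi> = atgt \<phi>"
 shows "nt (Add W \<phi> \<psi>)"
proof (rule ntI)
 fix b assume [simp]: "b : Arr G"
 show "FA (atgt (Add W \<phi> \<psi>)) b \<circ>\<^sub>D amap (Add W \<phi> \<psi>) (Src G b) =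
     amap (Add W \<phi> \<psi>) (Tgt G b) \<circ>\<^sub>D FA (asrc (Add W \<phi> \<psi>)) b"
  by (simp add: D.add_cmp[where y = "FO (atgt \<phi>) (Src G b)"] D.cmp_add[where y = "FO (asrc \<phi>) (Tgt G b)"] homs_iff nt_nat)
qed (auto simp: homs_iff W_ext)

lemma nt_scl [simp]:
 assumes [simp]: "nt \<phi>"
 shows "nt (Scl W c \<phi>)"
proof (rule ntI)
 fix b assume [simp]: "b : Arr G"
 show "FA (atgt (Scl W c \<phi>)) b \<circ>\<^sub>D amap (Scl W c \<phi>) (Src G b) =
     amap (Scl W c \<phi>) (Tgt G b) \<circ>\<^sub>D FA (asrc (Scl W c \<phi>)) b"
  by (simp add: D.scl_cmp[where y = "FO (atgt \<phi>) (Src G b)"] D.cmp_scl[where y = "FO (asrc \<phi>) (Tgt G b)"] homs_iff nt_nat)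
qed (auto simp: homs_iff W_ext)

sublocale W: category W
 by standard (auto simp: homs_iff D.assoc intro!: nt_eqI)

text \<open>A natural transformation is invertible as soon as its components are.\<close>

lemma W_inverse:
 assumes \<phi>: "nt \<phi>" and iso: "\<And>x. x : Obj G ==> is_iso D (amap \<phi> x)"
 shows "is_iso W \<phi>" "x : Obj G ==> amap (inv_arr W \<phi>) x = inv_arr D (amap \<phi> x)"
proof -
 let ?\<psi> = "\<lparr>asrc = atgt \<phi>, atgt = asrc \<phi>, amap = (\<lambda>x \<in> Obj G. inv_arr D (amap \<phi> x))\<rparr>"
 note [simp] = \<phi> iso
 have "nt ?\<psi>"
 proof (rule ntI)
  fix b assume [simp]: "b : Arr G"
  show "FA (atgt ?\<psi>) b \<circ>\<^sub>D amap ?\<psi> (Src G b) = amap ?\<psi> (Tgt G b) \<circ>\<^sub>D FA (asrc ?\<psi>) b"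
   using D.iso_square[OF nt_nat[OF \<phi>, of b, symmetric]] by simp
 qed (auto simp: homs_iff)
 then have i: "inverse_arrows W \<phi> ?\<psi>"
  by (intro W.inverse_arrowsI) (auto intro!: nt_eqI)
 then show "is_iso W \<phi>" by (auto simp: is_iso_def)
 show "x : Obj G ==> amap (inv_arr W \<phi>) x = inv_arr D (amap \<phi> x)"
  using W.inv_arr_eq[OF i] by simp
qed

lemma W_is_iso_iff: "is_iso W \<phi> \<longleftrightarrow> nt \<phi> \<and> (\<forall>x \<in> Obj G. is_iso D (amap \<phi> x))"
proof
 assume i: "is_iso W \<phi>"
 then have n [simp]: "nt \<phi>" "nt (inv_arr W \<phi>)" "asrc (inv_arr W \<phi>) = atgt \<phi>" "atgt (inv_arr W \<phi>) = asrc \<phi>"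
  using iso_arr[OF i] W.inv_simps[OF i] by auto
 have "is_iso D (amap \<phi> x)" if "x : Obj G" for x
  by (rule D.is_isoI[where g = "amap (inv_arr W \<phi>) x"])
   (use that W.inv_simps(4,5)[OF i] in "auto simp flip: W_sel(11)")
 then show "nt \<phi> \<and> (\<forall>x \<in> Obj G. is_iso D (amap \<phi> x))" by simp
qed (use W_inverse in blast)

sublocale W: monoidal_category W
 by standard (auto simp: homs_iff isos_iff W_is_iso_iff D.asc_nat' D.lun_nat' D.run_nat' D.interchange D.assoc
  D.triangle D.pentagon intro!: nt_eqI func_eqI)

end

text \<open>
 A translation is a right action of a 2-group on its own underlying groupoid: objects and arrows
 of the groupoid are translated by objects (\<open>TO\<close>, \<open>TB\<close>), arrows of the 2-group give natural
 transformations between translations (\<open>TN\<close>), and \<open>TA g h x : x(g \<otimes> h) \<rightarrow> (xg)h\<close> and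
 \<open>TU x : x1 \<rightarrow> x\<close> are the coherence isomorphisms. Precomposition turns it into a left action on
 functors, and both regular algebras arise in this way.
\<close>

record ('g, 'a) transl =
 TO :: "'g => 'g => 'g"
 TB :: "'g => 'a => 'a"
 TN :: "'a => 'g => 'a"
 TA :: "'g => 'g => 'g => 'a"
 TU :: "'g => 'a"

definition tlO :: "('g, 'a, 'x) moncat_scheme => ('g, 'a) transl => 'g =>
  ('g, 'a, 'o, 'm) func => ('g, 'a, 'o, 'm) func" where
 "tlO G t g F = \<lparr>FO = (\<lambda>x \<in> Obj G. FO F (TO t g x)), FA = (\<lambda>b \<in> Arr G. FA F (TB t g b))\<rparr>"

definition tlA :: "('g, 'a, 'x) moncat_scheme => ('o, 'm, 'y) precat_scheme => ('g, 'a) transl => 'a =>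
  (('g, 'a, 'o, 'm) func, 'g => 'm) arrow => (('g, 'a, 'o, 'm) func, 'g => 'm) arrow" where
 "tlA G D t a \<phi> = \<lparr>asrc = tlO G t (Src G a) (asrc \<phi>), atgt = tlO G t (Tgt G a) (atgt \<phi>),
   amap = (\<lambda>x \<in> Obj G. amap \<phi> (TO t (Tgt G a) x) \<cdot>\<^sub>D FA (asrc \<phi>) (TN t a x))\<rparr>"

definition tlAsc where
 "tlAsc G t g h F = coherence_arrow G (tlO G t (g \<otimes>\<^sub>o\<^sub>G h) F) (tlO G t g (tlO G t h F)) F (TA t g h)"

definition tlUnt where
 "tlUnt G t F = coherence_arrow G (tlO G t (Unt G) F) F F (TU t)"

text \<open>
 Translating a pointwise tensor product translates both factors, so the action is compatible with the
 multiplication and the unit by identity transformations.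
\<close>

definition reg_algebra ::
 "('g, 'a, 'x) moncat_scheme => ('o, 'm, 'k, 'y) lsmcat_scheme => ('g, 'a) transl =>
  (('g, 'a, 'o, 'm) func, (('g, 'a, 'o, 'm) func, 'g => 'm) arrow, 'k, 'g, 'a) galgebra" where
 "reg_algebra G D t = lsmcat.extend (Fun_cat G D)
   (galgebra.fields (tlO G t) (tlA G D t) (tlAsc G t) (tlUnt G t)
    (\<lambda>g F F'. Idn (Fun_cat G D) (tlO G t g (tensor_func G D F F')))
    (\<lambda>g. Idn (Fun_cat G D) (unit_func G D)))"

lemma reg_sel [simp]:
 "Obj (reg_algebra G D t) = Obj (Fun_cat G D)" "Arr (reg_algebra G D t) = Arr (Fun_cat G D)"
 "Src (reg_algebra G D t) = Src (Fun_cat G D)" "Tgt (reg_algebra G D t) = Tgt (Fun_cat G D)"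
 "Idn (reg_algebra G D t) = Idn (Fun_cat G D)" "Cmp (reg_algebra G D t) = Cmp (Fun_cat G D)"
 "TenO (reg_algebra G D t) = TenO (Fun_cat G D)" "TenA (reg_algebra G D t) = TenA (Fun_cat G D)"
 "Unt (reg_algebra G D t) = Unt (Fun_cat G D)" "Asc (reg_algebra G D t) = Asc (Fun_cat G D)"
 "Lun (reg_algebra G D t) = Lun (Fun_cat G D)" "Run (reg_algebra G D t) = Run (Fun_cat G D)"
 "Brd (reg_algebra G D t) = Brd (Fun_cat G D)" "Add (reg_algebra G D t) = Add (Fun_cat G D)"
 "Scl (reg_algebra G D t) = Scl (Fun_cat G D)"
 "ActO (reg_algebra G D t) = tlO G t" "ActA (reg_algebra G D t) = tlA G D t"
 "ActAsc (reg_algebra G D t) = tlAsc G t" "ActUnt (reg_algebra G D t) = tlUnt G t"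
 "ActMu (reg_algebra G D t) g F F' = Idn (Fun_cat G D) (tlO G t g (tensor_func G D F F'))"
 "ActIota (reg_algebra G D t) g = Idn (Fun_cat G D) (unit_func G D)"
 by (auto simp: reg_algebra_def lsmcat.defs galgebra.defs)

lemma reg_derived [simp]:
 "homs (reg_algebra G D t) = homs (Fun_cat G D)" "is_iso (reg_algebra G D t) = is_iso (Fun_cat G D)"
 "isos (reg_algebra G D t) = isos (Fun_cat G D)" "inv_arr (reg_algebra G D t) = inv_arr (Fun_cat G D)"
proof -
 have i: "inverse_arrows (reg_algebra G D t) = inverse_arrows (Fun_cat G D)"
  by (intro ext) (simp add: inverse_arrows_def homs_def)
 show "homs (reg_algebra G D t) = homs (Fun_cat G D)" by (intro ext) (simp add: homs_def)
 then show "is_iso (reg_algebra G D t) = is_iso (Fun_cat G D)" "isos (reg_algebra G D t) = isos (Fun_cat G D)"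
  "inv_arr (reg_algebra G D t) = inv_arr (Fun_cat G D)"
  by (auto simp: is_iso_def isos_def inv_arr_def i intro!: ext)
qed

locale translation = two_group G for G :: "('g, 'a, 'x) moncat_scheme" (structure) +
 fixes t :: "('g, 'a) transl"
 assumes TO_obj [simp]: "g : Obj G ==> x : Obj G ==> TO t g x : Obj G"
  and TB_arr [simp]: "g : Obj G ==> b : Arr G ==> TB t g b : Arr G"
   "g : Obj G ==> b : Arr G ==> Src G (TB t g b) = TO t g (Src G b)"
   "g : Obj G ==> b : Arr G ==> Tgt G (TB t g b) = TO t g (Tgt G b)"
  and TB_idn [simp]: "g : Obj G ==> x : Obj G ==> TB t g (Idn G x) = Idn G (TO t g x)"
  and TB_cmp: "g : Obj G ==> b : Arr G ==> c : Arr G ==> Src G c = Tgt G b ==>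
   TB t g c \<cdot> TB t g b = TB t g (c \<cdot> b)"
  and TN_arr [simp]: "a : Arr G ==> x : Obj G ==> TN t a x : Arr G"
   "a : Arr G ==> x : Obj G ==> Src G (TN t a x) = TO t (Src G a) x"
   "a : Arr G ==> x : Obj G ==> Tgt G (TN t a x) = TO t (Tgt G a) x"
  and TN_idn [simp]: "g : Obj G ==> x : Obj G ==> TN t (Idn G g) x = Idn G (TO t g x)"
  and TN_cmp: "a : Arr G ==> a' : Arr G ==> Src G a' = Tgt G a ==> x : Obj G ==>
   TN t a' x \<cdot> TN t a x = TN t (a' \<cdot> a) x"
  and TN_nat: "a : Arr G ==> b : Arr G ==>
   TB t (Tgt G a) b \<cdot> TN t a (Src G b) = TN t a (Tgt G b) \<cdot> TB t (Src G a) b"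
  and TA_arr [simp]: "g : Obj G ==> h : Obj G ==> x : Obj G ==> TA t g h x : Arr G"
   "g : Obj G ==> h : Obj G ==> x : Obj G ==> Src G (TA t g h x) = TO t (g \<otimes>\<^sub>o h) x"
   "g : Obj G ==> h : Obj G ==> x : Obj G ==> Tgt G (TA t g h x) = TO t h (TO t g x)"
  and TA_nat: "g : Obj G ==> h : Obj G ==> b : Arr G ==>
   TB t h (TB t g b) \<cdot> TA t g h (Src G b) = TA t g h (Tgt G b) \<cdot> TB t (g \<otimes>\<^sub>o h) b"
  and TA_TN: "a : Arr G ==> b : Arr G ==> x : Obj G ==>
   TN t b (TO t (Tgt G a) x) \<cdot> (TB t (Src G b) (TN t a x) \<cdot> TA t (Src G a) (Src G b) x) =
   TA t (Tgt G a) (Tgt G b) x \<cdot> TN t (a \<otimes> b) x"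
  and TA_asc: "g : Obj G ==> h : Obj G ==> k : Obj G ==> x : Obj G ==>
   TB t k (TA t g h x) \<cdot> TA t (g \<otimes>\<^sub>o h) k x =
   TA t h k (TO t g x) \<cdot> (TA t g (h \<otimes>\<^sub>o k) x \<cdot> TN t (Asc G g h k) x)"
  and TU_arr [simp]: "x : Obj G ==> TU t x : Arr G"
   "x : Obj G ==> Src G (TU t x) = TO t (Unt G) x" "x : Obj G ==> Tgt G (TU t x) = x"
  and TU_nat: "b : Arr G ==> b \<cdot> TU t (Src G b) = TU t (Tgt G b) \<cdot> TB t (Unt G) b"
  and TA_lun: "g : Obj G ==> x : Obj G ==> TB t g (TU t x) \<cdot> TA t (Unt G) g x = TN t (Lun G g) x"
  and TA_run: "g : Obj G ==> x : Obj G ==> TU t (TO t g x) \<cdot> TA t g (Unt G) x = TN t (Run G g) x"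

locale translation_action = functor_category G D + T: translation G t
 for G :: "('g, 'a, 'x) moncat_scheme" and D :: "('o, 'm, 'k, 'y) lsmcat_scheme" and t :: "('g, 'a) transl"
begin

abbreviation RA where "RA \<equiv> reg_algebra G D t"

lemma tlO_simps [simp]:
 "x : Obj G ==> FO (tlO G t g F) x = FO F (TO t g x)" "b : Arr G ==> FA (tlO G t g F) b = FA F (TB t g b)"
 by (auto simp: tlO_def)

lemma func_tlO [simp]: "g : Obj G ==> func F ==> func (tlO G t g F)"
 by (rule funcI) (auto simp: homs_iff func_cmp T.TB_cmp, auto simp: tlO_def)

lemma tlA_simps [simp]:
 "asrc (tlA G D t a \<phi>) = tlO G t (Src G a) (asrc \<phi>)" "atgt (tlA G D t a \<phi>) = tlO G t (Tgt G a) (atgt \<phi>)"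
 "x : Obj G ==> amap (tlA G D t a \<phi>) x = amap \<phi> (TO t (Tgt G a) x) \<circ>\<^sub>D FA (asrc \<phi>) (TN t a x)"
 by (auto simp: tlA_def)

lemma nt_tlA [simp]: "a : Arr G ==> nt \<phi> ==> nt (tlA G D t a \<phi>)"
 by (rule ntI) (auto simp: homs_iff nt_nat_ext func_cmp D.assoc T.TN_nat, auto simp: tlA_def)

lemma tlAsc_simps [simp]:
 "asrc (tlAsc G t g h F) = tlO G t (g \<otimes>\<^sub>o\<^sub>G h) F" "atgt (tlAsc G t g h F) = tlO G t g (tlO G t h F)"
 "x : Obj G ==> amap (tlAsc G t g h F) x = FA F (TA t g h x)"
 "asrc (tlUnt G t F) = tlO G t (Unt G) F" "atgt (tlUnt G t F) = F"
 "x : Obj G ==> amap (tlUnt G t F) x = FA F (TU t x)"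
 by (auto simp: tlAsc_def tlUnt_def coherence_arrow_def)

lemma nt_tlAsc [simp]: "g : Obj G ==> h : Obj G ==> func F ==> nt (tlAsc G t g h F)"
 by (rule ntI) (auto simp: homs_iff func_cmp T.TA_nat, auto simp: tlAsc_def coherence_arrow_def)

lemma nt_tlUnt [simp]: "func F ==> nt (tlUnt G t F)"
 by (rule ntI) (auto simp: homs_iff func_cmp T.TU_nat, auto simp: tlUnt_def coherence_arrow_def)

lemma iso_tl [simp]:
 "g : Obj G ==> h : Obj G ==> func F ==> is_iso W (tlAsc G t g h F)"
 "func F ==> is_iso W (tlUnt G t F)"
 by (auto simp: W_is_iso_iff)

lemma tlO_tens [simp]: "g : Obj G ==> func F ==> func F' ==> tlO G t g (F \<boxtimes> F') = tlO G t g F \<boxtimes> tlO G t g F'"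
 by (rule func_eqI) auto

lemma tlO_unit [simp]: "g : Obj G ==> tlO G t g (unit_func G D) = unit_func G D"
 by (rule func_eqI) auto

lemma tlA_idn [simp]: "g : Obj G ==> func F ==> tlA G D t (Idn G g) (Idn W F) = Idn W (tlO G t g F)"
 by (rule nt_eqI) auto

lemma tlA_cmp:
 "a : Arr G ==> a' : Arr G ==> Src G a' = Tgt G a ==> nt \<phi> ==> nt \<phi>' ==> asrc \<phi>' = atgt \<phi> ==>
  tlA G D t (a' \<circ>\<^sub>G a) (\<phi>' \<ast> \<phi>) = tlA G D t a' \<phi>' \<ast> tlA G D t a \<phi>"
 by (rule nt_eqI) (auto simp: D.assoc nt_nat_ext func_cmp T.TN_cmp)

lemma monoidal_reg: "monoidal_category RA"
 using W.monoidal_category_axioms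
 unfolding monoidal_category_def category_def monoidal_category_axioms_def reg_sel reg_derived .

sublocale RA: galg G RA
proof -
 interpret R: monoidal_category RA by (rule monoidal_reg)
 show "galg G RA"
  by unfold_locales (auto simp: homs_iff isos_iff W_is_iso_iff tlA_cmp)
qed

end

section \<open>Translations commuting with the action\<close>

context translation_action
begin

lemma amap_inv_tl [simp]:
 "g : Obj G ==> h : Obj G ==> func F ==> x : Obj G ==> amap (inv_arr W (tlAsc G t g h F)) x = FA F (inv_arr G (TA t g h x))"
 "func F ==> x : Obj G ==> amap (inv_arr W (tlUnt G t F)) x = FA F (inv_arr G (TU t x))"
 by (simp_all add: W_inverse func_inv)

lemma inv_tl [simp]:
 "g : Obj G ==> h : Obj G ==> func F ==> nt (inv_arr W (tlAsc G t g h F))"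
 "g : Obj G ==> h : Obj G ==> func F ==> asrc (inv_arr W (tlAsc G t g h F)) = tlO G t g (tlO G t h F)"
 "g : Obj G ==> h : Obj G ==> func F ==> atgt (inv_arr W (tlAsc G t g h F)) = tlO G t (g \<otimes>\<^sub>o\<^sub>G h) F"
 "func F ==> nt (inv_arr W (tlUnt G t F))"
 "func F ==> asrc (inv_arr W (tlUnt G t F)) = F"
 "func F ==> atgt (inv_arr W (tlUnt G t F)) = tlO G t (Unt G) F"
 using W.inv_simps[OF iso_tl(1)] W.inv_simps[OF iso_tl(2)] by auto

text \<open>Translation by \<open>g\<close> is an equivalence, with translation by an inverse of \<open>g\<close> as quasi-inverse.\<close>

lemma translation_equivalence:
 assumes g [simp]: "g : Obj G" and FO: "\<And>F. func F ==> FO \<Phi> F = tlO G t g F" "FO \<Phi> : extensional {F. func F}"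
  and FA: "\<And>\<phi>. nt \<phi> ==> FA \<Phi> \<phi> = tlA G D t (Idn G g) \<phi>" "FA \<Phi> : extensional {\<phi>. nt \<phi>}"
 shows "category_equivalence RA RA \<Phi>"
proof -
 obtain h v w where h [simp]: "h : Obj G" and v: "v : isos G (g \<otimes>\<^sub>o\<^sub>G h) (Unt G)" and w: "w : isos G (h \<otimes>\<^sub>o\<^sub>G g) (Unt G)"
  by (rule G.obtain_inverse[OF g])
 define H :: "(('g, 'a, 'o, 'm) func, (('g, 'a, 'o, 'm) func, 'g => 'm) arrow,
   ('g, 'a, 'o, 'm) func, (('g, 'a, 'o, 'm) func, 'g => 'm) arrow) func"
  where "H = \<lparr>FO = (\<lambda>F \<in> {F. func F}. tlO G t h F), FA = (\<lambda>\<phi> \<in> {\<phi>. nt \<phi>}. tlA G D t (Idn G h) \<phi>)\<rparr>"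
 define \<zeta> where "\<zeta> k l u F = tlUnt G t F \<ast> (tlA G D t u (Idn W F) \<ast> inv_arr W (tlAsc G t k l F))" for k l u F
 have \<zeta>: "nt (\<zeta> k l u F)" "asrc (\<zeta> k l u F) = tlO G t k (tlO G t l F)" "atgt (\<zeta> k l u F) = F"
   "is_iso W (\<zeta> k l u F)"
   if "func F" "k : Obj G" "l : Obj G" "u : isos G (k \<otimes>\<^sub>o\<^sub>G l) (Unt G)" for k l u F
  unfolding \<zeta>_def using that by (auto simp: isos_iff W_is_iso_iff)
 have \<zeta>n: "\<phi> \<ast> \<zeta> k l u (asrc \<phi>) = \<zeta> k l u (atgt \<phi>) \<ast> tlA G D t (Idn G k) (tlA G D t (Idn G l) \<phi>)"
   if "nt \<phi>" "k : Obj G" "l : Obj G" "u : isos G (k \<otimes>\<^sub>o\<^sub>G l) (Unt G)" for k l u \<phi>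
  unfolding \<zeta>_def using that
  by (intro nt_eqI) (auto simp: isos_iff func_cmp func_cmp_ext nt_nat D.assoc)
 have Arr_W: "Arr W = {\<phi>. nt \<phi>}" by auto
 have fun1: "is_functor RA RA \<Phi>"
  unfolding is_functor_def using FO(2) FA(2) Arr_W
  by (auto simp: homs_iff FO(1) FA(1) PiE_def simp flip: tlA_cmp)
 have fun2: "is_functor RA RA H"
  unfolding is_functor_def using Arr_W by (auto simp: homs_iff H_def simp flip: tlA_cmp)
 have 1: "nat_iso RA RA (comp_func RA \<Phi> H) (id_func RA) (\<lambda>F \<in> {F. func F}. \<zeta> g h v F)"
  unfolding nat_iso_def
  by (intro conjI nat_transI) (auto simp: comp_func_def id_func_def \<zeta>[OF _ _ _ v] H_def FO(1) FA(1) \<zeta>n[OF _ _ _ v])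
 have \<eta>: "tlA G D t (Idn G h) (tlA G D t (Idn G g) \<phi>) \<ast> inv_arr W (\<zeta> h g w (asrc \<phi>)) = inv_arr W (\<zeta> h g w (atgt \<phi>)) \<ast> \<phi>"
  if "nt \<phi>" for \<phi>
  by (rule W.iso_square[symmetric, OF \<zeta>n[symmetric, OF that _ _ w]]) (use that \<zeta>[OF _ _ _ w] in auto)
 have 2: "nat_iso RA RA (id_func RA) (comp_func RA H \<Phi>) (\<lambda>F \<in> {F. func F}. inv_arr W (\<zeta> h g w F))"
  unfolding nat_iso_def
  using W.inv_simps[OF \<zeta>(4)[OF _ _ _ w]] \<zeta>[OF _ _ _ w]
  by (intro conjI nat_transI) (auto simp: comp_func_def id_func_def H_def FO(1) FA(1) \<eta>)
 show ?thesis unfolding category_equivalence_def using fun1 fun2 1 2 by blast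
qed

end

text \<open>
 Two translations that commute up to \<open>c g h x\<close>: the action of \<open>G\<close> on the functor category is the
 one from \<open>s\<close>, and precomposition with \<open>t\<close> gives auto-equivalences, whose compatibility with the
 action is expressed by \<open>c\<close>.
\<close>

locale bitranslation = functor_category G D + P: translation_action G D s + Q: translation_action G D t
 for G :: "('g, 'a, 'x) moncat_scheme" and D :: "('o, 'm, 'k, 'y) lsmcat_scheme"
  and s t :: "('g, 'a) transl" +
 fixes c :: "'g => 'g => 'g => 'a"
 assumes c_arr [simp]: "g : Obj G ==> h : Obj G ==> x : Obj G ==> c g h x : Arr G"
   "g : Obj G ==> h : Obj G ==> x : Obj G ==> Src G (c g h x) = TO s h (TO t g x)"
   "g : Obj G ==> h : Obj G ==> x : Obj G ==> Tgt G (c g h x) = TO t g (TO s h x)"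
  and c_nat: "g : Obj G ==> h : Obj G ==> b : Arr G ==>
   TB t g (TB s h b) \<cdot>\<^sub>G c g h (Src G b) = c g h (Tgt G b) \<cdot>\<^sub>G TB s h (TB t g b)"
  and c_TN_s: "g : Obj G ==> a : Arr G ==> x : Obj G ==>
   TB t g (TN s a x) \<cdot>\<^sub>G c g (Src G a) x = c g (Tgt G a) x \<cdot>\<^sub>G TN s a (TO t g x)"
  and c_TN_t: "a : Arr G ==> h : Obj G ==> x : Obj G ==>
   TN t a (TO s h x) \<cdot>\<^sub>G c (Src G a) h x = c (Tgt G a) h x \<cdot>\<^sub>G TB s h (TN t a x)"
  and c_TA_s: "g : Obj G ==> h : Obj G ==> k : Obj G ==> x : Obj G ==>
   TB t g (TA s h k x) \<cdot>\<^sub>G c g (h \<otimes>\<^sub>o\<^sub>G k) x =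
   c g k (TO s h x) \<cdot>\<^sub>G (TB s k (c g h x) \<cdot>\<^sub>G TA s h k (TO t g x))"
  and c_TU_s: "g : Obj G ==> x : Obj G ==> TB t g (TU s x) \<cdot>\<^sub>G c g (Unt G) x = TU s (TO t g x)"
  and c_TA_t: "g : Obj G ==> k : Obj G ==> h : Obj G ==> x : Obj G ==>
   TA t g k (TO s h x) \<cdot>\<^sub>G c (g \<otimes>\<^sub>o\<^sub>G k) h x =
   TB t k (c g h x) \<cdot>\<^sub>G (c k h (TO t g x) \<cdot>\<^sub>G TB s h (TA t g k x))"
  and c_TU_t: "h : Obj G ==> x : Obj G ==> TU t (TO s h x) \<cdot>\<^sub>G c (Unt G) h x = TB s h (TU t x)"
begin

abbreviation A where "A \<equiv> reg_algebra G D s"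

definition cstr where
 "cstr g h F = coherence_arrow G (tlO G t g (tlO G s h F)) (tlO G s h (tlO G t g F)) F (c g h)"

definition trf where "trf = translation_functor G A (reg_algebra G D t) cstr"

definition phi where
 "phi g = \<lparr>FO = (\<lambda>F \<in> Obj W. tlO G t g F), FA = (\<lambda>\<phi> \<in> Arr W. tlA G D t (Idn G g) \<phi>),
   Mu = restrict2 (Obj W) (Obj W) (\<lambda>F F'. Idn W (tlO G t g (F \<boxtimes> F'))),
   Iota = Idn W (unit_func G D), Str = restrict2 (Obj G) (Obj W) (cstr g)\<rparr>"

lemma cstr_simps [simp]:
 "asrc (cstr g h F) = tlO G t g (tlO G s h F)" "atgt (cstr g h F) = tlO G s h (tlO G t g F)"
 "x : Obj G ==> amap (cstr g h F) x = FA F (c g h x)"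
 by (auto simp: cstr_def coherence_arrow_def)

lemma nt_cstr [simp]: "g : Obj G ==> h : Obj G ==> func F ==> nt (cstr g h F)"
 by (rule ntI) (auto simp: homs_iff func_cmp c_nat, auto simp: cstr_def coherence_arrow_def)

lemma phi_simps [simp]:
 "func F ==> FO (phi g) F = tlO G t g F" "nt \<phi> ==> FA (phi g) \<phi> = tlA G D t (Idn G g) \<phi>"
 "func F ==> func F' ==> Mu (phi g) F F' = Idn W (tlO G t g (F \<boxtimes> F'))"
 "Iota (phi g) = Idn W (unit_func G D)"
 "h : Obj G ==> func F ==> Str (phi g) h F = cstr g h F"
 by (auto simp: phi_def restrict2_def)

text \<open>
 At each object the compatibilities of \<open>phi g\<close> with the action are the images under \<open>F\<close> of the axioms
 for \<open>c g\<close>; those with the tensor product hold strictly.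
\<close>

lemma aut_phi [simp]:
 assumes g [simp]: "g : Obj G"
 shows "P.RA.aut (phi g)"
proof (rule P.RA.autI)
 have "category_equivalence Q.RA Q.RA (phi g)"
  by (rule Q.translation_equivalence[OF g]) (auto simp: phi_def)
 then show "category_equivalence A A (phi g)"
  by (simp add: category_equivalence_def is_functor_def nat_iso_def nat_trans_def comp_func_def id_func_def)
 show "extensional2 (Obj A) (Obj A) (Mu (phi g))" "extensional2 (Obj G) (Obj A) (Str (phi g))"
  by (auto simp: phi_def restrict2_def extensional2_def extensional_def)
 fix f k assume [simp]: "f : Arr A" "k : Arr A"
 show "FA (phi g) (f \<otimes>\<^sub>A k) \<cdot>\<^sub>A Mu (phi g) (Src A f) (Src A k) =
      Mu (phi g) (Tgt A f) (Tgt A k) \<cdot>\<^sub>A (FA (phi g) f \<otimes>\<^sub>A FA (phi g) k)"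
  using \<open>f : Arr A\<close> \<open>k : Arr A\<close> by (auto intro!: nt_eqI)
qed (auto simp: homs_iff isos_iff W_is_iso_iff func_cmp func_cmp_ext c_TN_s c_TA_s c_TU_s D.assoc G.assoc nt_nat nt_nat_ext intro!: nt_eqI)

lemma transf_phi:
 assumes [simp]: "a : Arr G"
 shows "P.RA.transf (phi (Src G a)) (phi (Tgt G a)) (\<lambda>F \<in> Obj W. tlA G D t a (Idn W F))"
 by (rule P.RA.transfI)
  (auto simp: isos_iff W_is_iso_iff func_cmp func_cmp_ext c_TN_t D.assoc G.assoc nt_nat nt_nat_ext intro!: nt_eqI)

lemma transf_phi_asc:
 assumes [simp]: "g : Obj G" "h : Obj G"
 shows "P.RA.transf (phi (g \<otimes>\<^sub>o\<^sub>G h)) (P.RA.comp (phi g) (phi h)) (\<lambda>F \<in> Obj W. tlAsc G t g h F)"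
 by (rule P.RA.transfI)
  (auto simp: isos_iff W_is_iso_iff func_cmp func_cmp_ext c_TA_t D.assoc G.assoc nt_nat nt_nat_ext intro!: nt_eqI)

lemma transf_phi_unt: "P.RA.transf (phi (Unt G)) P.RA.ident (\<lambda>F \<in> Obj W. tlUnt G t F)"
 by (rule P.RA.transfI)
  (auto simp: isos_iff W_is_iso_iff func_cmp func_cmp_ext c_TU_t D.assoc G.assoc nt_nat nt_nat_ext intro!: nt_eqI)

lemma trf_simps [simp]:
 "g : Obj G ==> FO trf g = phi g"
 "a : Arr G ==> FA trf a = \<lparr>asrc = phi (Src G a), atgt = phi (Tgt G a), amap = (\<lambda>F \<in> Obj W. tlA G D t a (Idn W F))\<rparr>"
 "g : Obj G ==> h : Obj G ==> Mu trf g h = \<lparr>asrc = P.RA.comp (phi g) (phi h), atgt = phi (g \<otimes>\<^sub>o\<^sub>G h),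
   amap = (\<lambda>F \<in> Obj W. inv_arr W (tlAsc G t g h F))\<rparr>"
 "Iota trf = \<lparr>asrc = P.RA.ident, atgt = phi (Unt G), amap = (\<lambda>F \<in> Obj W. inv_arr W (tlUnt G t F))\<rparr>"
proof -
 have p: "\<lparr>FO = (\<lambda>x \<in> Obj A. ActO (reg_algebra G D t) g x), FA = (\<lambda>f \<in> Arr A. ActA (reg_algebra G D t) (Idn G g) f),
   Mu = restrict2 (Obj A) (Obj A) (ActMu (reg_algebra G D t) g), Iota = ActIota (reg_algebra G D t) g,
   Str = restrict2 (Obj G) (Obj A) (cstr g)\<rparr> = phi g" for g
  by (auto simp: phi_def restrict2_def intro!: ext)
 show "g : Obj G ==> FO trf g = phi g"
  "a : Arr G ==> FA trf a = \<lparr>asrc = phi (Src G a), atgt = phi (Tgt G a), amap = (\<lambda>F \<in> Obj W. tlA G D t a (Idn W F))\<rparr>"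
  "g : Obj G ==> h : Obj G ==> Mu trf g h = \<lparr>asrc = P.RA.comp (phi g) (phi h), atgt = phi (g \<otimes>\<^sub>o\<^sub>G h),
   amap = (\<lambda>F \<in> Obj W. inv_arr W (tlAsc G t g h F))\<rparr>"
  "Iota trf = \<lparr>asrc = P.RA.ident, atgt = phi (Unt G), amap = (\<lambda>F \<in> Obj W. inv_arr W (tlUnt G t F))\<rparr>"
  unfolding trf_def translation_functor_def Let_def p by (auto simp: restrict2_def)
qed

abbreviation U where "U \<equiv> Aut_E3 G A"

lemma functor_trf: "is_functor G U trf"
proof -
 have 1: "tlA G D t (c' \<cdot>\<^sub>G b) (Idn W F) = tlA G D t c' (Idn W F) \<ast> tlA G D t b (Idn W F)"
  if "b : Arr G" "c' : Arr G" "Src G c' = Tgt G b" "func F" for b c' F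
  using Q.tlA_cmp[of b c' "Idn W F" "Idn W F"] that by simp
 have "FO trf : extensional (Obj G)" "FA trf : extensional (Arr G)"
  by (auto simp: trf_def translation_functor_def Let_def)
 then show ?thesis
  unfolding is_functor_def PiE_def
  using transf_phi by (auto simp: homs_iff 1 intro!: ext)
qed

text \<open>
 The coherence isomorphisms of \<open>trf\<close> are the inverses of those of the translation action \<open>t\<close>.
\<close>

lemma monoidal_functor_trf: "monoidal_functor G U trf"
proof -
 interpret U: monoidal_category U by (rule P.RA.monoidal_category_Aut)
 have mu: "Mu trf g h : isos U (P.RA.comp (phi g) (phi h)) (phi (g \<otimes>\<^sub>o\<^sub>G h))" if "g : Obj G" "h : Obj G" for g h
 proof -
  have "P.RA.transf (P.RA.comp (phi g) (phi h)) (phi (g \<otimes>\<^sub>o\<^sub>G h)) (\<lambda>F \<in> Obj W. inv_arr W (tlAsc G t g h F))"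
   using P.RA.transf_inv[OF _ _ transf_phi_asc[OF that]] that by (simp cong: restrict_cong)
  then have "Mu trf g h : Arr U" using that by simp
  then show ?thesis using P.RA.Aut_is_iso[of "Mu trf g h"] that by (simp add: isos_iff)
 qed
 have iota: "Iota trf : isos U P.RA.ident (phi (Unt G))"
 proof -
  have "P.RA.transf P.RA.ident (phi (Unt G)) (\<lambda>F \<in> Obj W. inv_arr W (tlUnt G t F))"
   using P.RA.transf_inv[OF _ _ transf_phi_unt] by (simp cong: restrict_cong)
  then have "Iota trf : Arr U" by simp
  then show ?thesis using P.RA.Aut_is_iso[of "Iota trf"] by (simp add: isos_iff)
 qed
 have ext: "extensional2 (Obj G) (Obj G) (Mu trf)"
  by (auto simp: trf_def translation_functor_def Let_def restrict2_def extensional2_def extensional_def)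
 \<comment> \<open>Each coherence condition is the inverse of the corresponding one for the translation.\<close>
 have nat: "FA trf (f \<otimes>\<^sub>G g) \<cdot>\<^sub>U Mu trf (Src G f) (Src G g) = Mu trf (Tgt G f) (Tgt G g) \<cdot>\<^sub>U (FA trf f \<otimes>\<^sub>U FA trf g)"
  if [simp]: "f : Arr G" "g : Arr G" for f g
 proof -
  have G: "TN t (f \<otimes>\<^sub>G g) x \<circ>\<^sub>G inv_arr G (TA t (Src G f) (Src G g) x) =
   inv_arr G (TA t (Tgt G f) (Tgt G g) x) \<circ>\<^sub>G (TN t g (TO t (Tgt G f) x) \<circ>\<^sub>G TB t (Src G g) (TN t f x))" if "x : Obj G" for x
   by (rule G.iso_square[symmetric]) (use that Q.T.TA_TN[of f g x] in "auto simp: G.assoc")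
  have n: "TB t (Tgt G g) (TN t f x) \<circ>\<^sub>G TN t g (TO t (Src G f) x) = TN t g (TO t (Tgt G f) x) \<circ>\<^sub>G TB t (Src G g) (TN t f x)"
   if "x : Obj G" for x using Q.T.TN_nat[of g "TN t f x"] that by simp
  show ?thesis
   by (simp, intro restrict_ext nt_eqI) (auto simp: G n func_cmp func_cmp_ext D.assoc G.assoc)
 qed
 have asc: "Mu trf x (y \<otimes>\<^sub>o\<^sub>G z) \<cdot>\<^sub>U (Idn U (phi x) \<otimes>\<^sub>U Mu trf y z) \<cdot>\<^sub>U Asc U (phi x) (phi y) (phi z) =
    FA trf (Asc G x y z) \<cdot>\<^sub>U Mu trf (x \<otimes>\<^sub>o\<^sub>G y) z \<cdot>\<^sub>U (Mu trf x y \<otimes>\<^sub>U Idn U (phi z))"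
  if [simp]: "x : Obj G" "y : Obj G" "z : Obj G" for x y z
 proof -
  have G: "inv_arr G (TA t x (y \<otimes>\<^sub>o\<^sub>G z) p) \<circ>\<^sub>G inv_arr G (TA t y z (TO t x p)) =
   TN t (Asc G x y z) p \<circ>\<^sub>G (inv_arr G (TA t (x \<otimes>\<^sub>o\<^sub>G y) z p) \<circ>\<^sub>G TB t z (inv_arr G (TA t x y p)))"
   if [simp]: "p : Obj G" for p
  proof -
   have "TB t z (inv_arr G (TA t x y p)) = inv_arr G (TB t z (TA t x y p))"
    by (rule G.inv_arr_eq[symmetric], rule G.inverse_arrowsI) (auto simp: Q.T.TB_cmp)
   then have 1: "inv_arr G (TA t (x \<otimes>\<^sub>o\<^sub>G y) z p) \<circ>\<^sub>G TB t z (inv_arr G (TA t x y p))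
     = inv_arr G (TB t z (TA t x y p) \<circ>\<^sub>G TA t (x \<otimes>\<^sub>o\<^sub>G y) z p)"
    by (simp add: G.inv_cmp)
   show ?thesis unfolding 1 Q.T.TA_asc[OF \<open>x : Obj G\<close> \<open>y : Obj G\<close> \<open>z : Obj G\<close> \<open>p : Obj G\<close>] by (simp add: G.inv_cmp G.assoc)
  qed
  show ?thesis
   by (simp add: P.RA.Aut_coherence P.RA.comp_assoc, intro restrict_ext nt_eqI)
    (auto simp: G func_cmp func_cmp_ext D.assoc G.assoc)
 qed
 have lun: "Lun U (phi x) = FA trf (Lun G x) \<cdot>\<^sub>U Mu trf (Unt G) x \<cdot>\<^sub>U (Iota trf \<otimes>\<^sub>U Idn U (phi x))"
  "Run U (phi x) = FA trf (Run G x) \<cdot>\<^sub>U Mu trf x (Unt G) \<cdot>\<^sub>U (Idn U (phi x) \<otimes>\<^sub>U Iota trf)"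
  if [simp]: "x : Obj G" for x
 proof -
  have G: "TN t (Lun G x) p \<circ>\<^sub>G (inv_arr G (TA t (Unt G) x p) \<circ>\<^sub>G TB t x (inv_arr G (TU t p))) = Idn G (TO t x p)"
    "TN t (Run G x) p \<circ>\<^sub>G (inv_arr G (TA t x (Unt G) p) \<circ>\<^sub>G inv_arr G (TU t (TO t x p))) = Idn G (TO t x p)"
   if [simp]: "p : Obj G" for p
   by (simp_all add: G.assoc Q.T.TB_cmp flip: Q.T.TA_lun Q.T.TA_run)
  show "Lun U (phi x) = FA trf (Lun G x) \<cdot>\<^sub>U Mu trf (Unt G) x \<cdot>\<^sub>U (Iota trf \<otimes>\<^sub>U Idn U (phi x))"
   by (simp add: P.RA.Aut_coherence P.RA.comp_ident_left, intro restrict_ext nt_eqI)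
    (auto simp: G func_cmp func_cmp_ext D.assoc G.assoc)
  show "Run U (phi x) = FA trf (Run G x) \<cdot>\<^sub>U Mu trf x (Unt G) \<cdot>\<^sub>U (Idn U (phi x) \<otimes>\<^sub>U Iota trf)"
   by (simp add: P.RA.Aut_coherence P.RA.comp_ident_right, intro restrict_ext nt_eqI)
    (auto simp: G func_cmp func_cmp_ext D.assoc G.assoc)
 qed
 show ?thesis
  unfolding monoidal_functor_def
  using functor_trf ext mu iota nat asc lun by (auto simp: homs_iff simp del: P.RA.Aut_sel(4,5,8) trf_simps(2-4))
qed

end

section \<open>Finite-dimensional vector spaces\<close>

abbreviation el where "el \<equiv> carrier"
abbreviation fd where "fd V \<equiv> V : fd_spaces"

lemma fd_vs: "fd V ==> vectorspace class_ring V"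
 and fd_fin: "fd V ==> vectorspace.fin_dim class_ring V"
 by (auto simp: fd_spaces_def)

lemma fd_simps [simp]:
 assumes "fd V"
 shows "v : el V ==> w : el V ==> v \<oplus>\<^sub>V w : el V"
  "v : el V ==> a \<odot>\<^sub>V v : el V" "\<zero>\<^sub>V : el V"
  "v : el V ==> v \<oplus>\<^sub>V \<zero>\<^sub>V = v" "v : el V ==> \<zero>\<^sub>V \<oplus>\<^sub>V v = v"
  "v : el V ==> 0 \<odot>\<^sub>V v = \<zero>\<^sub>V" "v : el V ==> 1 \<odot>\<^sub>V v = v" "a \<odot>\<^sub>V \<zero>\<^sub>V = \<zero>\<^sub>V"
  "v : el V ==> a \<odot>\<^sub>V (b \<odot>\<^sub>V v) = (a * b) \<odot>\<^sub>V v"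
proof -
 interpret vectorspace class_ring V by (rule fd_vs[OF assms])
 show "v : el V ==> w : el V ==> v \<oplus>\<^sub>V w : el V"
  "v : el V ==> a \<odot>\<^sub>V v : el V" "\<zero>\<^sub>V : el V"
  "v : el V ==> v \<oplus>\<^sub>V \<zero>\<^sub>V = v" "v : el V ==> \<zero>\<^sub>V \<oplus>\<^sub>V v = v"
  by auto
 show "v : el V ==> 0 \<odot>\<^sub>V v = \<zero>\<^sub>V" "v : el V ==> 1 \<odot>\<^sub>V v = v"
  "a \<odot>\<^sub>V \<zero>\<^sub>V = \<zero>\<^sub>V" "v : el V ==> a \<odot>\<^sub>V (b \<odot>\<^sub>V v) = (a * b) \<odot>\<^sub>V v"
  using lmult_0[of v] smult_one[of v] rmult_0[of a] smult_assoc1[of a b v] by (auto simp: class_ring_simps)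
qed

lemma fd_algebra:
 assumes "fd V"
 shows fd_distr: "v : el V ==> w : el V ==> a \<odot>\<^sub>V (v \<oplus>\<^sub>V w) = a \<odot>\<^sub>V v \<oplus>\<^sub>V a \<odot>\<^sub>V w"
  "v : el V ==> (a + b) \<odot>\<^sub>V v = a \<odot>\<^sub>V v \<oplus>\<^sub>V b \<odot>\<^sub>V v"
  and fd_ac: "v : el V ==> w : el V ==> v \<oplus>\<^sub>V w = w \<oplus>\<^sub>V v"
  "u : el V ==> v : el V ==> w : el V ==> (u \<oplus>\<^sub>V v) \<oplus>\<^sub>V w = u \<oplus>\<^sub>V (v \<oplus>\<^sub>V w)"
  "u : el V ==> v : el V ==> w : el V ==> u \<oplus>\<^sub>V (v \<oplus>\<^sub>V w) = v \<oplus>\<^sub>V (u \<oplus>\<^sub>V w)"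
proof -
 interpret vectorspace class_ring V by (rule fd_vs[OF assms])
 show "v : el V ==> w : el V ==> a \<odot>\<^sub>V (v \<oplus>\<^sub>V w) = a \<odot>\<^sub>V v \<oplus>\<^sub>V a \<odot>\<^sub>V w"
  "v : el V ==> (a + b) \<odot>\<^sub>V v = a \<odot>\<^sub>V v \<oplus>\<^sub>V b \<odot>\<^sub>V v"
  using smult_r_distr[of a v w] smult_l_distr[of a b v] by (auto simp: class_ring_simps)
 show "v : el V ==> w : el V ==> v \<oplus>\<^sub>V w = w \<oplus>\<^sub>V v"
  "u : el V ==> v : el V ==> w : el V ==> (u \<oplus>\<^sub>V v) \<oplus>\<^sub>V w = u \<oplus>\<^sub>V (v \<oplus>\<^sub>V w)"
  "u : el V ==> v : el V ==> w : el V ==> u \<oplus>\<^sub>V (v \<oplus>\<^sub>V w) = v \<oplus>\<^sub>V (u \<oplus>\<^sub>V w)"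
  by (rule M.a_comm M.a_assoc M.a_lcomm; assumption)+
qed

lemma lin_mapsD:
 assumes "f : lin_maps V W"
 shows "v : el V ==> f v : el W"
  "v : el V ==> w : el V ==> f (v \<oplus>\<^sub>V w) = f v \<oplus>\<^sub>W f w"
  "v : el V ==> f (a \<odot>\<^sub>V v) = a \<odot>\<^sub>W f v"
  "f : extensional (el V)"
 using assms by (auto simp: lin_maps_def LinearCombinations.module_hom_def)

lemma lin_maps_zero: "f : lin_maps V W ==> fd V ==> fd W ==> f \<zero>\<^sub>V = \<zero>\<^sub>W"
 using lin_mapsD(3)[of f V W "\<zero>\<^sub>V" 0] lin_mapsD(1)[of f V W "\<zero>\<^sub>V"] by simp

lemma lin_mapsI:
 assumes "\<And>v. v : el V ==> f v : el W"
  "\<And>v w. v : el V ==> w : el V ==> f (v \<oplus>\<^sub>V w) = f v \<oplus>\<^sub>W f w"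
  "\<And>a v. v : el V ==> f (a \<odot>\<^sub>V v) = a \<odot>\<^sub>W f v" "fd V"
 shows "(\<lambda>v \<in> el V. f v) : lin_maps V W"
 using assms by (auto simp: lin_maps_def LinearCombinations.module_hom_def)

lemma lin_maps_eqI:
 "f : lin_maps V W ==> g : lin_maps V W ==> (\<And>v. v : el V ==> f v = g v) ==> f = g"
 by (rule extensionalityI[of _ "el V"]) (auto dest: lin_mapsD)

lemma lin_maps_add:
 "f : lin_maps V W ==> g : lin_maps V W ==> fd V ==> fd W ==>
  (\<lambda>v \<in> el V. f v \<oplus>\<^sub>W g v) : lin_maps V W"
 by (rule lin_mapsI) (auto simp: lin_mapsD fd_distr fd_ac)

lemma lin_maps_scl:
 "f : lin_maps V W ==> fd V ==> fd W ==> (\<lambda>v \<in> el V. c \<odot>\<^sub>W f v) : lin_maps V W"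
 by (rule lin_mapsI) (auto simp: lin_mapsD fd_distr mult.commute)

lemma lin_maps_comp:
 "f : lin_maps U V ==> g : lin_maps V W ==> fd U ==> (\<lambda>v \<in> el U. g (f v)) : lin_maps U W"
 by (rule lin_mapsI) (auto simp: lin_mapsD)

text \<open>
 A set on which linear maps out of \<open>V\<close> are determined. By the universal property of the tensor product
 this passes to tensor products, so equations between maps out of iterated tensor products can be
 tested on pure tensors.
\<close>

definition lgen :: "('k::field, 'v) module => 'v set => bool" where
 "lgen V B \<longleftrightarrow> B \<subseteq> el V \<and>
   (\<forall>X \<in> fd_spaces. \<forall>h \<in> lin_maps V X. \<forall>h' \<in> lin_maps V X. (\<forall>b \<in> B. h b = h' b) --> h = h')"

text \<open>
 Linearity on the carrier alone, with no condition outside it, so that composites and partial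
 applications need not be restricted.
\<close>

definition lin :: "('k::field, 'v) module => ('k, 'v) module => ('v => 'v) => bool" where
 "lin V W f \<longleftrightarrow> (\<forall>v \<in> el V. f v : el W) \<and>
   (\<forall>v \<in> el V. \<forall>w \<in> el V. f (v \<oplus>\<^sub>V w) = f v \<oplus>\<^sub>W f w) \<and>
   (\<forall>a. \<forall>v \<in> el V. f (a \<odot>\<^sub>V v) = a \<odot>\<^sub>W f v)"

lemma lin_restrict: "fd V ==> lin V W f ==> (\<lambda>v \<in> el V. f v) : lin_maps V W"
 unfolding lin_def by (rule lin_mapsI) auto

lemma lin_mapsD': "f : lin_maps V W ==> lin V W f"
 unfolding lin_def by (auto simp: lin_mapsD)

lemma lin_comp: "lin U V f ==> lin V W g ==> lin U W (\<lambda>v. g (f v))"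
 unfolding lin_def by simp

lemma lgen_ext:
 assumes "lgen V B" "lin V X h" "lin V X h'" "fd V" "fd X" "\<And>b. b : B ==> h b = h' b" "v : el V"
 shows "h v = h' v"
proof -
 have "B \<subseteq> el V" using assms(1) by (simp add: lgen_def)
 then have "(\<lambda>v \<in> el V. h v) = (\<lambda>v \<in> el V. h' v)"
  using assms(1)[unfolded lgen_def, THEN conjunct2, rule_format, OF assms(5) lin_restrict[OF assms(4,2)] lin_restrict[OF assms(4,3)]]
   assms(6) by (simp add: subset_iff)
 from fun_cong[OF this, of v] assms(7) show ?thesis by simp
qed

lemma lgen_lin_maps_eqI:
 assumes "lgen V B" "h : lin_maps V X" "h' : lin_maps V X" "fd X" "\<And>b. b : B ==> h b = h' b"
 shows "h = h'"
 using assms unfolding lgen_def by blast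

lemma lgen_carrier: "lgen V (el V)"
 unfolding lgen_def by (auto intro: lin_maps_eqI)

definition bilin :: "('k::field, 'v) module => ('k, 'v) module => ('k, 'v) module => ('v => 'v => 'v) => bool" where
 "bilin V W X b \<longleftrightarrow> (\<forall>v \<in> el V. \<forall>w \<in> el W. b v w : el X \<and>
   (\<forall>v' \<in> el V. b (v \<oplus>\<^sub>V v') w = b v w \<oplus>\<^sub>X b v' w) \<and>
   (\<forall>w' \<in> el W. b v (w \<oplus>\<^sub>W w') = b v w \<oplus>\<^sub>X b v w') \<and>
   (\<forall>a. b (a \<odot>\<^sub>V v) w = a \<odot>\<^sub>X b v w \<and> b v (a \<odot>\<^sub>W w) = a \<odot>\<^sub>X b v w))"

lemma bilin_iff: "bilinear_map V W X b \<longleftrightarrow> bilin V W X b"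
 unfolding bilinear_map_def bilin_def LinearCombinations.module_hom_def by auto

locale vec_tensor =
 fixes T :: "('k::field, 'v) vec_tensor"
 assumes is_tensor: "is_vec_tensor T"
begin

abbreviation D where "D \<equiv> Vec T"
abbreviation ten  (infixr \<open>\<otimes>\<^sub>V\<close> 72) where "V \<otimes>\<^sub>V W \<equiv> Tensor T V W"
abbreviation K where "K \<equiv> Ground T"
abbreviation one where "one \<equiv> GUnit T"
abbreviation pure where "pure \<equiv> Pure T"

lemma ground [simp]: "fd K" "one : el K"
 using is_tensor by (auto simp: is_vec_tensor_def)

lemma ten_fd [simp]: "fd V ==> fd W ==> V \<otimes>\<^sub>V W : fd_spaces"
 using is_tensor by (auto simp: is_vec_tensor_def)

lemma pure_bilin: "fd V ==> fd W ==> bilin V W (V \<otimes>\<^sub>V W) (pure V W)"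
 using is_tensor by (auto simp: is_vec_tensor_def bilin_iff)

lemma pure_simps [simp]:
 assumes "fd V" "fd W"
 shows "v : el V ==> w : el W ==> pure V W v w : el (V \<otimes>\<^sub>V W)"
  "v : el V ==> v' : el V ==> w : el W ==>
   pure V W (v \<oplus>\<^sub>V v') w = pure V W v w \<oplus>\<^bsub>V \<otimes>\<^sub>V W\<^esub> pure V W v' w"
  "v : el V ==> w : el W ==> w' : el W ==>
   pure V W v (w \<oplus>\<^sub>W w') = pure V W v w \<oplus>\<^bsub>V \<otimes>\<^sub>V W\<^esub> pure V W v w'"
  "v : el V ==> w : el W ==> pure V W (a \<odot>\<^sub>V v) w = a \<odot>\<^bsub>V \<otimes>\<^sub>V W\<^esub> pure V W v w"
  "v : el V ==> w : el W ==> pure V W v (a \<odot>\<^sub>W w) = a \<odot>\<^bsub>V \<otimes>\<^sub>V W\<^esub> pure V W v w"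
 using pure_bilin[OF assms] by (auto simp: bilin_def)

lemma tensor_lift:
 assumes "fd V" "fd W" "fd X" "bilin V W X b"
 shows "\<exists>!h. h : lin_maps (V \<otimes>\<^sub>V W) X \<and> (\<forall>v \<in> el V. \<forall>w \<in> el W. h (pure V W v w) = b v w)"
 using is_tensor assms by (auto simp: is_vec_tensor_def bilin_iff)

lemma obtain_lift:
 assumes "fd V" "fd W" "fd X" "bilin V W X b"
 obtains h where "h : lin_maps (V \<otimes>\<^sub>V W) X"
  "\<And>v w. v : el V ==> w : el W ==> h (pure V W v w) = b v w"
 using tensor_lift[OF assms] by blast

lemma lin_bilin:
 assumes "h : lin_maps (V \<otimes>\<^sub>V W) X" "fd V" "fd W"
 shows "bilin V W X (\<lambda>v w. h (pure V W v w))"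
 using assms by (auto simp: bilin_def lin_mapsD)

lemma tensor_ext:
 assumes "h : lin_maps (V \<otimes>\<^sub>V W) X" "h' : lin_maps (V \<otimes>\<^sub>V W) X" "fd V" "fd W" "fd X"
  "\<And>v w. v : el V ==> w : el W ==> h (pure V W v w) = h' (pure V W v w)"
 shows "h = h'"
 using tensor_lift[OF assms(3-5) lin_bilin[OF assms(2-4)]] assms by blast

lemma lgen_tensor:
 assumes V [simp]: "fd V" and W [simp]: "fd W" and B: "lgen V B" and C: "lgen W C"
 shows "lgen (V \<otimes>\<^sub>V W) {pure V W b c |b c. b : B \<and> c : C}"
 unfolding lgen_def
proof (intro conjI ballI impI)
 have BC: "B \<subseteq> el V" "C \<subseteq> el W" using B C by (auto simp: lgen_def)
 then show "{pure V W b c |b c. b : B \<and> c : C} \<subseteq> el (V \<otimes>\<^sub>V W)"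
  by (auto simp: subset_iff)
 fix X h h' assume X [simp]: "fd X" and h: "h : lin_maps (V \<otimes>\<^sub>V W) X" "h' : lin_maps (V \<otimes>\<^sub>V W) X"
  and e: "\<forall>b\<in>{pure V W b c |b c. b : B \<and> c : C}. h b = h' b"
 show "h = h'"
 proof (rule tensor_ext[OF h])
  fix v w assume v [simp]: "v : el V" "w : el W"
  show "h (pure V W v w) = h' (pure V W v w)"
  proof (rule lgen_ext[OF C, where h = "\<lambda>w. h (pure V W v w)" and h' = "\<lambda>w. h' (pure V W v w)" and X = X])
   fix c assume c: "c : C"
   then have [simp]: "c : el W" using BC by auto
   show "h (pure V W v c) = h' (pure V W v c)"
    by (rule lgen_ext[OF B, where h = "\<lambda>v. h (pure V W v c)" and h' = "\<lambda>v. h' (pure V W v c)" and X = X])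
     (use e c in "auto simp: lin_def lin_mapsD[OF h(1)] lin_mapsD[OF h(2)]")
  qed (auto simp: lin_def lin_mapsD[OF h(1)] lin_mapsD[OF h(2)])
 qed auto
qed

text \<open>
 Lifting a trilinear map in two steps requires that the lifts \<open>L w\<close> of the first step depend linearly
 on \<open>w\<close>. It suffices to know this on generators.
\<close>

lemma family_lift:
 assumes V [simp]: "fd V" "fd W" and X [simp]: "fd X" and gen: "lgen V B"
  and L: "\<And>w. w : el W ==> L w : lin_maps V X" and B: "\<And>b. b : B ==> lin W X (\<lambda>w. L w b)"
 obtains h where "h : lin_maps (V \<otimes>\<^sub>V W) X" "\<And>v w. v : el V ==> w : el W ==> h (pure V W v w) = L w v"
proof -
 have b: "L w b : el X" "L (w \<oplus>\<^sub>W w') b = L w b \<oplus>\<^sub>X L w' b" "L (a \<odot>\<^sub>W w) b = a \<odot>\<^sub>X L w b"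
  if "w : el W" "w' : el W" "b : B" for b w w' a using B[OF that(3)] that by (auto simp: lin_def)
 have "bilin V W X (\<lambda>v w. L w v)"
  unfolding bilin_def
 proof (intro ballI conjI allI)
  fix v w v' w' a assume v: "v : el V" "w : el W"
  show "L w v : el X" "L w (a \<odot>\<^sub>V v) = a \<odot>\<^sub>X L w v" using v lin_mapsD[OF L] by auto
  show "L w (v \<oplus>\<^sub>V v') = L w v \<oplus>\<^sub>X L w v'" if "v' : el V" using v that lin_mapsD[OF L] by auto
  show "L (w \<oplus>\<^sub>W w') v = L w v \<oplus>\<^sub>X L w' v" if "w' : el W"
   by (rule lgen_ext[OF gen, where X = X and h = "L (w \<oplus>\<^sub>W w')" and h' = "\<lambda>v. L w v \<oplus>\<^sub>X L w' v"])
    (use v that L[of w] L[of w'] L[of "w \<oplus>\<^sub>W w'"] in "auto simp: lin_def lin_mapsD fd_distr fd_ac b")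
  show "L (a \<odot>\<^sub>W w) v = a \<odot>\<^sub>X L w v"
   by (rule lgen_ext[OF gen, where X = X and h = "L (a \<odot>\<^sub>W w)" and h' = "\<lambda>v. a \<odot>\<^sub>X L w v"])
    (use v L[of w] L[of "a \<odot>\<^sub>W w"] in "auto simp: lin_def lin_mapsD fd_distr b mult.commute")
 qed
 then show ?thesis using obtain_lift[OF V X] that by blast
qed

lemma lgen_pure:
 "fd V ==> fd W ==> lgen (V \<otimes>\<^sub>V W) {pure V W b c |b c. b : el V \<and> c : el W}"
 by (rule lgen_tensor) (auto intro: lgen_carrier)

lemma lgen_pure3:
 "fd U ==> fd V ==> fd W ==> lgen ((U \<otimes>\<^sub>V V) \<otimes>\<^sub>V W)
  {pure (U \<otimes>\<^sub>V V) W t w |t w. t : {pure U V u v |u v. u : el U \<and> v : el V} \<and> w : el W}"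
 by (rule lgen_tensor[OF _ _ lgen_pure lgen_carrier]) auto

lemma the_lift:
 assumes V: "fd V" "fd W" "fd X" and b: "bilin V W X b"
 shows "(THE h. h : lin_maps (V \<otimes>\<^sub>V W) X \<and> (\<forall>v \<in> el V. \<forall>w \<in> el W. h (pure V W v w) = b v w)) : lin_maps (V \<otimes>\<^sub>V W) X"
  "v : el V ==> w : el W ==>
   (THE h. h : lin_maps (V \<otimes>\<^sub>V W) X \<and> (\<forall>v \<in> el V. \<forall>w \<in> el W. h (pure V W v w) = b v w)) (pure V W v w) = b v w"
 using theI'[OF tensor_lift[OF assms]] by auto

lemma ex_asc:
 assumes [simp]: "fd U" "fd V" "fd W"
 shows "\<exists>!h. h : lin_maps ((U \<otimes>\<^sub>V V) \<otimes>\<^sub>V W) (U \<otimes>\<^sub>V (V \<otimes>\<^sub>V W)) \<and>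
   (\<forall>u \<in> el U. \<forall>v \<in> el V. \<forall>w \<in> el W.
    h (pure (U \<otimes>\<^sub>V V) W (pure U V u v) w) = pure U (V \<otimes>\<^sub>V W) u (pure V W v w))"
proof (rule ex_ex1I)
 let ?X = "U \<otimes>\<^sub>V (V \<otimes>\<^sub>V W)"
 have "\<exists>h. h : lin_maps (U \<otimes>\<^sub>V V) ?X \<and> (\<forall>u \<in> el U. \<forall>v \<in> el V. h (pure U V u v) = pure U (V \<otimes>\<^sub>V W) u (pure V W v w))"
  if "w : el W" for w
  by (rule ex1_implies_ex, rule tensor_lift) (use that in "auto simp: bilin_def")
 then obtain L where L: "\<And>w. w : el W ==> L w : lin_maps (U \<otimes>\<^sub>V V) ?X"
  and Lp: "\<And>w u v. w : el W ==> u : el U ==> v : el V ==> L w (pure U V u v) = pure U (V \<otimes>\<^sub>V W) u (pure V W v w)"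
  by metis
 obtain h where "h : lin_maps ((U \<otimes>\<^sub>V V) \<otimes>\<^sub>V W) ?X"
  "\<And>t w. t : el (U \<otimes>\<^sub>V V) ==> w : el W ==> h (pure (U \<otimes>\<^sub>V V) W t w) = L w t"
  by (rule family_lift[OF _ _ _ lgen_pure[of U V] L]) (auto simp: lin_def Lp)
 then show "\<exists>h. h : lin_maps ((U \<otimes>\<^sub>V V) \<otimes>\<^sub>V W) ?X \<and> (\<forall>u \<in> el U. \<forall>v \<in> el V. \<forall>w \<in> el W.
    h (pure (U \<otimes>\<^sub>V V) W (pure U V u v) w) = pure U (V \<otimes>\<^sub>V W) u (pure V W v w))"
  by (auto simp: Lp)
qed (rule lgen_lin_maps_eqI[OF lgen_pure3[of U V W]], auto)

text \<open>
 The lift is constructed with the factors in the order that \<open>family_lift\<close> provides, then swapped.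
\<close>

lemma ex_asc_inv:
 assumes [simp]: "fd U" "fd V" "fd W"
 shows "\<exists>h. h : lin_maps (U \<otimes>\<^sub>V (V \<otimes>\<^sub>V W)) ((U \<otimes>\<^sub>V V) \<otimes>\<^sub>V W) \<and>
   (\<forall>u \<in> el U. \<forall>v \<in> el V. \<forall>w \<in> el W.
    h (pure U (V \<otimes>\<^sub>V W) u (pure V W v w)) = pure (U \<otimes>\<^sub>V V) W (pure U V u v) w)"
proof -
 let ?X = "(U \<otimes>\<^sub>V V) \<otimes>\<^sub>V W"
 have "\<exists>h. h : lin_maps (V \<otimes>\<^sub>V W) ?X \<and> (\<forall>v \<in> el V. \<forall>w \<in> el W. h (pure V W v w) = pure (U \<otimes>\<^sub>V V) W (pure U V u v) w)"
  if "u : el U" for u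
  by (rule ex1_implies_ex, rule tensor_lift) (use that in "auto simp: bilin_def")
 then obtain L where L: "\<And>u. u : el U ==> L u : lin_maps (V \<otimes>\<^sub>V W) ?X"
  and Lp: "\<And>w u v. w : el W ==> u : el U ==> v : el V ==> L u (pure V W v w) = pure (U \<otimes>\<^sub>V V) W (pure U V u v) w"
  by metis
 obtain k where k: "k : lin_maps ((V \<otimes>\<^sub>V W) \<otimes>\<^sub>V U) ?X"
  "\<And>t u. t : el (V \<otimes>\<^sub>V W) ==> u : el U ==> k (pure (V \<otimes>\<^sub>V W) U t u) = L u t"
  by (rule family_lift[OF _ _ _ lgen_pure[of V W] L]) (auto simp: lin_def Lp)
 have "bilin U (V \<otimes>\<^sub>V W) ?X (\<lambda>u t. k (pure (V \<otimes>\<^sub>V W) U t u))"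
  using lin_mapsD[OF k(1)] by (simp add: bilin_def)
 then obtain h where "h : lin_maps (U \<otimes>\<^sub>V (V \<otimes>\<^sub>V W)) ?X"
  "\<And>u t. u : el U ==> t : el (V \<otimes>\<^sub>V W) ==> h (pure U (V \<otimes>\<^sub>V W) u t) = k (pure (V \<otimes>\<^sub>V W) U t u)"
  by (rule obtain_lift[rotated 3]) auto
 then show ?thesis by (auto simp: k Lp)
qed

text \<open>The coordinate of an element of the ground field copy.\<close>

definition coef where "coef = inv_into UNIV (\<lambda>c. c \<odot>\<^sub>K one)"

lemma coef [simp]: "g : el K ==> coef g \<odot>\<^sub>K one = g" "coef (a \<odot>\<^sub>K one) = a"
proof -
 have b: "bij_betw (\<lambda>c. c \<odot>\<^sub>K one) UNIV (el K)"
  using is_tensor by (auto simp: is_vec_tensor_def)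
 show "g : el K ==> coef g \<odot>\<^sub>K one = g"
  unfolding coef_def using bij_betw_inv_into_right[OF b, of g] by simp
 show "coef (a \<odot>\<^sub>K one) = a"
  unfolding coef_def using bij_betw_inv_into_left[OF b, of a] by simp
qed

lemma coef_add [simp]:
 assumes "g : el K" "h : el K"
 shows "coef (g \<oplus>\<^sub>K h) = coef g + coef h"
proof -
 have "g \<oplus>\<^sub>K h = (coef g + coef h) \<odot>\<^sub>K one" using assms by (simp add: fd_distr)
 then show ?thesis by (metis coef(2))
qed

lemma coef_scl [simp]:
 assumes "g : el K"
 shows "coef (a \<odot>\<^sub>K g) = a * coef g"
proof -
 have "a \<odot>\<^sub>K g = a \<odot>\<^sub>K (coef g \<odot>\<^sub>K one)" using assms by simp
 then have "a \<odot>\<^sub>K g = (a * coef g) \<odot>\<^sub>K one" by (simp del: coef)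
 then show ?thesis by (metis coef(2))
qed

lemma coef_one [simp]: "coef one = 1"
 using coef(2)[of 1] by simp

lemma lgen_ground: "lgen K {one}"
proof -
 have "h = h'" if h: "h : lin_maps K X" "h' : lin_maps K X" "h one = h' one" for X :: "('k, 'v) module" and h h'
 proof (rule lin_maps_eqI[OF h(1,2)])
  fix g assume "g : el K"
  then show "h g = h' g"
   using lin_mapsD(3)[OF h(1), of one "coef g"] lin_mapsD(3)[OF h(2), of one "coef g"] h(3) by simp
 qed
 then show ?thesis by (simp add: lgen_def)
qed

lemma lgen_unit:
 assumes "fd V"
 shows "lgen (K \<otimes>\<^sub>V V) {pure K V b c |b c. b : {one} \<and> c : el V}"
  "lgen (V \<otimes>\<^sub>V K) {pure V K b c |b c. b : el V \<and> c : {one}}"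
 by (rule lgen_tensor lgen_ground lgen_carrier ground(1) assms)+

lemma ex_lun:
 assumes [simp]: "fd V"
 shows "\<exists>!h. h : lin_maps (K \<otimes>\<^sub>V V) V \<and> (\<forall>v \<in> el V. h (pure K V one v) = v)"
proof (rule ex_ex1I)
 have "bilin K V V (\<lambda>g v. coef g \<odot>\<^sub>V v)" by (auto simp: bilin_def fd_distr mult.commute)
 then show "\<exists>h. h : lin_maps (K \<otimes>\<^sub>V V) V \<and> (\<forall>v \<in> el V. h (pure K V one v) = v)"
  by (rule obtain_lift[rotated 3]) auto
qed (rule lgen_lin_maps_eqI[OF lgen_unit(1)], auto)

lemma ex_run:
 assumes [simp]: "fd V"
 shows "\<exists>!h. h : lin_maps (V \<otimes>\<^sub>V K) V \<and> (\<forall>v \<in> el V. h (pure V K v one) = v)"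
proof (rule ex_ex1I)
 have "bilin V K V (\<lambda>v g. coef g \<odot>\<^sub>V v)" by (auto simp: bilin_def fd_distr mult.commute)
 then show "\<exists>h. h : lin_maps (V \<otimes>\<^sub>V K) V \<and> (\<forall>v \<in> el V. h (pure V K v one) = v)"
  by (rule obtain_lift[rotated 3]) auto
qed (rule lgen_lin_maps_eqI[OF lgen_unit(2)], auto)

lemma Vec_sel [simp]:
 "Obj D = fd_spaces" "Src D = asrc" "Tgt D = atgt" "TenO D = Tensor T" "Unt D = K"
 "asrc (Idn D V) = V" "atgt (Idn D V) = V" "v : el V ==> amap (Idn D V) v = v"
 "asrc (g \<cdot>\<^sub>D f) = asrc f" "atgt (g \<cdot>\<^sub>D f) = atgt g"
 "v : el (asrc f) ==> amap (g \<cdot>\<^sub>D f) v = amap g (amap f v)"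
 "asrc (f \<otimes>\<^sub>D g) = asrc f \<otimes>\<^sub>V asrc g" "atgt (f \<otimes>\<^sub>D g) = atgt f \<otimes>\<^sub>V atgt g"
 "asrc (Asc D U V W) = (U \<otimes>\<^sub>V V) \<otimes>\<^sub>V W" "atgt (Asc D U V W) = U \<otimes>\<^sub>V (V \<otimes>\<^sub>V W)"
 "asrc (Lun D V) = K \<otimes>\<^sub>V V" "atgt (Lun D V) = V" "asrc (Run D V) = V \<otimes>\<^sub>V K" "atgt (Run D V) = V"
 "asrc (Brd D V W) = V \<otimes>\<^sub>V W" "atgt (Brd D V W) = W \<otimes>\<^sub>V V"
 "asrc (Add D f g) = asrc f" "atgt (Add D f g) = atgt f"
 "v : el (asrc f) ==> amap (Add D f g) v = amap f v \<oplus>\<^bsub>atgt f\<^esub> amap g v"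
 "asrc (Scl D a f) = asrc f" "atgt (Scl D a f) = atgt f"
 "v : el (asrc f) ==> amap (Scl D a f) v = a \<odot>\<^bsub>atgt f\<^esub> amap f v"
 by (auto simp: Vec_def)

lemma Vec_amap:
 "amap (Idn D V) = (\<lambda>v \<in> el V. v)"
 "amap (g \<cdot>\<^sub>D f) = (\<lambda>v \<in> el (asrc f). amap g (amap f v))"
 "amap (Add D f g) = (\<lambda>v \<in> el (asrc f). amap f v \<oplus>\<^bsub>atgt f\<^esub> amap g v)"
 "amap (Scl D a f) = (\<lambda>v \<in> el (asrc f). a \<odot>\<^bsub>atgt f\<^esub> amap f v)"
 "amap (f \<otimes>\<^sub>D g) = (THE h. h : lin_maps (asrc f \<otimes>\<^sub>V asrc g) (atgt f \<otimes>\<^sub>V atgt g) \<and>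
   (\<forall>v \<in> el (asrc f). \<forall>w \<in> el (asrc g).
    h (pure (asrc f) (asrc g) v w) = pure (atgt f) (atgt g) (amap f v) (amap g w)))"
 "amap (Asc D U V W) = (THE h. h : lin_maps ((U \<otimes>\<^sub>V V) \<otimes>\<^sub>V W) (U \<otimes>\<^sub>V (V \<otimes>\<^sub>V W)) \<and>
   (\<forall>u \<in> el U. \<forall>v \<in> el V. \<forall>w \<in> el W.
    h (pure (U \<otimes>\<^sub>V V) W (pure U V u v) w) = pure U (V \<otimes>\<^sub>V W) u (pure V W v w)))"
 "amap (Lun D V) = (THE h. h : lin_maps (K \<otimes>\<^sub>V V) V \<and> (\<forall>v \<in> el V. h (pure K V one v) = v))"
 "amap (Run D V) = (THE h. h : lin_maps (V \<otimes>\<^sub>V K) V \<and> (\<forall>v \<in> el V. h (pure V K v one) = v))"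
 "amap (Brd D V W) = (THE h. h : lin_maps (V \<otimes>\<^sub>V W) (W \<otimes>\<^sub>V V) \<and>
   (\<forall>v \<in> el V. \<forall>w \<in> el W. h (pure V W v w) = pure W V w v))"
 by (auto simp: Vec_def)

lemma Vec_Arr: "f : Arr D \<longleftrightarrow> asrc f : fd_spaces \<and> atgt f : fd_spaces \<and> amap f : lin_maps (asrc f) (atgt f)"
 by (auto simp: Vec_def)

lemma Vec_arr [simp]:
 assumes "f : Arr D"
 shows "asrc f : fd_spaces" "atgt f : fd_spaces"
  "atgt f = W ==> v : el (asrc f) ==> amap f v : el W"
  "asrc f = V ==> v : el V ==> w : el V ==> amap f (v \<oplus>\<^sub>V w) = amap f v \<oplus>\<^bsub>atgt f\<^esub> amap f w"
  "asrc f = V ==> v : el V ==> amap f (a \<odot>\<^sub>V v) = a \<odot>\<^bsub>atgt f\<^esub> amap f v"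
 using assms lin_mapsD[of "amap f" "asrc f" "atgt f"] by (auto simp: Vec_Arr)

lemma Vec_lin: "f : Arr D ==> asrc f = V ==> atgt f = W ==> amap f : lin_maps V W"
 by (auto simp: Vec_Arr)

lemma Vec_eqI:
 assumes "f : Arr D" "g : Arr D" "asrc f = asrc g" "atgt f = atgt g" "\<And>v. v : el (asrc f) ==> amap f v = amap g v"
 shows "f = g"
proof -
 have "amap f = amap g" by (rule lin_maps_eqI) (use assms Vec_lin in auto)
 then show ?thesis using assms by simp
qed

lemma lin_amap: "f : Arr D ==> asrc f = V ==> atgt f = W ==> lin V W (amap f)"
 by (auto simp: lin_def)

lemma Vec_eqI_gen:
 assumes "lgen V B" "f : Arr D" "g : Arr D" "asrc f = V" "asrc g = V" "atgt f = W" "atgt g = W"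
  "\<And>b. b : B ==> amap f b = amap g b"
 shows "f = g"
proof (rule Vec_eqI[OF assms(2,3)])
 have fd: "fd V" "fd W" using Vec_arr(1,2)[OF assms(2)] assms(4,6) by auto
 fix v assume "v : el (asrc f)"
 then have "v : el V" using assms(4) by simp
 then show "amap f v = amap g v"
  using lgen_ext[OF assms(1) lin_amap[OF assms(2,4,6)] lin_amap[OF assms(3,5,7)] fd, of v] assms(8) by blast
qed (use assms in auto)

lemma Vec_idn [simp]: "fd V ==> Idn D V : Arr D"
 unfolding Vec_Arr by (auto simp: Vec_amap intro!: lin_mapsI)

lemma Vec_cmp [simp]: "f : Arr D ==> g : Arr D ==> asrc g = atgt f ==> g \<cdot>\<^sub>D f : Arr D"
 using lin_maps_comp[of "amap f" "asrc f" "atgt f" "amap g" "atgt g"]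
 unfolding Vec_Arr[of "g \<cdot>\<^sub>D f"] by (simp add: Vec_amap Vec_lin)

lemma Vec_ten [simp]:
 assumes [simp]: "f : Arr D" "g : Arr D"
 shows "f \<otimes>\<^sub>D g : Arr D"
  "v : el (asrc f) ==> w : el (asrc g) ==>
   amap (f \<otimes>\<^sub>D g) (pure (asrc f) (asrc g) v w) = pure (atgt f) (atgt g) (amap f v) (amap g w)"
proof -
 have b: "bilin (asrc f) (asrc g) (atgt f \<otimes>\<^sub>V atgt g) (\<lambda>v w. pure (atgt f) (atgt g) (amap f v) (amap g w))"
  by (auto simp: bilin_def)
 show "f \<otimes>\<^sub>D g : Arr D"
  unfolding Vec_Arr[of "f \<otimes>\<^sub>D g"] using the_lift(1)[OF _ _ _ b] by (simp add: Vec_amap)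
 show "v : el (asrc f) ==> w : el (asrc g) ==>
   amap (f \<otimes>\<^sub>D g) (pure (asrc f) (asrc g) v w) = pure (atgt f) (atgt g) (amap f v) (amap g w)"
  using the_lift(2)[OF _ _ _ b] by (simp add: Vec_amap)
qed

lemma Vec_ten_pure [simp]:
 assumes "f : Arr D" "g : Arr D" "asrc f = V" "asrc g = W" "v : el V" "w : el W"
 shows "amap (f \<otimes>\<^sub>D g) (pure V W v w) = pure (atgt f) (atgt g) (amap f v) (amap g w)"
 using Vec_ten(2)[of f g v w] assms by simp

lemma Vec_asc [simp]:
 assumes "fd U" "fd V" "fd W"
 shows "Asc D U V W : Arr D"
  "u : el U ==> v : el V ==> w : el W ==>
   amap (Asc D U V W) (pure (U \<otimes>\<^sub>V V) W (pure U V u v) w) = pure U (V \<otimes>\<^sub>V W) u (pure V W v w)"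
 using theI'[OF ex_asc[OF assms]] assms by (auto simp: Vec_Arr Vec_amap)

lemma Vec_lun [simp]:
 assumes "fd V"
 shows "Lun D V : Arr D" "v : el V ==> amap (Lun D V) (pure K V one v) = v"
 using theI'[OF ex_lun[OF assms]] assms by (auto simp: Vec_Arr Vec_amap)

lemma Vec_run [simp]:
 assumes "fd V"
 shows "Run D V : Arr D" "v : el V ==> amap (Run D V) (pure V K v one) = v"
 using theI'[OF ex_run[OF assms]] assms by (auto simp: Vec_Arr Vec_amap)

lemma Vec_brd [simp]:
 assumes [simp]: "fd V" "fd W"
 shows "Brd D V W : Arr D" "v : el V ==> w : el W ==> amap (Brd D V W) (pure V W v w) = pure W V w v"
proof -
 have b: "bilin V W (W \<otimes>\<^sub>V V) (\<lambda>v w. pure W V w v)" by (auto simp: bilin_def)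
 show "Brd D V W : Arr D" unfolding Vec_Arr using the_lift(1)[OF _ _ _ b] by (simp add: Vec_amap)
 show "v : el V ==> w : el W ==> amap (Brd D V W) (pure V W v w) = pure W V w v"
  using the_lift(2)[OF _ _ _ b] by (simp add: Vec_amap)
qed

lemma Vec_lun_coef [simp]: "fd V ==> v : el V ==> g : el K ==> amap (Lun D V) (pure K V g v) = coef g \<odot>\<^sub>V v"
 using Vec_arr(5)[of "Lun D V" _ "pure K V one v" "coef g"] pure_simps(4)[of K V one v "coef g"] by simp

lemma Vec_run_coef [simp]: "fd V ==> v : el V ==> g : el K ==> amap (Run D V) (pure V K v g) = coef g \<odot>\<^sub>V v"
 using Vec_arr(5)[of "Run D V" _ "pure V K v one" "coef g"] pure_simps(5)[of V K v one "coef g"] by simp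

lemma Vec_add [simp]: "f : Arr D ==> g : Arr D ==> asrc f = asrc g ==> atgt f = atgt g ==> Add D f g : Arr D"
 unfolding Vec_Arr[of "Add D f g"] by (auto simp: Vec_amap Vec_lin intro!: lin_maps_add)

lemma Vec_scl [simp]: "f : Arr D ==> Scl D a f : Arr D"
 unfolding Vec_Arr[of "Scl D a f"] by (auto simp: Vec_amap Vec_lin intro!: lin_maps_scl)

sublocale category D
 by standard (auto simp: homs_iff intro: Vec_eqI)

text \<open>An arrow given by a linear function.\<close>

definition arr where "arr V W f = \<lparr>asrc = V, atgt = W, amap = (\<lambda>v \<in> el V. f v)\<rparr>"

lemma arr_simps [simp]: "asrc (arr V W f) = V" "atgt (arr V W f) = W" "v : el V ==> amap (arr V W f) v = f v"
 by (auto simp: arr_def)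

lemma arr_in:
 assumes "fd V" "fd W" "\<And>v. v : el V ==> f v : el W"
  "\<And>v w. v : el V ==> w : el V ==> f (v \<oplus>\<^sub>V w) = f v \<oplus>\<^sub>W f w"
  "\<And>a v. v : el V ==> f (a \<odot>\<^sub>V v) = a \<odot>\<^sub>W f v"
 shows "arr V W f : Arr D"
 unfolding Vec_Arr using lin_mapsI[of V f W] assms by (simp, simp add: arr_def)

lemma is_iso_asc:
 assumes [simp]: "fd U" "fd V" "fd W"
 shows "is_iso D (Asc D U V W)"
proof -
 let ?X = "(U \<otimes>\<^sub>V V) \<otimes>\<^sub>V W" and ?Y = "U \<otimes>\<^sub>V (V \<otimes>\<^sub>V W)"
 obtain h where h: "h : lin_maps ?Y ?X" "\<And>u v w. u : el U ==> v : el V ==> w : el W ==>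
    h (pure U (V \<otimes>\<^sub>V W) u (pure V W v w)) = pure (U \<otimes>\<^sub>V V) W (pure U V u v) w"
  using ex_asc_inv[OF assms] by blast
 let ?h = "\<lparr>asrc = ?Y, atgt = ?X, amap = h\<rparr>"
 have h' [simp]: "?h : Arr D" unfolding Vec_Arr using h(1) by simp
 show ?thesis
 proof (rule is_isoI[where g = ?h])
  show "?h \<cdot>\<^sub>D Asc D U V W = Idn D (Src D (Asc D U V W))"
   by (rule Vec_eqI_gen[OF lgen_pure3[of U V W]]) (auto simp: h(2))
  show "Asc D U V W \<cdot>\<^sub>D ?h = Idn D (Tgt D (Asc D U V W))"
   by (rule Vec_eqI_gen[OF lgen_tensor[OF _ _ lgen_carrier lgen_pure[of V W]]]) (auto simp: h(2))
 qed auto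
qed

lemma is_iso_unit:
 assumes [simp]: "fd V"
 shows "is_iso D (Lun D V)" "is_iso D (Run D V)"
proof -
 let ?h = "arr V (K \<otimes>\<^sub>V V) (pure K V one)" and ?k = "arr V (V \<otimes>\<^sub>V K) (\<lambda>v. pure V K v one)"
 have [simp]: "?h : Arr D" "?k : Arr D" by (rule arr_in; simp)+
 show "is_iso D (Lun D V)"
 proof (rule is_isoI[where g = ?h])
  show "?h \<cdot>\<^sub>D Lun D V = Idn D (Src D (Lun D V))"
   by (rule Vec_eqI_gen[OF lgen_unit(1)[OF assms]]) auto
 qed (auto intro!: Vec_eqI)
 show "is_iso D (Run D V)"
 proof (rule is_isoI[where g = ?k])
  show "?k \<cdot>\<^sub>D Run D V = Idn D (Src D (Run D V))"
   by (rule Vec_eqI_gen[OF lgen_unit(2)[OF assms]]) auto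
 qed (auto intro!: Vec_eqI)
qed

sublocale monoidal_category D
proof
 fix w x y z assume "w : Obj D" "x : Obj D" "y : Obj D" "z : Obj D"
 then have [simp]: "fd w" "fd x" "fd y" "fd z" by auto
 show "Asc D w x (y \<otimes>\<^sub>o\<^sub>D z) \<cdot>\<^sub>D Asc D (w \<otimes>\<^sub>o\<^sub>D x) y z =
   (Idn D w \<otimes>\<^sub>D Asc D x y z) \<cdot>\<^sub>D Asc D w (x \<otimes>\<^sub>o\<^sub>D y) z \<cdot>\<^sub>D (Asc D w x y \<otimes>\<^sub>D Idn D z)"
  by (rule Vec_eqI_gen[OF lgen_tensor[OF _ _ lgen_pure3[of w x y] lgen_carrier[of z]]]) auto
next
 fix f x x' g y y' h z z' assume "f : homs D x x'" "g : homs D y y'" "h : homs D z z'"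
 then have [simp]: "f : Arr D" "g : Arr D" "h : Arr D" and e: "x = asrc f" "x' = atgt f" "y = asrc g" "y' = atgt g" "z = asrc h" "z' = atgt h"
  by (auto simp: homs_iff)
 show "Asc D x' y' z' \<cdot>\<^sub>D ((f \<otimes>\<^sub>D g) \<otimes>\<^sub>D h) = (f \<otimes>\<^sub>D (g \<otimes>\<^sub>D h)) \<cdot>\<^sub>D Asc D x y z"
  unfolding e by (rule Vec_eqI_gen[OF lgen_pure3[of "asrc f" "asrc g" "asrc h"]]) auto
next
 fix x y assume "x : Obj D" "y : Obj D"
 then have [simp]: "fd x" "fd y" by auto
 show "(Idn D x \<otimes>\<^sub>D Lun D y) \<cdot>\<^sub>D Asc D x (Unt D) y = Run D x \<otimes>\<^sub>D Idn D y"
  by (rule Vec_eqI_gen[OF lgen_tensor[OF _ _ lgen_tensor[OF _ _ lgen_carrier[of x] lgen_ground] lgen_carrier[of y]]]) auto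
next
 fix f x x' assume "f : homs D x x'"
 then have [simp]: "f : Arr D" and e: "x = asrc f" "x' = atgt f" by (auto simp: homs_iff)
 show "Lun D x' \<cdot>\<^sub>D (Idn D (Unt D) \<otimes>\<^sub>D f) = f \<cdot>\<^sub>D Lun D x"
  unfolding e by (rule Vec_eqI_gen[OF lgen_unit(1)[of "asrc f"]]) auto
 show "Run D x' \<cdot>\<^sub>D (f \<otimes>\<^sub>D Idn D (Unt D)) = f \<cdot>\<^sub>D Run D x"
  unfolding e by (rule Vec_eqI_gen[OF lgen_unit(2)[of "asrc f"]]) auto
next
 fix f x x' f' x'' g y y' g' y''
 assume "f : homs D x x'" "f' : homs D x' x''" "g : homs D y y'" "g' : homs D y' y''"
 then have [simp]: "f : Arr D" "f' : Arr D" "g : Arr D" "g' : Arr D" "asrc f' = atgt f" "asrc g' = atgt g"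
  by (auto simp: homs_iff)
 show "(f' \<cdot>\<^sub>D f) \<otimes>\<^sub>D (g' \<cdot>\<^sub>D g) = (f' \<otimes>\<^sub>D g') \<cdot>\<^sub>D (f \<otimes>\<^sub>D g)"
  by (rule Vec_eqI_gen[OF lgen_pure[of "asrc f" "asrc g"]]) auto
next
 fix x y assume "x : Obj D" "y : Obj D"
 then show "Idn D x \<otimes>\<^sub>D Idn D y = Idn D (x \<otimes>\<^sub>o\<^sub>D y)"
  by (intro Vec_eqI_gen[OF lgen_pure[of x y]]) auto
qed (auto simp: homs_iff isos_iff is_iso_asc is_iso_unit)

sublocale lsm D
proof
 fix f g assume [simp]: "f : Arr D" "g : Arr D"
 show "Brd D (Tgt D f) (Tgt D g) \<cdot>\<^sub>D (f \<otimes>\<^sub>D g) = (g \<otimes>\<^sub>D f) \<cdot>\<^sub>D Brd D (Src D f) (Src D g)"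
  by (rule Vec_eqI_gen[OF lgen_pure[of "asrc f" "asrc g"]]) auto
qed (auto simp: homs_iff fd_distr intro!: Vec_eqI)

end

section \<open>Linear algebra: free spaces, functionals and characters\<close>

text \<open>A finite spanning set, with spanning expressed as an induction principle.\<close>

definition spanned :: "('k::field, 'v) module => 'v set => bool" where
 "spanned V B \<longleftrightarrow> B \<subseteq> el V \<and> (\<forall>P. P \<zero>\<^sub>V --> (\<forall>b \<in> B. P b) -->
   (\<forall>v \<in> el V. \<forall>w \<in> el V. P v --> P w --> P (v \<oplus>\<^sub>V w)) -->
   (\<forall>v \<in> el V. \<forall>a. P v --> P (a \<odot>\<^sub>V v)) --> (\<forall>v \<in> el V. P v))"

lemma spanned_induct:
 assumes "spanned V B" "v : el V" "P \<zero>\<^sub>V" "\<And>b. b : B ==> P b"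
  "\<And>v w. v : el V ==> w : el V ==> P v ==> P w ==> P (v \<oplus>\<^sub>V w)"
  "\<And>v a. v : el V ==> P v ==> P (a \<odot>\<^sub>V v)"
 shows "P v"
proof -
 have "P \<zero>\<^sub>V --> (\<forall>b \<in> B. P b) -->
   (\<forall>v \<in> el V. \<forall>w \<in> el V. P v --> P w --> P (v \<oplus>\<^sub>V w)) -->
   (\<forall>v \<in> el V. \<forall>a. P v --> P (a \<odot>\<^sub>V v)) --> (\<forall>v \<in> el V. P v)"
  using assms(1) unfolding spanned_def by (elim conjE) (erule spec)
 then show ?thesis using assms(2-) by simp
qed

lemma spanned_ext:
 assumes "spanned V B" "h : lin_maps V W" "h' : lin_maps V W" "fd V" "fd W"
  "\<And>b. b : B ==> h b = h' b"
 shows "h = h'"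
proof (rule lin_maps_eqI[OF assms(2,3)])
 fix v assume "v : el V"
 with assms(1) show "h v = h' v"
  by (rule spanned_induct) (use assms in "auto simp: lin_maps_zero lin_mapsD")
qed

lemma (in vectorspace) lincomb_induct:
 assumes "finite A" "A \<subseteq> el V" "a : A \<rightarrow> el K" "P \<zero>\<^sub>V" "\<And>b. b : A ==> P b"
  "\<And>v w. v : el V ==> w : el V ==> P v ==> P w ==> P (v \<oplus>\<^sub>V w)"
  "\<And>v a. a : el K ==> v : el V ==> P v ==> P (a \<odot>\<^sub>V v)"
 shows "P (lincomb a A)"
 using assms(1-3,5)
proof (induction A)
 case empty
 then show ?case using assms(4) by (simp add: lincomb_def)
next
 case (insert x A)
 have "lincomb a (insert x A) = a x \<odot>\<^sub>V x \<oplus>\<^sub>V lincomb a A"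
  unfolding lincomb_def by (rule M.finsum_insert) (use insert in "auto intro!: smult_closed")
 moreover have "P (a x \<odot>\<^sub>V x)" using insert by (intro assms(7)) auto
 moreover have "P (lincomb a A)" using insert by auto
 moreover have "a x \<odot>\<^sub>V x : el V" "lincomb a A : el V" using insert by auto
 ultimately show ?case using assms(6) by simp
qed

lemma fd_spanned:
 assumes "fd V"
 obtains B where "finite B" "spanned V B"
proof -
 interpret vectorspace class_ring V by (rule fd_vs[OF assms])
 obtain B where B: "finite B" "B \<subseteq> el V" "gen_set B"
  using fd_fin[OF assms] unfolding fin_dim_def by blast
 have "spanned V B"
  unfolding spanned_def
 proof (intro conjI allI impI ballI)
  fix P v
  assume P: "P \<zero>\<^sub>V" "\<forall>b\<in>B. P b" "\<forall>v\<in>el V. \<forall>w\<in>el V. P v --> P w --> P (v \<oplus>\<^sub>V w)"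
   "\<forall>v\<in>el V. \<forall>a. P v --> P (a \<odot>\<^sub>V v)" and v: "v : el V"
  obtain a where "a : B \<rightarrow> el class_ring" "lincomb a B = v"
   using finite_in_span[OF B(1,2), of v] B(3) v by auto
  then show "P v" using lincomb_induct[OF B(1,2), of a P] P by auto
 qed (use B in auto)
 then show ?thesis using that B(1) by blast
qed

text \<open>
 A property of linear endomorphisms that is closed under sums and holds for those of rank one
 holds for the identity, by expanding the identity along a basis and its dual basis.
\<close>

lemma (in vec_tensor) rank_one_induct:
 assumes V [simp]: "fd V" and zero: "Q (\<lambda>v \<in> el V. \<zero>\<^sub>V)"
  and one: "\<And>l u. l : lin_maps V K ==> u : el V ==> Q (\<lambda>v \<in> el V. coef (l v) \<odot>\<^sub>V u)"
  and add: "\<And>f g. f : lin_maps V V ==> g : lin_maps V V ==> Q f ==> Q g ==> Q (\<lambda>v \<in> el V. f v \<oplus>\<^sub>V g v)"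
 shows "Q (\<lambda>v \<in> el V. v)"
proof -
 interpret vectorspace class_ring V by (rule fd_vs[OF V])
 obtain B where B: "finite B" "basis B" using finite_basis_exists[OF fd_fin[OF V]] by blast
 then have BC: "B \<subseteq> el V" by (simp add: basis_def)
 have ex: "\<exists>!a. a : B \<rightarrow>\<^sub>E UNIV \<and> lincomb a B = v" if "v : el V" for v
  using basis_criterion[OF B(1) BC] B(2) that by simp
 define a where "a v = (THE a. a : B \<rightarrow>\<^sub>E UNIV \<and> lincomb a B = v)" for v
 have a: "a v : B \<rightarrow>\<^sub>E UNIV" "lincomb (a v) B = v" if "v : el V" for v
  using theI'[OF ex[OF that]] unfolding a_def by auto
 have uniq: "a v = b" if "b : B \<rightarrow>\<^sub>E UNIV" "lincomb b B = v" "v : el V" for v b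
  using ex[OF that(3)] a[OF that(3)] that by blast
 have a_add: "a (v \<oplus>\<^sub>V w) b = a v b + a w b" if v: "v : el V" "w : el V" and b: "b : B" for v w b
 proof -
  have "lincomb (\<lambda>b\<in>B. a v b + a w b) B = finsum V (\<lambda>b. a v b \<odot>\<^sub>V b \<oplus>\<^sub>V a w b \<odot>\<^sub>V b) B"
   unfolding lincomb_def by (rule M.finsum_cong') (use BC in "auto simp: fd_distr(2)[OF V]")
  also have "... = lincomb (a v) B \<oplus>\<^sub>V lincomb (a w) B"
   unfolding lincomb_def by (rule M.finsum_addf) (use BC in auto)
  finally have "a (v \<oplus>\<^sub>V w) = (\<lambda>b\<in>B. a v b + a w b)"
   using v by (intro uniq) (auto simp: a)
  then show ?thesis using b by simp
 qed
 have a_scl: "a (c \<odot>\<^sub>V v) b = c * a v b" if v: "v : el V" and b: "b : B" for v c b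
 proof -
  have "lincomb (\<lambda>b\<in>B. c * a v b) B = finsum V (\<lambda>b. c \<odot>\<^sub>V (a v b \<odot>\<^sub>V b)) B"
   unfolding lincomb_def by (rule M.finsum_cong') (use BC in auto)
  also have "... = c \<odot>\<^sub>V lincomb (a v) B"
   unfolding lincomb_def by (rule finsum_smult[symmetric]) (use BC in auto)
  finally have "a (c \<odot>\<^sub>V v) = (\<lambda>b\<in>B. c * a v b)"
   using v by (intro uniq) (auto simp: a)
  then show ?thesis using b by simp
 qed
 have l: "(\<lambda>v \<in> el V. a v b \<odot>\<^sub>K one) : lin_maps V K" if "b : B" for b
  using that by (intro lin_mapsI) (auto simp: a_add a_scl fd_distr)
 let ?S = "\<lambda>F. \<lambda>v \<in> el V. finsum V (\<lambda>b. a v b \<odot>\<^sub>V b) F"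
 have "?S F : lin_maps V V \<and> Q (?S F)" if "finite F" "F \<subseteq> B" for F
  using that
 proof (induction F)
  case empty
  have "?S {} = (\<lambda>v \<in> el V. \<zero>\<^sub>V)" by (rule restrict_ext) simp
  moreover have "(\<lambda>v \<in> el V. \<zero>\<^sub>V) : lin_maps V V" by (rule lin_mapsI) auto
  ultimately show ?case using zero by (simp only: simp_thms)
 next
  case (insert b F)
  let ?f = "\<lambda>v \<in> el V. coef ((\<lambda>v \<in> el V. a v b \<odot>\<^sub>K one) v) \<odot>\<^sub>V b"
  have b: "b : B" "b : el V" using insert BC by auto
  have f: "?f : lin_maps V V"
   by (rule lin_mapsI) (use b in "auto simp: a_add a_scl fd_distr")
  have "Q ?f" by (rule one[OF l]) (use b in auto)
  have e: "?S (insert b F) = (\<lambda>v \<in> el V. ?f v \<oplus>\<^sub>V ?S F v)"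
   by (rule restrict_ext, subst M.finsum_insert) (use insert BC b in auto)
  have IH: "?S F : lin_maps V V" "Q (?S F)" using insert.IH insert.prems by blast+
  show ?case unfolding e
   by (rule conjI[OF lin_maps_add[OF f IH(1) V V] add[OF f IH(1) \<open>Q ?f\<close> IH(2)]])
 qed
 from this[OF B(1) order_refl] have "Q (?S B)" by blast
 moreover have "?S B = (\<lambda>v \<in> el V. v)"
  by (rule restrict_ext) (use a in "auto simp: lincomb_def")
 ultimately show ?thesis by simp
qed

lemma (in vec_tensor) obtain_functional:
 assumes V [simp]: "fd V" and v [simp]: "v : el V" "v \<noteq> \<zero>\<^sub>V"
 obtains l where "l : lin_maps V K" "l v = one"
proof -
 have "\<exists>l \<in> lin_maps V K. l v \<noteq> \<zero>\<^sub>K"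
 proof (rule ccontr)
  assume "\<not> ?thesis"
  then have 0: "l v = \<zero>\<^sub>K" if "l : lin_maps V K" for l using that by blast
  have "coef \<zero>\<^sub>K = 0" using coef(2)[of 0] by simp
  then have "(\<lambda>v \<in> el V. v) v = \<zero>\<^sub>V"
   by (intro rank_one_induct[where V = V and Q = "\<lambda>f. f v = \<zero>\<^sub>V"]) (auto simp: 0)
  then show False using v by simp
 qed
 then obtain l where l: "l : lin_maps V K" "l v \<noteq> \<zero>\<^sub>K" by blast
 have lv: "l v : el K" using l by (simp add: lin_mapsD)
 then have c: "coef (l v) \<noteq> 0" using l(2) coef(1)[of "l v"] by (metis fd_simps(6) ground)
 let ?l = "\<lambda>w \<in> el V. (1 / coef (l v)) \<odot>\<^sub>K l w"
 have "?l : lin_maps V K" by (rule lin_maps_scl[OF l(1)]) auto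
 moreover have "?l v = one"
 proof -
  have "(1 / coef (l v)) \<odot>\<^sub>K l v = (1 / coef (l v)) \<odot>\<^sub>K (coef (l v) \<odot>\<^sub>K one)" using lv by simp
  also have "... = (1 / coef (l v) * coef (l v)) \<odot>\<^sub>K one" by (simp del: coef)
  also have "... = one" using c by simp
  finally show ?thesis by simp
 qed
 ultimately show ?thesis by (rule that)
qed

text \<open>
 The free space on a finite set exists inside the type \<open>'v\<close>: an infinite field is equipotent
 with its finite powers, and the ground field copy embeds it into \<open>'v\<close>.
\<close>

lemma ex_inj_PiE:
 assumes "infinite (UNIV :: 'k set)" "finite S"
 shows "\<exists>j :: ('s => 'k) => 'k. inj_on j (S \<rightarrow>\<^sub>E UNIV)"
 using assms(2)
proof (induction S)
 case empty
 then show ?case by auto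
next
 case (insert s S)
 then obtain j :: "('s => 'k) => 'k" where j: "inj_on j (S \<rightarrow>\<^sub>E UNIV)" by blast
 obtain p :: "'k \<times> 'k => 'k" where p: "bij_betw p (UNIV \<times> UNIV) UNIV"
  using card_of_ordIso[THEN iffD2, OF card_of_Times_same_infinite[OF assms(1)]] by blast
 then have "inj p" by (simp add: bij_betw_def)
 have "inj_on (\<lambda>\<phi>. p (\<phi> s, j (restrict \<phi> S))) (insert s S \<rightarrow>\<^sub>E UNIV)"
 proof (rule inj_onI)
  fix \<phi> \<psi> :: "'s => 'k"
  assume \<phi>: "\<phi> : insert s S \<rightarrow>\<^sub>E UNIV" "\<psi> : insert s S \<rightarrow>\<^sub>E UNIV"
   and e: "p (\<phi> s, j (restrict \<phi> S)) = p (\<psi> s, j (restrict \<psi> S))"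
  from e have "\<phi> s = \<psi> s" "j (restrict \<phi> S) = j (restrict \<psi> S)" using \<open>inj p\<close> by (auto dest: injD)
  moreover from this(2) have "restrict \<phi> S = restrict \<psi> S" by (rule inj_onD[OF j]) auto
  ultimately have "\<phi> x = \<psi> x" if "x : insert s S" for x
   using that by (metis insert_iff restrict_apply')
  then show "\<phi> = \<psi>" using \<phi> by (intro PiE_ext) auto
 qed
 then show ?case by blast
qed

definition free_on :: "'s set => ('k::field, 'v) module => ('s => 'v) => bool" where
 "free_on S V \<delta> \<longleftrightarrow> V : fd_spaces \<and> spanned V (\<delta> ` S) \<and>
   (\<forall>W \<in> fd_spaces. \<forall>\<beta> \<in> S \<rightarrow> el W. \<exists>h \<in> lin_maps V W. \<forall>s \<in> S. h (\<delta> s) = \<beta> s)"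

lemma (in vec_tensor) ex_free_on:
 assumes "infinite (UNIV :: 'k set)" and S [simp]: "finite S"
 shows "\<exists>(V :: ('k, 'v) module) \<delta>. free_on (S :: 's set) V \<delta>"
proof -
 obtain j :: "('s => 'k) => 'k" where j: "inj_on j (S \<rightarrow>\<^sub>E UNIV)" using ex_inj_PiE[OF assms] by blast
 define \<iota> where "\<iota> \<phi> = j \<phi> \<odot>\<^sub>K one" for \<phi>
 let ?E = "S \<rightarrow>\<^sub>E (UNIV :: 'k set)"
 have \<iota>: "inj_on \<iota> ?E"
  by (rule inj_onI) (metis \<iota>_def coef(2) inj_onD[OF j])
 define c where "c = inv_into ?E \<iota>"
 have c: "c (\<iota> \<phi>) = \<phi>" if "\<phi> : ?E" for \<phi> unfolding c_def by (rule inv_into_f_f[OF \<iota> that])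
 define V :: "('k, 'v) module" where "V = \<lparr>carrier = \<iota> ` ?E, mult = undefined, one = undefined,
   zero = \<iota> (\<lambda>s \<in> S. 0), add = (\<lambda>v w. \<iota> (\<lambda>s \<in> S. c v s + c w s)), smult = (\<lambda>a v. \<iota> (\<lambda>s \<in> S. a * c v s))\<rparr>"
 have carr: "el V = \<iota> ` ?E" by (simp add: V_def)
 have add: "\<iota> \<phi> \<oplus>\<^sub>V \<iota> \<psi> = \<iota> (\<lambda>s \<in> S. \<phi> s + \<psi> s)" if "\<phi> : ?E" "\<psi> : ?E" for \<phi> \<psi>
  using that by (simp add: V_def c)
 have smult: "a \<odot>\<^sub>V \<iota> \<phi> = \<iota> (\<lambda>s \<in> S. a * \<phi> s)" if "\<phi> : ?E" for \<phi> a
  using that by (simp add: V_def c)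
 have zero: "\<zero>\<^sub>V = \<iota> (\<lambda>s \<in> S. 0)" by (simp add: V_def)
 have vs: "vectorspace class_ring V"
 proof (rule vs_criteria)
  show "field (class_ring :: 'k ring)" using fd_vs[OF ground(1)] by (rule vectorspace.axioms(2))
  show "\<forall>v\<in>el V. \<exists>neg_v\<in>el V. v \<oplus>\<^sub>V neg_v = \<zero>\<^sub>V"
  proof
   fix v assume "v : el V"
   then obtain \<phi> where \<phi>: "\<phi> : ?E" "v = \<iota> \<phi>" by (auto simp: carr)
   have "v \<oplus>\<^sub>V \<iota> (\<lambda>s \<in> S. - \<phi> s) = \<zero>\<^sub>V" using \<phi> by (auto simp: add zero intro!: arg_cong[where f = \<iota>])
   then show "\<exists>neg_v\<in>el V. v \<oplus>\<^sub>V neg_v = \<zero>\<^sub>V" by (auto simp: carr)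
  qed
  show "\<forall>v\<in>el V. v \<oplus>\<^sub>V \<zero>\<^sub>V = v" "\<forall>v\<in>el V. \<one>\<^bsub>class_ring\<^esub> \<odot>\<^sub>V v = v"
   by (auto simp: carr zero add smult PiE_restrict cong: restrict_cong)
 qed (auto simp: carr zero add smult algebra_simps intro!: arg_cong[where f = \<iota>] restrict_ext)
 then interpret vectorspace class_ring V .
 define \<delta> where "\<delta> s = \<iota> (\<lambda>r \<in> S. if r = s then 1 else 0)" for s
 have \<delta>: "\<delta> s : el V" for s by (auto simp: \<delta>_def carr)
 have span: "P (\<iota> \<phi>)" if P: "P \<zero>\<^sub>V" "\<And>s. s : S ==> P (\<delta> s)"
   "\<And>v w. v : el V ==> w : el V ==> P v ==> P w ==> P (v \<oplus>\<^sub>V w)"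
   "\<And>v a. v : el V ==> P v ==> P (a \<odot>\<^sub>V v)" and \<phi>: "\<phi> : ?E" for P \<phi>
 proof -
  have "P (\<iota> (\<lambda>s \<in> S. if s : F then \<phi> s else 0))" if "finite F" "F \<subseteq> S" for F
   using that
  proof (induction F)
   case empty
   have "(\<lambda>s \<in> S. if s : {} then \<phi> s else 0) = (\<lambda>s \<in> S. 0)" by (rule restrict_ext) simp
   then show ?case using P(1) unfolding zero by (simp only:)
  next
   case (insert s F)
   have e: "\<iota> (\<lambda>r \<in> S. if r : insert s F then \<phi> r else 0) = \<phi> s \<odot>\<^sub>V \<delta> s \<oplus>\<^sub>V \<iota> (\<lambda>r \<in> S. if r : F then \<phi> r else 0)"
    using insert by (auto simp: \<delta>_def smult add intro!: arg_cong[where f = \<iota>])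
   have d: "P (\<phi> s \<odot>\<^sub>V \<delta> s)" "\<phi> s \<odot>\<^sub>V \<delta> s : el V" using insert \<delta> P by auto
   have c2: "\<iota> (\<lambda>r \<in> S. if r : F then \<phi> r else 0) : el V" unfolding carr by (rule imageI) auto
   have ih: "P (\<iota> (\<lambda>r \<in> S. if r : F then \<phi> r else 0))" using insert.IH insert.prems by blast
   show ?case unfolding e by (rule P(3)[OF d(2) c2 d(1) ih])
  qed
  from this[OF S order_refl] have "P (\<iota> (\<lambda>s \<in> S. \<phi> s))" by (simp cong: restrict_cong)
  then show ?thesis using \<phi> by (simp add: extensional_restrict PiE_def)
 qed
 have "el V \<subseteq> span (\<delta> ` S)"
 proof
  fix v assume "v : el V"
  then obtain \<phi> where \<phi>: "\<phi> : ?E" "v = \<iota> \<phi>" by (auto simp: carr)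
  have sm: "submodule class_ring (span (\<delta> ` S)) V" by (rule span_is_submodule) (use \<delta> in auto)
  have own: "\<delta> ` S \<subseteq> span (\<delta> ` S)" by (rule in_own_span) (use \<delta> in auto)
  show "v : span (\<delta> ` S)" unfolding \<phi>(2)
   by (rule span[OF _ _ _ _ \<phi>(1)])
    (use sm own in "auto simp: submodule_def LinearCombinations.submodule_def")
 qed
 moreover have "span (\<delta> ` S) \<subseteq> el V" by (rule span_is_subset2) (use \<delta> in auto)
 ultimately have "gen_set (\<delta> ` S)" by auto
 then have fin: "fin_dim" unfolding fin_dim_def using \<delta> by (intro exI[of _ "\<delta> ` S"]) auto
 have fd: "fd V" using vs fin by (simp add: fd_spaces_def)
 have sp: "spanned V (\<delta> ` S)"
  unfolding spanned_def
 proof (intro conjI allI impI ballI)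
  fix P v
  assume P: "P \<zero>\<^sub>V" "\<forall>b\<in>\<delta> ` S. P b" "\<forall>v\<in>el V. \<forall>w\<in>el V. P v --> P w --> P (v \<oplus>\<^sub>V w)"
   "\<forall>v\<in>el V. \<forall>a. P v --> P (a \<odot>\<^sub>V v)" and "v : el V"
  then obtain \<phi> where "\<phi> : ?E" "v = \<iota> \<phi>" by (auto simp: carr)
  then show "P v" using span[of P \<phi>] P by auto
 qed (use \<delta> in auto)
 have "\<exists>h \<in> lin_maps V W. \<forall>s \<in> S. h (\<delta> s) = \<beta> s" if W [simp]: "fd W" and \<beta>: "\<beta> : S \<rightarrow> el W" for W :: "('k, 'v) module" and \<beta>
 proof -
  interpret W: vectorspace class_ring W by (rule fd_vs[OF W])
  let ?h = "\<lambda>v \<in> el V. finsum W (\<lambda>s. c v s \<odot>\<^sub>W \<beta> s) S"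
  have "?h : lin_maps V W"
  proof (rule lin_mapsI[OF _ _ _ fd])
   fix v w assume "v : el V" "w : el V"
   then obtain \<phi> \<psi> where \<phi>: "\<phi> : ?E" "v = \<iota> \<phi>" "\<psi> : ?E" "w = \<iota> \<psi>" by (auto simp: carr)
   have "finsum W (\<lambda>s. c (v \<oplus>\<^sub>V w) s \<odot>\<^sub>W \<beta> s) S = finsum W (\<lambda>s. \<phi> s \<odot>\<^sub>W \<beta> s \<oplus>\<^sub>W \<psi> s \<odot>\<^sub>W \<beta> s) S"
    by (rule W.M.finsum_cong') (use \<phi> \<beta> in "auto simp: add c fd_distr(2)[OF W] Pi_def")
   also have "... = finsum W (\<lambda>s. \<phi> s \<odot>\<^sub>W \<beta> s) S \<oplus>\<^sub>W finsum W (\<lambda>s. \<psi> s \<odot>\<^sub>W \<beta> s) S"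
    by (rule W.M.finsum_addf) (use \<beta> in "auto simp: Pi_def")
   finally show "finsum W (\<lambda>s. c (v \<oplus>\<^sub>V w) s \<odot>\<^sub>W \<beta> s) S
     = finsum W (\<lambda>s. c v s \<odot>\<^sub>W \<beta> s) S \<oplus>\<^sub>W finsum W (\<lambda>s. c w s \<odot>\<^sub>W \<beta> s) S"
    using \<phi> by (simp add: c)
  next
   fix v a assume "v : el V"
   then obtain \<phi> where \<phi>: "\<phi> : ?E" "v = \<iota> \<phi>" by (auto simp: carr)
   have "finsum W (\<lambda>s. c (a \<odot>\<^sub>V v) s \<odot>\<^sub>W \<beta> s) S = finsum W (\<lambda>s. a \<odot>\<^sub>W (\<phi> s \<odot>\<^sub>W \<beta> s)) S"
    by (rule W.M.finsum_cong') (use \<phi> \<beta> in "auto simp: smult c Pi_def")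
   also have "... = a \<odot>\<^sub>W finsum W (\<lambda>s. \<phi> s \<odot>\<^sub>W \<beta> s) S"
    by (rule W.finsum_smult[symmetric]) (use \<beta> in "auto simp: Pi_def")
   finally show "finsum W (\<lambda>s. c (a \<odot>\<^sub>V v) s \<odot>\<^sub>W \<beta> s) S = a \<odot>\<^sub>W finsum W (\<lambda>s. c v s \<odot>\<^sub>W \<beta> s) S"
    using \<phi> by (simp add: c)
  qed (use \<beta> in "auto simp: Pi_def intro!: W.M.finsum_closed")
  moreover have "?h (\<delta> s) = \<beta> s" if "s : S" for s
  proof -
   have "?h (\<delta> s) = finsum W (\<lambda>r. (if r = s then 1 else 0) \<odot>\<^sub>W \<beta> r) S"
    using \<delta> that \<beta> by (auto simp: \<delta>_def c Pi_def intro!: W.M.finsum_cong')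
   also have "... = finsum W (\<lambda>r. if s = r then \<beta> r else \<zero>\<^sub>W) S"
    using that \<beta> by (auto simp: Pi_def intro!: W.M.finsum_cong')
   also have "... = \<beta> s" by (rule W.M.finsum_singleton) (use that \<beta> in auto)
   finally show ?thesis .
  qed
  ultimately show ?thesis by blast
 qed
 with fd sp show ?thesis unfolding free_on_def by blast
qed

lemma free_onD:
 assumes "free_on S V \<delta>"
 shows "fd V" "spanned V (\<delta> ` S)" "\<And>s. s : S ==> \<delta> s : el V"
  "\<And>W \<beta>. W : fd_spaces ==> \<beta> : S \<rightarrow> el W ==> \<exists>h \<in> lin_maps V W. \<forall>s \<in> S. h (\<delta> s) = \<beta> s"
 using assms by (auto simp: free_on_def spanned_def)

text \<open>
 Over an algebraically closed field every linear endomorphism of a nonzero finite-dimensional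
 space has an eigenvector; here it is found inside a given invariant subspace \<open>S\<close>. The
 vectors \<open>w, f w, f (f w), ...\<close> are linearly dependent, so some polynomial in \<open>f\<close> kills \<open>w\<close>, and
 splitting off its linear factors one after the other reaches an eigenvector.
\<close>

lemma eigenvector:
 fixes V :: "('k::alg_closed_field, 'v) module"
 assumes V [simp]: "fd V" and f: "f : lin_maps V V" and S: "S \<subseteq> el V"
  and S_add: "\<And>v w. v : S ==> w : S ==> v \<oplus>\<^sub>V w : S" and S_scl: "\<And>v a. v : S ==> a \<odot>\<^sub>V v : S"
  and S_f: "\<And>v. v : S ==> f v : S" and w: "w : S" "w \<noteq> \<zero>\<^sub>V"
 obtains v a where "v : S" "v \<noteq> \<zero>\<^sub>V" "f v = a \<odot>\<^sub>V v"
proof -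
 interpret vectorspace class_ring V by (rule fd_vs[OF V])
 define ev where "ev p = fold_coeffs (\<lambda>a x. a \<odot>\<^sub>V w \<oplus>\<^sub>V f x) p \<zero>\<^sub>V" for p :: "'k poly"
 have w' [simp]: "w : el V" using w S by auto
 note f' [simp] = lin_mapsD(1-3)[OF f] lin_maps_zero[OF f V V]
 have S0: "\<zero>\<^sub>V : S" using S_scl[OF w(1), of 0] by simp
 have ev_pCons: "ev (pCons a p) = a \<odot>\<^sub>V w \<oplus>\<^sub>V f (ev p)" for a p
  by (cases "p = 0 \<and> a = 0") (auto simp: ev_def fold_coeffs_pCons_not_0_0_eq fold_coeffs_pCons_coeff_not_0_eq)
 have ev_0 [simp]: "ev 0 = \<zero>\<^sub>V" by (simp add: ev_def)
 have ev_S: "ev p : S" for p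
  by (induction p) (auto simp: ev_pCons S0 intro!: S_add S_scl S_f w)
 then have ev_c [simp]: "ev p : el V" for p using S by auto
 have ev_add: "ev (p + q) = ev p \<oplus>\<^sub>V ev q" for p q
  by (induction p q rule: poly_induct2) (auto simp: ev_pCons fd_distr fd_ac)
 have ev_smult: "ev (Polynomial.smult a p) = a \<odot>\<^sub>V ev p" for a p
  by (induction p) (auto simp: ev_pCons fd_distr)
 have ev_monom: "ev (monom a n) = a \<odot>\<^sub>V (f ^^ n) w" for a n
 proof (induction n)
  case (Suc n)
  have "(f ^^ n) w : el V" by (induction n) auto
  then show ?case using Suc by (simp add: monom_Suc ev_pCons)
 qed (simp add: monom_0 ev_pCons)
 have fn [simp]: "(f ^^ n) w : el V" for n by (induction n) auto
 have "\<exists>p. p \<noteq> 0 \<and> ev p = \<zero>\<^sub>V"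
 proof (cases "inj_on (\<lambda>i. (f ^^ i) w) {..dim}")
  case True
  let ?A = "(\<lambda>i. (f ^^ i) w) ` {..dim}"
  have "card ?A = Suc dim" using True by (simp add: card_image)
  moreover have sub: "?A \<subseteq> el V" by (rule image_subsetI) simp
  ultimately have "lin_dep ?A"
   using li_le_dim(2)[OF fd_fin[OF V] sub] by fastforce
  then obtain a v where a: "lincomb a ?A = \<zero>\<^sub>V" "v : ?A" "a v \<noteq> 0"
   using finite_lin_dep[of ?A] sub by auto
  then obtain i where i: "i \<le> dim" "v = (f ^^ i) w" by auto
  define p where "p n = (\<Sum>i<n. monom (a ((f ^^ i) w)) i)" for n
  have "ev (p n) = finsum V (\<lambda>i. a ((f ^^ i) w) \<odot>\<^sub>V (f ^^ i) w) {..<n}" for n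
   by (induction n) (auto simp: p_def ev_add ev_monom lessThan_Suc fd_ac)
  then have "ev (p (Suc dim)) = finsum V (\<lambda>i. a ((f ^^ i) w) \<odot>\<^sub>V (f ^^ i) w) {..dim}"
   by (simp add: lessThan_Suc_atMost)
  also have "... = lincomb a ?A"
   unfolding lincomb_def by (rule M.finsum_reindex[symmetric]) (use True in auto)
  finally have "ev (p (Suc dim)) = \<zero>\<^sub>V" using a(1) by simp
  moreover have "coeff (p (Suc dim)) i = a v"
   using i by (simp add: p_def coeff_sum)
  then have "p (Suc dim) \<noteq> 0" using a(3) by (metis coeff_0)
  ultimately show ?thesis by blast
 next
  case False
  then obtain i j where ij: "i \<noteq> j" "(f ^^ i) w = (f ^^ j) w" by (auto simp: inj_on_def)
  let ?p = "monom 1 i + monom (-1) j :: 'k poly"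
  have "coeff ?p i = 1" using ij by simp
  then have "?p \<noteq> 0" by (metis coeff_0 zero_neq_one)
  have "ev ?p = 1 \<odot>\<^sub>V (f ^^ j) w \<oplus>\<^sub>V (-1) \<odot>\<^sub>V (f ^^ j) w" by (simp add: ev_add ev_monom ij)
  also have "... = (1 + (-1)) \<odot>\<^sub>V (f ^^ j) w" by (rule fd_distr(2)[OF V, symmetric]) simp
  finally show ?thesis using \<open>?p \<noteq> 0\<close> by (intro exI[of _ ?p]) simp
 qed
 then obtain p where p: "p \<noteq> 0" "ev p = \<zero>\<^sub>V" by blast
 have "\<exists>v \<in> S. \<exists>a. v \<noteq> \<zero>\<^sub>V \<and> f v = a \<odot>\<^sub>V v" if "p \<noteq> 0" "ev p = \<zero>\<^sub>V" for p
  using that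
 proof (induction "degree p" arbitrary: p rule: less_induct)
  case less
  show ?case
  proof (cases "degree p = 0")
   case True
   then obtain a where "p = [:a:]" by (rule degree_eq_zeroE)
   with less have "a \<noteq> 0" "a \<odot>\<^sub>V w = \<zero>\<^sub>V" by (auto simp: ev_pCons)
   then have "(1 / a) \<odot>\<^sub>V (a \<odot>\<^sub>V w) = \<zero>\<^sub>V" by simp
   moreover have "(1 / a) \<odot>\<^sub>V (a \<odot>\<^sub>V w) = w"
    using fd_simps(9)[OF V w', of "1 / a" a] \<open>a \<noteq> 0\<close> by simp
   ultimately show ?thesis using w by simp
  next
   case False
   then obtain x where "poly p x = 0" using alg_closed_imp_poly_has_root[of p] by auto
   then obtain q where q: "p = [:-x, 1:] * q" by (auto simp: poly_eq_0_iff_dvd)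
   have "q \<noteq> 0" using q less by auto
   then have deg: "degree q < degree p" unfolding q by (subst degree_mult_eq) auto
   have "p = Polynomial.smult (-x) q + pCons 0 q" unfolding q by simp
   then have "ev p = ev (Polynomial.smult (-x) q) \<oplus>\<^sub>V ev (pCons 0 q)" by (simp only: ev_add)
   then have "ev p = (-x) \<odot>\<^sub>V ev q \<oplus>\<^sub>V f (ev q)" by (simp only: ev_smult, simp add: ev_pCons)
   then have e: "(-x) \<odot>\<^sub>V ev q \<oplus>\<^sub>V f (ev q) = \<zero>\<^sub>V" using less by simp
   show ?thesis
   proof (cases "ev q = \<zero>\<^sub>V")
    case True
    then show ?thesis using less.hyps[OF deg \<open>q \<noteq> 0\<close>] by blast
   next
    case F: False
    have "x \<odot>\<^sub>V ev q \<oplus>\<^sub>V ((-x) \<odot>\<^sub>V ev q \<oplus>\<^sub>V f (ev q)) = (x \<odot>\<^sub>V ev q \<oplus>\<^sub>V (-x) \<odot>\<^sub>V ev q) \<oplus>\<^sub>V f (ev q)"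
     by (simp add: fd_ac)
    also have "x \<odot>\<^sub>V ev q \<oplus>\<^sub>V (-x) \<odot>\<^sub>V ev q = (x + (-x)) \<odot>\<^sub>V ev q"
     by (rule fd_distr(2)[OF V, symmetric]) simp
    finally have "f (ev q) = x \<odot>\<^sub>V ev q" unfolding e by simp
    then show ?thesis using F ev_S by blast
   qed
  qed
 qed
 from this[OF p] show ?thesis using that by blast
qed

text \<open>
 A nonzero finite-dimensional commutative algebra over an algebraically closed field has a
 character: the multiplication operators commute, hence have a common eigenvector, and the
 eigenvalues form a character.
\<close>

lemma ex_character:
 fixes V :: "('k::alg_closed_field, 'v) module"
 assumes V [simp]: "fd V" and m: "bilin V V V m" and u: "u : el V" "u \<noteq> \<zero>\<^sub>V"
  and comm: "\<And>a b. a : el V ==> b : el V ==> m a b = m b a"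
  and assoc: "\<And>a b c. a : el V ==> b : el V ==> c : el V ==> m (m a b) c = m a (m b c)"
  and unit: "\<And>a. a : el V ==> m u a = a"
 obtains \<chi> where "\<chi> u = 1" "\<And>a b. a : el V ==> b : el V ==> \<chi> (m a b) = \<chi> a * \<chi> b"
  "\<And>a b. a : el V ==> b : el V ==> \<chi> (a \<oplus>\<^sub>V b) = \<chi> a + \<chi> b"
  "\<And>a c. a : el V ==> \<chi> (c \<odot>\<^sub>V a) = c * \<chi> a"
proof -
 have m' [simp]: "\<And>a b. a : el V ==> b : el V ==> m a b : el V"
  "\<And>a b c. a : el V ==> b : el V ==> c : el V ==> m (a \<oplus>\<^sub>V b) c = m a c \<oplus>\<^sub>V m b c"
  "\<And>a b c. a : el V ==> b : el V ==> c : el V ==> m a (b \<oplus>\<^sub>V c) = m a b \<oplus>\<^sub>V m a c"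
  "\<And>a b c. a : el V ==> b : el V ==> m (c \<odot>\<^sub>V a) b = c \<odot>\<^sub>V m a b"
  "\<And>a b c. a : el V ==> b : el V ==> m a (c \<odot>\<^sub>V b) = c \<odot>\<^sub>V m a b"
  using m by (auto simp: bilin_def)
 obtain B where B: "finite B" "spanned V B" by (rule fd_spanned[OF V])
 then have BC: "B \<subseteq> el V" by (simp add: spanned_def)
 have "\<exists>v \<in> el V. v \<noteq> \<zero>\<^sub>V \<and> (\<forall>b \<in> F. \<exists>a. m b v = a \<odot>\<^sub>V v)" if "finite F" "F \<subseteq> B" for F
  using that
 proof (induction F)
  case empty
  then show ?case using u by blast
 next
  case (insert x F)
  then have x [simp]: "x : el V" using BC by auto
  obtain v a where v: "v : el V" "v \<noteq> \<zero>\<^sub>V" "\<And>b. b : F ==> m b v = a b \<odot>\<^sub>V v"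
   using insert by (metis insert_subset)
  let ?S = "{v \<in> el V. \<forall>b \<in> F. m b v = a b \<odot>\<^sub>V v}"
  have F: "b : el V" if "b : F" for b using that insert BC by auto
  have "(\<lambda>v \<in> el V. m x v) : lin_maps V V" by (rule lin_mapsI) auto
  then obtain v' c where v': "v' : ?S" "v' \<noteq> \<zero>\<^sub>V" "(\<lambda>v \<in> el V. m x v) v' = c \<odot>\<^sub>V v'"
  proof (rule eigenvector[OF V, where S = ?S and w = v])
   fix v w c assume v: "v : ?S"
   show "c \<odot>\<^sub>V v : ?S" using v by (auto simp: F mult.commute)
   have "m b (m x v) = a b \<odot>\<^sub>V m x v" if "b : F" for b
   proof -
    have "m b (m x v) = m (m b x) v" using v that F by (simp add: assoc)
    also have "... = m (m x b) v" using that F by (simp add: comm)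
    also have "... = m x (m b v)" using v that F by (simp add: assoc)
    also have "... = a b \<odot>\<^sub>V m x v" using v that by simp
    finally show ?thesis .
   qed
   then show "(\<lambda>v \<in> el V. m x v) v : ?S" using v by auto
   fix w assume "w : ?S"
   then show "v \<oplus>\<^sub>V w : ?S" using v by (auto simp: F fd_distr)
  qed (use v in auto)
  then show ?case by (intro bexI[of _ v']) auto
 qed
 from this[OF B(1) order_refl] obtain v where v [simp]: "v : el V" "v \<noteq> \<zero>\<^sub>V" and vB: "\<And>b. b : B ==> \<exists>a. m b v = a \<odot>\<^sub>V v"
  by blast
 have "\<exists>a. m b v = a \<odot>\<^sub>V v" if "b : el V" for b
  using B(2) that
 proof (rule spanned_induct)
  have "m \<zero>\<^sub>V v = 0 \<odot>\<^sub>V v" using m'(4)[of v v 0] by simp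
  then show "\<exists>a. m \<zero>\<^sub>V v = a \<odot>\<^sub>V v" by blast
  fix b c assume "b : el V" "c : el V" "\<exists>a. m b v = a \<odot>\<^sub>V v" "\<exists>a. m c v = a \<odot>\<^sub>V v"
  then obtain a a' where "m (b \<oplus>\<^sub>V c) v = (a + a') \<odot>\<^sub>V v" by (auto simp: fd_distr)
  then show "\<exists>a. m (b \<oplus>\<^sub>V c) v = a \<odot>\<^sub>V v" by blast
 next
  fix b c assume "b : el V" "\<exists>a. m b v = a \<odot>\<^sub>V v"
  then obtain a where "m (c \<odot>\<^sub>V b) v = (c * a) \<odot>\<^sub>V v" by auto
  then show "\<exists>a. m (c \<odot>\<^sub>V b) v = a \<odot>\<^sub>V v" by blast
 qed (rule vB)
 then obtain \<chi> where \<chi>: "\<And>b. b : el V ==> m b v = \<chi> b \<odot>\<^sub>V v" by metis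
 have inj: "a = b" if "a \<odot>\<^sub>V v = b \<odot>\<^sub>V v" for a b
 proof (rule ccontr)
  assume "a \<noteq> b"
  have "(a - b) \<odot>\<^sub>V v = a \<odot>\<^sub>V v \<oplus>\<^sub>V (-b) \<odot>\<^sub>V v" using fd_distr(2)[OF V v(1), of a "-b"] by simp
  also have "... = (b + (-b)) \<odot>\<^sub>V v" unfolding that by (rule fd_distr(2)[OF V, symmetric]) simp
  also have "... = \<zero>\<^sub>V" by simp
  finally have "(1 / (a - b)) \<odot>\<^sub>V ((a - b) \<odot>\<^sub>V v) = \<zero>\<^sub>V" by simp
  then show False using fd_simps(9)[OF V v(1), of "1 / (a - b)" "a - b"] \<open>a \<noteq> b\<close> by simp
 qed
 show ?thesis
 proof (rule that[of \<chi>])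
  show "\<chi> u = 1" by (rule inj) (simp add: u unit flip: \<chi>)
  fix a b c assume [simp]: "a : el V"
  have "\<chi> (c \<odot>\<^sub>V a) \<odot>\<^sub>V v = m (c \<odot>\<^sub>V a) v" by (rule \<chi>[symmetric]) simp
  also have "... = (c * \<chi> a) \<odot>\<^sub>V v" by (simp add: \<chi>[OF \<open>a : el V\<close>])
  finally show "\<chi> (c \<odot>\<^sub>V a) = c * \<chi> a" by (rule inj)
  assume [simp]: "b : el V"
  show "\<chi> (a \<oplus>\<^sub>V b) = \<chi> a + \<chi> b" by (rule inj) (simp add: fd_distr flip: \<chi>)
  have "\<chi> (m a b) \<odot>\<^sub>V v = m (m a b) v" by (rule \<chi>[symmetric]) simp
  also have "... = m a (m b v)" by (rule assoc) auto
  also have "... = (\<chi> a * \<chi> b) \<odot>\<^sub>V v"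
   by (simp add: \<chi>[OF \<open>a : el V\<close>] \<chi>[OF \<open>b : el V\<close>] mult.commute)
  finally show "\<chi> (m a b) = \<chi> a * \<chi> b" by (rule inj)
 qed
qed

section \<open>Representable functors on a finite groupoid\<close>

lemma lgen_spanned: "spanned V B ==> fd V ==> lgen V B"
 unfolding lgen_def using spanned_ext[of V B] by (auto simp: spanned_def)

lemma lin_finsum:
 assumes "lin V W h" and V [simp]: "fd V" and W [simp]: "fd W" and "finite S" "g : S \<rightarrow> el V"
 shows "h (finsum V g S) = finsum W (\<lambda>s. h (g s)) S"
proof -
 interpret V: vectorspace class_ring V by (rule fd_vs[OF V])
 interpret W: vectorspace class_ring W by (rule fd_vs[OF W])
 have h: "\<And>v. v : el V ==> h v : el W" "\<And>v w. v : el V ==> w : el V ==> h (v \<oplus>\<^sub>V w) = h v \<oplus>\<^sub>W h w"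
  "\<And>a v. v : el V ==> h (a \<odot>\<^sub>V v) = a \<odot>\<^sub>W h v"
  using assms(1) by (auto simp: lin_def)
 have "h \<zero>\<^sub>V = \<zero>\<^sub>W" using h(3)[of "\<zero>\<^sub>V" 0] h(1)[of "\<zero>\<^sub>V"] by simp
 with assms(4,5) show ?thesis
  by (induction S) (auto simp: h Pi_def)
qed

context vec_tensor
begin

text \<open>Linear maps out of a tensor product with a free space.\<close>

lemma free_tensor_lift:
 assumes F: "free_on S V \<delta>" and W [simp]: "fd W" and X [simp]: "fd X" and \<beta>: "\<And>s. s : S ==> lin W X (\<beta> s)"
 obtains h where "h : lin_maps (V \<otimes>\<^sub>V W) X" "\<And>s w. s : S ==> w : el W ==> h (pure V W (\<delta> s) w) = \<beta> s w"
proof -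
 note V [simp] = free_onD(1)[OF F] and \<delta> = free_onD(3)[OF F]
 have gen: "lgen V (\<delta> ` S)" by (rule lgen_spanned[OF free_onD(2)[OF F] V])
 have "\<exists>h \<in> lin_maps V X. \<forall>s \<in> S. h (\<delta> s) = \<beta> s w" if "w : el W" for w
  by (rule free_onD(4)[OF F]) (use that \<beta> in "auto simp: lin_def")
 then obtain L where L: "\<And>w. w : el W ==> L w : lin_maps V X" "\<And>w s. w : el W ==> s : S ==> L w (\<delta> s) = \<beta> s w"
  by metis
 obtain h where "h : lin_maps (V \<otimes>\<^sub>V W) X" "\<And>v w. v : el V ==> w : el W ==> h (pure V W v w) = L w v"
  by (rule family_lift[OF _ _ _ gen L(1)]) (use \<beta> in "auto simp: lin_def L(2)")
 then show ?thesis using that L(2) \<delta> by simp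
qed

end

type_synonym ('g, 'a, 'k, 'v) vfunc = "('g, 'a, ('k, 'v) module, (('k, 'v) module, 'v => 'v) arrow) func"

locale tannaka = V: vec_tensor T + G: finite_two_group G
 for T :: "('k :: {alg_closed_field, field_char_0}, 'v) vec_tensor" and G :: "('g, 'a, 'x) moncat_scheme"
begin

sublocale functor_category G "Vec T" ..

notation cmpG  (infixl \<open>\<circ>\<^sub>G\<close> 68)
notation cmpW  (infixl \<open>\<ast>\<close> 68)
notation cmpD  (infixl \<open>\<circ>\<^sub>D\<close> 68)
notation tens  (infixr \<open>\<boxtimes>\<close> 72)
abbreviation K where "K \<equiv> Ground T"
abbreviation one where "one \<equiv> GUnit T"
abbreviation pure where "pure \<equiv> Pure T"
abbreviation D where "D \<equiv> Vec T"
abbreviation I where "I \<equiv> unit_func G D"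

lemma func_fd [simp]: "func F ==> x : Obj G ==> FO F x : fd_spaces"
 using func_simps(1) by simp

lemma FA_simps [simp]:
 assumes "func F" "b : Arr G"
 shows "asrc (FA F b) = FO F (Src G b)" "atgt (FA F b) = FO F (Tgt G b)"
  "y = Tgt G b ==> v : el (FO F (Src G b)) ==> amap (FA F b) v : el (FO F y)"
 using func_simps(2-4)[OF assms(1)] assms by auto

lemma act_idn [simp]: "func F ==> x : Obj G ==> v : el (FO F x) ==> amap (FA F (Idn G x)) v = v"
 by simp

lemma act_cmp [simp]:
 assumes "func F" "b : Arr G" "c : Arr G" "Src G c = Tgt G b" "v : el (FO F (Src G b))"
 shows "amap (FA F c) (amap (FA F b) v) = amap (FA F (c \<circ>\<^sub>G b)) v"
 using func_cmp[OF assms(1-4)] V.Vec_sel(11)[of v "FA F b" "FA F c"] assms by simp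

lemma act_lin: "func F ==> b : Arr G ==> x = Src G b ==> y = Tgt G b ==> lin (FO F x) (FO F y) (amap (FA F b))"
 by (auto simp: lin_def)

abbreviation ev where "ev \<phi> x v \<equiv> amap (amap \<phi> x) v"

lemma nt_comp [simp]:
 assumes "nt \<phi>" "x : Obj G"
 shows "asrc (amap \<phi> x) = FO (asrc \<phi>) x" "atgt (amap \<phi> x) = FO (atgt \<phi>) x"
  "F = atgt \<phi> ==> v : el (FO (asrc \<phi>) x) ==> ev \<phi> x v : el (FO F x)"
 using nt_simps(3-5)[OF assms] assms by auto

lemma ev_nat:
 assumes "nt \<phi>" "b : Arr G" "x = Src G b" "F = asrc \<phi>" "v : el (FO (asrc \<phi>) x)"
 shows "ev \<phi> (Tgt G b) (amap (FA F b) v) = amap (FA (atgt \<phi>) b) (ev \<phi> x v)"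
proof -
 have "amap (FA (atgt \<phi>) b \<circ>\<^sub>D amap \<phi> x) v = amap (amap \<phi> (Tgt G b) \<circ>\<^sub>D FA (asrc \<phi>) b) v"
  using nt_nat[OF assms(1,2)] assms by simp
 then show ?thesis using assms by simp
qed

lemma ev_lin: "nt \<phi> ==> x : Obj G ==> F = asrc \<phi> ==> F' = atgt \<phi> ==> lin (FO F x) (FO F' x) (ev \<phi> x)"
 by (auto simp: lin_def)

lemma nt_ext:
 assumes "nt \<phi>" "nt \<psi>" "asrc \<phi> = asrc \<psi>" "atgt \<phi> = atgt \<psi>"
  "\<And>x. x : Obj G ==> \<exists>B. lgen (FO (asrc \<phi>) x) B \<and> (\<forall>b \<in> B. ev \<phi> x b = ev \<psi> x b)"
 shows "\<phi> = \<psi>"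
proof (rule nt_eqI[OF assms(1-4)])
 fix x assume x: "x : Obj G"
 then obtain B where B: "lgen (FO (asrc \<phi>) x) B" "\<And>b. b : B ==> ev \<phi> x b = ev \<psi> x b" using assms(5) by blast
 show "amap \<phi> x = amap \<psi> x"
  by (rule V.Vec_eqI_gen[OF B(1)]) (use B(2) x assms(1-4) nt_simps(3) in auto)
qed

text \<open>The transformation with given maps on elements; naturality may be tested on generators.\<close>

definition mkn where
 "mkn F F' h = \<lparr>asrc = F, atgt = F', amap = (\<lambda>x \<in> Obj G. V.arr (FO F x) (FO F' x) (h x))\<rparr>"

lemma mkn_simps [simp]: "asrc (mkn F F' h) = F" "atgt (mkn F F' h) = F'"
 "x : Obj G ==> v : el (FO F x) ==> ev (mkn F F' h) x v = h x v"
 by (auto simp: mkn_def)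

lemma nt_mkn:
 assumes [simp]: "func F" "func F'" and h: "\<And>x. x : Obj G ==> lin (FO F x) (FO F' x) (h x)"
  and nat: "\<And>b. b : Arr G ==> \<exists>B. lgen (FO F (Src G b)) B \<and>
   (\<forall>v \<in> B. amap (FA F' b) (h (Src G b) v) = h (Tgt G b) (amap (FA F b) v))"
 shows "nt (mkn F F' h)"
proof -
 have a: "V.arr (FO F x) (FO F' x) (h x) : Arr D" if "x : Obj G" for x
  using h[OF that] that by (intro V.arr_in) (auto simp: lin_def)
 have n: "amap (FA F' b) (h (Src G b) v) = h (Tgt G b) (amap (FA F b) v)"
  if b [simp]: "b : Arr G" and v: "v : el (FO F (Src G b))" for b v
 proof -
  obtain B where B: "lgen (FO F (Src G b)) B" "\<And>v. v : B ==> amap (FA F' b) (h (Src G b) v) = h (Tgt G b) (amap (FA F b) v)"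
   using nat[OF b] by blast
  have hl: "lin (FO F (Src G b)) (FO F' (Src G b)) (h (Src G b))" "lin (FO F (Tgt G b)) (FO F' (Tgt G b)) (h (Tgt G b))"
   by (auto intro: h)
  show ?thesis
   by (rule lgen_ext[OF B(1) lin_comp[OF hl(1) act_lin] lin_comp[OF act_lin hl(2)] _ _ B(2) v]) auto
 qed
 show ?thesis
 proof (rule ntI)
  fix b assume b [simp]: "b : Arr G"
  show "FA (atgt (mkn F F' h)) b \<circ>\<^sub>D amap (mkn F F' h) (Src G b) = amap (mkn F F' h) (Tgt G b) \<circ>\<^sub>D FA (asrc (mkn F F' h)) b"
   by (rule V.Vec_eqI) (use a func_simps(2) in "auto simp: n mkn_def")
 qed (use a in "auto simp: homs_iff mkn_def")
qed

lemma unit_simps [simp]: "x : Obj G ==> FO I x = K" "b : Arr G ==> FA I b = Idn D K"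
 using tens_simps(3,4) by simp_all

lemma tens_D [simp]: "x : Obj G ==> FO (F \<boxtimes> F') x = FO F x \<otimes>\<^sub>V FO F' x"
 using tens_simps(1) by simp

lemma act_tens [simp]:
 assumes "func F" "func F'" "b : Arr G" "x = Src G b" "v : el (FO F x)" "w : el (FO F' x)"
 shows "amap (FA (F \<boxtimes> F') b) (pure (FO F x) (FO F' x) v w) =
  pure (FO F (Tgt G b)) (FO F' (Tgt G b)) (amap (FA F b) v) (amap (FA F' b) w)"
 using assms func_simps(2) by simp

lemma ev_tens [simp]:
 assumes "nt \<phi>" "nt \<psi>" "x : Obj G" "FO (asrc \<phi>) x = A" "FO (asrc \<psi>) x = B" "v : el A" "w : el B"
 shows "ev (\<phi> \<otimes>\<^sub>W \<psi>) x (pure A B v w) =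
  pure (FO (atgt \<phi>) x) (FO (atgt \<psi>) x) (ev \<phi> x v) (ev \<psi> x w)"
 using assms nt_simps(3) by simp

lemma ev_W [simp]:
 "x : Obj G ==> v : el (FO F x) ==> ev (Idn W F) x v = v"
 "nt \<phi> ==> x : Obj G ==> v : el (FO (asrc \<phi>) x) ==> ev (\<psi> \<ast> \<phi>) x v = ev \<psi> x (ev \<phi> x v)"
 "func F ==> func F' ==> func F'' ==> x : Obj G ==> FO F x = A ==> FO F' x = B ==> FO F'' x = C ==> u : el A ==> v : el B ==> w : el C ==>
  ev (Asc W F F' F'') x (pure (A \<otimes>\<^sub>V B) C (pure A B u v) w) = pure A (B \<otimes>\<^sub>V C) u (pure B C v w)"
 "func F ==> x : Obj G ==> FO F x = A ==> v : el A ==> g : el K ==> ev (Lun W F) x (pure K A g v) = V.coef g \<odot>\<^sub>A v"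
 "func F ==> x : Obj G ==> FO F x = A ==> v : el A ==> g : el K ==> ev (Run W F) x (pure A K v g) = V.coef g \<odot>\<^sub>A v"
 "func F ==> func F' ==> x : Obj G ==> FO F x = A ==> FO F' x = B ==> v : el A ==> w : el B ==>
  ev (Brd W F F') x (pure A B v w) = pure B A w v"
 "nt \<phi> ==> x : Obj G ==> v : el (FO (asrc \<phi>) x) ==> ev (Add W \<phi> \<psi>) x v = ev \<phi> x v \<oplus>\<^bsub>FO (atgt \<phi>) x\<^esub> ev \<psi> x v"
 "nt \<phi> ==> x : Obj G ==> v : el (FO (asrc \<phi>) x) ==> ev (Scl W a \<phi>) x v = a \<odot>\<^bsub>FO (atgt \<phi>) x\<^esub> ev \<phi> x v"
 by auto

text \<open>
 The functor represented by \<open>x\<close>, linearised: the value at \<open>y\<close> is the free space on the arrows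
 from \<open>x\<close> to \<open>y\<close>, with basis element \<open>del f\<close> for the arrow \<open>f\<close>.
\<close>

definition pfree where "pfree x y = (SOME p. free_on (homs G x y) (fst p :: ('k, 'v) module) (snd p))"

abbreviation pr where "pr x y \<equiv> fst (pfree x y)"

definition del where "del f = snd (pfree (Src G f) (Tgt G f)) f"

definition rep where
 "rep x = \<lparr>FO = (\<lambda>y \<in> Obj G. pr x y),
   FA = (\<lambda>b \<in> Arr G. \<lparr>asrc = pr x (Src G b), atgt = pr x (Tgt G b),
    amap = (SOME h. h : lin_maps (pr x (Src G b)) (pr x (Tgt G b)) \<and>
      (\<forall>f \<in> homs G x (Src G b). h (del f) = del (b \<circ>\<^sub>G f)))\<rparr>)\<rparr>"

lemma pfree: "free_on (homs G x y) (pr x y) del"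
proof -
 have "infinite (UNIV :: 'k set)" by (rule infinite_UNIV_char_0)
 then have "\<exists>p :: ('k, 'v) module \<times> ('a => 'v). free_on (homs G x y) (fst p) (snd p)"
  using V.ex_free_on[OF _ G.finite_homs[of x y]] by auto
 then have "free_on (homs G x y) (pr x y) (snd (pfree x y))"
  unfolding pfree_def by (rule someI_ex)
 moreover have "snd (pfree x y) f = del f" if "f : homs G x y" for f
  using that by (auto simp: del_def homs_iff)
 ultimately show ?thesis by (simp add: free_on_def cong: image_cong_simp)
qed

lemma rep_FO [simp]: "y : Obj G ==> FO (rep x) y = pr x y"
 by (simp add: rep_def)

lemma pfree_fd [simp]: "pr x y : fd_spaces"
 using free_onD(1)[OF pfree] .

lemma del_in [simp]: "f : Arr G ==> x = Src G f ==> y = Tgt G f ==> del f : el (pr x y)"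
 using free_onD(3)[OF pfree, of f] by (simp add: homs_iff)

lemma lgen_del: "lgen (pr x y) (del ` homs G x y)"
 by (rule lgen_spanned[OF free_onD(2)[OF pfree]]) simp

lemma rep_FA:
 assumes "b : Arr G"
 shows "FA (rep x) b : Arr D" "asrc (FA (rep x) b) = pr x (Src G b)" "atgt (FA (rep x) b) = pr x (Tgt G b)"
  "f : homs G x (Src G b) ==> amap (FA (rep x) b) (del f) = del (b \<circ>\<^sub>G f)"
proof -
 have "\<exists>h. h : lin_maps (pr x (Src G b)) (pr x (Tgt G b)) \<and>
   (\<forall>f \<in> homs G x (Src G b). h (del f) = del (b \<circ>\<^sub>G f))"
  using free_onD(4)[OF pfree[of x "Src G b"], of "pr x (Tgt G b)" "\<lambda>f. del (b \<circ>\<^sub>G f)"] assms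
  by (auto simp: homs_iff)
 from someI_ex[OF this] show "FA (rep x) b : Arr D" "asrc (FA (rep x) b) = pr x (Src G b)" "atgt (FA (rep x) b) = pr x (Tgt G b)"
  "f : homs G x (Src G b) ==> amap (FA (rep x) b) (del f) = del (b \<circ>\<^sub>G f)"
  using assms unfolding V.Vec_Arr by (auto simp: rep_def)
qed

lemma func_rep [simp]: "func (rep x)"
proof (rule funcI)
 fix b assume "b : Arr G"
 then show "FA (rep x) b : homs D (FO (rep x) (Src G b)) (FO (rep x) (Tgt G b))"
  using rep_FA by (simp add: homs_iff)
next
 fix y assume y [simp]: "y : Obj G"
 show "FA (rep x) (Idn G y) = Idn D (FO (rep x) y)"
  by (rule V.Vec_eqI_gen[OF lgen_del[of x y]])
   (use rep_FA[where b = "Idn G y" and x = x] in "auto simp: homs_iff")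
next
 fix b c assume b [simp]: "b : Arr G" "c : Arr G" "Src G c = Tgt G b"
 show "FA (rep x) (c \<circ>\<^sub>G b) = FA (rep x) c \<circ>\<^sub>D FA (rep x) b"
  by (rule V.Vec_eqI_gen[OF lgen_del[of x "Src G b"]])
   (use rep_FA[where b = b and x = x] rep_FA[where b = c and x = x] rep_FA[where b = "c \<circ>\<^sub>G b" and x = x]
    in "auto simp: homs_iff G.assoc")
qed (auto simp: rep_def)

lemma act_del [simp]:
 "b : Arr G ==> f : Arr G ==> Src G f = x ==> Tgt G f = Src G b ==> amap (FA (rep x) b) (del f) = del (b \<circ>\<^sub>G f)"
 using rep_FA(4)[of b f x] by (simp add: homs_iff)

text \<open>The Yoneda lemma: an element \<open>v\<close> of \<open>F x\<close> is the same as a transformation \<open>hat v\<close> from \<open>rep x\<close> to \<open>F\<close>.\<close>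

lemma rep_ext:
 assumes "nt \<phi>" "nt \<psi>" "asrc \<phi> = rep x" "asrc \<psi> = rep x" "atgt \<phi> = atgt \<psi>" "x : Obj G"
  "ev \<phi> x (del (Idn G x)) = ev \<psi> x (del (Idn G x))"
 shows "\<phi> = \<psi>"
proof (rule nt_ext)
 fix y assume y: "y : Obj G"
 have "ev \<phi> y (del f) = ev \<psi> y (del f)" if "f : homs G x y" for f
  using ev_nat[of \<phi> f x "rep x" "del (Idn G x)"] ev_nat[of \<psi> f x "rep x" "del (Idn G x)"] assms that
  by (auto simp: homs_iff)
 then show "\<exists>B. lgen (FO (asrc \<phi>) y) B \<and> (\<forall>b\<in>B. ev \<phi> y b = ev \<psi> y b)"
  using y assms lgen_del[of x y] by (intro exI[of _ "del ` homs G x y"]) auto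
qed (use assms in auto)

lemma ex_hat:
 assumes x [simp]: "x : Obj G" and F [simp]: "func F" and v: "v : el (FO F x)"
 shows "\<exists>\<phi>. nt \<phi> \<and> asrc \<phi> = rep x \<and> atgt \<phi> = F \<and> (\<forall>f \<in> Arr G. Src G f = x --> ev \<phi> (Tgt G f) (del f) = amap (FA F f) v)"
proof -
 have "\<exists>h. h : lin_maps (pr x y) (FO F y) \<and> (\<forall>f \<in> homs G x y. h (del f) = amap (FA F f) v)" if "y : Obj G" for y
  using free_onD(4)[OF pfree[of x y], of "FO F y" "\<lambda>f. amap (FA F f) v"] v that by (auto simp: homs_iff)
 then obtain h where h: "\<And>y. y : Obj G ==> h y : lin_maps (pr x y) (FO F y)"
  "\<And>y f. y : Obj G ==> f : homs G x y ==> h y (del f) = amap (FA F f) v" by metis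
 have h' [simp]: "h y (del f) = amap (FA F f) v" if "f : Arr G" "Src G f = x" "Tgt G f = y" for f y
  using h(2)[of y f] that by (auto simp: homs_iff)
 have "nt (mkn (rep x) F h)"
 proof (rule nt_mkn)
  fix b assume b [simp]: "b : Arr G"
  show "\<exists>B. lgen (FO (rep x) (Src G b)) B \<and> (\<forall>v\<in>B. amap (FA F b) (h (Src G b) v) = h (Tgt G b) (amap (FA (rep x) b) v))"
   using lgen_del[of x "Src G b"] v by (intro exI[of _ "del ` homs G x (Src G b)"]) (auto simp: homs_iff)
 qed (use h(1) in "auto intro: lin_mapsD'")
 then show ?thesis by (intro exI[of _ "mkn (rep x) F h"]) auto
qed

definition hat where
 "hat x F v = (SOME \<phi>. nt \<phi> \<and> asrc \<phi> = rep x \<and> atgt \<phi> = F \<and> (\<forall>f \<in> Arr G. Src G f = x --> ev \<phi> (Tgt G f) (del f) = amap (FA F f) v))"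

lemma hat [simp]:
 assumes "x : Obj G" "func F" "v : el (FO F x)"
 shows "nt (hat x F v)" "asrc (hat x F v) = rep x" "atgt (hat x F v) = F"
  "f : Arr G ==> Src G f = x ==> y = Tgt G f ==> ev (hat x F v) y (del f) = amap (FA F f) v"
 using someI_ex[OF ex_hat[OF assms]] unfolding hat_def[symmetric] by auto

text \<open>
 More generally a linear map \<open>l\<close> from \<open>F x\<close> to \<open>F' x\<close>, natural or not, is the same as a
 transformation from \<open>rep x \<boxtimes> F\<close> to \<open>F'\<close>: it sends \<open>del f \<otimes> w\<close> to \<open>F'(f) (l (F(f\<inverse>) w))\<close>.
\<close>

lemma act_rep_tens:
 assumes "func F" "b : Arr G" "g : Arr G" "Tgt G g = Src G b" "w : el (FO F (Src G b))"
 shows "amap (FA (rep (Src G g) \<boxtimes> F) b) (pure (fst (pfree (Src G g) (Src G b))) (FO F (Src G b)) (del g) w)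
  = pure (fst (pfree (Src G g) (Tgt G b))) (FO F (Tgt G b)) (del (b \<circ>\<^sub>G g)) (amap (FA F b) w)"
proof -
 have d: "del g : el (FO (rep (Src G g)) (Src G b))" using assms by simp
 have e: "amap (FA (rep (Src G g)) b) (del g) = del (b \<circ>\<^sub>G g)" using assms by simp
 have o: "Src G b : Obj G" "Tgt G b : Obj G" using assms by auto
 show ?thesis
  using act_tens[OF func_rep assms(1,2) refl d assms(5)] unfolding e rep_FO[OF o(1)] rep_FO[OF o(2)] .
qed

lemma rep_tens_ext:
 assumes "nt \<phi>" "nt \<psi>" "asrc \<phi> = rep x \<boxtimes> F" "asrc \<psi> = rep x \<boxtimes> F" "atgt \<phi> = atgt \<psi>" "x : Obj G" and F [simp]: "func F"
  and e: "\<And>w. w : el (FO F x) ==> ev \<phi> x (pure (pr x x) (FO F x) (del (Idn G x)) w) =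
    ev \<psi> x (pure (pr x x) (FO F x) (del (Idn G x)) w)"
 shows "\<phi> = \<psi>"
proof (rule nt_ext)
 note [simp] = assms(1-6)
 fix y assume y [simp]: "y : Obj G"
 have "ev \<phi> y (pure (pr x y) (FO F y) (del f) w) = ev \<psi> y (pure (pr x y) (FO F y) (del f) w)"
  if "f : homs G x y" and w [simp]: "w : el (FO F y)" for f w
 proof -
  note f [simp] = that(1)[unfolded homs_iff]
  let ?t = "pure (pr x x) (FO F x) (del (Idn G x)) (amap (FA F (inv_arr G f)) w)"
  have a: "amap (FA F (inv_arr G f)) w : el (FO F x)" by simp
  have p: "amap (FA F f) (amap (FA F (inv_arr G f)) w) = w" by (subst act_cmp) auto
  have "amap (FA (rep x \<boxtimes> F) f) ?t = pure (pr x y) (FO F y) (del f) w"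
   using act_rep_tens[of F f "Idn G x" "amap (FA F (inv_arr G f)) w"] a p by simp
  moreover have t: "?t : el (FO (rep x \<boxtimes> F) x)" using a by simp
  ultimately show ?thesis
   using ev_nat[of \<phi> f x "rep x \<boxtimes> F" ?t] ev_nat[of \<psi> f x "rep x \<boxtimes> F" ?t] e[OF a]
   by (simp only: assms(1-5) f)
 qed
 then show "\<exists>B. lgen (FO (asrc \<phi>) y) B \<and> (\<forall>b\<in>B. ev \<phi> y b = ev \<psi> y b)"
  using V.lgen_tensor[OF _ _ lgen_del[of x y] lgen_carrier[of "FO F y"]]
  by (intro exI[of _ "{pure (pr x y) (FO F y) b c |b c. b : del ` homs G x y \<and> c : el (FO F y)}"]) auto
qed (use assms in auto)

lemma ex_TL:
 assumes x [simp]: "x : Obj G" and F [simp]: "func F" "func F'" and l: "lin (FO F x) (FO F' x) l"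
 shows "\<exists>\<phi>. nt \<phi> \<and> asrc \<phi> = rep x \<boxtimes> F \<and> atgt \<phi> = F' \<and> (\<forall>f \<in> Arr G. \<forall>w \<in> el (FO F (Tgt G f)). Src G f = x -->
  ev \<phi> (Tgt G f) (pure (fst (pfree x (Tgt G f))) (FO F (Tgt G f)) (del f) w) = amap (FA F' f) (l (amap (FA F (inv_arr G f)) w)))"
proof -
 have l' [simp]: "\<And>v. v : el (FO F x) ==> l v : el (FO F' x)" using l by (auto simp: lin_def)
 have "\<exists>h. h : lin_maps (pr x y \<otimes>\<^sub>V FO F y) (FO F' y) \<and> (\<forall>f \<in> homs G x y. \<forall>w \<in> el (FO F y).
   h (pure (pr x y) (FO F y) (del f) w) = amap (FA F' f) (l (amap (FA F (inv_arr G f)) w)))" if y [simp]: "y : Obj G" for y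
 proof -
  have \<beta>: "lin (FO F y) (FO F' y) (\<lambda>w. amap (FA F' f) (l (amap (FA F (inv_arr G f)) w)))" if "f : homs G x y" for f
   by (rule lin_comp[OF lin_comp[OF act_lin l] act_lin]) (use that in "auto simp: homs_iff")
  obtain h where "h : lin_maps (pr x y \<otimes>\<^sub>V FO F y) (FO F' y)"
   "\<And>f w. f : homs G x y ==> w : el (FO F y) ==>
    h (pure (pr x y) (FO F y) (del f) w) = amap (FA F' f) (l (amap (FA F (inv_arr G f)) w))"
   by (rule V.free_tensor_lift[OF pfree, where W = "FO F y" and X = "FO F' y"
     and \<beta> = "\<lambda>f w. amap (FA F' f) (l (amap (FA F (inv_arr G f)) w))"])
    (use \<beta> in auto)
  then show ?thesis by blast
 qed
 then obtain h where h: "\<And>y. y : Obj G ==> h y : lin_maps (pr x y \<otimes>\<^sub>V FO F y) (FO F' y)"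
  "\<And>y f w. y : Obj G ==> f : homs G x y ==> w : el (FO F y) ==>
   h y (pure (pr x y) (FO F y) (del f) w) = amap (FA F' f) (l (amap (FA F (inv_arr G f)) w))" by metis
 have "nt (mkn (rep x \<boxtimes> F) F' h)"
 proof (rule nt_mkn)
  fix b assume b [simp]: "b : Arr G"
  let ?B = "{pure (pr x (Src G b)) (FO F (Src G b)) d c |d c. d : del ` homs G x (Src G b) \<and> c : el (FO F (Src G b))}"
  have "amap (FA F' b) (h (Src G b) (pure (pr x (Src G b)) (FO F (Src G b)) (del f) w)) =
    h (Tgt G b) (amap (FA (rep x \<boxtimes> F) b) (pure (pr x (Src G b)) (FO F (Src G b)) (del f) w))"
   if f: "f : homs G x (Src G b)" and w [simp]: "w : el (FO F (Src G b))" for f w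
  proof -
   note f' [simp] = f[unfolded homs_iff]
   have i: "inv_arr G (b \<circ>\<^sub>G f) \<circ>\<^sub>G b = inv_arr G f" by (simp add: G.inv_cmp G.assoc)
   have "amap (FA (rep x \<boxtimes> F) b) (pure (pr x (Src G b)) (FO F (Src G b)) (del f) w)
     = pure (pr x (Tgt G b)) (FO F (Tgt G b)) (del (b \<circ>\<^sub>G f)) (amap (FA F b) w)"
    using act_rep_tens[of F b f w] by simp
   moreover have "b \<circ>\<^sub>G f : homs G x (Tgt G b)" by (simp add: homs_iff)
   ultimately show ?thesis using f by (simp add: h(2) i)
  qed
  then have "\<forall>v\<in>?B. amap (FA F' b) (h (Src G b) v) = h (Tgt G b) (amap (FA (rep x \<boxtimes> F) b) v)" by blast
  moreover have "lgen (FO (rep x \<boxtimes> F) (Src G b)) ?B"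
   using V.lgen_tensor[OF _ _ lgen_del[of x "Src G b"] lgen_carrier[of "FO F (Src G b)"]] by simp
  ultimately show "\<exists>B. lgen (FO (rep x \<boxtimes> F) (Src G b)) B \<and> (\<forall>v\<in>B. amap (FA F' b) (h (Src G b) v) = h (Tgt G b) (amap (FA (rep x \<boxtimes> F) b) v))"
   by blast
 qed (use h in "auto intro: lin_mapsD'")
 then show ?thesis using h(2) by (intro exI[of _ "mkn (rep x \<boxtimes> F) F' h"]) (auto simp: homs_iff)
qed

definition TL where
 "TL x F F' l = (SOME \<phi>. nt \<phi> \<and> asrc \<phi> = rep x \<boxtimes> F \<and> atgt \<phi> = F' \<and> (\<forall>f \<in> Arr G. \<forall>w \<in> el (FO F (Tgt G f)). Src G f = x -->
  ev \<phi> (Tgt G f) (pure (fst (pfree x (Tgt G f))) (FO F (Tgt G f)) (del f) w) = amap (FA F' f) (l (amap (FA F (inv_arr G f)) w))))"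

lemma TL:
 assumes "x : Obj G" "func F" "func F'" "lin (FO F x) (FO F' x) l"
 shows "nt (TL x F F' l)" "asrc (TL x F F' l) = rep x \<boxtimes> F" "atgt (TL x F F' l) = F'"
  "f : Arr G ==> Src G f = x ==> y = Tgt G f ==> w : el (FO F y) ==>
   ev (TL x F F' l) y (pure (pr x y) (FO F y) (del f) w) = amap (FA F' f) (l (amap (FA F (inv_arr G f)) w))"
  "w : el (FO F x) ==> ev (TL x F F' l) x (pure (pr x x) (FO F x) (del (Idn G x)) w) = l w"
proof -
 have *: "nt (TL x F F' l)" "asrc (TL x F F' l) = rep x \<boxtimes> F" "atgt (TL x F F' l) = F'"
  "\<And>f y w. f : Arr G ==> Src G f = x ==> y = Tgt G f ==> w : el (FO F y) ==>
   ev (TL x F F' l) y (pure (pr x y) (FO F y) (del f) w) = amap (FA F' f) (l (amap (FA F (inv_arr G f)) w))"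
  using someI_ex[OF ex_TL[OF assms]] unfolding TL_def[symmetric] by auto
 show "nt (TL x F F' l)" "asrc (TL x F F' l) = rep x \<boxtimes> F" "atgt (TL x F F' l) = F'"
  "f : Arr G ==> Src G f = x ==> y = Tgt G f ==> w : el (FO F y) ==>
   ev (TL x F F' l) y (pure (pr x y) (FO F y) (del f) w) = amap (FA F' f) (l (amap (FA F (inv_arr G f)) w))"
  by (rule * ; assumption?)+
 show "w : el (FO F x) ==> ev (TL x F F' l) x (pure (pr x x) (FO F x) (del (Idn G x)) w) = l w"
  using *(4)[of "Idn G x" x w] assms by (auto simp: lin_def)
qed

end

section \<open>Fibre functors are evaluation functors\<close>

lemma finsum_const_fd:
 assumes V [simp]: "fd V" and a [simp]: "a : el V" and "finite S"
 shows "finsum V (\<lambda>_. a) S = of_nat (card S) \<odot>\<^sub>V a"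
proof -
 interpret vectorspace class_ring V by (rule fd_vs[OF V])
 show ?thesis using assms(3)
 proof (induction S)
  case (insert s S)
  have "finsum V (\<lambda>_. a) (insert s S) = a \<oplus>\<^sub>V of_nat (card S) \<odot>\<^sub>V a"
   using insert by (simp add: M.finsum_insert)
  also have "... = (1 + of_nat (card S)) \<odot>\<^sub>V a" by (simp add: fd_distr)
  finally show ?case using insert by simp
 qed simp
qed

lemma lin_zero: "lin V W h ==> fd V ==> fd W ==> h \<zero>\<^sub>V = \<zero>\<^sub>W"
proof -
 assume h: "lin V W h" and [simp]: "fd V" "fd W"
 have "\<zero>\<^sub>V : el V" by simp
 with h have "h (0 \<odot>\<^sub>V \<zero>\<^sub>V) = 0 \<odot>\<^sub>W h \<zero>\<^sub>V" "h \<zero>\<^sub>V : el W" unfolding lin_def by blast+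
 then show ?thesis by simp
qed

lemma linD:
 assumes "lin V W f"
 shows "v : el V ==> f v : el W"
  "v : el V ==> w : el V ==> f (v \<oplus>\<^sub>V w) = f v \<oplus>\<^sub>W f w"
  "v : el V ==> f (a \<odot>\<^sub>V v) = a \<odot>\<^sub>W f v"
 using assms by (auto simp: lin_def)

lemma linI:
 assumes "\<And>v. v : el V ==> f v : el W"
  "\<And>v w. v : el V ==> w : el V ==> f (v \<oplus>\<^sub>V w) = f v \<oplus>\<^sub>W f w"
  "\<And>a v. v : el V ==> f (a \<odot>\<^sub>V v) = a \<odot>\<^sub>W f v"
 shows "lin V W f"
 using assms by (auto simp: lin_def)

context vec_tensor
begin

lemma pure_zero [simp]:
 assumes [simp]: "fd V" "fd W"
 shows "w : el W ==> pure V W \<zero>\<^sub>V w = \<zero>\<^bsub>V \<otimes>\<^sub>V W\<^esub>" "v : el V ==> pure V W v \<zero>\<^sub>W = \<zero>\<^bsub>V \<otimes>\<^sub>V W\<^esub>"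
 using pure_simps(4)[of V W "\<zero>\<^sub>V" w 0] pure_simps(5)[of V W v "\<zero>\<^sub>W" 0]
 by (auto simp del: pure_simps(4,5))

end

context tannaka
begin

lemmas finite_homs [simp] = G.finite_homs

lemma tens_fd [simp]: "func F ==> func F' ==> x : Obj G ==> FO F x \<otimes>\<^sub>V FO F' x : fd_spaces"
 by simp

lemma ev_zero [simp]:
 assumes "nt \<phi>" "x : Obj G" "FO (asrc \<phi>) x = A"
 shows "ev \<phi> x \<zero>\<^sub>A = \<zero>\<^bsub>FO (atgt \<phi>) x\<^esub>"
 unfolding assms(3)[symmetric] by (rule lin_zero[OF ev_lin[OF assms(1,2) refl refl]]) (use assms in auto)

lemma act_zero [simp]:
 assumes "func F" "b : Arr G" "FO F (Src G b) = A"
 shows "amap (FA F b) \<zero>\<^sub>A = \<zero>\<^bsub>FO F (Tgt G b)\<^esub>"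
 unfolding assms(3)[symmetric] by (rule lin_zero[OF act_lin[OF assms(1,2) refl refl]]) (use assms in auto)

lemma nt_inv_asc [simp]:
 assumes "func F" "func F'" "func F''"
 shows "nt (inv_arr W (Asc W F F' F''))" "asrc (inv_arr W (Asc W F F' F'')) = F \<boxtimes> (F' \<boxtimes> F'')"
  "atgt (inv_arr W (Asc W F F' F'')) = (F \<boxtimes> F') \<boxtimes> F''"
 using W.inv_simps[OF W.asc_simps(4)[of F F' F'']] assms by auto

lemma ev_inv_asc [simp]:
 assumes [simp]: "func F" "func F'" "func F''" "x : Obj G" "u : el (FO F x)" "v : el (FO F' x)" "w : el (FO F'' x)"
  and A: "FO F x = A" "FO F' x = B" "FO F'' x = C"
 shows "ev (inv_arr W (Asc W F F' F'')) x (pure A (B \<otimes>\<^sub>V C) u (pure B C v w)) = pure (A \<otimes>\<^sub>V B) C (pure A B u v) w"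
proof -
 let ?t = "pure (FO F x \<otimes>\<^sub>V FO F' x) (FO F'' x) (pure (FO F x) (FO F' x) u v) w"
 have "ev (inv_arr W (Asc W F F' F'') \<ast> Asc W F F' F'') x ?t = ?t"
  using W.inv_simps(4)[OF W.asc_simps(4)[of F F' F'']] by simp
 then show ?thesis unfolding A[symmetric] by (subst (asm) ev_W(2)) auto
qed

lemma card_homs:
 assumes "f : Arr G" "Src G f = x" "Tgt G f = y"
 shows "card (homs G x y) = card (homs G x x)"
proof (rule bij_betw_same_card[symmetric], rule bij_betwI[where f = "\<lambda>g. f \<circ>\<^sub>G g" and g = "\<lambda>g. inv_arr G f \<circ>\<^sub>G g"])
qed (use assms in "auto simp: homs_iff")

text \<open>
 The identity of the unit functor is a combination of transformations that factor through the
 representable functors: on the component of \<open>x\<close>, the composite \<open>I \<rightarrow> rep x \<rightarrow> I\<close> below is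
 multiplication by the order of the automorphism group of \<open>x\<close>, which is invertible in
 characteristic zero, and there are finitely many components.
\<close>

definition uni where
 "uni x = mkn I (rep x) (\<lambda>y g. V.coef g \<odot>\<^bsub>pr x y\<^esub> finsum (pr x y) del (homs G x y))"

lemma sum_del_in [simp]: "finsum (pr x y) del (homs G x y) : el (pr x y)"
proof -
 interpret V: vectorspace class_ring "pr x y" by (rule fd_vs) simp
 show ?thesis by (rule V.M.finsum_closed) (auto simp: homs_iff)
qed

lemma uni [simp]:
 shows "nt (uni x)" "asrc (uni x) = I" "atgt (uni x) = rep x"
  "y : Obj G ==> ev (uni x) y one = finsum (pr x y) del (homs G x y)"
proof -
 show "nt (uni x)"
  unfolding uni_def
 proof (rule nt_mkn)
  fix y assume "y : Obj G"
  then show "lin (FO I y) (FO (rep x) y) (\<lambda>g. V.coef g \<odot>\<^bsub>pr x y\<^esub> finsum (pr x y) del (homs G x y))"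
   by (auto simp: lin_def fd_distr)
 next
  fix b assume b [simp]: "b : Arr G"
  interpret Y: vectorspace class_ring "fst (pfree x (Src G b))" by (rule fd_vs) simp
  interpret Z: vectorspace class_ring "fst (pfree x (Tgt G b))" by (rule fd_vs) simp
  have "amap (FA (rep x) b) (finsum (fst (pfree x (Src G b))) del (homs G x (Src G b))) =
   finsum (fst (pfree x (Tgt G b))) (\<lambda>f. amap (FA (rep x) b) (del f)) (homs G x (Src G b))"
   by (rule lin_finsum) (use act_lin[of "rep x" b] in "auto simp: homs_iff")
  also have "... = finsum (fst (pfree x (Tgt G b))) (\<lambda>f. del (b \<circ>\<^sub>G f)) (homs G x (Src G b))"
   by (rule Z.M.finsum_cong') (auto simp: homs_iff)
  also have "... = finsum (fst (pfree x (Tgt G b))) del ((\<lambda>f. b \<circ>\<^sub>G f) ` homs G x (Src G b))"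
   by (rule Z.M.finsum_reindex[symmetric])
    (auto simp: homs_iff inj_on_def dest: G.iso_cancel_left)
  also have "(\<lambda>f. b \<circ>\<^sub>G f) ` homs G x (Src G b) = homs G x (Tgt G b)"
  proof (intro equalityI subsetI)
   fix f assume "f : homs G x (Tgt G b)"
   then show "f : (\<lambda>f. b \<circ>\<^sub>G f) ` homs G x (Src G b)"
    by (intro image_eqI[of _ _ "inv_arr G b \<circ>\<^sub>G f"]) (auto simp: homs_iff)
  qed (auto simp: homs_iff)
  finally have "amap (FA (rep x) b) (finsum (fst (pfree x (Src G b))) del (homs G x (Src G b))) =
    finsum (fst (pfree x (Tgt G b))) del (homs G x (Tgt G b))" .
  then show "\<exists>B. lgen (FO I (Src G b)) B \<and>
    (\<forall>v\<in>B. amap (FA (rep x) b) (V.coef v \<odot>\<^bsub>fst (pfree x (Src G b))\<^esub> finsum (fst (pfree x (Src G b))) del (homs G x (Src G b))) =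
     V.coef (amap (FA I b) v) \<odot>\<^bsub>fst (pfree x (Tgt G b))\<^esub> finsum (fst (pfree x (Tgt G b))) del (homs G x (Tgt G b)))"
   by (intro exI[of _ "el K"]) (auto simp: lgen_carrier linD(3)[OF act_lin])
 qed auto
 show "asrc (uni x) = I" "atgt (uni x) = rep x"
  "y : Obj G ==> ev (uni x) y one = finsum (pr x y) del (homs G x y)"
  by (auto simp: uni_def)
qed

abbreviation eps where "eps x \<equiv> hat x I one"

lemma ev_eps_uni:
 assumes [simp]: "x : Obj G" "y : Obj G"
 shows "ev (eps x \<ast> uni x) y one = of_nat (card (homs G x y)) \<odot>\<^sub>K one"
proof -
 interpret K: vectorspace class_ring K by (rule fd_vs) simp
 have "ev (eps x) y (finsum (pr x y) del (homs G x y)) = finsum K (\<lambda>f. ev (eps x) y (del f)) (homs G x y)"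
  by (rule lin_finsum[where V = "pr x y"]) (use ev_lin[of "eps x" y "rep x" I] in "auto simp: homs_iff")
 also have "... = finsum K (\<lambda>f. one) (homs G x y)"
  by (rule K.M.finsum_cong') (auto simp: homs_iff)
 also have "... = of_nat (card (homs G x y)) \<odot>\<^sub>K one" by (rule finsum_const_fd) auto
 finally show ?thesis by simp
qed

text \<open>
 For a union \<open>S\<close> of isomorphism classes this is the projection of the unit functor onto its part
 supported on \<open>S\<close>.
\<close>

definition ind where "ind S = mkn I I (\<lambda>y g. if y : S then g else \<zero>\<^sub>K)"

lemma ind [simp]:
 assumes "\<And>b. b : Arr G ==> Src G b : S \<longleftrightarrow> Tgt G b : S"
 shows "nt (ind S)"
 unfolding ind_def
proof (rule nt_mkn)
 fix b assume [simp]: "b : Arr G"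
 show "\<exists>B. lgen (FO I (Src G b)) B \<and> (\<forall>v\<in>B. amap (FA I b) (if Src G b : S then v else \<zero>\<^sub>K) = (if Tgt G b : S then amap (FA I b) v else \<zero>\<^sub>K))"
  using assms by (intro exI[of _ "el K"]) (auto simp: lgen_carrier)
qed (auto simp: lin_def)

lemma ind_simps [simp]: "asrc (ind S) = I" "atgt (ind S) = I"
 "y : Obj G ==> g : el K ==> ev (ind S) y g = (if y : S then g else \<zero>\<^sub>K)"
 by (auto simp: ind_def)

lemma iso_rel_iff: "(x, y) : iso_rel G \<longleftrightarrow> (\<exists>f \<in> Arr G. Src G f = x \<and> Tgt G f = y)"
 unfolding iso_rel_def by (auto simp: isos_iff) (metis ex_in_conv isos_iff G.arr_iso)

lemma equiv_iso_rel: "equiv (Obj G) (iso_rel G)"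
proof (rule equivI)
 show "iso_rel G \<subseteq> Obj G \<times> Obj G" by (auto simp: iso_rel_def)
 show "refl_on (Obj G) (iso_rel G)"
 proof (rule refl_onI)
  fix x assume "x : Obj G"
  then show "(x, x) : iso_rel G" unfolding iso_rel_iff by (intro bexI[of _ "Idn G x"]) auto
 qed
 show "sym (iso_rel G)"
 proof (rule symI)
  fix x y assume "(x, y) : iso_rel G"
  then obtain f where "f : Arr G" "Src G f = x" "Tgt G f = y" by (auto simp: iso_rel_iff)
  then show "(y, x) : iso_rel G" unfolding iso_rel_iff by (intro bexI[of _ "inv_arr G f"]) auto
 qed
 show "trans (iso_rel G)"
 proof (rule transI)
  fix x y z assume "(x, y) : iso_rel G" "(y, z) : iso_rel G"
  then obtain f g where "f : Arr G" "Src G f = x" "Tgt G f = y" "g : Arr G" "Src G g = y" "Tgt G g = z"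
   by (auto simp: iso_rel_iff)
  then show "(x, z) : iso_rel G" unfolding iso_rel_iff by (intro bexI[of _ "g \<circ>\<^sub>G f"]) auto
 qed
qed

lemma ind_class:
 assumes x [simp]: "x : Obj G"
 shows "ind (iso_rel G `` {x}) = Scl W (1 / of_nat (card (homs G x x))) (eps x \<ast> uni x)"
proof (rule nt_ext)
 have sat: "Src G b : iso_rel G `` {x} \<longleftrightarrow> Tgt G b : iso_rel G `` {x}" if "b : Arr G" for b
 proof -
  have "(Src G b, Tgt G b) : iso_rel G" using that by (auto simp: iso_rel_iff)
  then show ?thesis using equiv_iso_rel by (auto simp: equiv_def dest: symD transD)
 qed
 then show "nt (ind (iso_rel G `` {x}))" by simp
 have "Idn G x : homs G x x" by (simp add: homs_iff)
 then have n: "card (homs G x x) \<noteq> 0" using G.finite_homs[of x x] by auto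
 fix y assume y [simp]: "y : Obj (G :: ('g, 'a, 'x) moncat_scheme)"
 have "card (homs G x y) = (if y : iso_rel G `` {x} then card (homs G x x) else 0)"
 proof (cases "homs G x y = {}")
  case True
  then have "y \<notin> iso_rel G `` {x}" by (auto simp: iso_rel_iff homs_iff)
  then show ?thesis using True by simp
 next
  case False
  then obtain f where "f : homs G x y" by blast
  then have f: "f : Arr G" "Src G f = x" "Tgt G f = y" by (auto simp: homs_iff)
  then have "y : iso_rel G `` {x}" by (auto simp: iso_rel_iff)
  then show ?thesis using card_homs[OF f] by simp
 qed
 then have "ev (ind (iso_rel G `` {x})) y one = ev (Scl W (1 / of_nat (card (homs G x x))) (eps x \<ast> uni x)) y one"
  using n ev_eps_uni[OF x y] by simp
 then show "\<exists>B. lgen (FO (asrc (ind (iso_rel G `` {x}))) y) B \<and>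
   (\<forall>b\<in>B. ev (ind (iso_rel G `` {x})) y b = ev (Scl W (1 / of_nat (card (homs G x x))) (eps x \<ast> uni x)) y b)"
  by (intro exI[of _ "{one}"]) (auto simp: V.lgen_ground)
qed auto

end

text \<open>
 A fibre functor on the functor category, given by its action on elements: \<open>mu\<close> exhibits
 \<open>Om (F \<boxtimes> F')\<close> as a tensor product of \<open>Om F\<close> and \<open>Om F'\<close>, and \<open>io\<close> is a basis of the value at
 the unit.
\<close>

locale fibre_functor = tannaka T G
 for T :: "('k :: {alg_closed_field, field_char_0}, 'v) vec_tensor" and G :: "('g, 'a, 'x) moncat_scheme" +
 fixes Om :: "('g, 'a, 'k, 'v) vfunc => ('k, 'v) module"
  and M :: "(('g, 'a, 'k, 'v) vfunc, 'g => (('k, 'v) module, 'v => 'v) arrow) arrow => 'v => 'v"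
  and mu :: "('g, 'a, 'k, 'v) vfunc =>
   ('g, 'a, 'k, 'v) vfunc => 'v => 'v => 'v"
  and io :: 'v
 assumes Om_fd [simp]: "func F ==> Om F : fd_spaces"
  and M_lin: "nt \<phi> ==> lin (Om (asrc \<phi>)) (Om (atgt \<phi>)) (M \<phi>)"
  and M_idn [simp]: "func F ==> v : el (Om F) ==> M (Idn W F) v = v"
  and M_cmp: "nt \<phi> ==> nt \<psi> ==> asrc \<psi> = atgt \<phi> ==> v : el (Om (asrc \<phi>)) ==> M (\<psi> \<ast> \<phi>) v = M \<psi> (M \<phi> v)"
  and M_add: "nt \<phi> ==> nt \<psi> ==> asrc \<psi> = asrc \<phi> ==> atgt \<psi> = atgt \<phi> ==> v : el (Om (asrc \<phi>)) ==>
   M (Add W \<phi> \<psi>) v = M \<phi> v \<oplus>\<^bsub>Om (atgt \<phi>)\<^esub> M \<psi> v"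
  and M_scl: "nt \<phi> ==> v : el (Om (asrc \<phi>)) ==> M (Scl W a \<phi>) v = a \<odot>\<^bsub>Om (atgt \<phi>)\<^esub> M \<phi> v"
  and mu_bilin: "func F ==> func F' ==> bilin (Om F) (Om F') (Om (F \<boxtimes> F')) (mu F F')"
  and mu_ext: "func F ==> func F' ==> fd X ==> lin (Om (F \<boxtimes> F')) X h ==> lin (Om (F \<boxtimes> F')) X h' ==>
   (\<And>v w. v : el (Om F) ==> w : el (Om F') ==> h (mu F F' v w) = h' (mu F F' v w)) ==>
   t : el (Om (F \<boxtimes> F')) ==> h t = h' t"
  and mu_lift: "func F ==> func F' ==> fd X ==> bilin (Om F) (Om F') X b ==>
   \<exists>h. lin (Om (F \<boxtimes> F')) X h \<and> (\<forall>v \<in> el (Om F). \<forall>w \<in> el (Om F'). h (mu F F' v w) = b v w)"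
  and mu_nat: "nt \<phi> ==> nt \<psi> ==> v : el (Om (asrc \<phi>)) ==> w : el (Om (asrc \<psi>)) ==>
   M (\<phi> \<otimes>\<^sub>W \<psi>) (mu (asrc \<phi>) (asrc \<psi>) v w) = mu (atgt \<phi>) (atgt \<psi>) (M \<phi> v) (M \<psi> w)"
  and mu_asc: "func F ==> func F' ==> func F'' ==> u : el (Om F) ==> v : el (Om F') ==> w : el (Om F'') ==>
   M (Asc W F F' F'') (mu (F \<boxtimes> F') F'' (mu F F' u v) w) = mu F (F' \<boxtimes> F'') u (mu F' F'' v w)"
  and mu_lun: "func F ==> v : el (Om F) ==> M (Lun W F) (mu I F io v) = v"
  and mu_run: "func F ==> v : el (Om F) ==> M (Run W F) (mu F I v io) = v"
  and mu_brd: "func F ==> func F' ==> v : el (Om F) ==> w : el (Om F') ==>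
   M (Brd W F F') (mu F F' v w) = mu F' F w v"
  and io [simp]: "io : el (Om I)" "io \<noteq> \<zero>\<^bsub>Om I\<^esub>"
  and io_span: "t : el (Om I) ==> \<exists>a. t = a \<odot>\<^bsub>Om I\<^esub> io"
begin

lemma M_simps [simp]:
 assumes "nt \<phi>"
 shows "F = atgt \<phi> ==> v : el (Om (asrc \<phi>)) ==> M \<phi> v : el (Om F)"
  "F = asrc \<phi> ==> v : el (Om (asrc \<phi>)) ==> w : el (Om (asrc \<phi>)) ==> M \<phi> (v \<oplus>\<^bsub>Om F\<^esub> w) = M \<phi> v \<oplus>\<^bsub>Om (atgt \<phi>)\<^esub> M \<phi> w"
  "F = asrc \<phi> ==> v : el (Om (asrc \<phi>)) ==> M \<phi> (a \<odot>\<^bsub>Om F\<^esub> v) = a \<odot>\<^bsub>Om (atgt \<phi>)\<^esub> M \<phi> v"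
  "F = asrc \<phi> ==> M \<phi> \<zero>\<^bsub>Om F\<^esub> = \<zero>\<^bsub>Om (atgt \<phi>)\<^esub>"
 using linD[OF M_lin[OF assms]] lin_zero[OF M_lin[OF assms]] assms by auto

lemma mu_simps [simp]:
 assumes "func F" "func F'"
 shows "v : el (Om F) ==> w : el (Om F') ==> mu F F' v w : el (Om (F \<boxtimes> F'))"
  "v : el (Om F) ==> v' : el (Om F) ==> w : el (Om F') ==>
   mu F F' (v \<oplus>\<^bsub>Om F\<^esub> v') w = mu F F' v w \<oplus>\<^bsub>Om (F \<boxtimes> F')\<^esub> mu F F' v' w"
  "v : el (Om F) ==> w : el (Om F') ==> w' : el (Om F') ==>
   mu F F' v (w \<oplus>\<^bsub>Om F'\<^esub> w') = mu F F' v w \<oplus>\<^bsub>Om (F \<boxtimes> F')\<^esub> mu F F' v w'"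
  "v : el (Om F) ==> w : el (Om F') ==> mu F F' (a \<odot>\<^bsub>Om F\<^esub> v) w = a \<odot>\<^bsub>Om (F \<boxtimes> F')\<^esub> mu F F' v w"
  "v : el (Om F) ==> w : el (Om F') ==> mu F F' v (a \<odot>\<^bsub>Om F'\<^esub> w) = a \<odot>\<^bsub>Om (F \<boxtimes> F')\<^esub> mu F F' v w"
 using mu_bilin[OF assms] by (auto simp: bilin_def)

lemma M_inv_asc:
 assumes [simp]: "func F" "func F'" "func F''" "u : el (Om F)" "v : el (Om F')" "w : el (Om F'')"
 shows "M (inv_arr W (Asc W F F' F'')) (mu F (F' \<boxtimes> F'') u (mu F' F'' v w)) = mu (F \<boxtimes> F') F'' (mu F F' u v) w"
proof -
 let ?t = "mu (F \<boxtimes> F') F'' (mu F F' u v) w"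
 have "M (inv_arr W (Asc W F F' F'') \<ast> Asc W F F' F'') ?t = ?t"
  using W.inv_simps(4)[OF W.asc_simps(4)[of F F' F'']] by simp
 then show ?thesis by (subst (asm) M_cmp) (auto simp: mu_asc)
qed

lemma mu_nat':
 assumes "nt \<phi>" "nt \<psi>" "asrc \<phi> = F" "asrc \<psi> = F'" "v : el (Om F)" "w : el (Om F')"
 shows "M (\<phi> \<otimes>\<^sub>W \<psi>) (mu F F' v w) = mu (atgt \<phi>) (atgt \<psi>) (M \<phi> v) (M \<psi> w)"
 using mu_nat[of \<phi> \<psi> v w] assms by simp

text \<open>
 Were all values at representable functors zero, every \<open>ind\<close> of a class, factoring through one of them,
 would act as zero. Their sum is the identity of the unit functor, whose value contains \<open>io\<close>.
\<close>

lemma ex_nonzero: "\<exists>x \<in> Obj G. \<exists>v \<in> el (Om (rep x)). v \<noteq> \<zero>\<^bsub>Om (rep x)\<^esub>"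
proof (rule ccontr)
 assume "\<not> ?thesis"
 then have N: "v = \<zero>\<^bsub>Om (rep x)\<^esub>" if "x : Obj G" "v : el (Om (rep x))" for x v using that by blast
 have cls: "M (ind c) io = \<zero>\<^bsub>Om I\<^esub>" if "c : Obj G // iso_rel G" for c
 proof -
  obtain x where x: "x : Obj G" "c = iso_rel G `` {x}"
   using \<open>c : Obj G // iso_rel G\<close> by (rule quotientE)
  have "M (uni x) io = \<zero>\<^bsub>Om (rep x)\<^esub>" by (rule N[OF x(1)]) simp
  then show ?thesis unfolding x(2) ind_class[OF x(1)] using x by (simp add: M_scl M_cmp)
 qed
 have sat: "Src G b : \<Union>C \<longleftrightarrow> Tgt G b : \<Union>C" if "C \<subseteq> Obj G // iso_rel G" "b : Arr G" for C b
 proof -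
  have b: "(Src G b, Tgt G b) : iso_rel G" using that by (auto simp: iso_rel_iff)
  have "Src G b : c \<longleftrightarrow> Tgt G b : c" if "c : Obj G // iso_rel G" for c
   using that b equiv_iso_rel by (auto simp: quotient_def equiv_def dest: symD transD)
  then show ?thesis using that(1) by blast
 qed
 have "M (ind (\<Union>C)) io = \<zero>\<^bsub>Om I\<^esub>" if "finite C" "C \<subseteq> Obj G // iso_rel G" for C
  using that
 proof (induction C)
  case empty
  have "ind {} = Scl W 0 (Idn W I)"
   by (rule nt_ext) (auto intro!: exI[of _ "{one}"] simp: V.lgen_ground)
  then show ?case by (simp add: M_scl)
 next
  case (insert c C)
  have c: "nt (ind c)" "nt (ind (\<Union>C))" "nt (ind (\<Union>(insert c C)))"
   using sat[of "{c}"] sat[of C] sat[of "insert c C"] insert by auto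
  have disj: "y \<notin> c" if "y : \<Union>C" for y
   using that insert quotient_disj[OF equiv_iso_rel] by blast
  have "ind (\<Union>(insert c C)) = Add W (ind c) (ind (\<Union>C))"
   by (rule nt_ext) (use c disj in \<open>auto intro!: exI[of _ "{one}"] simp: V.lgen_ground\<close>)
  then show ?case using c insert cls[of c] by (simp add: M_add)
 qed
 from this[OF G.finite_pi1 order_refl] have "M (ind (Obj G)) io = \<zero>\<^bsub>Om I\<^esub>"
  by (simp add: Union_quotient[OF equiv_iso_rel])
 moreover have "ind (Obj G) = Idn W I"
  by (rule nt_ext) (auto intro!: exI[of _ "{one}"] simp: V.lgen_ground)
 ultimately show False using M_idn[of I io] by simp
qed

end

section \<open>The Frobenius algebra of a representable functor\<close>

context tannaka
begin

text \<open>
 The representable functor \<open>rep x\<close> is an algebra under pointwise multiplication of functions on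
 arrows, with basis idempotents \<open>del f\<close>, and a coalgebra with group-like elements \<open>del f\<close>.
\<close>

definition prj where
 "prj x = (SOME h. lin (pr x x) (pr x x) h \<and>
   (\<forall>g \<in> homs G x x. h (del g) = (if g = Idn G x then del g else \<zero>\<^bsub>pr x x\<^esub>)))"

lemma prj:
 shows "lin (pr x x) (pr x x) (prj x)"
  "g : homs G x x ==> prj x (del g) = (if g = Idn G x then del g else \<zero>\<^bsub>pr x x\<^esub>)"
proof -
 have "\<exists>h \<in> lin_maps (pr x x) (pr x x).
   \<forall>g \<in> homs G x x. h (del g) = (if g = Idn G x then del g else \<zero>\<^bsub>pr x x\<^esub>)"
  by (rule free_onD(4)[OF pfree]) (auto simp: homs_iff)
 then have "\<exists>h. lin (pr x x) (pr x x) h \<and>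
   (\<forall>g \<in> homs G x x. h (del g) = (if g = Idn G x then del g else \<zero>\<^bsub>pr x x\<^esub>))"
  using lin_mapsD' by blast
 from someI_ex[OF this] show "lin (pr x x) (pr x x) (prj x)"
  "g : homs G x x ==> prj x (del g) = (if g = Idn G x then del g else \<zero>\<^bsub>pr x x\<^esub>)"
  unfolding prj_def[symmetric] by auto
qed

definition mlt where "mlt x = TL x (rep x) (rep x) (prj x)"

lemma mlt [simp]:
 assumes "x : Obj G"
 shows "nt (mlt x)" "asrc (mlt x) = rep x \<boxtimes> rep x" "atgt (mlt x) = rep x"
  "f : Arr G ==> g : Arr G ==> Src G f = x ==> Src G g = x ==> Tgt G f = y ==> Tgt G g = y ==>
   ev (mlt x) y (pure (pr x y) (pr x y) (del f) (del g)) = (if f = g then del f else \<zero>\<^bsub>pr x y\<^esub>)"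
proof -
 have l: "lin (FO (rep x) x) (FO (rep x) x) (prj x)" using prj(1) assms by simp
 note t = TL[OF assms func_rep func_rep l, folded mlt_def]
 show "nt (mlt x)" "asrc (mlt x) = rep x \<boxtimes> rep x" "atgt (mlt x) = rep x" by (rule t)+
 assume [simp]: "f : Arr G" "g : Arr G" "Src G f = x" "Src G g = x" "Tgt G f = y" "Tgt G g = y"
 have x: "x : Obj G" "y : Obj G" using G.src_in[of f] G.tgt_in[of f] by auto
 have iff: "inv_arr G f \<circ>\<^sub>G g = Idn G x \<longleftrightarrow> f = g"
 proof
  assume "inv_arr G f \<circ>\<^sub>G g = Idn G x"
  then have "f \<circ>\<^sub>G (inv_arr G f \<circ>\<^sub>G g) = f \<circ>\<^sub>G Idn G x" by simp
  then show "f = g" by simp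
 qed auto
 have "ev (mlt x) y (pure (pr x y) (FO (rep x) y) (del f) (del g)) = amap (FA (rep x) f) (prj x (amap (FA (rep x) (inv_arr G f)) (del g)))"
  by (rule t(4)) (use x in auto)
 also have "amap (FA (rep x) (inv_arr G f)) (del g) = del (inv_arr G f \<circ>\<^sub>G g)" by simp
 also have "prj x (del (inv_arr G f \<circ>\<^sub>G g)) = (if f = g then del (Idn G x) else \<zero>\<^bsub>pr x x\<^esub>)"
  using prj(2)[of "inv_arr G f \<circ>\<^sub>G g" x] iff by (simp add: homs_iff)
 finally show "ev (mlt x) y (pure (pr x y) (pr x y) (del f) (del g)) = (if f = g then del f else \<zero>\<^bsub>pr x y\<^esub>)"
  using x by simp
qed

definition dia where
 "dia x = hat x (rep x \<boxtimes> rep x) (pure (pr x x) (pr x x) (del (Idn G x)) (del (Idn G x)))"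

lemma dia [simp]:
 assumes "x : Obj G"
 shows "nt (dia x)" "asrc (dia x) = rep x" "atgt (dia x) = rep x \<boxtimes> rep x"
  "f : Arr G ==> Src G f = x ==> Tgt G f = y ==>
   ev (dia x) y (del f) = pure (pr x y) (pr x y) (del f) (del f)"
proof -
 have v: "pure (pr x x) (pr x x) (del (Idn G x)) (del (Idn G x)) : el (FO (rep x \<boxtimes> rep x) x)"
  using assms by simp
 note h = hat[OF assms func_tens[OF func_rep func_rep] v, folded dia_def]
 show "nt (dia x)" "asrc (dia x) = rep x" "atgt (dia x) = rep x \<boxtimes> rep x" by (rule h)+
 assume f: "f : Arr G" "Src G f = x" "Tgt G f = y"
 have "ev (dia x) y (del f) = amap (FA (rep x \<boxtimes> rep x) f) (pure (pr x x) (pr x x) (del (Idn G x)) (del (Idn G x)))"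
  by (rule h(4)) (use f in auto)
 also have "... = pure (pr x y) (pr x y) (del f) (del f)"
  using act_rep_tens[of "rep x" f "Idn G x" "del (Idn G x)"] f assms G.tgt_in[of f] by simp
 finally show "ev (dia x) y (del f) = pure (pr x y) (pr x y) (del f) (del f)" .
qed

text \<open>
 Transformations out of tensor powers of \<open>rep x\<close> are compared on tensors of basis elements.
\<close>

lemma lgen_PP: "lgen (pr x y \<otimes>\<^sub>V pr x y)
  {pure (pr x y) (pr x y) b c |b c. b : del ` homs G x y \<and> c : del ` homs G x y}"
 by (rule V.lgen_tensor[OF _ _ lgen_del lgen_del]) auto

lemma PP_ext:
 assumes "nt \<phi>" "nt \<psi>" "asrc \<phi> = rep x \<boxtimes> rep x" "asrc \<psi> = rep x \<boxtimes> rep x" "atgt \<phi> = atgt \<psi>"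
  "\<And>f g y. f : Arr G ==> g : Arr G ==> Src G f = x ==> Src G g = x ==> Tgt G f = y ==> Tgt G g = y ==> y : Obj G ==>
   ev \<phi> y (pure (pr x y) (pr x y) (del f) (del g)) = ev \<psi> y (pure (pr x y) (pr x y) (del f) (del g))"
 shows "\<phi> = \<psi>"
proof (rule nt_ext[OF assms(1,2)])
 fix y assume y: "y : Obj G"
 show "\<exists>B. lgen (FO (asrc \<phi>) y) B \<and> (\<forall>b\<in>B. ev \<phi> y b = ev \<psi> y b)"
  using lgen_PP[of x y] assms(3,6) y by (intro exI[of _ "{pure (pr x y) (pr x y) b c |b c. b : del ` homs G x y \<and> c : del ` homs G x y}"])
   (auto simp: homs_iff)
qed (use assms in auto)

lemma PPP_ext:
 assumes "nt \<phi>" "nt \<psi>" "asrc \<phi> = (rep x \<boxtimes> rep x) \<boxtimes> rep x" "asrc \<psi> = (rep x \<boxtimes> rep x) \<boxtimes> rep x" "atgt \<phi> = atgt \<psi>"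
  "\<And>f g h y. f : Arr G ==> g : Arr G ==> h : Arr G ==> Src G f = x ==> Src G g = x ==> Src G h = x ==>
   Tgt G f = y ==> Tgt G g = y ==> Tgt G h = y ==> y : Obj G ==>
   ev \<phi> y (pure (pr x y \<otimes>\<^sub>V pr x y) (pr x y) (pure (pr x y) (pr x y) (del f) (del g)) (del h)) =
   ev \<psi> y (pure (pr x y \<otimes>\<^sub>V pr x y) (pr x y) (pure (pr x y) (pr x y) (del f) (del g)) (del h))"
 shows "\<phi> = \<psi>"
proof (rule nt_ext[OF assms(1,2)])
 fix y assume y: "y : Obj G"
 have "lgen ((pr x y \<otimes>\<^sub>V pr x y) \<otimes>\<^sub>V pr x y)
   {pure (pr x y \<otimes>\<^sub>V pr x y) (pr x y) b c |b c.
    b : {pure (pr x y) (pr x y) b c |b c. b : del ` homs G x y \<and> c : del ` homs G x y} \<and> c : del ` homs G x y}"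
  (is "lgen _ ?B")
  by (rule V.lgen_tensor[OF _ _ lgen_PP lgen_del]) auto
 then show "\<exists>B. lgen (FO (asrc \<phi>) y) B \<and> (\<forall>b\<in>B. ev \<phi> y b = ev \<psi> y b)"
  using assms(3,6) y by (intro exI[of _ ?B]) (auto simp: homs_iff)
qed (use assms in auto)

lemma mlt_dia:
 assumes [simp]: "x : Obj G"
 shows "mlt x \<ast> dia x = Idn W (rep x)"
 by (rule rep_ext[of _ _ x]) auto

lemma mlt_comm:
 assumes [simp]: "x : Obj G"
 shows "mlt x \<ast> Brd W (rep x) (rep x) = mlt x"
 by (rule PP_ext[of _ _ x]) auto

lemma mlt_assoc:
 assumes [simp]: "x : Obj G"
 shows "mlt x \<ast> (mlt x \<otimes>\<^sub>W Idn W (rep x)) = mlt x \<ast> ((Idn W (rep x) \<otimes>\<^sub>W mlt x) \<ast> Asc W (rep x) (rep x) (rep x))"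
 by (rule PPP_ext[of _ _ x]) auto

text \<open>
 The unit for pointwise multiplication is the constant function 1, the sum of all \<open>del f\<close>.
\<close>

lemma mlt_uni:
 assumes x [simp]: "x : Obj G"
 shows "mlt x \<ast> ((Idn W (rep x) \<otimes>\<^sub>W uni x) \<ast> inv_arr W (Run W (rep x))) = Idn W (rep x)"
proof (rule rep_ext[of _ _ x])
 let ?X = "pr x x"
 have l1: "lin ?X (?X \<otimes>\<^sub>V ?X) (pure ?X ?X (del (Idn G x)))" by (rule linI) simp_all
 have l2: "lin (?X \<otimes>\<^sub>V ?X) ?X (ev (mlt x) x)" using ev_lin[OF mlt(1)[OF x] x refl refl] by simp
 have l3: "lin ?X ?X (\<lambda>w. ev (mlt x) x (pure ?X ?X (del (Idn G x)) w))" by (rule lin_comp[OF l1 l2])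
 interpret X: vectorspace class_ring "pr x x" by (rule fd_vs) simp
 have i: "nt (inv_arr W (Run W (rep x)))" "asrc (inv_arr W (Run W (rep x))) = rep x" "atgt (inv_arr W (Run W (rep x))) = rep x \<boxtimes> I"
  using W.inv_simps[OF W.run_simps(4)[of "rep x"]] by auto
 have "ev (inv_arr W (Run W (rep x)) \<ast> Run W (rep x)) x (pure ?X K (del (Idn G x)) one) = pure ?X K (del (Idn G x)) one"
  using W.inv_simps(4)[OF W.run_simps(4)[of "rep x"]] by simp
 then have r: "ev (inv_arr W (Run W (rep x))) x (del (Idn G x)) = pure ?X K (del (Idn G x)) one"
  by (subst (asm) ev_W(2)) auto
 from l3 have "ev (mlt x) x (pure ?X ?X (del (Idn G x)) (finsum ?X del (homs G x x)))
   = finsum ?X (\<lambda>f. ev (mlt x) x (pure ?X ?X (del (Idn G x)) (del f))) (homs G x x)"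
  by (rule lin_finsum[where h = "\<lambda>w. ev (mlt x) x (pure ?X ?X (del (Idn G x)) w)"]) (auto simp: homs_iff)
 also have "... = finsum ?X (\<lambda>f. if Idn G x = f then del f else \<zero>\<^sub>?X) (homs G x x)"
  by (rule X.M.finsum_cong') (auto simp: homs_iff)
 also have "... = del (Idn G x)"
  by (rule X.M.finsum_singleton) (auto simp: homs_iff)
 finally show "ev (mlt x \<ast> ((Idn W (rep x) \<otimes>\<^sub>W uni x) \<ast> inv_arr W (Run W (rep x)))) x (del (Idn G x)) = ev (Idn W (rep x)) x (del (Idn G x))"
  using i r by simp
qed (use W.inv_simps[OF W.run_simps(4)[of "rep x"]] in auto)

text \<open>Multiplication by an element on either tensor factor.\<close>

definition ml1 where
 "ml1 x = (mlt x \<otimes>\<^sub>W Idn W (rep x)) \<ast> inv_arr W (Asc W (rep x) (rep x) (rep x))"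

definition ml2 where
 "ml2 x = (Idn W (rep x) \<otimes>\<^sub>W mlt x) \<ast> (Asc W (rep x) (rep x) (rep x) \<ast>
   ((Brd W (rep x) (rep x) \<otimes>\<^sub>W Idn W (rep x)) \<ast> inv_arr W (Asc W (rep x) (rep x) (rep x))))"

lemma ml [simp]:
 assumes "x : Obj G"
 shows "nt (ml1 x)" "asrc (ml1 x) = rep x \<boxtimes> (rep x \<boxtimes> rep x)" "atgt (ml1 x) = rep x \<boxtimes> rep x"
  "nt (ml2 x)" "asrc (ml2 x) = rep x \<boxtimes> (rep x \<boxtimes> rep x)" "atgt (ml2 x) = rep x \<boxtimes> rep x"
 using assms by (auto simp: ml1_def ml2_def)

lemma frobenius:
 assumes x [simp]: "x : Obj G"
 shows "dia x \<ast> mlt x = ml1 x \<ast> (Idn W (rep x) \<otimes>\<^sub>W dia x)"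
  "dia x \<ast> mlt x = ml2 x \<ast> (Idn W (rep x) \<otimes>\<^sub>W dia x)"
 by (rule PP_ext[of _ _ x]; auto simp: ml1_def ml2_def)+

lemma counit:
 assumes [simp]: "x : Obj G"
 shows "Lun W (rep x) \<ast> ((eps x \<otimes>\<^sub>W Idn W (rep x)) \<ast> dia x) = Idn W (rep x)"
 by (rule rep_ext[of _ _ x]) auto

end

context fibre_functor
begin

text \<open>
 A nonzero value \<open>B\<close> of the fibre functor at \<open>rep x\<close> contains a group-like element: \<open>B\<close> is a
 commutative algebra, so it has a character \<open>\<chi>\<close>, and \<open>e = (\<chi> \<otimes> id)(\<Delta> 1)\<close> is the corresponding
 idempotent, \<open>b e = \<chi>(b) e\<close>. The Frobenius relation \<open>\<Delta>(b c) = b \<Delta>(c)\<close>, in either factor, turns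
 this into \<open>\<Delta> e = e \<otimes> e\<close>.
\<close>

lemma ex_grouplike:
 assumes x [simp]: "x : Obj G" and v: "v : el (Om (rep x))" "v \<noteq> \<zero>\<^bsub>Om (rep x)\<^esub>"
 obtains e where "e : el (Om (rep x))" "M (dia x) e = mu (rep x) (rep x) e e" "M (eps x) e = io"
proof -
 let ?P = "rep x" and ?B = "Om (rep x)" and ?BB = "Om (rep x \<boxtimes> rep x)"
 let ?m = "mu (rep x) (rep x)"
 define m where "m b c = M (mlt x) (?m b c)" for b c
 define u where "u = M (uni x) io"
 have m_in [simp]: "m b c : el ?B" if "b : el ?B" "c : el ?B" for b c
  using that by (simp add: m_def)
 have u_in [simp]: "u : el ?B" by (simp add: u_def)
 have m_bilin: "bilin ?B ?B ?B m" by (auto simp: bilin_def m_def)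
 have comm: "m b c = m c b" if [simp]: "b : el ?B" "c : el ?B" for b c
 proof -
  have "M (mlt x \<ast> Brd W ?P ?P) (?m b c) = m c b" by (simp add: M_cmp mu_brd m_def)
  then show ?thesis unfolding mlt_comm[OF x] by (simp add: m_def)
 qed
 have assoc: "m (m a b) c = m a (m b c)" if [simp]: "a : el ?B" "b : el ?B" "c : el ?B" for a b c
 proof -
  have "M (mlt x \<ast> (mlt x \<otimes>\<^sub>W Idn W ?P)) (mu (?P \<boxtimes> ?P) ?P (?m a b) c) = m (m a b) c"
   by (simp add: M_cmp mu_nat' m_def)
  moreover have "M (mlt x \<ast> ((Idn W ?P \<otimes>\<^sub>W mlt x) \<ast> Asc W ?P ?P ?P)) (mu (?P \<boxtimes> ?P) ?P (?m a b) c) = m a (m b c)"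
   by (simp add: M_cmp mu_nat' mu_asc m_def)
  ultimately show ?thesis unfolding mlt_assoc[OF x] by simp
 qed
 have unit': "m a u = a" if [simp]: "a : el ?B" for a
 proof -
  have i: "nt (inv_arr W (Run W ?P))" "asrc (inv_arr W (Run W ?P)) = ?P" "atgt (inv_arr W (Run W ?P)) = ?P \<boxtimes> I"
   using W.inv_simps[OF W.run_simps(4)[of ?P]] by auto
  have "M (inv_arr W (Run W ?P) \<ast> Run W ?P) (mu ?P I a io) = mu ?P I a io"
   using W.inv_simps(4)[OF W.run_simps(4)[of ?P]] by simp
  then have r: "M (inv_arr W (Run W ?P)) a = mu ?P I a io"
   by (subst (asm) M_cmp) (auto simp: i mu_run)
  have "M (mlt x \<ast> ((Idn W ?P \<otimes>\<^sub>W uni x) \<ast> inv_arr W (Run W ?P))) a = m a u"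
   using i by (simp add: M_cmp r mu_nat' m_def u_def)
  then show ?thesis unfolding mlt_uni[OF x] by simp
 qed
 have unit: "m u a = a" if "a : el ?B" for a using comm[of u a] unit'[of a] that by simp
 have u0: "u \<noteq> \<zero>\<^sub>?B"
 proof
  assume "u = \<zero>\<^sub>?B"
  then have "v = m (0 \<odot>\<^sub>?B u) v" using unit[OF v(1)] by simp
  also have "... = 0 \<odot>\<^sub>?B m u v" using m_bilin v(1) u_in unfolding bilin_def by blast
  finally show False using v by simp
 qed
 obtain \<chi> where \<chi>: "\<chi> u = 1" "\<And>a b. a : el ?B ==> b : el ?B ==> \<chi> (m a b) = \<chi> a * \<chi> b"
  "\<And>a b. a : el ?B ==> b : el ?B ==> \<chi> (a \<oplus>\<^sub>?B b) = \<chi> a + \<chi> b"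
  "\<And>a c. a : el ?B ==> \<chi> (c \<odot>\<^sub>?B a) = c * \<chi> a"
  by (rule ex_character[OF _ m_bilin u_in u0 comm assoc unit]) simp_all
 note m_simps [simp] = m_bilin[unfolded bilin_def, rule_format, THEN conjunct2, THEN conjunct1, rule_format]
  m_bilin[unfolded bilin_def, rule_format, THEN conjunct2, THEN conjunct2, THEN conjunct1, rule_format]
  m_bilin[unfolded bilin_def, rule_format, THEN conjunct2, THEN conjunct2, THEN conjunct2, rule_format, THEN conjunct1]
  m_bilin[unfolded bilin_def, rule_format, THEN conjunct2, THEN conjunct2, THEN conjunct2, rule_format, THEN conjunct2]
 have "bilin ?B ?B ?B (\<lambda>c d. \<chi> c \<odot>\<^sub>?B d)"
  by (auto simp: bilin_def \<chi> fd_distr mult.commute)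
 from mu_lift[OF _ _ _ this] obtain R where R: "lin ?BB ?B R"
  "\<And>c d. c : el ?B ==> d : el ?B ==> R (?m c d) = \<chi> c \<odot>\<^sub>?B d" by auto
 note R_simps [simp] = linD[OF R(1)]
 define L1 where "L1 b t = M (ml1 x) (mu ?P (?P \<boxtimes> ?P) b t)" for b t
 define L2 where "L2 b t = M (ml2 x) (mu ?P (?P \<boxtimes> ?P) b t)" for b t
 have L1_mu: "L1 b (?m c d) = ?m (m b c) d" if [simp]: "b : el ?B" "c : el ?B" "d : el ?B" for b c d
  by (simp add: L1_def ml1_def M_cmp M_inv_asc mu_nat' m_def)
 have L2_mu: "L2 b (?m c d) = ?m c (m b d)" if [simp]: "b : el ?B" "c : el ?B" "d : el ?B" for b c d
  by (simp add: L2_def ml2_def M_cmp M_inv_asc mu_nat' mu_asc mu_brd m_def)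
 have L_lin: "lin ?BB ?BB (L1 b)" "lin ?BB ?BB (L2 b)" if "b : el ?B" for b
  using that by (auto simp: lin_def L1_def L2_def)
 have dia_m: "M (dia x) (m b c) = L1 b (M (dia x) c)" "M (dia x) (m b c) = L2 b (M (dia x) c)"
  if [simp]: "b : el ?B" "c : el ?B" for b c
 proof -
  have "M (dia x \<ast> mlt x) (?m b c) = M (dia x) (m b c)" by (simp add: M_cmp m_def)
  moreover have "M (ml1 x \<ast> (Idn W ?P \<otimes>\<^sub>W dia x)) (?m b c) = L1 b (M (dia x) c)"
   "M (ml2 x \<ast> (Idn W ?P \<otimes>\<^sub>W dia x)) (?m b c) = L2 b (M (dia x) c)"
   by (simp_all add: M_cmp mu_nat' L1_def L2_def)
  ultimately show "M (dia x) (m b c) = L1 b (M (dia x) c)" "M (dia x) (m b c) = L2 b (M (dia x) c)"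
   using frobenius[OF x] by simp_all
 qed
 have mR: "m b (R t) = R (L2 b t)" if [simp]: "b : el ?B" "t : el ?BB" for b t
  by (rule mu_ext[of ?P ?P ?B "\<lambda>t. m b (R t)" "\<lambda>t. R (L2 b t)"])
   (auto simp: R L2_mu intro!: lin_comp[OF L_lin(2) R(1)] linI)
 have \<chi>R: "\<chi> b \<odot>\<^sub>?B R t = R (L1 b t)" if [simp]: "b : el ?B" "t : el ?BB" for b t
  by (rule mu_ext[of ?P ?P ?B "\<lambda>t. \<chi> b \<odot>\<^sub>?B R t" "\<lambda>t. R (L1 b t)"])
   (auto simp: R L1_mu \<chi> fd_distr mult.commute intro!: lin_comp[OF L_lin(1) R(1)] linI)
 have \<chi>R': "\<chi> (R t) \<odot>\<^sub>?B u = \<chi> (M (mlt x) t) \<odot>\<^sub>?B u" if [simp]: "t : el ?BB" for t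
  by (rule mu_ext[of ?P ?P ?B "\<lambda>t. \<chi> (R t) \<odot>\<^sub>?B u" "\<lambda>t. \<chi> (M (mlt x) t) \<odot>\<^sub>?B u"])
   (auto simp: R \<chi> fd_distr m_def[symmetric] intro!: linI)
 define e where "e = R (M (dia x) u)"
 have e_in [simp]: "e : el ?B" by (simp add: e_def)
 have be: "m b e = \<chi> b \<odot>\<^sub>?B e" if [simp]: "b : el ?B" for b
 proof -
  have "m b e = R (M (dia x) (m b u))" by (simp add: e_def mR dia_m(2))
  also have "... = \<chi> b \<odot>\<^sub>?B e" by (simp add: e_def \<chi>R dia_m(1) del: unit')
  finally show ?thesis .
 qed
 have \<chi>e: "\<chi> e = 1"
 proof -
  have "M (mlt x) (M (dia x) u) = M (mlt x \<ast> dia x) u" by (simp add: M_cmp)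
  then have "M (mlt x) (M (dia x) u) = u" unfolding mlt_dia[OF x] by simp
  then have "\<chi> (\<chi> e \<odot>\<^sub>?B u) = \<chi> (\<chi> u \<odot>\<^sub>?B u)" using \<chi>R'[of "M (dia x) u"] by (simp add: e_def)
  then show ?thesis by (simp add: \<chi>)
 qed
 have LL: "L1 e (L2 e t) = \<chi> (R t) \<odot>\<^bsub>?BB\<^esub> ?m e e" if [simp]: "t : el ?BB" for t
 proof (rule mu_ext[of ?P ?P ?BB "\<lambda>t. L1 e (L2 e t)" "\<lambda>t. \<chi> (R t) \<odot>\<^bsub>?BB\<^esub> ?m e e"])
  fix c d assume [simp]: "c : el ?B" "d : el ?B"
  have "m e c = \<chi> c \<odot>\<^sub>?B e" "m e d = \<chi> d \<odot>\<^sub>?B e" by (simp_all add: comm[of e] be)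
  then show "L1 e (L2 e (?m c d)) = \<chi> (R (?m c d)) \<odot>\<^bsub>?BB\<^esub> ?m e e" by (simp add: L1_mu L2_mu R \<chi> linD(3)[OF L_lin(1)[OF e_in]] mult.commute)
 qed (auto simp: \<chi> fd_distr intro!: lin_comp[OF L_lin(2) L_lin(1)] linI)
 have "M (dia x) e = M (dia x) (m e (m e u))" by (simp add: unit' be \<chi>e)
 also have "... = L1 e (L2 e (M (dia x) u))" by (simp only: dia_m(1)[OF e_in m_in[OF e_in u_in]] dia_m(2)[OF e_in u_in])
 also have "... = ?m e e" using LL[of "M (dia x) u"] \<chi>e by (simp add: e_def[symmetric])
 finally have dia_e: "M (dia x) e = ?m e e" .
 obtain a where a: "M (eps x) e = a \<odot>\<^bsub>Om I\<^esub> io" using io_span[of "M (eps x) e"] by auto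
 have "M (Idn W ?P) e = M (Lun W ?P \<ast> ((eps x \<otimes>\<^sub>W Idn W ?P) \<ast> dia x)) e"
  by (simp only: counit[OF x])
 then have "e = M (Lun W ?P) (mu I ?P (M (eps x) e) e)" by (simp add: M_cmp dia_e mu_nat')
 also have "... = a \<odot>\<^sub>?B e" by (simp add: a mu_lun)
 finally have "\<chi> e = a * \<chi> e" using \<chi>(4)[OF e_in, of a] by simp
 then have "M (eps x) e = io" using a \<chi>e by simp
 with dia_e show ?thesis using that[of e] by simp
qed

text \<open>
 A group-like element \<open>e\<close> of \<open>Om (rep x)\<close> identifies the fibre functor with evaluation at \<open>x\<close>,
 by \<open>theta v = Om (hat v) e\<close>. More generally every linear map \<open>l\<close> from \<open>F x\<close> to \<open>F' x\<close>, natural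
 or not, induces a map from \<open>Om F\<close> to \<open>Om F'\<close>, linearly and functorially in \<open>l\<close>. Functionals on
 \<open>F x\<close> show in this way that \<open>theta\<close> is injective, and the expansion of the identity of \<open>F x\<close>
 into maps of rank one shows that it is surjective.
\<close>

theorem fibre_functor_evaluation:
 obtains x \<theta> where "x : Obj G"
  "\<And>F. func F ==> lin (FO F x) (Om F) (\<theta> F)" "\<And>F. func F ==> bij_betw (\<theta> F) (el (FO F x)) (el (Om F))"
  "\<And>\<phi> v. nt \<phi> ==> v : el (FO (asrc \<phi>) x) ==> \<theta> (atgt \<phi>) (ev \<phi> x v) = M \<phi> (\<theta> (asrc \<phi>) v)"
  "\<And>F F' v w. func F ==> func F' ==> v : el (FO F x) ==> w : el (FO F' x) ==>
    \<theta> (F \<boxtimes> F') (pure (FO F x) (FO F' x) v w) = mu F F' (\<theta> F v) (\<theta> F' w)"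
  "\<theta> I one = io"
proof -
 obtain x v where x [simp]: "x : Obj G" and v: "v : el (Om (rep x))" "v \<noteq> \<zero>\<^bsub>Om (rep x)\<^esub>"
  using ex_nonzero by blast
 obtain e where e [simp]: "e : el (Om (rep x))" and dia_e: "M (dia x) e = mu (rep x) (rep x) e e" and eps_e: "M (eps x) e = io"
  using ex_grouplike[OF x v] .
 let ?P = "rep x" and ?X = "pr x x"
 define \<theta> where "\<theta> F v = M (hat x F v) e" for F v
 define le where "le F F' l w = M (TL x F F' l) (mu ?P F e w)" for F F' l w
 have \<theta>_in [simp]: "\<theta> F v : el (Om F)" if "func F" "v : el (FO F x)" for F v
  using that by (simp add: \<theta>_def)
 have hat_add: "hat x F (v \<oplus>\<^bsub>FO F x\<^esub> w) = Add W (hat x F v) (hat x F w)"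
  "hat x F (a \<odot>\<^bsub>FO F x\<^esub> v) = Scl W a (hat x F v)"
  if [simp]: "func F" "v : el (FO F x)" "w : el (FO F x)" for F v w a
  by (rule rep_ext[of _ _ x]; simp)+
 have \<theta>_lin: "lin (FO F x) (Om F) (\<theta> F)" if "func F" for F
  using that by (intro linI) (auto simp: \<theta>_def hat_add M_add M_scl)
 have \<theta>_nat: "\<theta> (atgt \<phi>) (ev \<phi> x v) = M \<phi> (\<theta> (asrc \<phi>) v)" if [simp]: "nt \<phi>" "v : el (FO (asrc \<phi>) x)" for \<phi> v
 proof -
  have "hat x (atgt \<phi>) (ev \<phi> x v) = \<phi> \<ast> hat x (asrc \<phi>) v" by (rule rep_ext[of _ _ x]) auto
  then show ?thesis by (simp add: \<theta>_def M_cmp)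
 qed
 have \<theta>_mu: "\<theta> (F \<boxtimes> F') (pure (FO F x) (FO F' x) v w) = mu F F' (\<theta> F v) (\<theta> F' w)"
  if [simp]: "func F" "func F'" "v : el (FO F x)" "w : el (FO F' x)" for F F' v w
 proof -
  have "hat x (F \<boxtimes> F') (pure (FO F x) (FO F' x) v w) = (hat x F v \<otimes>\<^sub>W hat x F' w) \<ast> dia x"
   by (rule rep_ext[of _ _ x]) auto
  then show ?thesis by (simp add: \<theta>_def M_cmp dia_e mu_nat')
 qed
 have \<theta>_one: "\<theta> I one = io" by (simp add: \<theta>_def eps_e)
 note TL' = TL[OF x]
 have le_in: "le F F' l w : el (Om F')" if "func F" "func F'" "lin (FO F x) (FO F' x) l" "w : el (Om F)" for F F' l w
  using that TL'(1-3)[OF that(1-3)] by (simp add: le_def)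
 have le_lin: "lin (Om F) (Om F') (le F F' l)" if "func F" "func F'" "lin (FO F x) (FO F' x) l" for F F' l
  using that TL'(1-3)[OF that] by (intro linI) (auto simp: le_def)
 have le_id: "le F F (\<lambda>v \<in> el (FO F x). v) w = w" if [simp]: "func F" "w : el (Om F)" for F w
 proof -
  have l: "lin (FO F x) (FO F x) (\<lambda>v \<in> el (FO F x). v)" by (rule linI) auto
  have "TL x F F (\<lambda>v \<in> el (FO F x). v) = Lun W F \<ast> (eps x \<otimes>\<^sub>W Idn W F)"
   by (rule rep_tens_ext[of _ _ x F]) (use TL'[OF _ _ l] in auto)
  then show ?thesis by (simp add: le_def M_cmp mu_nat' eps_e mu_lun)
 qed
 have le_cmp: "le F F'' (\<lambda>v \<in> el (FO F x). l' (l v)) w = le F' F'' l' (le F F' l w)"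
  if [simp]: "func F" "func F'" "func F''" "w : el (Om F)" and l: "lin (FO F x) (FO F' x) l" and l': "lin (FO F' x) (FO F'' x) l'" for F F' F'' l l' w
 proof -
  note [simp] = TL'(1-3)[OF that(1,2) l] TL'(1-3)[OF that(2,3) l'] linD(1)[OF l] linD(1)[OF l']
  have c: "lin (FO F x) (FO F'' x) (\<lambda>v \<in> el (FO F x). l' (l v))"
   using linD[OF lin_comp[OF l l']] by (intro linI) auto
  have "TL x F F'' (\<lambda>v \<in> el (FO F x). l' (l v)) =
   TL x F' F'' l' \<ast> ((Idn W ?P \<otimes>\<^sub>W TL x F F' l) \<ast> (Asc W ?P ?P F \<ast> (dia x \<otimes>\<^sub>W Idn W F)))"
   by (rule rep_tens_ext[of _ _ x F])
    (use TL'[OF that(1,3) c] TL'(5)[OF that(1,2) l] TL'(5)[OF that(2,3) l'] in auto)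
  then show ?thesis by (simp add: le_def M_cmp mu_nat' dia_e mu_asc)
 qed
 have le_add: "le F F' (\<lambda>v \<in> el (FO F x). l v \<oplus>\<^bsub>FO F' x\<^esub> l' v) w = le F F' l w \<oplus>\<^bsub>Om F'\<^esub> le F F' l' w"
  if [simp]: "func F" "func F'" "w : el (Om F)" and l: "lin (FO F x) (FO F' x) l" and l': "lin (FO F x) (FO F' x) l'" for F F' l l' w
 proof -
  note [simp] = TL'(1-3)[OF that(1,2) l] TL'(1-3)[OF that(1,2) l']
  have c: "lin (FO F x) (FO F' x) (\<lambda>v \<in> el (FO F x). l v \<oplus>\<^bsub>FO F' x\<^esub> l' v)"
   using linD[OF l] linD[OF l'] by (intro linI) (auto simp: fd_distr fd_ac)
  have "TL x F F' (\<lambda>v \<in> el (FO F x). l v \<oplus>\<^bsub>FO F' x\<^esub> l' v) = Add W (TL x F F' l) (TL x F F' l')"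
   by (rule rep_tens_ext[of _ _ x F])
    (use TL'[OF that(1,2) c] TL'(5)[OF that(1,2) l] TL'(5)[OF that(1,2) l'] in auto)
  then show ?thesis by (simp add: le_def M_add)
 qed
 have le_\<theta>: "le F F' l (\<theta> F v) = \<theta> F' (l v)" if [simp]: "func F" "func F'" "v : el (FO F x)" and l: "lin (FO F x) (FO F' x) l" for F F' l v
 proof -
  note [simp] = TL'(1-3)[OF that(1,2) l] linD(1)[OF l]
  have "hat x F' (l v) = TL x F F' l \<ast> ((Idn W ?P \<otimes>\<^sub>W hat x F v) \<ast> dia x)"
   by (rule rep_ext[of _ _ x]) (use TL'(5)[OF that(1,2) l] in auto)
  then show ?thesis by (simp add: le_def \<theta>_def M_cmp mu_nat' dia_e)
 qed
 have inj: "inj_on (\<theta> F) (el (FO F x))" if F [simp]: "func F" for F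
 proof (rule inj_onI, rule ccontr)
  interpret X: vectorspace class_ring "FO F x" by (rule fd_vs) simp
  fix v w assume v: "v : el (FO F x)" "w : el (FO F x)" and eq: "\<theta> F v = \<theta> F w" and "v \<noteq> w"
  let ?d = "v \<oplus>\<^bsub>FO F x\<^esub> (-1) \<odot>\<^bsub>FO F x\<^esub> w"
  have d: "?d : el (FO F x)" using v by simp
  have "?d \<oplus>\<^bsub>FO F x\<^esub> w = v \<oplus>\<^bsub>FO F x\<^esub> ((-1) \<odot>\<^bsub>FO F x\<^esub> w \<oplus>\<^bsub>FO F x\<^esub> 1 \<odot>\<^bsub>FO F x\<^esub> w)"
   using v by (simp add: fd_ac)
  also have "(-1) \<odot>\<^bsub>FO F x\<^esub> w \<oplus>\<^bsub>FO F x\<^esub> 1 \<odot>\<^bsub>FO F x\<^esub> w = (-1 + 1) \<odot>\<^bsub>FO F x\<^esub> w"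
   by (rule fd_distr(2)[symmetric]) (use v in auto)
  finally have "?d \<oplus>\<^bsub>FO F x\<^esub> w = v" using v by simp
  then have "?d \<noteq> \<zero>\<^bsub>FO F x\<^esub>" using \<open>v \<noteq> w\<close> v by auto
  then obtain l where l: "l : lin_maps (FO F x) K" "l ?d = one"
   using V.obtain_functional[OF func_fd[OF F x] d] by blast
  have l': "lin (FO F x) (FO I x) l" using lin_mapsD'[OF l(1)] by simp
  have "\<theta> F ?d = \<theta> F v \<oplus>\<^bsub>Om F\<^esub> (-1) \<odot>\<^bsub>Om F\<^esub> \<theta> F v"
   using v linD[OF \<theta>_lin[OF F]] eq by simp
  also have "... = 1 \<odot>\<^bsub>Om F\<^esub> \<theta> F v \<oplus>\<^bsub>Om F\<^esub> (-1) \<odot>\<^bsub>Om F\<^esub> \<theta> F v" using v by simp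
  also have "... = (1 + (-1)) \<odot>\<^bsub>Om F\<^esub> \<theta> F v" by (rule fd_distr(2)[symmetric]) (use v in auto)
  also have "... = \<zero>\<^bsub>Om F\<^esub>" using v by simp
  finally have "le F I l (\<theta> F ?d) = \<zero>\<^bsub>Om I\<^esub>" using lin_zero[OF le_lin[OF F func_unit l']] by simp
  moreover have "le F I l (\<theta> F ?d) = io" using le_\<theta>[OF F func_unit d l'] l(2) \<theta>_one by simp
  ultimately show False by simp
 qed
 have surj: "w : \<theta> F ` el (FO F x)" if F [simp]: "func F" and w [simp]: "w : el (Om F)" for F w
 proof -
  let ?V = "FO F x"
  have "lin ?V ?V (\<lambda>v \<in> el ?V. v) \<and> le F F (\<lambda>v \<in> el ?V. v) w : \<theta> F ` el ?V"
  proof (rule V.rank_one_induct[where V = ?V and Q = "\<lambda>l. lin ?V ?V l \<and> le F F l w : \<theta> F ` el ?V"])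
   fix l u assume l: "l : lin_maps ?V K" and u [simp]: "u : el ?V"
   have l': "lin ?V (FO I x) l" using lin_mapsD'[OF l] by simp
   have k: "lin (FO I x) ?V (\<lambda>g. V.coef g \<odot>\<^sub>?V u)" by (rule linI) (auto simp: fd_distr)
   have lin: "lin ?V ?V (\<lambda>v \<in> el ?V. V.coef (l v) \<odot>\<^sub>?V u)"
    using linD[OF lin_comp[OF l' k]] by (intro linI) auto
   have "le F F (\<lambda>v \<in> el ?V. V.coef (l v) \<odot>\<^sub>?V u) w = le I F (\<lambda>g. V.coef g \<odot>\<^sub>?V u) (le F I l w)"
    by (rule le_cmp[OF F func_unit F w l' k])
   moreover obtain a where "le F I l w = a \<odot>\<^bsub>Om I\<^esub> io" using io_span[OF le_in[OF F func_unit l' w]] by blast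
   moreover have "le I F (\<lambda>g. V.coef g \<odot>\<^sub>?V u) (a \<odot>\<^bsub>Om I\<^esub> \<theta> I one) = \<theta> F (a \<odot>\<^sub>?V u)" for a
    using linD(3)[OF le_lin[OF func_unit F k]] le_\<theta>[OF func_unit F _ k, of one] linD(3)[OF \<theta>_lin[OF F]] by simp
   ultimately show "lin ?V ?V (\<lambda>v \<in> el ?V. V.coef (l v) \<odot>\<^sub>?V u) \<and>
     le F F (\<lambda>v \<in> el ?V. V.coef (l v) \<odot>\<^sub>?V u) w : \<theta> F ` el ?V"
    using lin by (simp add: \<theta>_one)
  next
   have z: "lin ?V ?V (\<lambda>v \<in> el ?V. \<zero>\<^sub>?V)" by (rule linI) auto
   have "TL x F F (\<lambda>v \<in> el ?V. \<zero>\<^sub>?V) = Scl W 0 (TL x F F (\<lambda>v \<in> el ?V. \<zero>\<^sub>?V))"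
    by (rule rep_tens_ext[of _ _ x F]) (use TL'[OF F F z] in auto)
   then have "le F F (\<lambda>v \<in> el ?V. \<zero>\<^sub>?V) w = M (Scl W 0 (TL x F F (\<lambda>v \<in> el ?V. \<zero>\<^sub>?V))) (mu ?P F e w)"
    by (simp add: le_def)
   also have "... = \<zero>\<^bsub>Om F\<^esub>" using TL'(1-3)[OF F F z] by (simp add: M_scl)
   finally have "le F F (\<lambda>v \<in> el ?V. \<zero>\<^sub>?V) w = \<theta> F \<zero>\<^sub>?V" using lin_zero[OF \<theta>_lin[OF F]] by simp
   then show "lin ?V ?V (\<lambda>v \<in> el ?V. \<zero>\<^sub>?V) \<and> le F F (\<lambda>v \<in> el ?V. \<zero>\<^sub>?V) w : \<theta> F ` el ?V"
    using z by simp
  next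
   fix f g assume "f : lin_maps ?V ?V" "g : lin_maps ?V ?V"
    and f: "lin ?V ?V f \<and> le F F f w : \<theta> F ` el ?V" and g: "lin ?V ?V g \<and> le F F g w : \<theta> F ` el ?V"
   then obtain v v' where v: "v : el ?V" "le F F f w = \<theta> F v" "v' : el ?V" "le F F g w = \<theta> F v'" by auto
   have "lin ?V ?V (\<lambda>v \<in> el ?V. f v \<oplus>\<^sub>?V g v)"
    using linD[OF conjunct1[OF f]] linD[OF conjunct1[OF g]] by (intro linI) (auto simp: fd_distr fd_ac)
   moreover have "le F F (\<lambda>v \<in> el ?V. f v \<oplus>\<^sub>?V g v) w = \<theta> F (v \<oplus>\<^sub>?V v')"
    using le_add[OF F F w conjunct1[OF f] conjunct1[OF g]] v linD(2)[OF \<theta>_lin[OF F]] by simp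
   ultimately show "lin ?V ?V (\<lambda>v \<in> el ?V. f v \<oplus>\<^sub>?V g v) \<and> le F F (\<lambda>v \<in> el ?V. f v \<oplus>\<^sub>?V g v) w : \<theta> F ` el ?V"
    using v by simp
  qed simp
  then show ?thesis using le_id[OF F w] by simp
 qed
 have bij: "bij_betw (\<theta> F) (el (FO F x)) (el (Om F))" if "func F" for F
  unfolding bij_betw_def using inj[OF that] surj[OF that] that by auto
 show ?thesis by (rule that[of x \<theta>]) (use \<theta>_lin bij \<theta>_nat \<theta>_mu \<theta>_one in auto)
qed

end

section \<open>Monoidal transformations between evaluation functors\<close>

context tannaka
begin

lemma one_nonzero: "one \<noteq> \<zero>\<^sub>K"
proof
 assume "one = \<zero>\<^sub>K"
 then have "V.coef one = V.coef (0 \<odot>\<^sub>K one)" by simp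
 then show False unfolding V.coef(2) V.coef_one by simp
qed

lemma ex_coordinate:
 assumes "f : homs G x y"
 obtains \<kappa> where "lin (pr x y) K \<kappa>" "\<forall>g \<in> homs G x y. \<kappa> (del g) = (if g = f then one else \<zero>\<^sub>K)"
proof -
 have "\<exists>h \<in> lin_maps (pr x y) K. \<forall>g \<in> homs G x y. h (del g) = (if g = f then one else \<zero>\<^sub>K)"
  by (rule free_onD(4)[OF pfree]) auto
 then show ?thesis using that lin_mapsD' by blast
qed

lemma del_inj:
 assumes "f : homs G x y" "g : homs G x y" "del f = del g"
 shows "f = g"
proof (rule ccontr)
 assume "f \<noteq> g"
 obtain \<kappa> where \<kappa>: "lin (pr x y) K \<kappa>" "\<forall>g \<in> homs G x y. \<kappa> (del g) = (if g = f then one else \<zero>\<^sub>K)"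
  by (rule ex_coordinate[OF assms(1)])
 from bspec[OF \<kappa>(2) assms(1)] bspec[OF \<kappa>(2) assms(2)] show False using assms(3) \<open>f \<noteq> g\<close> one_nonzero by simp
qed

text \<open>
 The only group-like elements of \<open>rep x\<close> at \<open>y\<close> are the basis elements: if \<open>c\<close> is the
 coordinate of \<open>e\<close> at \<open>f\<close>, applying this coordinate to the left factor of \<open>\<Delta> e = e \<otimes> e\<close> gives
 \<open>c (del f) = c e\<close>. And the coordinates do not all vanish, since otherwise \<open>e = e e\<close> would be zero.
\<close>

lemma grouplike_del:
 assumes [simp]: "x : Obj G" "y : Obj G" and e [simp]: "e : el (pr x y)"
  and dia_e: "ev (dia x) y e = pure (pr x y) (pr x y) e e" and eps_e: "ev (eps x) y e = one"
 obtains f where "f : homs G x y" "e = del f"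
proof (rule ccontr)
 let ?X = "pr x y"
 assume "\<not> thesis"
 then have no: "e \<noteq> del f" if "f : homs G x y" for f using that \<open>\<And>f. f : homs G x y ==> e = del f ==> thesis\<close> by blast
 have lm: "lin (?X \<otimes>\<^sub>V ?X) ?X (ev (mlt x) y)" using ev_lin[OF mlt(1) _ refl refl, of x y] by simp
 have lr: "lin ?X (?X \<otimes>\<^sub>V ?X) (\<lambda>v. pure ?X ?X v (del f))" if "f : homs G x y" for f
  by (rule linI) (use that in "auto simp: homs_iff")
 have ll: "lin ?X (?X \<otimes>\<^sub>V ?X) (pure ?X ?X e)" by (rule linI) auto
 have ld: "lin ?X (?X \<otimes>\<^sub>V ?X) (ev (dia x) y)" using ev_lin[OF dia(1) _ refl refl, of x y] by simp
 have z: "ev (mlt x) y (pure ?X ?X e (del f)) = \<zero>\<^sub>?X" if f: "f : homs G x y" for f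
 proof -
  obtain \<kappa> where \<kappa>: "lin ?X K \<kappa>" "\<forall>g \<in> homs G x y. \<kappa> (del g) = (if g = f then one else \<zero>\<^sub>K)"
   by (rule ex_coordinate[OF f])
  have c0: "V.coef \<zero>\<^sub>K = 0" using V.coef(2)[of 0] by simp
  have d [simp]: "del f : el ?X" using f by (simp add: homs_iff)
  have lk: "lin ?X ?X (\<lambda>v. V.coef (\<kappa> v) \<odot>\<^sub>?X del f)"
   by (rule linI) (auto simp: linD[OF \<kappa>(1)] fd_distr)
  have 1: "ev (mlt x) y (pure ?X ?X e (del f)) = V.coef (\<kappa> e) \<odot>\<^sub>?X del f"
   by (rule lgen_ext[OF lgen_del lin_comp[OF lr[OF f] lm] lk, of e])
    (use f in \<open>auto simp: homs_iff \<kappa>(2) c0\<close>)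
  have "bilin ?X ?X ?X (\<lambda>v w. V.coef (\<kappa> v) \<odot>\<^sub>?X w)"
   by (auto simp: bilin_def linD[OF \<kappa>(1)] fd_distr mult.commute)
  then obtain R where R: "R : lin_maps (?X \<otimes>\<^sub>V ?X) ?X"
   "\<And>v w. v : el ?X ==> w : el ?X ==> R (pure ?X ?X v w) = V.coef (\<kappa> v) \<odot>\<^sub>?X w"
   by (rule V.obtain_lift[rotated 3]) auto
  have Rd: "R (ev (dia x) y (del g)) = V.coef (\<kappa> (del g)) \<odot>\<^sub>?X del f" if g: "g : homs G x y" for g
  proof -
   have [simp]: "del g : el ?X" and "ev (dia x) y (del g) = pure ?X ?X (del g) (del g)"
    using g by (auto simp: homs_iff)
   then have "R (ev (dia x) y (del g)) = V.coef (\<kappa> (del g)) \<odot>\<^sub>?X del g" by (simp add: R(2))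
   then show ?thesis using g \<kappa>(2) c0 by simp
  qed
  have "R (ev (dia x) y e) = V.coef (\<kappa> e) \<odot>\<^sub>?X del f"
   by (rule lgen_ext[OF lgen_del lin_comp[OF ld lin_mapsD'[OF R(1)]] lk, of e]) (auto simp: Rd)
  then have eq: "V.coef (\<kappa> e) \<odot>\<^sub>?X e = V.coef (\<kappa> e) \<odot>\<^sub>?X del f" by (simp add: dia_e R(2))
  have "V.coef (\<kappa> e) = 0"
  proof (rule ccontr)
   assume n: "V.coef (\<kappa> e) \<noteq> 0"
   have "e = (1 / V.coef (\<kappa> e)) \<odot>\<^sub>?X (V.coef (\<kappa> e) \<odot>\<^sub>?X e)" using n by simp
   also have "... = del f" unfolding eq using n by simp
   finally show False using no[OF f] by simp
  qed
  then show ?thesis using 1 d by simp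
 qed
 have "ev (mlt x \<ast> dia x) y e = e" unfolding mlt_dia[OF \<open>x : Obj G\<close>] by simp
 then have "e = ev (mlt x) y (pure ?X ?X e e)" by (simp add: dia_e)
 also have "... = \<zero>\<^sub>?X"
  by (rule lgen_ext[OF lgen_del lin_comp[OF ll lm] linI, of "\<lambda>_. \<zero>\<^sub>?X" e]) (auto simp: z)
 finally show False using eps_e one_nonzero by (simp add: ev_zero)
qed

text \<open>
 By the Yoneda lemma the family \<open>\<alpha>\<close> is determined by the image of \<open>del (Idn y)\<close> in \<open>rep y\<close> at \<open>z\<close>.
 Compatibility with tensor products makes this image group-like, hence equal to \<open>del b\<close> for some arrow.
\<close>

theorem monoidal_family_evaluation:
 fixes \<alpha> :: "('g, 'a, 'k, 'v) vfunc => 'v => 'v"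
 assumes y [simp]: "y : Obj G" and z [simp]: "z : Obj G"
  and \<alpha>_in: "\<And>F v. func F ==> v : el (FO F y) ==> \<alpha> F v : el (FO F z)"
  and \<alpha>_nat: "\<And>\<phi> v. nt \<phi> ==> v : el (FO (asrc \<phi>) y) ==> \<alpha> (atgt \<phi>) (ev \<phi> y v) = ev \<phi> z (\<alpha> (asrc \<phi>) v)"
  and \<alpha>_mu: "\<And>F F' v w. func F ==> func F' ==> v : el (FO F y) ==> w : el (FO F' y) ==>
    \<alpha> (F \<boxtimes> F') (pure (FO F y) (FO F' y) v w) = pure (FO F z) (FO F' z) (\<alpha> F v) (\<alpha> F' w)"
  and \<alpha>_one: "\<alpha> I one = one"
 obtains b where "b : homs G y z" "\<And>F v. func F ==> v : el (FO F y) ==> \<alpha> F v = amap (FA F b) v"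
proof -
 let ?d = "del (Idn G y)"
 define e where "e = \<alpha> (rep y) ?d"
 have e: "e : el (pr y z)" using \<alpha>_in[of "rep y" ?d] by (simp add: e_def)
 have "ev (dia y) z e = pure (pr y z) (pr y z) e e"
  using \<alpha>_nat[of "dia y" ?d] \<alpha>_mu[of "rep y" "rep y" ?d ?d] by (simp add: e_def)
 moreover have "ev (eps y) z e = one"
  using \<alpha>_nat[of "eps y" ?d] \<alpha>_one by (simp add: e_def)
 ultimately obtain b where b: "b : homs G y z" "e = del b" using grouplike_del[OF y z e] by blast
 have "\<alpha> F v = amap (FA F b) v" if [simp]: "func F" "v : el (FO F y)" for F v
  using \<alpha>_nat[of "hat y F v" ?d] b by (simp add: e_def[symmetric] homs_iff)
 with b(1) show ?thesis using that by blast
qed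

lemma evaluation_faithful:
 assumes "b : homs G y z" "b' : homs G y z"
  "\<And>(F :: ('g, 'a, 'k, 'v) vfunc) v.
    func F ==> v : el (FO F y) ==> amap (FA F b) v = amap (FA F b') v"
 shows "b = b'"
proof (rule del_inj[OF assms(1,2)])
 have "y : Obj G" using assms(1) by (auto simp: homs_iff)
 then show "del b = del b'" using assms(3)[of "rep y" "del (Idn G y)"] assms(1,2) by (simp add: homs_iff)
qed

lemma iso_nt:
 assumes "is_iso W \<phi>" "x : Obj G"
 shows "nt (inv_arr W \<phi>)" "asrc (inv_arr W \<phi>) = atgt \<phi>" "atgt (inv_arr W \<phi>) = asrc \<phi>"
  "v : el (FO (asrc \<phi>) x) ==> ev (inv_arr W \<phi>) x (ev \<phi> x v) = v"
  "v : el (FO (atgt \<phi>) x) ==> ev \<phi> x (ev (inv_arr W \<phi>) x v) = v"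
proof -
 note i = W.inv_simps[OF assms(1)]
 have \<phi>: "nt \<phi>" using assms(1) by (simp add: W_is_iso_iff)
 show n: "nt (inv_arr W \<phi>)" "asrc (inv_arr W \<phi>) = atgt \<phi>" "atgt (inv_arr W \<phi>) = asrc \<phi>" using i by auto
 have "ev (inv_arr W \<phi> \<ast> \<phi>) x v = ev (Idn W (asrc \<phi>)) x v" "ev (\<phi> \<ast> inv_arr W \<phi>) x v = ev (Idn W (atgt \<phi>)) x v"
  using i by auto
 then show "v : el (FO (asrc \<phi>) x) ==> ev (inv_arr W \<phi>) x (ev \<phi> x v) = v"
  "v : el (FO (atgt \<phi>) x) ==> ev \<phi> x (ev (inv_arr W \<phi>) x v) = v"
  using \<phi> n assms(2) by auto
qed

lemma Vec_is_isoI: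
 assumes f: "f : Arr D" and b: "bij_betw (amap f) (el (asrc f)) (el (atgt f))"
 shows "is_iso D f"
proof -
 let ?S = "asrc f" and ?T = "atgt f"
 define h where "h = inv_into (el ?S) (amap f)"
 have fd: "fd ?S" "fd ?T" using f by auto
 have h: "w : el ?T ==> h w : el ?S" "w : el ?T ==> amap f (h w) = w"
   "v : el ?S ==> h (amap f v) = v" for v w
  unfolding h_def using b bij_betw_inv_into_right[OF b] bij_betw_inv_into_left[OF b]
  by (auto simp: bij_betw_def intro: inv_into_into)
 have lin: "h (v \<oplus>\<^sub>?T w) = h v \<oplus>\<^sub>?S h w" "h (a \<odot>\<^sub>?T v) = a \<odot>\<^sub>?S h v"
  if v: "v : el ?T" "w : el ?T" for v w a
 proof -
  have "amap f (h v \<oplus>\<^sub>?S h w) = v \<oplus>\<^sub>?T w" "amap f (a \<odot>\<^sub>?S h v) = a \<odot>\<^sub>?T v" using v f h by simp_all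
  then show "h (v \<oplus>\<^sub>?T w) = h v \<oplus>\<^sub>?S h w" "h (a \<odot>\<^sub>?T v) = a \<odot>\<^sub>?S h v"
   using h(3)[of "h v \<oplus>\<^sub>?S h w"] h(3)[of "a \<odot>\<^sub>?S h v"] v fd h(1) by simp_all
 qed
 have g: "V.arr ?T ?S h : Arr D" by (rule V.arr_in) (use fd h lin in auto)
 show ?thesis
 proof (rule V.is_isoI[where g = "V.arr ?T ?S h"])
  show "V.arr ?T ?S h \<cdot>\<^sub>D f = Idn D (Src D f)" by (rule V.Vec_eqI) (use f g h fd in auto)
  show "f \<cdot>\<^sub>D V.arr ?T ?S h = Idn D (Tgt D f)" by (rule V.Vec_eqI) (use f g h fd in auto)
 qed (use f g in auto)
qed

end

section \<open>Auto-equivalences are translations\<close>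

text \<open>
 Moving the base point, \<open>g \<mapsto> TO t g 1\<close>, is an equivalence from \<open>G\<close> onto its own underlying
 groupoid; that is, the groupoid is a torsor under the translation action.
\<close>

locale torsor = translation G t for G :: "('g, 'a, 'x) moncat_scheme" (structure) and t +
 assumes TO_surj: "x : Obj G ==> \<exists>g \<in> Obj G. homs G (TO t g (Unt G)) x \<noteq> {}"
  and TN_full: "g : Obj G ==> h : Obj G ==> b : homs G (TO t g (Unt G)) (TO t h (Unt G)) ==>
   \<exists>a \<in> homs G g h. TN t a (Unt G) = b"
  and TN_faithful: "a : homs G g h ==> a' : homs G g h ==> TN t a (Unt G) = TN t a' (Unt G) ==> a = a'"

locale commuting_torsors = tannaka T G + bitranslation G "Vec T" s t c + S: torsor G s + R: torsor G t
 for T :: "('k :: {alg_closed_field, field_char_0}, 'v) vec_tensor" and G :: "('g, 'a, 'x) moncat_scheme"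
  and s t :: "('g, 'a) transl" and c :: "'g => 'g => 'g => 'a"
begin

abbreviation aut where "aut \<equiv> algebra_auto_equivalence G A"
abbreviation ob where "ob E F \<equiv> FO (FO E F)"
abbreviation pt where "pt \<equiv> Unt G"

context
 fixes E assumes E: "aut E"
begin

lemma aut_nt [simp]:
 "func F ==> func (FO E F)" "nt \<phi> ==> nt (FA E \<phi>)"
 "nt \<phi> ==> asrc (FA E \<phi>) = FO E (asrc \<phi>)" "nt \<phi> ==> atgt (FA E \<phi>) = FO E (atgt \<phi>)"
 "func F ==> FA E (Idn W F) = Idn W (FO E F)"
 "func F ==> func F' ==> nt (Mu E F F')" "func F ==> func F' ==> asrc (Mu E F F') = FO E F \<boxtimes> FO E F'"
 "func F ==> func F' ==> atgt (Mu E F F') = FO E (F \<boxtimes> F')"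
 "nt (Iota E)" "asrc (Iota E) = I" "atgt (Iota E) = FO E I"
 "k : Obj G ==> func F ==> nt (Str E k F)" "k : Obj G ==> func F ==> asrc (Str E k F) = FO E (tlO G s k F)"
 "k : Obj G ==> func F ==> atgt (Str E k F) = tlO G s k (FO E F)"
 using P.RA.aut_simps[OF E] P.RA.aut_mu_simps[OF E] by simp_all

lemma aut_iso:
 "func F ==> func F' ==> is_iso W (Mu E F F')" "is_iso W (Iota E)"
 "k : Obj G ==> func F ==> is_iso W (Str E k F)"
 using P.RA.aut_mu_simps[OF E] by simp_all

lemma ev_aut_cmp:
 assumes "nt \<phi>" "nt \<psi>" "asrc \<psi> = atgt \<phi>" "x : Obj G" "v : el (ob E (asrc \<phi>) x)"
 shows "ev (FA E (\<psi> \<ast> \<phi>)) x v = ev (FA E \<psi>) x (ev (FA E \<phi>) x v)"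
 using P.RA.aut_cmp[OF E, of \<phi> \<psi>, symmetric] assms by simp

lemma ev_aut_mu:
 assumes "nt \<phi>" "nt \<psi>" "x : Obj G" "v : el (ob E (asrc \<phi>) x)" "w : el (ob E (asrc \<psi>) x)"
 shows "ev (FA E (\<phi> \<otimes>\<^sub>W \<psi>)) x (ev (Mu E (asrc \<phi>) (asrc \<psi>)) x (pure (ob E (asrc \<phi>) x) (ob E (asrc \<psi>) x) v w)) =
  ev (Mu E (atgt \<phi>) (atgt \<psi>)) x (pure (ob E (atgt \<phi>) x) (ob E (atgt \<psi>) x) (ev (FA E \<phi>) x v) (ev (FA E \<psi>) x w))"
 using arg_cong[OF P.RA.aut_mu_nat[OF E, of \<phi> \<psi> "asrc \<phi>" "asrc \<psi>"],
   where f = "\<lambda>\<xi>. ev \<xi> x (pure (ob E (asrc \<phi>) x) (ob E (asrc \<psi>) x) v w)"] assms by simp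

lemma ev_aut_add:
 assumes "nt \<phi>" "nt \<psi>" "asrc \<psi> = asrc \<phi>" "atgt \<psi> = atgt \<phi>" "x : Obj G" "v : el (ob E (asrc \<phi>) x)"
 shows "ev (FA E (Add W \<phi> \<psi>)) x v = ev (FA E \<phi>) x v \<oplus>\<^bsub>ob E (atgt \<phi>) x\<^esub> ev (FA E \<psi>) x v"
  "ev (FA E (Scl W a \<phi>)) x v = a \<odot>\<^bsub>ob E (atgt \<phi>) x\<^esub> ev (FA E \<phi>) x v"
 using P.RA.aut_linear(1)[OF E, of \<phi> "asrc \<phi>" "atgt \<phi>" \<psi>] P.RA.aut_linear(2)[OF E, of \<phi> a] assms
 by (simp_all add: homs_iff)

text \<open>An auto-equivalence followed by evaluation at an object is a fibre functor.\<close>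

lemma aut_fibre_functor:
 assumes x [simp]: "x : Obj G"
 shows "fibre_functor T G (\<lambda>F. ob E F x) (\<lambda>\<phi>. ev (FA E \<phi>) x)
  (\<lambda>F F' v w. ev (Mu E F F') x (pure (ob E F x) (ob E F' x) v w)) (ev (Iota E) x one)"
proof
 note mu = iso_nt[OF aut_iso(1) x] and io = iso_nt[OF aut_iso(2) x]
 show "func F ==> ob E F x : fd_spaces" for F :: "('g, 'a, 'k, 'v) vfunc" by simp
 show "nt \<phi> ==> lin (ob E (asrc \<phi>) x) (ob E (atgt \<phi>) x) (ev (FA E \<phi>) x)" for \<phi>
  by (rule ev_lin) auto
 show "func F ==> v : el (ob E F x) ==> ev (FA E (Idn W F)) x v = v"
  for F :: "('g, 'a, 'k, 'v) vfunc" and v by simp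
 show "nt \<phi> ==> nt \<psi> ==> asrc \<psi> = atgt \<phi> ==> v : el (ob E (asrc \<phi>) x) ==>
   ev (FA E (\<psi> \<ast> \<phi>)) x v = ev (FA E \<psi>) x (ev (FA E \<phi>) x v)" for \<phi> \<psi> v
  by (rule ev_aut_cmp) auto
 show "nt \<phi> ==> nt \<psi> ==> asrc \<psi> = asrc \<phi> ==> atgt \<psi> = atgt \<phi> ==> v : el (ob E (asrc \<phi>) x) ==>
   ev (FA E (Add W \<phi> \<psi>)) x v = ev (FA E \<phi>) x v \<oplus>\<^bsub>ob E (atgt \<phi>) x\<^esub> ev (FA E \<psi>) x v" for \<phi> \<psi> v
  by (rule ev_aut_add(1)) auto
 show "nt \<phi> ==> v : el (ob E (asrc \<phi>) x) ==>
   ev (FA E (Scl W a \<phi>)) x v = a \<odot>\<^bsub>ob E (atgt \<phi>) x\<^esub> ev (FA E \<phi>) x v" for \<phi> a v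
  by (rule ev_aut_add(2)[of \<phi> \<phi>]) auto
 show "nt \<phi> ==> nt \<psi> ==> v : el (ob E (asrc \<phi>) x) ==> w : el (ob E (asrc \<psi>) x) ==>
  ev (FA E (\<phi> \<otimes>\<^sub>W \<psi>)) x (ev (Mu E (asrc \<phi>) (asrc \<psi>)) x (pure (ob E (asrc \<phi>) x) (ob E (asrc \<psi>) x) v w)) =
  ev (Mu E (atgt \<phi>) (atgt \<psi>)) x (pure (ob E (atgt \<phi>) x) (ob E (atgt \<psi>) x) (ev (FA E \<phi>) x v) (ev (FA E \<psi>) x w))" for \<phi> \<psi> v w
  by (rule ev_aut_mu) auto
 show io_in: "ev (Iota E) x one : el (ob E I x)" by simp
 show "ev (Iota E) x one \<noteq> \<zero>\<^bsub>ob E I x\<^esub>"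
 proof
  assume "ev (Iota E) x one = \<zero>\<^bsub>ob E I x\<^esub>"
  then have "ev (inv_arr W (Iota E)) x (ev (Iota E) x one) = \<zero>\<^sub>K" using io(1-3) by simp
  then show False using io(4)[of one] one_nonzero by simp
 qed
 show "\<exists>a. v = a \<odot>\<^bsub>ob E I x\<^esub> ev (Iota E) x one" if v: "v : el (ob E I x)" for v
 proof -
  let ?g = "ev (inv_arr W (Iota E)) x v"
  have g: "?g : el K" using io(1-3) v by simp
  have "v = ev (Iota E) x (V.coef ?g \<odot>\<^sub>K one)" using io(5)[of v] v g by simp
  also have "... = V.coef ?g \<odot>\<^bsub>ob E I x\<^esub> ev (Iota E) x one"
   using linD(3)[OF ev_lin[of "Iota E" x I "FO E I"], of one] by simp
  finally show ?thesis by blast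
 qed
 fix F F' :: "('g, 'a, 'k, 'v) vfunc"
 assume [simp]: "func F"
 show "v : el (ob E F x) ==>
   ev (FA E (Lun W F)) x (ev (Mu E I F) x (pure (ob E I x) (ob E F x) (ev (Iota E) x one) v)) = v" for v
  using arg_cong[OF P.RA.aut_lun[OF E, of F], where f = "\<lambda>\<xi>. ev \<xi> x (pure K (ob E F x) one v)"] by simp
 show "v : el (ob E F x) ==>
   ev (FA E (Run W F)) x (ev (Mu E F I) x (pure (ob E F x) (ob E I x) v (ev (Iota E) x one))) = v" for v
  using arg_cong[OF P.RA.aut_run[OF E, of F], where f = "\<lambda>\<xi>. ev \<xi> x (pure (ob E F x) K v one)"] by simp
 assume [simp]: "func F'"
 let ?V = "ob E F x" and ?V' = "ob E F' x" and ?VV = "ob E (F \<boxtimes> F') x"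
 have lmu: "lin (?V \<otimes>\<^sub>V ?V') ?VV (ev (Mu E F F') x)"
  using ev_lin[OF aut_nt(6) x refl refl, of F F'] by simp
 have lmu': "lin ?VV (?V \<otimes>\<^sub>V ?V') (ev (inv_arr W (Mu E F F')) x)"
  using ev_lin[OF mu(1) x refl refl, of F F'] mu(2,3)[of F F'] by simp
 show "bilin ?V ?V' ?VV (\<lambda>v w. ev (Mu E F F') x (pure ?V ?V' v w))"
  unfolding bilin_def using linD[OF lmu] by simp
 show "v : el ?V ==> w : el ?V' ==>
   ev (FA E (Brd W F F')) x (ev (Mu E F F') x (pure ?V ?V' v w)) = ev (Mu E F' F) x (pure ?V' ?V w v)" for v w
  using arg_cong[OF P.RA.aut_brd[OF E, of F F'], where f = "\<lambda>\<xi>. ev \<xi> x (pure ?V ?V' v w)"] by simp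
 show "h u = h' u" if X: "fd X" and h: "lin ?VV X h" "lin ?VV X h'" and u: "u : el ?VV"
   and e: "\<And>v w. v : el ?V ==> w : el ?V' ==>
    h (ev (Mu E F F') x (pure ?V ?V' v w)) = h' (ev (Mu E F F') x (pure ?V ?V' v w))"
  for X :: "('k, 'v) module" and h h' u
 proof -
  let ?u = "ev (inv_arr W (Mu E F F')) x u"
  have "h (ev (Mu E F F') x ?u) = h' (ev (Mu E F F') x ?u)"
   by (rule lgen_ext[OF V.lgen_tensor[OF _ _ lgen_carrier lgen_carrier, of ?V ?V'] lin_comp[OF lmu h(1)] lin_comp[OF lmu h(2)]])
    (use X e linD(1)[OF lmu' u] in auto)
  then show ?thesis using mu(5)[of F F' u] u by simp
 qed
 show "\<exists>h. lin ?VV X h \<and> (\<forall>v \<in> el ?V. \<forall>w \<in> el ?V'. h (ev (Mu E F F') x (pure ?V ?V' v w)) = b v w)"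
  if X: "fd X" and b: "bilin ?V ?V' X b" for X :: "('k, 'v) module" and b
 proof -
  from b obtain h where h: "h : lin_maps (?V \<otimes>\<^sub>V ?V') X" "\<And>v w. v : el ?V ==> w : el ?V' ==> h (pure ?V ?V' v w) = b v w"
   by (rule V.obtain_lift[rotated 3]) (use X in auto)
  show ?thesis
   by (rule exI[of _ "\<lambda>u. h (ev (inv_arr W (Mu E F F')) x u)"])
    (use lin_comp[OF lmu' lin_mapsD'[OF h(1)]] h(2) mu(4)[of F F'] in simp)
 qed
 fix F'' :: "('g, 'a, 'k, 'v) vfunc"
 assume [simp]: "func F''"
 let ?V'' = "ob E F'' x"
 show "v : el ?V ==> v' : el ?V' ==> v'' : el ?V'' ==>
  ev (FA E (Asc W F F' F'')) x (ev (Mu E (F \<boxtimes> F') F'') x (pure ?VV ?V'' (ev (Mu E F F') x (pure ?V ?V' v v')) v'')) =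
  ev (Mu E F (F' \<boxtimes> F'')) x (pure ?V (ob E (F' \<boxtimes> F'') x) v (ev (Mu E F' F'') x (pure ?V' ?V'' v' v'')))" for v v' v''
  using arg_cong[OF P.RA.aut_mu_asc[OF E, of F F' F''], where f = "\<lambda>\<xi>. ev \<xi> x (pure (?V \<otimes>\<^sub>V ?V') ?V'' (pure ?V ?V' v v') v'')"] by simp
qed

end

end

context commuting_torsors
begin

lemma nt_ev_ext:
 assumes "nt \<phi>" "nt \<psi>" "asrc \<phi> = asrc \<psi>" "atgt \<phi> = atgt \<psi>"
  "\<And>x v. x : Obj G ==> v : el (FO (asrc \<phi>) x) ==> ev \<phi> x v = ev \<psi> x v"
 shows "\<phi> = \<psi>"
 by (rule nt_ext[OF assms(1-4)]) (use assms(5) lgen_carrier in blast)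

lemma inv_c [simp]:
 assumes "g : Obj G" "h : Obj G" "x : Obj G"
 shows "inv_arr G (c g h x) : Arr G" "Src G (inv_arr G (c g h x)) = TO t g (TO s h x)"
  "Tgt G (inv_arr G (c g h x)) = TO s h (TO t g x)"
 using assms by auto

text \<open>
 Evaluation at the base point after an auto-equivalence \<open>E\<close> is evaluation at some object, which
 is isomorphic to \<open>TO t g pt\<close>.
\<close>

lemma aut_evaluation:
 assumes E: "aut E"
 obtains g \<theta> where "g : Obj G"
  "\<And>F. func F ==> lin (FO F (TO t g pt)) (ob E F pt) (\<theta> F)"
  "\<And>F. func F ==> bij_betw (\<theta> F) (el (FO F (TO t g pt))) (el (ob E F pt))"
  "\<And>\<phi> v. nt \<phi> ==> v : el (FO (asrc \<phi>) (TO t g pt)) ==>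
    \<theta> (atgt \<phi>) (ev \<phi> (TO t g pt) v) = ev (FA E \<phi>) pt (\<theta> (asrc \<phi>) v)"
  "\<And>F F' v w. func F ==> func F' ==> v : el (FO F (TO t g pt)) ==> w : el (FO F' (TO t g pt)) ==>
    \<theta> (F \<boxtimes> F') (pure (FO F (TO t g pt)) (FO F' (TO t g pt)) v w) =
    ev (Mu E F F') pt (pure (ob E F pt) (ob E F' pt) (\<theta> F v) (\<theta> F' w))"
  "\<theta> I one = ev (Iota E) pt one"
proof -
 have pt: "pt : Obj G" by simp
 show ?thesis
 proof (rule fibre_functor.fibre_functor_evaluation[OF aut_fibre_functor[OF E pt]])
 fix y \<theta> assume y: "y : Obj G"
  and \<theta>: "\<And>F. func F ==> lin (FO F y) (ob E F pt) (\<theta> F)"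
   "\<And>F. func F ==> bij_betw (\<theta> F) (el (FO F y)) (el (ob E F pt))"
   "\<And>\<phi> v. nt \<phi> ==> v : el (FO (asrc \<phi>) y) ==> \<theta> (atgt \<phi>) (ev \<phi> y v) = ev (FA E \<phi>) pt (\<theta> (asrc \<phi>) v)"
   "\<And>F F' v w. func F ==> func F' ==> v : el (FO F y) ==> w : el (FO F' y) ==>
    \<theta> (F \<boxtimes> F') (pure (FO F y) (FO F' y) v w) =
    ev (Mu E F F') pt (pure (ob E F pt) (ob E F' pt) (\<theta> F v) (\<theta> F' w))"
   "\<theta> I one = ev (Iota E) pt one"
 obtain g j where g [simp]: "g : Obj G" and "j : homs G (TO t g pt) y" using R.TO_surj[OF y] by blast
 then have j [simp]: "j : Arr G" "Src G j = TO t g pt" "Tgt G j = y" by (auto simp: homs_iff)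
 let ?p = "TO t g pt"
 have lj: "lin (FO F ?p) (FO F y) (amap (FA F j))" if "func F" for F using act_lin[of F j ?p y] that by simp
 have bj: "bij_betw (amap (FA F j)) (el (FO F ?p)) (el (FO F y))" if [simp]: "func F" for F
  by (rule bij_betw_byWitness[where f' = "amap (FA F (inv_arr G j))"]) (use y in auto)
 show ?thesis
 proof (rule that[of g "\<lambda>F v. \<theta> F (amap (FA F j) v)"])
  show "lin (FO F ?p) (ob E F pt) (\<lambda>v. \<theta> F (amap (FA F j) v))" if "func F" for F
   by (rule lin_comp[OF lj[OF that] \<theta>(1)[OF that]])
  show "bij_betw (\<lambda>v. \<theta> F (amap (FA F j) v)) (el (FO F ?p)) (el (ob E F pt))" if "func F" for F
   using bij_betw_trans[OF bj[OF that] \<theta>(2)[OF that]] by (simp add: comp_def)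
  show "\<theta> (atgt \<phi>) (amap (FA (atgt \<phi>) j) (ev \<phi> ?p v)) = ev (FA E \<phi>) pt (\<theta> (asrc \<phi>) (amap (FA (asrc \<phi>) j) v))"
   if "nt \<phi>" "v : el (FO (asrc \<phi>) ?p)" for \<phi> v
   using ev_nat[of \<phi> j ?p "asrc \<phi>" v] \<theta>(3)[of \<phi> "amap (FA (asrc \<phi>) j) v"] that by simp
  show "\<theta> (F \<boxtimes> F') (amap (FA (F \<boxtimes> F') j) (pure (FO F ?p) (FO F' ?p) v w)) =
    ev (Mu E F F') pt (pure (ob E F pt) (ob E F' pt) (\<theta> F (amap (FA F j) v)) (\<theta> F' (amap (FA F' j) w)))"
   if "func F" "func F'" "v : el (FO F ?p)" "w : el (FO F' ?p)" for F F' v w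
   using act_tens[of F F' j ?p v w] \<theta>(4) that by simp
  show "\<theta> I (amap (FA I j) one) = ev (Iota E) pt one" using \<theta>(5) by simp
 qed simp
 qed
qed

text \<open>
 Every auto-equivalence \<open>E\<close> is a translation. The module structure of \<open>E\<close> carries the
 identification \<open>\<theta>\<close> of \<open>F (TO t g pt)\<close> with \<open>E F pt\<close> from the base point to all objects \<open>TO s k pt\<close>,
 which gives \<open>\<kappa> k\<close>, and naturality carries it on to every object \<open>x\<close>, by means of a chosen arrow
 \<open>j x\<close> from some \<open>TO s k pt\<close> to \<open>x\<close>. Since every arrow between objects of the form \<open>TO s k pt\<close>
 comes from an arrow of \<open>G\<close>, the choice does not matter.
\<close>

lemma aut_is_translation:
 assumes E: "aut E"
 shows "\<exists>g \<in> Obj G. \<exists>\<eta>. P.RA.transf (phi g) E \<eta>"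
proof -
 note [simp] = aut_nt[OF E]
 show ?thesis
 proof (rule aut_evaluation[OF E])
 fix g \<theta> assume g [simp]: "g : Obj G"
  and \<theta>_lin: "\<And>F. func F ==> lin (FO F (TO t g pt)) (ob E F pt) (\<theta> F)"
  and \<theta>_bij: "\<And>F. func F ==> bij_betw (\<theta> F) (el (FO F (TO t g pt))) (el (ob E F pt))"
  and \<theta>_nat: "\<And>\<phi> v. nt \<phi> ==> v : el (FO (asrc \<phi>) (TO t g pt)) ==>
    \<theta> (atgt \<phi>) (ev \<phi> (TO t g pt) v) = ev (FA E \<phi>) pt (\<theta> (asrc \<phi>) v)"
  and \<theta>_mu: "\<And>F F' v w. func F ==> func F' ==> v : el (FO F (TO t g pt)) ==> w : el (FO F' (TO t g pt)) ==>
    \<theta> (F \<boxtimes> F') (pure (FO F (TO t g pt)) (FO F' (TO t g pt)) v w) =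
    ev (Mu E F F') pt (pure (ob E F pt) (ob E F' pt) (\<theta> F v) (\<theta> F' w))"
  and \<theta>_one: "\<theta> I one = ev (Iota E) pt one"
 let ?p = "TO t g pt"
 have \<theta>_in [simp]: "\<theta> F v : el (ob E F pt)" if "func F" "v : el (FO F ?p)" for F v
  using linD(1)[OF \<theta>_lin] that by blast
 define q where "q k = TO s k pt" for k
 define ci where "ci k = inv_arr G (c g k pt)" for k
 have q [simp]: "q k : Obj G" if "k : Obj G" for k using that by (simp add: q_def)
 have qq [simp]: "TO s k pt = q k" for k by (simp add: q_def)
 have ci [simp]: "ci k : Arr G" "Src G (ci k) = TO t g (q k)" "Tgt G (ci k) = TO s k ?p" if "k : Obj G" for k
  using that by (simp_all add: ci_def)
 define \<kappa> where "\<kappa> k F v = ev (Str E k F) pt (\<theta> (tlO G s k F) (amap (FA F (ci k)) v))" for k F v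
 have Str_lin: "lin (ob E (tlO G s k F) x) (ob E F (TO s k x)) (ev (Str E k F) x)"
  if [simp]: "k : Obj G" "func F" "x : Obj G" for k F x
  using ev_lin[of "Str E k F" x "FO E (tlO G s k F)" "tlO G s k (FO E F)"] by simp
 have Str_bij: "bij_betw (ev (Str E k F) x) (el (ob E (tlO G s k F) x)) (el (ob E F (TO s k x)))"
  if [simp]: "k : Obj G" "func F" "x : Obj G" for k F x
 proof -
  note i = iso_nt[OF aut_iso(3)[OF E that(1,2)] that(3)]
  show ?thesis
   by (rule bij_betw_byWitness[where f' = "ev (inv_arr W (Str E k F)) x"]) (use i linD(1)[OF Str_lin] in auto)
 qed
 have \<kappa>_lin: "lin (FO F (TO t g (q k))) (ob E F (q k)) (\<kappa> k F)" if [simp]: "k : Obj G" "func F" for k F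
 proof -
  have 1: "lin (FO F (TO t g (q k))) (FO (tlO G s k F) ?p) (amap (FA F (ci k)))"
   using act_lin[of F "ci k"] by simp
  show ?thesis
   unfolding \<kappa>_def using lin_comp[OF 1 lin_comp[OF \<theta>_lin[OF P.func_tlO[OF that]] Str_lin[OF that G.unt_in]]] by simp
 qed
 have \<kappa>_bij: "bij_betw (\<kappa> k F) (el (FO F (TO t g (q k)))) (el (ob E F (q k)))" if [simp]: "k : Obj G" "func F" for k F
 proof -
  have 1: "bij_betw (amap (FA F (ci k))) (el (FO F (TO t g (q k)))) (el (FO (tlO G s k F) ?p))"
   by (rule bij_betw_byWitness[where f' = "amap (FA F (inv_arr G (ci k)))"]) auto
  show ?thesis
   using bij_betw_trans[OF 1 bij_betw_trans[OF \<theta>_bij[OF P.func_tlO[OF that]] Str_bij[OF that G.unt_in]]]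
   by (simp add: \<kappa>_def[abs_def] comp_def)
 qed
 have \<kappa>_in [simp]: "\<kappa> k F v : el (ob E F (q k))" if "k : Obj G" "func F" "v : el (FO F (TO t g (q k)))" for k F v
  using linD(1)[OF \<kappa>_lin] that by blast
 have \<kappa>_k: "\<kappa> k' F (amap (FA F (TB t g (TN s a pt))) v) = amap (FA (FO E F) (TN s a pt)) (\<kappa> k F v)"
  if [simp]: "a : Arr G" "Src G a = k" "Tgt G a = k'" "func F" "v : el (FO F (TO t g (q k)))" for a k k' F v
 proof -
  have kk [simp]: "k : Obj G" "k' : Obj G" using G.src_in[of a] G.tgt_in[of a] by auto
  have e: "ci k' \<circ>\<^sub>G TB t g (TN s a pt) = TN s a ?p \<circ>\<^sub>G ci k"
   unfolding ci_def by (rule G.iso_square) (use c_TN_s[of g a pt, symmetric] in auto)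
  let ?u = "amap (FA F (ci k)) v"
  have u [simp]: "?u : el (FO F (TO s k ?p))" by simp
  have n: "\<theta> (tlO G s k' F) (amap (FA F (TN s a ?p)) ?u) = ev (FA E (tlA G D s a (Idn W F))) pt (\<theta> (tlO G s k F) ?u)"
   using \<theta>_nat[of "tlA G D s a (Idn W F)" ?u] by simp
  have w [simp]: "\<theta> (tlO G s k F) ?u : el (ob E (tlO G s k F) pt)" by (rule \<theta>_in) simp_all
  have "tlA G D s a (Idn W (FO E F)) \<ast> Str E k F = Str E k' F \<ast> FA E (tlA G D s a (Idn W F))"
   using P.RA.aut_str_nat[OF E, of a "Idn W F" k F] by simp
  from arg_cong[OF this, where f = "\<lambda>\<xi>. ev \<xi> pt (\<theta> (tlO G s k F) ?u)"] show ?thesis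
   using n by (simp add: \<kappa>_def e)
 qed
 have \<kappa>_F: "\<kappa> k (atgt \<phi>) (ev \<phi> (TO t g (q k)) v) = ev (FA E \<phi>) (q k) (\<kappa> k (asrc \<phi>) v)"
  if [simp]: "k : Obj G" "nt \<phi>" "v : el (FO (asrc \<phi>) (TO t g (q k)))" for k \<phi> v
 proof -
  let ?u = "amap (FA (asrc \<phi>) (ci k)) v"
  have "\<theta> (tlO G s k (atgt \<phi>)) (ev \<phi> (TO s k ?p) ?u) = ev (FA E (tlA G D s (Idn G k) \<phi>)) pt (\<theta> (tlO G s k (asrc \<phi>)) ?u)"
   using \<theta>_nat[of "tlA G D s (Idn G k) \<phi>" ?u] by simp
  moreover have "ev \<phi> (TO s k ?p) ?u = amap (FA (atgt \<phi>) (ci k)) (ev \<phi> (TO t g (q k)) v)"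
   using ev_nat[of \<phi> "ci k" "TO t g (q k)" "asrc \<phi>" v] by simp
  moreover have [simp]: "\<theta> (tlO G s k (asrc \<phi>)) ?u : el (ob E (tlO G s k (asrc \<phi>)) pt)" by (rule \<theta>_in) simp_all
  moreover have "tlA G D s (Idn G k) (FA E \<phi>) \<ast> Str E k (asrc \<phi>) = Str E k (atgt \<phi>) \<ast> FA E (tlA G D s (Idn G k) \<phi>)"
   using P.RA.aut_str_nat[OF E, of "Idn G k" \<phi> k "asrc \<phi>"] by simp
  note arg_cong[OF this, where f = "\<lambda>\<xi>. ev \<xi> pt (\<theta> (tlO G s k (asrc \<phi>)) ?u)"]
  ultimately show ?thesis by (simp add: \<kappa>_def)
 qed
 have \<kappa>_mu: "\<kappa> k (F \<boxtimes> F') (pure (FO F (TO t g (q k))) (FO F' (TO t g (q k))) v w) =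
   ev (Mu E F F') (q k) (pure (ob E F (q k)) (ob E F' (q k)) (\<kappa> k F v) (\<kappa> k F' w))"
  if [simp]: "k : Obj G" "func F" "func F'" "v : el (FO F (TO t g (q k)))" "w : el (FO F' (TO t g (q k)))" for k F F' v w
 proof -
  let ?v = "\<theta> (tlO G s k F) (amap (FA F (ci k)) v)" and ?w = "\<theta> (tlO G s k F') (amap (FA F' (ci k)) w)"
  let ?V = "ob E (tlO G s k F) pt" and ?V' = "ob E (tlO G s k F') pt"
  have [simp]: "?v : el ?V" "?w : el ?V'" by (rule \<theta>_in; simp)+
  have "Str E k (F \<boxtimes> F') \<ast> (FA E (Idn W (tlO G s k (F \<boxtimes> F'))) \<ast> Mu E (tlO G s k F) (tlO G s k F')) =
   tlA G D s (Idn G k) (Mu E F F') \<ast> (Idn W (tlO G s k (FO E F \<boxtimes> FO E F')) \<ast> (Str E k F \<otimes>\<^sub>W Str E k F'))"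
   using P.RA.aut_str_mu[OF E, of k F F'] by (simp only: reg_sel G.unt_in that) simp
  from arg_cong[OF this, where f = "\<lambda>\<xi>. ev \<xi> pt (pure ?V ?V' ?v ?w)"]
  have "ev (Str E k (F \<boxtimes> F')) pt (ev (Mu E (tlO G s k F) (tlO G s k F')) pt (pure ?V ?V' ?v ?w)) =
    ev (Mu E F F') (q k) (pure (ob E F (q k)) (ob E F' (q k)) (\<kappa> k F v) (\<kappa> k F' w))"
   by (simp add: \<kappa>_def)
  then show ?thesis
   using \<theta>_mu[of "tlO G s k F" "tlO G s k F'" "amap (FA F (ci k)) v" "amap (FA F' (ci k)) w"]
   by (simp add: \<kappa>_def)
 qed
 have \<kappa>_one: "\<kappa> k I one = ev (Iota E) (q k) one" if [simp]: "k : Obj G" for k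
 proof -
  have "Str E k I \<ast> (FA E (Idn W I) \<ast> Iota E) = tlA G D s (Idn G k) (Iota E) \<ast> Idn W I"
   using P.RA.aut_str_iota[OF E, of k] by simp
  from arg_cong[OF this, where f = "\<lambda>\<xi>. ev \<xi> pt one"] show ?thesis
   by (simp add: \<kappa>_def \<theta>_one)
 qed
 \<comment> \<open>Compatibility with the module structure reduces to the one of \<open>E\<close> and of the commutation \<open>c\<close>.\<close>
 have \<kappa>_str: "amap (FA (FO E F) (TA s k h pt)) (\<kappa> (k \<otimes>\<^sub>o\<^sub>G h) F (amap (FA F (TB t g (inv_arr G (TA s k h pt)) \<circ>\<^sub>G c g h (q k))) v))
   = ev (Str E h F) (q k) (\<kappa> k (tlO G s h F) v)"
  if [simp]: "k : Obj G" "h : Obj G" "func F" "v : el (FO F (TO s h (TO t g (q k))))" for k h F v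
 proof -
  have [simp]: "TO s h (q k) : Obj G" by simp
  let ?T = "TA s k h pt" and ?u = "amap (FA F (ci (k \<otimes>\<^sub>o\<^sub>G h) \<circ>\<^sub>G (TB t g (inv_arr G (TA s k h pt)) \<circ>\<^sub>G c g h (q k)))) v"
  have TT: "TB t g (inv_arr G ?T) = inv_arr G (TB t g ?T)"
   by (rule G.inv_arr_eq[symmetric], rule G.inverse_arrowsI) (auto simp: Q.T.TB_cmp)
  have cc: "TB s h (ci k) = inv_arr G (TB s h (c g k pt))"
   unfolding ci_def by (rule G.inv_arr_eq[symmetric], rule G.inverse_arrowsI) (auto simp: P.T.TB_cmp)
  have "inv_arr G (TB t g ?T \<circ>\<^sub>G c g (k \<otimes>\<^sub>o\<^sub>G h) pt) = inv_arr G (c g h (q k) \<circ>\<^sub>G (TB s h (c g k pt) \<circ>\<^sub>G TA s k h ?p))"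
   using c_TA_s[of g k h pt] by simp
  then have "ci (k \<otimes>\<^sub>o\<^sub>G h) \<circ>\<^sub>G inv_arr G (TB t g ?T) = inv_arr G (TA s k h ?p) \<circ>\<^sub>G (TB s h (ci k) \<circ>\<^sub>G inv_arr G (c g h (q k)))"
   unfolding cc unfolding ci_def by (simp add: G.inv_cmp G.assoc)
  then have "TA s k h ?p \<circ>\<^sub>G ((ci (k \<otimes>\<^sub>o\<^sub>G h) \<circ>\<^sub>G inv_arr G (TB t g ?T)) \<circ>\<^sub>G c g h (q k)) = TB s h (ci k)"
   by (simp add: G.assoc)
  then have e: "TA s k h ?p \<circ>\<^sub>G (ci (k \<otimes>\<^sub>o\<^sub>G h) \<circ>\<^sub>G (TB t g (inv_arr G (TA s k h pt)) \<circ>\<^sub>G c g h (q k))) = TB s h (ci k)"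
   unfolding TT by (simp add: G.assoc)
  have [simp]: "?u : el (FO F (TO s (k \<otimes>\<^sub>o\<^sub>G h) ?p))" by simp
  let ?w = "\<theta> (tlO G s (k \<otimes>\<^sub>o\<^sub>G h) F) ?u"
  have w [simp]: "?w : el (ob E (tlO G s (k \<otimes>\<^sub>o\<^sub>G h) F) pt)" by (rule \<theta>_in) simp_all
  have "\<theta> (tlO G s k (tlO G s h F)) (ev (tlAsc G s k h F) ?p ?u) = ev (FA E (tlAsc G s k h F)) pt ?w"
   using \<theta>_nat[of "tlAsc G s k h F" ?u] by simp
  moreover have "ev (tlAsc G s k h F) ?p ?u = amap (FA F (TB s h (ci k))) v" by (simp flip: e)
  moreover have "tlA G D s (Idn G k) (Str E h F) \<ast> (Str E k (tlO G s h F) \<ast> FA E (tlAsc G s k h F)) =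
    tlAsc G s k h (FO E F) \<ast> Str E (k \<otimes>\<^sub>o\<^sub>G h) F"
   using P.RA.aut_str_asc[OF E, of k h F] by simp
  from arg_cong[OF this, where f = "\<lambda>\<xi>. ev \<xi> pt ?w"]
  have "ev (Str E h F) (q k) (ev (Str E k (tlO G s h F)) pt (ev (FA E (tlAsc G s k h F)) pt ?w)) =
    amap (FA (FO E F) (TA s k h pt)) (ev (Str E (k \<otimes>\<^sub>o\<^sub>G h) F) pt ?w)"
   by simp
  ultimately show ?thesis by (simp add: \<kappa>_def)
 qed
 have "\<exists>k j. k : Obj G \<and> j : homs G (q k) x" if "x : Obj G" for x using S.TO_surj[OF that] by auto
 then obtain kk jj where kj: "\<And>x. x : Obj G ==> kk x : Obj G \<and> jj x : homs G (q (kk x)) x" by metis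
 then have kj [simp]: "kk x : Obj G" "jj x : Arr G" "Src G (jj x) = q (kk x)" "Tgt G (jj x) = x" if "x : Obj G" for x
  using that by (auto simp: homs_iff)
 define \<eta> where "\<eta> F x v = amap (FA (FO E F) (jj x)) (\<kappa> (kk x) F (amap (FA F (TB t g (inv_arr G (jj x)))) v))" for F x v
 have \<eta>: "\<eta> F x v = amap (FA (FO E F) j) (\<kappa> k F (amap (FA F (TB t g (inv_arr G j))) v))"
  if [simp]: "k : Obj G" "j : Arr G" "Src G j = q k" "Tgt G j = x" "func F" "v : el (FO F (TO t g x))" for F x v k j
 proof -
  have x [simp]: "x : Obj G" using G.tgt_in[of j] by simp
  have "inv_arr G (jj x) \<circ>\<^sub>G j : homs G (TO s k pt) (TO s (kk x) pt)" by (simp add: homs_iff)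
  then obtain a where "a : homs G k (kk x)" and a': "TN s a pt = inv_arr G (jj x) \<circ>\<^sub>G j"
   using S.TN_full[of k "kk x"] by auto
  then have a [simp]: "a : Arr G" "Src G a = k" "Tgt G a = kk x" by (auto simp: homs_iff)
  have "TB t g (TN s a pt) \<circ>\<^sub>G TB t g (inv_arr G j) = TB t g (inv_arr G (jj x))"
   by (simp add: a' Q.T.TB_cmp G.assoc)
  moreover have "jj x \<circ>\<^sub>G TN s a pt = j" by (simp add: a')
  ultimately show ?thesis
   using \<kappa>_k[of a k "kk x" F "amap (FA F (TB t g (inv_arr G j))) v"] by (simp add: \<eta>_def )
 qed
 have \<eta>_lin: "lin (FO F (TO t g x)) (ob E F x) (\<eta> F x)" if [simp]: "func F" "x : Obj G" for F x
  unfolding \<eta>_def using act_lin[of F "TB t g (inv_arr G (jj x))"] act_lin[of "FO E F" "jj x"]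
  by (intro lin_comp[OF lin_comp[OF _ \<kappa>_lin]]) auto
 have \<eta>_bij: "bij_betw (\<eta> F x) (el (FO F (TO t g x))) (el (ob E F x))" if [simp]: "func F" "x : Obj G" for F x
 proof -
  have 1: "bij_betw (amap (FA F (TB t g (inv_arr G (jj x))))) (el (FO F (TO t g x))) (el (FO F (TO t g (q (kk x)))))"
   by (rule bij_betw_byWitness[where f' = "amap (FA F (TB t g (jj x)))"]) (auto simp: Q.T.TB_cmp)
  have 2: "bij_betw (amap (FA (FO E F) (jj x))) (el (ob E F (q (kk x)))) (el (ob E F x))"
   by (rule bij_betw_byWitness[where f' = "amap (FA (FO E F) (inv_arr G (jj x)))"]) auto
  show ?thesis
   using bij_betw_trans[OF bij_betw_trans[OF 1 \<kappa>_bij] 2] by (simp add: \<eta>_def[abs_def] comp_def)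
 qed
 have \<eta>_F: "\<eta> (atgt \<phi>) x (ev \<phi> (TO t g x) v) = ev (FA E \<phi>) x (\<eta> (asrc \<phi>) x v)"
  if [simp]: "nt \<phi>" "x : Obj G" "v : el (FO (asrc \<phi>) (TO t g x))" for \<phi> x v
 proof -
  let ?v = "amap (FA (asrc \<phi>) (TB t g (inv_arr G (jj x)))) v"
  have "ev \<phi> (TO t g (q (kk x))) ?v = amap (FA (atgt \<phi>) (TB t g (inv_arr G (jj x)))) (ev \<phi> (TO t g x) v)"
   using ev_nat[of \<phi> "TB t g (inv_arr G (jj x))" "TO t g x" "asrc \<phi>" v] by simp
  then show ?thesis
   using \<kappa>_F[of "kk x" \<phi> ?v] ev_nat[of "FA E \<phi>" "jj x" "q (kk x)" "FO E (asrc \<phi>)" "\<kappa> (kk x) (asrc \<phi>) ?v"]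
   by (simp add: \<eta>_def)
 qed
 have \<eta>_mu: "\<eta> (F \<boxtimes> F') x (pure (FO F (TO t g x)) (FO F' (TO t g x)) v w) =
   ev (Mu E F F') x (pure (ob E F x) (ob E F' x) (\<eta> F x v) (\<eta> F' x w))"
  if [simp]: "func F" "func F'" "x : Obj G" "v : el (FO F (TO t g x))" "w : el (FO F' (TO t g x))" for F F' x v w
 proof -
  let ?v = "amap (FA F (TB t g (inv_arr G (jj x)))) v" and ?w = "amap (FA F' (TB t g (inv_arr G (jj x)))) w"
  let ?k = "kk x"
  have [simp]: "?v : el (FO F (TO t g (q ?k)))" "?w : el (FO F' (TO t g (q ?k)))" by simp_all
  have "amap (FA (F \<boxtimes> F') (TB t g (inv_arr G (jj x)))) (pure (FO F (TO t g x)) (FO F' (TO t g x)) v w) =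
    pure (FO F (TO t g (q ?k))) (FO F' (TO t g (q ?k))) ?v ?w"
   using act_tens[of F F' "TB t g (inv_arr G (jj x))" "TO t g x" v w] by simp
  moreover have "amap (FA (FO E F \<boxtimes> FO E F') (jj x)) (pure (ob E F (q ?k)) (ob E F' (q ?k)) (\<kappa> ?k F ?v) (\<kappa> ?k F' ?w))
    = pure (ob E F x) (ob E F' x) (\<eta> F x v) (\<eta> F' x w)"
   using act_tens[of "FO E F" "FO E F'" "jj x" "q ?k" "\<kappa> ?k F ?v" "\<kappa> ?k F' ?w"] by (simp add: \<eta>_def)
  ultimately show ?thesis
   using \<kappa>_mu[of ?k F F' ?v ?w]
    ev_nat[of "Mu E F F'" "jj x" "q ?k" "FO E F \<boxtimes> FO E F'" "pure (ob E F (q ?k)) (ob E F' (q ?k)) (\<kappa> ?k F ?v) (\<kappa> ?k F' ?w)"]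
   by (simp add: \<eta>_def[of "F \<boxtimes> F'"])
 qed
 have \<eta>_one: "\<eta> I x one = ev (Iota E) x one" if [simp]: "x : Obj G" for x
  using ev_nat[of "Iota E" "jj x" "q (kk x)" I one] \<kappa>_one[of "kk x"] by (simp add: \<eta>_def)
 have \<eta>_str: "\<eta> F (TO s h x) (amap (FA F (c g h x)) v) = ev (Str E h F) x (\<eta> (tlO G s h F) x v)"
  if [simp]: "func F" "h : Obj G" "x : Obj G" "v : el (FO F (TO s h (TO t g x)))" for F h x v
 proof -
  let ?k = "kk x" and ?j = "jj x"
  let ?v = "amap (FA F (TB s h (TB t g (inv_arr G ?j)))) v" and ?i = "TB s h ?j \<circ>\<^sub>G TA s ?k h pt"
  have [simp]: "?v : el (FO F (TO s h (TO t g (q ?k))))" by simp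
  have TA [simp]: "TA s ?k h pt : Arr G" "Src G (TA s ?k h pt) = q (?k \<otimes>\<^sub>o\<^sub>G h)" "Tgt G (TA s ?k h pt) = TO s h (q ?k)"
   by simp_all
  have "inv_arr G ?i = inv_arr G (TA s ?k h pt) \<circ>\<^sub>G TB s h (inv_arr G ?j)"
  proof -
   have "inv_arr G (TB s h ?j) = TB s h (inv_arr G ?j)"
    by (rule G.inv_arr_eq, rule G.inverse_arrowsI) (auto simp: P.T.TB_cmp)
   then show ?thesis by (simp add: G.inv_cmp)
  qed
  then have "TB t g (inv_arr G ?i) \<circ>\<^sub>G c g h x = TB t g (inv_arr G (TA s ?k h pt)) \<circ>\<^sub>G (TB t g (TB s h (inv_arr G ?j)) \<circ>\<^sub>G c g h x)"
   by (simp add: G.assoc flip: Q.T.TB_cmp)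
  also have "TB t g (TB s h (inv_arr G ?j)) \<circ>\<^sub>G c g h x = c g h (q ?k) \<circ>\<^sub>G TB s h (TB t g (inv_arr G ?j))"
   using c_nat[of g h "inv_arr G ?j"] by simp
  finally have i: "TB t g (inv_arr G ?i) \<circ>\<^sub>G c g h x
    = (TB t g (inv_arr G (TA s ?k h pt)) \<circ>\<^sub>G c g h (q ?k)) \<circ>\<^sub>G TB s h (TB t g (inv_arr G ?j))"
   by (simp add: G.assoc)
  have "\<eta> F (TO s h x) (amap (FA F (c g h x)) v)
    = amap (FA (FO E F) ?i) (\<kappa> (?k \<otimes>\<^sub>o\<^sub>G h) F (amap (FA F (TB t g (inv_arr G ?i))) (amap (FA F (c g h x)) v)))"
   by (rule \<eta>) simp_all
  also have "amap (FA F (TB t g (inv_arr G ?i))) (amap (FA F (c g h x)) v) = amap (FA F (TB t g (inv_arr G ?i) \<circ>\<^sub>G c g h x)) v"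
   by (rule act_cmp) simp_all
  also have "... = amap (FA F (TB t g (inv_arr G (TA s ?k h pt)) \<circ>\<^sub>G c g h (q ?k))) ?v"
   unfolding i by (rule act_cmp[symmetric]) simp_all
  also have "amap (FA (FO E F) ?i) (\<kappa> (?k \<otimes>\<^sub>o\<^sub>G h) F ...)
    = amap (FA (FO E F) (TB s h ?j)) (amap (FA (FO E F) (TA s ?k h pt)) (\<kappa> (?k \<otimes>\<^sub>o\<^sub>G h) F ...))"
   by (rule act_cmp[symmetric]) simp_all
  also have "... = amap (FA (FO E F) (TB s h ?j)) (ev (Str E h F) (q ?k) (\<kappa> ?k (tlO G s h F) ?v))"
   by (simp only: \<kappa>_str[OF kj(1)[OF \<open>x : Obj G\<close>] \<open>h : Obj G\<close> \<open>func F\<close> \<open>?v : el (FO F (TO s h (TO t g (q ?k))))\<close>])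
  also have "... = ev (Str E h F) x (\<eta> (tlO G s h F) x v)"
   using ev_nat[of "Str E h F" ?j "q ?k" "FO E (tlO G s h F)" "\<kappa> ?k (tlO G s h F) ?v"]
   by (simp add: \<eta>_def)
  finally show ?thesis .
 qed
 define \<eta>' where "\<eta>' F = mkn (tlO G t g F) (FO E F) (\<eta> F)" for F
 have nt: "nt (\<eta>' F)" if [simp]: "func F" for F
  unfolding \<eta>'_def
 proof (rule nt_mkn)
  fix b assume b [simp]: "b : Arr G"
  have "amap (FA (FO E F) b) (\<eta> F (Src G b) v) = \<eta> F (Tgt G b) (amap (FA (tlO G t g F) b) v)"
   if [simp]: "v : el (FO F (TO t g (Src G b)))" for v
   using \<eta>[of "kk (Src G b)" "b \<circ>\<^sub>G jj (Src G b)" "Tgt G b" F "amap (FA F (TB t g b)) v"]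
   by (simp add: \<eta>_def G.inv_cmp Q.T.TB_cmp G.assoc)
  then show "\<exists>B. lgen (FO (tlO G t g F) (Src G b)) B \<and>
    (\<forall>v\<in>B. amap (FA (FO E F) b) (\<eta> F (Src G b) v) = \<eta> F (Tgt G b) (amap (FA (tlO G t g F) b) v))"
   by (intro exI[of _ "el (FO F (TO t g (Src G b)))"]) (auto simp: lgen_carrier)
 qed (use \<eta>_lin in auto)
 have st [simp]: "asrc (\<eta>' F) = tlO G t g F" "atgt (\<eta>' F) = FO E F" for F by (simp_all add: \<eta>'_def)
 have ev [simp]: "ev (\<eta>' F) x v = \<eta> F x v" if "x : Obj G" "v : el (FO F (TO t g x))" for F x v
  using that by (simp add: \<eta>'_def)
 have iso: "is_iso W (\<eta>' F)" if [simp]: "func F" for F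
  unfolding W_is_iso_iff
 proof (intro conjI ballI nt)
  fix x assume [simp]: "x : Obj G"
  have "bij_betw (ev (\<eta>' F) x) (el (FO F (TO t g x))) (el (ob E F x))"
   using \<eta>_bij[of F x] by (simp cong: bij_betw_cong)
  then show "is_iso D (amap (\<eta>' F) x)" using nt[of F] by (intro Vec_is_isoI) auto
 qed simp
 note [simp] = nt
 have "P.RA.transf (phi g) E (\<lambda>F \<in> Obj W. \<eta>' F)"
 proof (rule P.RA.transfI)
  fix \<phi> assume "\<phi> : Arr A"
  then have [simp]: "nt \<phi>" by simp
  have "FA E \<phi> \<ast> \<eta>' (asrc \<phi>) = \<eta>' (atgt \<phi>) \<ast> tlA G D t (Idn G g) \<phi>"
   by (rule nt_ev_ext) (simp_all add: \<eta>_F)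
  then show "FA E \<phi> \<cdot>\<^sub>A (\<lambda>F \<in> Obj W. \<eta>' F) (Src A \<phi>) = (\<lambda>F \<in> Obj W. \<eta>' F) (Tgt A \<phi>) \<cdot>\<^sub>A FA (phi g) \<phi>"
   by simp
 next
  fix F F' assume "F : Obj A" "F' : Obj A"
  then have [simp]: "func F" "func F'" by simp_all
  have "\<eta>' (F \<boxtimes> F') = Mu E F F' \<ast> (\<eta>' F \<otimes>\<^sub>W \<eta>' F')"
  proof (rule nt_ext)
   fix x assume [simp]: "x : Obj G"
   let ?B = "{pure (FO F (TO t g x)) (FO F' (TO t g x)) v w |v w. v : el (FO F (TO t g x)) \<and> w : el (FO F' (TO t g x))}"
   have "lgen (FO F (TO t g x) \<otimes>\<^sub>V FO F' (TO t g x)) ?B"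
    by (rule V.lgen_tensor[OF _ _ lgen_carrier lgen_carrier]) simp_all
   then show "\<exists>B. lgen (FO (asrc (\<eta>' (F \<boxtimes> F'))) x) B \<and>
     (\<forall>b\<in>B. ev (\<eta>' (F \<boxtimes> F')) x b = ev (Mu E F F' \<ast> (\<eta>' F \<otimes>\<^sub>W \<eta>' F')) x b)"
    by (intro exI[of _ ?B]) (auto simp: \<eta>_mu)
  qed simp_all
  then show "(\<lambda>F \<in> Obj W. \<eta>' F) (F \<otimes>\<^sub>o\<^sub>A F') \<cdot>\<^sub>A Mu (phi g) F F' =
    Mu E F F' \<cdot>\<^sub>A ((\<lambda>F \<in> Obj W. \<eta>' F) F \<otimes>\<^sub>A (\<lambda>F \<in> Obj W. \<eta>' F) F')"
   using W.idr[of "\<eta>' (F \<boxtimes> F')"] by simp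
 next
  have "\<eta>' I = Iota E"
  proof (rule nt_ext)
   fix x assume [simp]: "x : Obj G"
   show "\<exists>B. lgen (FO (asrc (\<eta>' I)) x) B \<and> (\<forall>b\<in>B. ev (\<eta>' I) x b = ev (Iota E) x b)"
    by (intro exI[of _ "{one}"]) (simp add: V.lgen_ground \<eta>_one)
  qed simp_all
  then show "(\<lambda>F \<in> Obj W. \<eta>' F) (Unt A) \<cdot>\<^sub>A Iota (phi g) = Iota E"
   using W.idr[of "Iota E"] by simp
 next
  fix h F assume [simp]: "h : Obj G" and "F : Obj A"
  then have [simp]: "func F" by simp
  have "tlA G D s (Idn G h) (\<eta>' F) \<ast> cstr g h F = Str E h F \<ast> \<eta>' (tlO G s h F)"
   by (rule nt_ev_ext) (simp_all add: \<eta>_str)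
  then show "ActA A (Idn G h) ((\<lambda>F \<in> Obj W. \<eta>' F) F) \<cdot>\<^sub>A Str (phi g) h F = Str E h F \<cdot>\<^sub>A (\<lambda>F \<in> Obj W. \<eta>' F) (ActO A h F)"
   by simp
 qed (use iso in "auto simp: isos_iff")
 then show ?thesis using g by blast
 qed
qed

end

section \<open>Transformations between translations\<close>

lemma (in category) isos_cmp: "f : isos C x y ==> g : isos C y z ==> g \<cdot> f : isos C x z"
 by (auto simp: isos_iff)

lemma (in category) isos_inv: "f : isos C x y ==> inv_arr C f : isos C y x"
 by (auto simp: isos_iff)

lemma (in monoidal_category) isos_ten:
 "f : isos C x x' ==> g : isos C y y' ==> f \<otimes> g : isos C (x \<otimes>\<^sub>o y) (x' \<otimes>\<^sub>o y')"
 by (auto simp: isos_iff is_iso_ten)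

lemma (in category) isos_idn: "x : Obj C ==> Idn C x : isos C x x"
 by (simp add: isos_iff)

context commuting_torsors
begin

text \<open>
 A transformation between translations by \<open>g\<close> and \<open>h\<close> is, at the base point, a monoidal
 transformation between evaluations, hence given by an arrow from \<open>TO t g pt\<close> to \<open>TO t h pt\<close>, which
 comes from a unique arrow \<open>a\<close> of \<open>G\<close>. Compatibility with the module structures then identifies the
 transformation at every \<open>TO s k pt\<close>, and naturality everywhere.
\<close>

lemma transf_is_translation:
 assumes g [simp]: "g : Obj G" and h [simp]: "h : Obj G" and \<eta>: "P.RA.transf (phi g) (phi h) \<eta>"
 shows "\<exists>a \<in> homs G g h. \<forall>F. func F --> \<eta> F = tlA G (Vec T) t a (Idn W F)"
proof -
 have nt [simp]: "nt (\<eta> F)" "asrc (\<eta> F) = tlO G t g F" "atgt (\<eta> F) = tlO G t h F" if "func F" for F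
  using P.RA.transf_simps[OF \<eta>, of F] that by simp_all
 have n: "\<eta> (atgt \<phi>) \<ast> tlA G D t (Idn G g) \<phi> = tlA G D t (Idn G h) \<phi> \<ast> \<eta> (asrc \<phi>)" if "nt \<phi>" for \<phi>
  using P.RA.transf_nat[OF \<eta>, of \<phi>] that by simp
 have m: "\<eta> (F \<boxtimes> F') = \<eta> F \<otimes>\<^sub>W \<eta> F'" if "func F" "func F'" for F F'
  using P.RA.transf_mu[OF \<eta>, of F F'] W.idr[of "\<eta> (F \<boxtimes> F')"] W.idl[of "\<eta> F \<otimes>\<^sub>W \<eta> F'"] that by simp
 have i: "\<eta> I = Idn W I"
  using P.RA.transf_iota[OF \<eta>] W.idr[of "\<eta> I"] by simp
 have st: "tlA G D s (Idn G k) (\<eta> F) \<ast> cstr g k F = cstr h k F \<ast> \<eta> (tlO G s k F)" if "k : Obj G" "func F" for k F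
  using P.RA.transf_str[OF \<eta>, of k F] that by simp
 show ?thesis
 proof (rule monoidal_family_evaluation[where y = "TO t g pt" and z = "TO t h pt" and \<alpha> = "\<lambda>F. ev (\<eta> F) pt"])
  show "ev (\<eta> F) pt v : el (FO F (TO t h pt))" if "func F" "v : el (FO F (TO t g pt))" for F v
   using that nt_comp(3)[of "\<eta> F" pt "tlO G t h F" v] by simp
  show "ev (\<eta> (atgt \<phi>)) pt (ev \<phi> (TO t g pt) v) = ev \<phi> (TO t h pt) (ev (\<eta> (asrc \<phi>)) pt v)"
   if "nt \<phi>" "v : el (FO (asrc \<phi>) (TO t g pt))" for \<phi> v
   using arg_cong[OF n[OF that(1)], where f = "\<lambda>\<xi>. ev \<xi> pt v"] that nt_comp(3)[of "\<eta> (asrc \<phi>)" pt "tlO G t h (asrc \<phi>)" v] by simp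
  show "ev (\<eta> (F \<boxtimes> F')) pt (pure (FO F (TO t g pt)) (FO F' (TO t g pt)) v w) =
    pure (FO F (TO t h pt)) (FO F' (TO t h pt)) (ev (\<eta> F) pt v) (ev (\<eta> F') pt w)"
   if "func F" "func F'" "v : el (FO F (TO t g pt))" "w : el (FO F' (TO t g pt))" for F F' v w
   using that by (simp add: m)
  show "ev (\<eta> I) pt one = one" by (simp add: i)
 next
  fix b assume "b : homs G (TO t g pt) (TO t h pt)"
   and b: "\<And>F v. func F ==> v : el (FO F (TO t g pt)) ==> ev (\<eta> F) pt v = amap (FA F b) v"
  then obtain a where a: "a : homs G g h" and ab: "TN t a pt = b" using R.TN_full[OF g h] by blast
  then have a' [simp]: "a : Arr G" "Src G a = g" "Tgt G a = h" by (auto simp: homs_iff)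
  have k: "ev (\<eta> F) (TO s k pt) v = amap (FA F (TN t a (TO s k pt))) v"
   if [simp]: "k : Obj G" "func F" "v : el (FO F (TO t g (TO s k pt)))" for k F v
  proof -
   let ?u = "amap (FA F (inv_arr G (c g k pt))) v"
   have u [simp]: "?u : el (FO F (TO s k (TO t g pt)))" by simp
   have "ev (\<eta> F) (TO s k pt) (amap (FA F (c g k pt)) ?u) = amap (FA F (c h k pt)) (ev (\<eta> (tlO G s k F)) pt ?u)"
    using arg_cong[OF st[OF that(1,2)], where f = "\<lambda>\<xi>. ev \<xi> pt ?u"] by simp
   moreover have "ev (\<eta> (tlO G s k F)) pt ?u = amap (FA F (TB s k (TN t a pt))) ?u"
    using b[of "tlO G s k F" ?u] unfolding ab[symmetric] by simp
   moreover have "c h k pt \<circ>\<^sub>G (TB s k (TN t a pt) \<circ>\<^sub>G inv_arr G (c g k pt)) = TN t a (TO s k pt)"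
   proof -
    have "(TN t a (TO s k pt) \<circ>\<^sub>G c g k pt) \<circ>\<^sub>G inv_arr G (c g k pt) = (c h k pt \<circ>\<^sub>G TB s k (TN t a pt)) \<circ>\<^sub>G inv_arr G (c g k pt)"
     using c_TN_t[of a k pt] by simp
    then show ?thesis by (simp add: G.assoc)
   qed
   ultimately show ?thesis by simp
  qed
  have "\<eta> F = tlA G D t a (Idn W F)" if [simp]: "func F" for F
  proof (rule nt_ev_ext)
   fix x v assume x [simp]: "x : Obj G" and "v : el (FO (asrc (\<eta> F)) x)"
   then have v [simp]: "v : el (FO F (TO t g x))" by simp
   obtain k j where k' [simp]: "k : Obj G" and "j : homs G (TO s k pt) x" using S.TO_surj[OF x] by blast
   then have j [simp]: "j : Arr G" "Src G j = TO s k pt" "Tgt G j = x" by (auto simp: homs_iff)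
   let ?u = "amap (FA F (TB t g (inv_arr G j))) v"
   have "ev (\<eta> F) x (amap (FA F (TB t g j)) ?u) = amap (FA F (TB t h j)) (ev (\<eta> F) (TO s k pt) ?u)"
    using ev_nat[of "\<eta> F" j "TO s k pt" "tlO G t g F" ?u] by simp
   moreover have "TB t h j \<circ>\<^sub>G (TN t a (TO s k pt) \<circ>\<^sub>G TB t g (inv_arr G j)) = TN t a x"
   proof -
    have "TN t a (TO s k pt) \<circ>\<^sub>G TB t g (inv_arr G j) = TB t h (inv_arr G j) \<circ>\<^sub>G TN t a x"
     using Q.T.TN_nat[of a "inv_arr G j"] by simp
    moreover have "(TB t h j \<circ>\<^sub>G TB t h (inv_arr G j)) \<circ>\<^sub>G TN t a x = TN t a x" by (subst Q.T.TB_cmp) simp_all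
    ultimately show ?thesis by (simp add: G.assoc)
   qed
   ultimately show "ev (\<eta> F) x v = ev (tlA G D t a (Idn W F)) x v"
    using k[of k F ?u] by (simp add: Q.T.TB_cmp)
  qed simp_all
  then show ?thesis using a by blast
 qed simp_all
qed

text \<open>
 Essential surjectivity and fullness are \<open>aut_is_translation\<close> and \<open>transf_is_translation\<close>, and
 representable functors detect arrows. Being a 2-group then passes from \<open>G\<close> to the auto-equivalences: each of them is
 isomorphic to some \<open>phi g\<close>, and translation by an inverse of \<open>g\<close> is inverse to it.
\<close>

theorem trf_equivalence: "two_group_equivalence G U trf"
proof -
 have cU: "category U" by (rule P.RA.category_Aut)
 interpret U: monoidal_category U by (rule P.RA.monoidal_category_Aut)
 have es: "\<exists>g \<in> Obj G. isos U (phi g) E \<noteq> {}" if E: "E : Obj U" for E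
 proof -
  obtain g \<eta> where g: "g : Obj G" and \<eta>: "P.RA.transf (phi g) E \<eta>" using aut_is_translation[of E] E by auto
  then have "\<lparr>asrc = phi g, atgt = E, amap = \<eta>\<rparr> : Arr U" using E by simp
  then have "\<lparr>asrc = phi g, atgt = E, amap = \<eta>\<rparr> : isos U (phi g) E" using P.RA.Aut_is_iso by (simp add: isos_iff)
  with g show ?thesis by blast
 qed
 have ff: "fully_faithful G U trf"
  unfolding fully_faithful_def
 proof (intro ballI)
  fix g h assume [simp]: "g : Obj G" "h : Obj G"
  show "bij_betw (FA trf) (homs G g h) (homs U (FO trf g) (FO trf h))"
   unfolding bij_betw_def
  proof (intro conjI inj_onI equalityI subsetI)
   fix a a' assume a: "a : homs G g h" "a' : homs G g h" and e: "FA trf a = FA trf a'"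
   then have [simp]: "a : Arr G" "a' : Arr G" "Src G a = g" "Tgt G a = h" "Src G a' = g" "Tgt G a' = h" by (auto simp: homs_iff)
   have "TN t a pt = TN t a' pt"
   proof (rule evaluation_faithful[of _ "TO t g pt" "TO t h pt"])
    fix F :: "('g, 'a, 'k, 'v) vfunc" and v
    assume [simp]: "func F" "v : el (FO F (TO t g pt))"
    have "amap (FA trf a) F = amap (FA trf a') F" using e by simp
    then have "tlA G D t a (Idn W F) = tlA G D t a' (Idn W F)" by simp
    from arg_cong[OF this, where f = "\<lambda>\<xi>. ev \<xi> pt v"] show "amap (FA F (TN t a pt)) v = amap (FA F (TN t a' pt)) v"
     by simp
   qed (auto simp: homs_iff)
   then show "a = a'" by (rule R.TN_faithful[OF a])
  next
   fix \<alpha> assume "\<alpha> : homs U (FO trf g) (FO trf h)"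
   then have \<alpha>: "asrc \<alpha> = phi g" "atgt \<alpha> = phi h" "P.RA.transf (phi g) (phi h) (amap \<alpha>)" by (auto simp: homs_iff)
   then obtain a where a: "a : homs G g h" "\<And>F. func F ==> amap \<alpha> F = tlA G D t a (Idn W F)"
    using transf_is_translation[of g h "amap \<alpha>"] by auto
   have "amap \<alpha> = (\<lambda>F \<in> Obj W. tlA G D t a (Idn W F))"
    using P.RA.transf_ext[OF \<alpha>(3)] a(2) by (intro extensionalityI[of _ "Obj W"]) auto
   then have "\<alpha> = FA trf a" using \<alpha>(1,2) a(1) by (auto simp: homs_iff)
   then show "\<alpha> : FA trf ` homs G g h" using a(1) by blast
  next
   fix \<alpha> assume "\<alpha> : FA trf ` homs G g h"
   then obtain a where "a : homs G g h" "\<alpha> = FA trf a" by blast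
   then show "\<alpha> : homs U (FO trf g) (FO trf h)" using functor_trf unfolding is_functor_def by blast
  qed
 qed
 have eq: "category_equivalence G U trf"
  by (rule fully_faithful_equivalence[OF G.category_axioms cU functor_trf ff])
   (use es in "simp add: essentially_surjective_def")
 have "two_group U"
 proof unfold_locales
  fix E assume E: "E : Obj U"
  from es[OF E] obtain g \<alpha> where g [simp]: "g : Obj G" and \<alpha>: "\<alpha> : isos U (phi g) E" by auto
  obtain h v w where h [simp]: "h : Obj G" and v: "v : isos G (g \<otimes>\<^sub>o\<^sub>G h) pt" and w: "w : isos G (h \<otimes>\<^sub>o\<^sub>G g) pt"
   by (rule G.obtain_inverse[OF g])
  have trf_iso: "FA trf u : isos U (phi x) (phi y)" if "u : isos G x y" for u x y
  proof -
   have x: "x : Obj G" "y : Obj G" "u : homs G x y" using that by (auto simp: isos_iff homs_iff)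
   then have "FA trf u : homs U (FO trf x) (FO trf y)" using functor_trf unfolding is_functor_def by blast
   then show ?thesis using x(1,2) P.RA.Aut_is_iso[of "FA trf u"] unfolding isos_def homs_def by (simp del: P.RA.Aut_Arr)
  qed
  have mu: "Mu trf x y : isos U (P.RA.comp (phi x) (phi y)) (phi (x \<otimes>\<^sub>o\<^sub>G y))" "Iota trf : isos U P.RA.ident (phi pt)"
   if "x : Obj G" "y : Obj G" for x y
   using monoidal_functor_trf that unfolding monoidal_functor_def by auto
  have unit: "isos U (P.RA.comp (phi x) (phi y)) P.RA.ident \<noteq> {}"
   if "x : Obj G" "y : Obj G" "u : isos G (x \<otimes>\<^sub>o\<^sub>G y) pt" for x y u
   using U.isos_cmp[OF mu(1)[OF that(1,2)] U.isos_cmp[OF trf_iso[OF that(3)] U.isos_inv[OF mu(2)[OF that(1,2)]]]] by blast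
  from unit[OF g h v] obtain \<gamma> where \<gamma>: "\<gamma> : isos U (P.RA.comp (phi g) (phi h)) P.RA.ident" by blast
  from unit[OF h g w] obtain \<delta> where \<delta>: "\<delta> : isos U (P.RA.comp (phi h) (phi g)) P.RA.ident" by blast
  have ph: "phi h : Obj U" and cO: "P.RA.comp = TenO U" "P.RA.ident = Unt U" by simp_all
  have id: "Idn U (phi h) : isos U (phi h) (phi h)" by (rule U.isos_idn[OF ph])
  have "isos U (E \<otimes>\<^sub>o\<^sub>U phi h) (Unt U) \<noteq> {}"
   using U.isos_cmp[OF U.isos_ten[OF U.isos_inv[OF \<alpha>] id] \<gamma>[unfolded cO]] by blast
  moreover have "isos U (phi h \<otimes>\<^sub>o\<^sub>U E) (Unt U) \<noteq> {}"
   using U.isos_cmp[OF U.isos_ten[OF id U.isos_inv[OF \<alpha>]] \<delta>[unfolded cO]] by blast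
  ultimately show "\<exists>\<Psi> \<in> Obj U. (E \<otimes>\<^sub>o\<^sub>U \<Psi>, Unt U) : iso_rel U \<and> (\<Psi> \<otimes>\<^sub>o\<^sub>U E, Unt U) : iso_rel U"
   using ph E U.tenO_obj U.unt_obj unfolding iso_rel_def by blast
 qed (rule P.RA.Aut_is_iso)
 then show ?thesis
  unfolding two_group_equivalence_def using eq monoidal_functor_trf G.two_group_axioms by blast
qed

end

section \<open>Right translation\<close>

definition right_transl :: "('g, 'a, 'x) moncat_scheme => ('g, 'a) transl" where
 "right_transl G = \<lparr>TO = (\<lambda>g x. x \<otimes>\<^sub>o\<^sub>G g), TB = (\<lambda>g b. b \<otimes>\<^sub>G Idn G g), TN = (\<lambda>a x. Idn G x \<otimes>\<^sub>G a),
   TA = (\<lambda>g h x. inv_arr G (Asc G x g h)), TU = Run G\<rparr>"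

lemma right_transl_simps [simp]:
 "TO (right_transl G) g x = x \<otimes>\<^sub>o\<^sub>G g" "TB (right_transl G) g b = b \<otimes>\<^sub>G Idn G g"
 "TN (right_transl G) a x = Idn G x \<otimes>\<^sub>G a" "TA (right_transl G) g h x = inv_arr G (Asc G x g h)"
 "TU (right_transl G) = Run G"
 by (simp_all add: right_transl_def)

context two_group
begin

lemma pentagon':
 assumes [simp]: "w : Obj G" "x : Obj G" "y : Obj G" "z : Obj G"
 shows "Asc G w x (y \<otimes>\<^sub>o z) \<cdot> Asc G (w \<otimes>\<^sub>o x) y z =
  (Idn G w \<otimes> Asc G x y z) \<cdot> (Asc G w (x \<otimes>\<^sub>o y) z \<cdot> (Asc G w x y \<otimes> Idn G z))"
 by (subst pentagon) (auto simp: assoc)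

lemma inv_pentagon:
 assumes [simp]: "w : Obj G" "x : Obj G" "y : Obj G" "z : Obj G"
 shows "(inv_arr G (Asc G w x y) \<otimes> Idn G z) \<cdot> (inv_arr G (Asc G w (x \<otimes>\<^sub>o y) z) \<cdot> (Idn G w \<otimes> inv_arr G (Asc G x y z)))
  = inv_arr G (Asc G (w \<otimes>\<^sub>o x) y z) \<cdot> inv_arr G (Asc G w x (y \<otimes>\<^sub>o z))"
proof -
 have i: "inv_arr G (Idn G w \<otimes> Asc G x y z) = Idn G w \<otimes> inv_arr G (Asc G x y z)"
  "inv_arr G (Asc G w x y \<otimes> Idn G z) = inv_arr G (Asc G w x y) \<otimes> Idn G z"
  by (simp_all add: inv_ten)
 show ?thesis
  using arg_cong[OF pentagon'[OF assms], where f = "inv_arr G"] by (simp add: inv_cmp i assoc)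
qed

lemma inv_pentagon':
 assumes [simp]: "w : Obj G" "x : Obj G" "y : Obj G" "z : Obj G"
 shows "(inv_arr G (Asc G w x y) \<otimes> Idn G z) \<cdot> inv_arr G (Asc G w (x \<otimes>\<^sub>o y) z)
  = inv_arr G (Asc G (w \<otimes>\<^sub>o x) y z) \<cdot> (inv_arr G (Asc G w x (y \<otimes>\<^sub>o z)) \<cdot> (Idn G w \<otimes> Asc G x y z))"
proof -
 have "((inv_arr G (Asc G w x y) \<otimes> Idn G z) \<cdot> (inv_arr G (Asc G w (x \<otimes>\<^sub>o y) z) \<cdot> (Idn G w \<otimes> inv_arr G (Asc G x y z))))
   \<cdot> (Idn G w \<otimes> Asc G x y z) = (inv_arr G (Asc G (w \<otimes>\<^sub>o x) y z) \<cdot> inv_arr G (Asc G w x (y \<otimes>\<^sub>o z))) \<cdot> (Idn G w \<otimes> Asc G x y z)"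
  by (simp only: inv_pentagon[OF assms])
 then show ?thesis by (simp add: assoc interchange)
qed

text \<open>
 The pentagon with some associators moved to the other side; this is how left translations are
 seen to commute coherently with right ones.
\<close>

lemma mixed_pentagon:
 assumes [simp]: "w : Obj G" "x : Obj G" "y : Obj G" "z : Obj G"
 shows "(Asc G w x y \<otimes> Idn G z) \<cdot> inv_arr G (Asc G (w \<otimes>\<^sub>o x) y z) =
   inv_arr G (Asc G w (x \<otimes>\<^sub>o y) z) \<cdot> ((Idn G w \<otimes> inv_arr G (Asc G x y z)) \<cdot> Asc G w x (y \<otimes>\<^sub>o z))"
  "(Idn G w \<otimes> inv_arr G (Asc G x y z)) \<cdot> Asc G w x (y \<otimes>\<^sub>o z) =
   Asc G w (x \<otimes>\<^sub>o y) z \<cdot> ((Asc G w x y \<otimes> Idn G z) \<cdot> inv_arr G (Asc G (w \<otimes>\<^sub>o x) y z))"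
proof -
 let ?i = "inv_arr G (Asc G (w \<otimes>\<^sub>o x) y z)" and ?j = "Idn G w \<otimes> inv_arr G (Asc G x y z)"
 have "?j \<cdot> ((Asc G w x (y \<otimes>\<^sub>o z) \<cdot> Asc G (w \<otimes>\<^sub>o x) y z) \<cdot> ?i) = ?j \<cdot> Asc G w x (y \<otimes>\<^sub>o z)"
  by (simp add: assoc)
 then show e: "?j \<cdot> Asc G w x (y \<otimes>\<^sub>o z) = Asc G w (x \<otimes>\<^sub>o y) z \<cdot> ((Asc G w x y \<otimes> Idn G z) \<cdot> ?i)"
  unfolding pentagon'[OF assms] by (simp add: assoc interchange_ext)
 show "(Asc G w x y \<otimes> Idn G z) \<cdot> ?i = inv_arr G (Asc G w (x \<otimes>\<^sub>o y) z) \<cdot> (?j \<cdot> Asc G w x (y \<otimes>\<^sub>o z))"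
  unfolding e by (simp add: assoc)
qed

lemma inv_triangle:
 assumes [simp]: "x : Obj G" "y : Obj G"
 shows "(Run G x \<otimes> Idn G y) \<cdot> inv_arr G (Asc G x (Unt G) y) = Idn G x \<otimes> Lun G y"
  "Run G (x \<otimes>\<^sub>o y) \<cdot> inv_arr G (Asc G x y (Unt G)) = Idn G x \<otimes> Run G y"
  "(Lun G x \<otimes> Idn G y) \<cdot> inv_arr G (Asc G (Unt G) x y) = Lun G (x \<otimes>\<^sub>o y)"
 by (simp_all add: assoc flip: triangle run_asc lun_asc)

lemma lun_unt: "Lun G (Unt G) = Run G (Unt G)"
proof (rule unt_ten_inj)
 have "Run G (Unt G) \<otimes> Idn G (Unt G) = (Idn G (Unt G) \<otimes> Lun G (Unt G)) \<cdot> Asc G (Unt G) (Unt G) (Unt G)"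
  by (simp add: triangle)
 have l: "Lun G (Unt G \<otimes>\<^sub>o Unt G) = Idn G (Unt G) \<otimes> Lun G (Unt G)"
  by (rule iso_cancel_left[where f = "Lun G (Unt G)"]) (use lun_nat'[of "Lun G (Unt G)" "Unt G"] in auto)
 have "(Idn G (Unt G) \<otimes> Lun G (Unt G)) \<cdot> Asc G (Unt G) (Unt G) (Unt G) = Lun G (Unt G) \<otimes> Idn G (Unt G)"
  using lun_asc[of "Unt G" "Unt G"] by (simp add: l)
 then have "Lun G (Unt G) \<otimes> Idn G (Unt G) = Run G (Unt G) \<otimes> Idn G (Unt G)"
  by (simp add: triangle)
 then have "Lun G (Unt G) = Run G (Unt G)" by (rule ten_unt_inj) auto
 then show "Idn G (Unt G) \<otimes> Lun G (Unt G) = Idn G (Unt G) \<otimes> Run G (Unt G)" by simp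
qed auto

text \<open>
 The left unitors identify \<open>g \<mapsto> 1 \<otimes> g\<close> with the identity functor, which is an equivalence.
\<close>

lemma torsor_right: "torsor G (right_transl G)"
proof
 show "TB (right_transl G) h (TB (right_transl G) g b) \<cdot> TA (right_transl G) g h (Src G b) =
   TA (right_transl G) g h (Tgt G b) \<cdot> TB (right_transl G) (g \<otimes>\<^sub>o h) b"
  if "g : Obj G" "h : Obj G" "b : Arr G" for g h b
  using inv_asc_nat[of b "Idn G g" "Idn G h" "Tgt G b" g h] that by simp
 show "TN (right_transl G) b (TO (right_transl G) (Tgt G a) x) \<cdot>
   (TB (right_transl G) (Src G b) (TN (right_transl G) a x) \<cdot> TA (right_transl G) (Src G a) (Src G b) x) =
   TA (right_transl G) (Tgt G a) (Tgt G b) x \<cdot> TN (right_transl G) (a \<otimes> b) x"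
  if "a : Arr G" "b : Arr G" "x : Obj G" for a b x
  using inv_asc_nat[of "Idn G x" a b x "Tgt G a" "Tgt G b"] that by (simp add: interchange_ext)
 show "\<exists>g \<in> Obj G. homs G (TO (right_transl G) g (Unt G)) x \<noteq> {}" if "x : Obj G" for x
 proof -
  have "Lun G x : homs G (TO (right_transl G) x (Unt G)) x" using that by (simp add: homs_iff)
  then show ?thesis using that by blast
 qed
 show "\<exists>a \<in> homs G g h. TN (right_transl G) a (Unt G) = b"
  if gh: "g : Obj G" "h : Obj G" "b : homs G (TO (right_transl G) g (Unt G)) (TO (right_transl G) h (Unt G))" for g h b
 proof -
  obtain a where "a : Arr G" "Src G a = g" "Tgt G a = h" "Idn G (Unt G) \<otimes> a = b"
   by (rule ten_left_surj[of b "Unt G" g h]) (use gh in "auto simp: homs_iff")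
  then show ?thesis by (intro bexI[of _ a]) (auto simp: homs_iff)
 qed
 show "a = a'" if "a : homs G g h" "a' : homs G g h" "TN (right_transl G) a (Unt G) = TN (right_transl G) a' (Unt G)" for a a' g h
  by (rule unt_ten_inj) (use that in "auto simp: homs_iff")
qed (auto simp: interchange inv_pentagon' inv_triangle run_nat')

end

section \<open>Coherence of the inverse functor\<close>

locale left_dual = two_group G for G :: "('g, 'a, 'x) moncat_scheme" (structure) +
 fixes d :: "('g, 'a) duality"
 assumes duality: "left_duality G d"
begin

abbreviation dual  (\<open>_\<star>\<close> [1000] 999) where "g\<star> \<equiv> Dual d g"
abbreviation one where "one \<equiv> Unt G"
abbreviation idn where "idn \<equiv> Idn G"
abbreviation iv where "iv \<equiv> inv_arr G"
abbreviation td where "td \<equiv> to_dual G d"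
abbreviation st where "st \<equiv> star_arr G d"
abbreviation mu where "mu \<equiv> star_mu G d"
abbreviation io where "io \<equiv> star_iota G d"

lemma dual_simps [simp]:
 assumes "g : Obj G"
 shows "g\<star> : Obj G" "Ev d g : Arr G" "Src G (Ev d g) = g\<star> \<otimes>\<^sub>o g" "Tgt G (Ev d g) = one"
  "Coev d g : Arr G" "Src G (Coev d g) = one" "Tgt G (Coev d g) = g \<otimes>\<^sub>o g\<star>"
 using duality assms by (auto simp: left_duality_def homs_iff)

lemma zigzag:
 assumes [simp]: "g : Obj G"
 shows "Lun G (g\<star>) \<cdot> ((Ev d g \<otimes> idn (g\<star>)) \<cdot> (iv (Asc G (g\<star>) g (g\<star>)) \<cdot>
  ((idn (g\<star>) \<otimes> Coev d g) \<cdot> iv (Run G (g\<star>))))) = idn (g\<star>)"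
proof -
 have "Lun G (g\<star>) \<cdot> (Ev d g \<otimes> idn (g\<star>)) \<cdot> iv (Asc G (g\<star>) g (g\<star>)) \<cdot>
  (idn (g\<star>) \<otimes> Coev d g) \<cdot> iv (Run G (g\<star>)) = idn (g\<star>)"
  using duality assms unfolding left_duality_def by blast
 then show ?thesis by (simp add: assoc)
qed

text \<open>
 Arrows into \<open>g\<star>\<close> are determined by composing with the evaluation \<open>Ev d g\<close>; this is how all
 identities between arrows into duals below are proved.
\<close>

lemma to_dual_ev:
 assumes [simp]: "t : Arr G" "Src G t = y" "Tgt G t = g\<star>" "g : Obj G"
 shows "td y g (Ev d g \<cdot> (t \<otimes> idn g)) = t"
proof -
 have y [simp]: "y : Obj G" using src_in[of t] by simp
 have 1: "((t \<otimes> idn g) \<otimes> idn (g\<star>)) \<cdot> iv (Asc G y g (g\<star>)) = iv (Asc G (g\<star>) g (g\<star>)) \<cdot> (t \<otimes> idn (g \<otimes>\<^sub>o g\<star>))"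
  using inv_asc_nat[of t "idn g" "idn (g\<star>)" "g\<star>" g "g\<star>"] by simp
 have 2: "(t \<otimes> idn (g \<otimes>\<^sub>o g\<star>)) \<cdot> (idn y \<otimes> Coev d g) = (idn (g\<star>) \<otimes> Coev d g) \<cdot> (t \<otimes> idn one)"
  by (simp add: interchange)
 have 3: "(t \<otimes> idn one) \<cdot> iv (Run G y) = iv (Run G (g\<star>)) \<cdot> t"
  by (rule iso_square[symmetric]) (use run_nat'[of t "g\<star>"] in auto)
 have "td y g (Ev d g \<cdot> (t \<otimes> idn g)) =
   Lun G (g\<star>) \<cdot> ((Ev d g \<otimes> idn (g\<star>)) \<cdot> (((t \<otimes> idn g) \<otimes> idn (g\<star>)) \<cdot> (iv (Asc G y g (g\<star>)) \<cdot>
    ((idn y \<otimes> Coev d g) \<cdot> iv (Run G y)))))"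
  by (simp add: to_dual_def assoc interchange_ext)
 also have "... = Lun G (g\<star>) \<cdot> ((Ev d g \<otimes> idn (g\<star>)) \<cdot> (iv (Asc G (g\<star>) g (g\<star>)) \<cdot> ((idn (g\<star>) \<otimes> Coev d g) \<cdot>
   ((t \<otimes> idn one) \<cdot> iv (Run G y)))))"
  by (subst ext2[OF 1], simp_all, subst ext2[OF 2], simp_all)
 also have "... = (Lun G (g\<star>) \<cdot> ((Ev d g \<otimes> idn (g\<star>)) \<cdot> (iv (Asc G (g\<star>) g (g\<star>)) \<cdot>
   ((idn (g\<star>) \<otimes> Coev d g) \<cdot> iv (Run G (g\<star>)))))) \<cdot> t"
  unfolding 3 by (simp add: assoc)
 finally show ?thesis unfolding zigzag[OF \<open>g : Obj G\<close>] by simp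
qed

lemma to_dual [simp]:
 assumes [simp]: "e : Arr G" "Src G e = y \<otimes>\<^sub>o g" "Tgt G e = one" "y : Obj G" "g : Obj G"
 shows "td y g e : Arr G" "Src G (td y g e) = y" "Tgt G (td y g e) = g\<star>"
  "Ev d g \<cdot> (td y g e \<otimes> idn g) = e"
proof -
 obtain t where t [simp]: "t : Arr G" "Src G t = y" "Tgt G t = g\<star>" and e: "t \<otimes> idn g = iv (Ev d g) \<cdot> e"
  by (rule ten_right_surj[of "iv (Ev d g) \<cdot> e" y g "g\<star>"]) auto
 have "Ev d g \<cdot> (t \<otimes> idn g) = e" by (simp add: e)
 moreover from this have "td y g e = t" using to_dual_ev[of t y g] by simp
 ultimately show "td y g e : Arr G" "Src G (td y g e) = y" "Tgt G (td y g e) = g\<star>"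
  "Ev d g \<cdot> (td y g e \<otimes> idn g) = e" by simp_all
qed

text \<open>
 The form used in practice, with an arrow \<open>a\<close> instead of an identity in the second factor.
\<close>

lemma ev_inj:
 assumes "Ev d (Tgt G a) \<cdot> (s \<otimes> a) = Ev d (Tgt G a) \<cdot> (s' \<otimes> a)" "s : Arr G" "s' : Arr G" "a : Arr G"
  "Tgt G s = (Tgt G a)\<star>" "Tgt G s' = (Tgt G a)\<star>" "Src G s = Src G s'"
 shows "s = s'"
proof -
 note [simp] = assms(2-)
 have "s \<otimes> a = s' \<otimes> a" by (rule iso_cancel_left[OF assms(1)]) auto
 then have "(s \<otimes> a) \<cdot> (idn (Src G s') \<otimes> iv a) = (s' \<otimes> a) \<cdot> (idn (Src G s') \<otimes> iv a)" by simp
 then have "s \<otimes> idn (Tgt G a) = s' \<otimes> idn (Tgt G a)" by (simp add: interchange)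
 then show ?thesis by (rule ten_right_inj) auto
qed

lemma star_arr [simp]:
 assumes [simp]: "a : Arr G"
 shows "st a : Arr G" "Src G (st a) = (Src G a)\<star>" "Tgt G (st a) = (Tgt G a)\<star>"
  "Tgt G a = h ==> Ev d h \<cdot> (st a \<otimes> a) = Ev d (Src G a)"
proof -
 let ?l = "dual_arr G d a"
 have l [simp]: "?l : Arr G" "Src G ?l = (Tgt G a)\<star>" "Tgt G ?l = (Src G a)\<star>"
  and e: "Ev d (Src G a) \<cdot> (?l \<otimes> idn (Src G a)) = Ev d (Tgt G a) \<cdot> (idn ((Tgt G a)\<star>) \<otimes> a)"
  by (simp_all add: dual_arr_def)
 show s: "st a : Arr G" "Src G (st a) = (Src G a)\<star>" "Tgt G (st a) = (Tgt G a)\<star>"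
  by (simp_all add: star_arr_def)
 have "Ev d (Tgt G a) \<cdot> (st a \<otimes> a) = (Ev d (Tgt G a) \<cdot> (idn ((Tgt G a)\<star>) \<otimes> a)) \<cdot> (st a \<otimes> idn (Src G a))"
  using s by (simp add: assoc interchange)
 also have "... = Ev d (Src G a)" unfolding e[symmetric] using s by (simp add: assoc interchange, simp add: star_arr_def)
 finally show "Tgt G a = h ==> Ev d h \<cdot> (st a \<otimes> a) = Ev d (Src G a)" by simp
qed

lemma star_arr_eqI:
 assumes "a : Arr G" "s : Arr G" "Src G s = (Src G a)\<star>" "Tgt G s = (Tgt G a)\<star>" "Ev d (Tgt G a) \<cdot> (s \<otimes> a) = Ev d (Src G a)"
 shows "st a = s"
 by (rule ev_inj[of a]) (use assms in auto)

lemma star_idn [simp]: "g : Obj G ==> st (idn g) = idn (g\<star>)"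
 by (rule star_arr_eqI) auto

lemma star_cmp:
 assumes "a : Arr G" "b : Arr G" "Src G b = Tgt G a"
 shows "st b \<cdot> st a = st (b \<cdot> a)"
proof (rule star_arr_eqI[symmetric])
 have "Ev d (Tgt G b) \<cdot> ((st b \<cdot> st a) \<otimes> (b \<cdot> a)) =
   (Ev d (Tgt G b) \<cdot> (st b \<otimes> b)) \<cdot> (st a \<otimes> a)"
  using assms by (simp add: assoc interchange del: star_arr(4))
 then show "Ev d (Tgt G (b \<cdot> a)) \<cdot> ((st b \<cdot> st a) \<otimes> (b \<cdot> a)) = Ev d (Src G (b \<cdot> a))"
  using assms by simp
qed (use assms in auto)

text \<open>The evaluation of \<open>g\<star>\<close> against the first factor of \<open>g \<otimes> x\<close>.\<close>

definition rho where "rho g x = Lun G x \<cdot> ((Ev d g \<otimes> idn x) \<cdot> iv (Asc G (g\<star>) g x))"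

lemma rho [simp]:
 assumes "g : Obj G" "x : Obj G"
 shows "rho g x : Arr G" "Src G (rho g x) = g\<star> \<otimes>\<^sub>o (g \<otimes>\<^sub>o x)" "Tgt G (rho g x) = x"
 using assms by (simp_all add: rho_def)

lemma rho_nat:
 assumes [simp]: "a : Arr G" "f : Arr G" "Tgt G a = g" "Tgt G f = x"
 shows "rho g x \<cdot> (st a \<otimes> (a \<otimes> f)) = f \<cdot> rho (Src G a) (Src G f)"
proof -
 have gx [simp]: "g : Obj G" "x : Obj G" using tgt_in[of a] tgt_in[of f] by auto
 have 1: "iv (Asc G (g\<star>) g x) \<cdot> (st a \<otimes> (a \<otimes> f)) =
   ((st a \<otimes> a) \<otimes> f) \<cdot> iv (Asc G ((Src G a)\<star>) (Src G a) (Src G f))"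
  using inv_asc_nat[of "st a" a f "g\<star>" g x] by simp
 have 2: "(Ev d g \<otimes> idn x) \<cdot> ((st a \<otimes> a) \<otimes> f) = (idn one \<otimes> f) \<cdot> (Ev d (Src G a) \<otimes> idn (Src G f))"
  by (simp add: interchange)
 have 3: "Lun G x \<cdot> (idn one \<otimes> f) = f \<cdot> Lun G (Src G f)" by (rule lun_nat') auto
 have "rho g x \<cdot> (st a \<otimes> (a \<otimes> f)) = Lun G x \<cdot> ((Ev d g \<otimes> idn x) \<cdot> (((st a \<otimes> a) \<otimes> f) \<cdot>
   iv (Asc G ((Src G a)\<star>) (Src G a) (Src G f))))"
  by (simp add: rho_def assoc 1)
 also have "... = Lun G x \<cdot> ((idn one \<otimes> f) \<cdot> ((Ev d (Src G a) \<otimes> idn (Src G f)) \<cdot>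
   iv (Asc G ((Src G a)\<star>) (Src G a) (Src G f))))"
  by (subst ext2[OF 2]) simp_all
 also have "... = f \<cdot> rho (Src G a) (Src G f)"
  unfolding rho_def by (subst ext2[OF 3]) simp_all
 finally show ?thesis .
qed

lemma rho_asc:
 assumes [simp]: "g : Obj G" "h : Obj G" "x : Obj G"
 shows "rho g (h \<otimes>\<^sub>o x) \<cdot> (idn (g\<star>) \<otimes> Asc G g h x) = (rho g h \<otimes> idn x) \<cdot> iv (Asc G (g\<star>) (g \<otimes>\<^sub>o h) x)"
proof -
 have 1: "iv (Asc G (g\<star>) g (h \<otimes>\<^sub>o x)) \<cdot> (idn (g\<star>) \<otimes> Asc G g h x) =
   Asc G (g\<star> \<otimes>\<^sub>o g) h x \<cdot> ((iv (Asc G (g\<star>) g h) \<otimes> idn x) \<cdot> iv (Asc G (g\<star>) (g \<otimes>\<^sub>o h) x))"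
  unfolding inv_pentagon'[of "g\<star>" g h x, simplified] by simp
 have 2: "(Ev d g \<otimes> idn (h \<otimes>\<^sub>o x)) \<cdot> Asc G (g\<star> \<otimes>\<^sub>o g) h x = Asc G one h x \<cdot> ((Ev d g \<otimes> idn h) \<otimes> idn x)"
  using asc_nat'[of "Ev d g" "idn h" "idn x" one h x] by simp
 have "rho g (h \<otimes>\<^sub>o x) \<cdot> (idn (g\<star>) \<otimes> Asc G g h x) = Lun G (h \<otimes>\<^sub>o x) \<cdot> ((Ev d g \<otimes> idn (h \<otimes>\<^sub>o x)) \<cdot>
   (Asc G (g\<star> \<otimes>\<^sub>o g) h x \<cdot> ((iv (Asc G (g\<star>) g h) \<otimes> idn x) \<cdot> iv (Asc G (g\<star>) (g \<otimes>\<^sub>o h) x))))"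
  by (simp add: rho_def assoc 1)
 also have "... = Lun G (h \<otimes>\<^sub>o x) \<cdot> (Asc G one h x \<cdot> (((Ev d g \<otimes> idn h) \<otimes> idn x) \<cdot>
   ((iv (Asc G (g\<star>) g h) \<otimes> idn x) \<cdot> iv (Asc G (g\<star>) (g \<otimes>\<^sub>o h) x))))"
  by (subst ext2[OF 2]) simp_all
 also have "... = (Lun G h \<otimes> idn x) \<cdot> (((Ev d g \<otimes> idn h) \<otimes> idn x) \<cdot>
   ((iv (Asc G (g\<star>) g h) \<otimes> idn x) \<cdot> iv (Asc G (g\<star>) (g \<otimes>\<^sub>o h) x)))"
  by (subst ext1[OF lun_asc]) simp_all
 also have "... = (rho g h \<otimes> idn x) \<cdot> iv (Asc G (g\<star>) (g \<otimes>\<^sub>o h) x)"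
  by (simp add: rho_def interchange_ext)
 finally show ?thesis .
qed

lemma rho_unt:
 assumes [simp]: "g : Obj G"
 shows "rho g one = Ev d g \<cdot> (idn (g\<star>) \<otimes> Run G g)"
proof -
 have "rho g one = (Run G one \<cdot> (Ev d g \<otimes> idn one)) \<cdot> iv (Asc G (g\<star>) g one)"
  by (simp add: rho_def lun_unt assoc)
 also have "Run G one \<cdot> (Ev d g \<otimes> idn one) = Ev d g \<cdot> Run G (g\<star> \<otimes>\<^sub>o g)"
  using run_nat'[of "Ev d g" one] by simp
 finally show ?thesis by (simp add: assoc inv_triangle)
qed

lemma star_mu [simp]:
 assumes [simp]: "g : Obj G" "h : Obj G"
 shows "mu g h : Arr G" "Src G (mu g h) = h\<star> \<otimes>\<^sub>o g\<star>" "Tgt G (mu g h) = (g \<otimes>\<^sub>o h)\<star>"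
  "Ev d (g \<otimes>\<^sub>o h) \<cdot> (mu g h \<otimes> idn (g \<otimes>\<^sub>o h)) = Ev d h \<cdot> ((idn (h\<star>) \<otimes> rho g h) \<cdot> Asc G (h\<star>) (g\<star>) (g \<otimes>\<^sub>o h))"
 by (simp_all add: star_mu_def rho_def assoc)

lemma star_iota [simp]:
 "io : Arr G" "Src G (io) = one" "Tgt G (io) = one\<star>"
 "Ev d one \<cdot> (io \<otimes> idn one) = Lun G one"
 by (simp_all add: star_iota_def)

lemma ev_star_mu:
 assumes [simp]: "g : Obj G" "h : Obj G" "w : Arr G" "Tgt G w = h\<star> \<otimes>\<^sub>o g\<star>" "a : Arr G" "Tgt G a = g \<otimes>\<^sub>o h"
 shows "Ev d (g \<otimes>\<^sub>o h) \<cdot> ((mu g h \<cdot> w) \<otimes> a) =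
  Ev d h \<cdot> ((idn (h\<star>) \<otimes> rho g h) \<cdot> (Asc G (h\<star>) (g\<star>) (g \<otimes>\<^sub>o h) \<cdot> (w \<otimes> a)))"
proof -
 have "Ev d (g \<otimes>\<^sub>o h) \<cdot> ((mu g h \<cdot> w) \<otimes> a) = (Ev d (g \<otimes>\<^sub>o h) \<cdot> (mu g h \<otimes> idn (g \<otimes>\<^sub>o h))) \<cdot> (w \<otimes> a)"
  by (simp add: assoc interchange del: star_mu(4))
 then show ?thesis by (simp add: assoc)
qed

text \<open>
 Evaluating \<open>(g \<otimes> h)\<star>\<close> amounts to evaluating \<open>g\<star>\<close> and then \<open>h\<star>\<close>, even with a further factor \<open>x\<close>.
 The coherence of \<open>mu\<close> for three objects is a consequence of this.
\<close>

lemma rho_mu: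
 assumes [simp]: "g : Obj G" "h : Obj G" "x : Obj G"
 shows "rho (g \<otimes>\<^sub>o h) x \<cdot> (mu g h \<otimes> idn ((g \<otimes>\<^sub>o h) \<otimes>\<^sub>o x)) =
  rho h x \<cdot> ((idn (h\<star>) \<otimes> (rho g (h \<otimes>\<^sub>o x) \<cdot> (idn (g\<star>) \<otimes> Asc G g h x))) \<cdot> Asc G (h\<star>) (g\<star>) ((g \<otimes>\<^sub>o h) \<otimes>\<^sub>o x))"
proof -
 let ?k = "g \<otimes>\<^sub>o h" and ?A = "Asc G (h\<star>) (g\<star>) (g \<otimes>\<^sub>o h)"
 let ?i = "iv (Asc G (h\<star> \<otimes>\<^sub>o g\<star>) ?k x)"
 have 1: "iv (Asc G (?k\<star>) ?k x) \<cdot> (mu g h \<otimes> idn (?k \<otimes>\<^sub>o x)) = ((mu g h \<otimes> idn ?k) \<otimes> idn x) \<cdot> ?i"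
  using inv_asc_nat[of "mu g h" "idn ?k" "idn x" "?k\<star>" ?k x] by simp
 have "rho ?k x \<cdot> (mu g h \<otimes> idn (?k \<otimes>\<^sub>o x)) =
   Lun G x \<cdot> (((Ev d ?k \<cdot> (mu g h \<otimes> idn ?k)) \<otimes> idn x) \<cdot> ?i)"
  by (simp add: rho_def assoc 1 interchange_ext del: star_mu(4))
 also have "... = Lun G x \<cdot> ((Ev d h \<otimes> idn x) \<cdot> (((idn (h\<star>) \<otimes> rho g h) \<otimes> idn x) \<cdot> ((?A \<otimes> idn x) \<cdot> ?i)))"
  by (simp add: interchange_ext)
 finally have L: "rho ?k x \<cdot> (mu g h \<otimes> idn (?k \<otimes>\<^sub>o x)) =
   Lun G x \<cdot> ((Ev d h \<otimes> idn x) \<cdot> (((idn (h\<star>) \<otimes> rho g h) \<otimes> idn x) \<cdot> ((?A \<otimes> idn x) \<cdot> ?i)))" .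
 have 2: "iv (Asc G (h\<star>) h x) \<cdot> (idn (h\<star>) \<otimes> (rho g h \<otimes> idn x)) =
   ((idn (h\<star>) \<otimes> rho g h) \<otimes> idn x) \<cdot> iv (Asc G (h\<star>) (g\<star> \<otimes>\<^sub>o ?k) x)"
  using inv_asc_nat[of "idn (h\<star>)" "rho g h" "idn x" "h\<star>" h x] by simp
 have 3: "iv (Asc G (h\<star>) (g\<star> \<otimes>\<^sub>o ?k) x) \<cdot> ((idn (h\<star>) \<otimes> iv (Asc G (g\<star>) ?k x)) \<cdot> Asc G (h\<star>) (g\<star>) (?k \<otimes>\<^sub>o x))
   = (?A \<otimes> idn x) \<cdot> ?i"
  by (rule mixed_pentagon(1)[symmetric]) simp_all
 have "rho h x \<cdot> ((idn (h\<star>) \<otimes> (rho g (h \<otimes>\<^sub>o x) \<cdot> (idn (g\<star>) \<otimes> Asc G g h x))) \<cdot> Asc G (h\<star>) (g\<star>) (?k \<otimes>\<^sub>o x))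
   = Lun G x \<cdot> ((Ev d h \<otimes> idn x) \<cdot> (iv (Asc G (h\<star>) h x) \<cdot> ((idn (h\<star>) \<otimes> (rho g h \<otimes> idn x)) \<cdot>
     ((idn (h\<star>) \<otimes> iv (Asc G (g\<star>) ?k x)) \<cdot> Asc G (h\<star>) (g\<star>) (?k \<otimes>\<^sub>o x)))))"
  by (simp add: rho_asc rho_def[of h x] assoc interchange_ext)
 also have "... = Lun G x \<cdot> ((Ev d h \<otimes> idn x) \<cdot> (((idn (h\<star>) \<otimes> rho g h) \<otimes> idn x) \<cdot> ((?A \<otimes> idn x) \<cdot> ?i)))"
  by (subst ext2[OF 2]) (simp_all add: 3)
 finally show ?thesis using L by simp
qed

text \<open>The dual is a monoidal functor to the 2-group with the reversed tensor product.\<close>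

lemma star_mu_nat:
 assumes [simp]: "a : Arr G" "b : Arr G"
 shows "st (a \<otimes> b) \<cdot> mu (Src G a) (Src G b) = mu (Tgt G a) (Tgt G b) \<cdot> (st b \<otimes> st a)"
proof (rule ev_inj[of "a \<otimes> b"])
 let ?g = "Src G a" and ?h = "Src G b" and ?g' = "Tgt G a" and ?h' = "Tgt G b" and ?a = "st a" and ?b = "st b"
 have 1: "Asc G (?h'\<star>) (?g'\<star>) (?g' \<otimes>\<^sub>o ?h') \<cdot> ((?b \<otimes> ?a) \<otimes> (a \<otimes> b)) = (?b \<otimes> (?a \<otimes> (a \<otimes> b))) \<cdot> Asc G (?h\<star>) (?g\<star>) (?g \<otimes>\<^sub>o ?h)"
  using asc_nat'[of ?b ?a "a \<otimes> b"] by simp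
 have "Ev d (?g' \<otimes>\<^sub>o ?h') \<cdot> ((mu ?g' ?h' \<cdot> (?b \<otimes> ?a)) \<otimes> (a \<otimes> b)) =
   (Ev d ?h' \<cdot> (?b \<otimes> b)) \<cdot> ((idn (?h\<star>) \<otimes> rho ?g ?h) \<cdot> Asc G (?h\<star>) (?g\<star>) (?g \<otimes>\<^sub>o ?h))"
  by (simp add: ev_star_mu 1 interchange_ext rho_nat assoc del: star_arr(4))
 also have "... = Ev d (?g \<otimes>\<^sub>o ?h) \<cdot> (mu ?g ?h \<otimes> idn (?g \<otimes>\<^sub>o ?h))" by simp
 also have "... = (Ev d (?g' \<otimes>\<^sub>o ?h') \<cdot> (st (a \<otimes> b) \<otimes> (a \<otimes> b))) \<cdot> (mu ?g ?h \<otimes> idn (?g \<otimes>\<^sub>o ?h))" by simp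
 also have "... = Ev d (?g' \<otimes>\<^sub>o ?h') \<cdot> ((st (a \<otimes> b) \<cdot> mu ?g ?h) \<otimes> (a \<otimes> b))"
  by (simp add: assoc interchange del: star_arr(4))
 finally show "Ev d (Tgt G (a \<otimes> b)) \<cdot> ((st (a \<otimes> b) \<cdot> mu ?g ?h) \<otimes> (a \<otimes> b)) =
  Ev d (Tgt G (a \<otimes> b)) \<cdot> ((mu ?g' ?h' \<cdot> (?b \<otimes> ?a)) \<otimes> (a \<otimes> b))" by simp
qed auto

lemma ev_star_cmp:
 assumes [simp]: "a : Arr G" "w : Arr G" "Tgt G a = g" "Tgt G w = (Src G a)\<star>"
 shows "Ev d g \<cdot> ((st a \<cdot> w) \<otimes> a) = Ev d (Src G a) \<cdot> (w \<otimes> idn (Src G a))"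
proof -
 have "g : Obj G" using tgt_in[of a] by simp
 then have "Ev d g \<cdot> ((st a \<cdot> w) \<otimes> a) = (Ev d g \<cdot> (st a \<otimes> a)) \<cdot> (w \<otimes> idn (Src G a))"
  by (simp add: assoc interchange del: star_arr(4))
 then show ?thesis by simp
qed

lemma star_lun:
 assumes [simp]: "g : Obj G"
 shows "st (Lun G g) \<cdot> (mu one g \<cdot> (idn (g\<star>) \<otimes> io)) = Run G (g\<star>)"
proof (rule ev_inj[of "Lun G g"])
 have 1: "Asc G (g\<star>) (one\<star>) (one \<otimes>\<^sub>o g) \<cdot> ((idn (g\<star>) \<otimes> io) \<otimes> idn (one \<otimes>\<^sub>o g)) =
   (idn (g\<star>) \<otimes> (io \<otimes> idn (one \<otimes>\<^sub>o g))) \<cdot> Asc G (g\<star>) one (one \<otimes>\<^sub>o g)"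
  using asc_nat'[of "idn (g\<star>)" "io" "idn (one \<otimes>\<^sub>o g)"] by simp
 have 2: "rho one g \<cdot> (io \<otimes> idn (one \<otimes>\<^sub>o g)) = Lun G g \<cdot> Lun G (one \<otimes>\<^sub>o g)"
 proof -
  have "iv (Asc G (one\<star>) one g) \<cdot> (io \<otimes> idn (one \<otimes>\<^sub>o g)) = ((io \<otimes> idn one) \<otimes> idn g) \<cdot> iv (Asc G one one g)"
   using inv_asc_nat[of "io" "idn one" "idn g" "one\<star>" one g] by simp
  then show ?thesis by (simp add: rho_def assoc interchange_ext inv_triangle)
 qed
 have 3: "(idn (g\<star>) \<otimes> Lun G (one \<otimes>\<^sub>o g)) \<cdot> Asc G (g\<star>) one (one \<otimes>\<^sub>o g) = Run G (g\<star>) \<otimes> idn (one \<otimes>\<^sub>o g)"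
  by (rule triangle) auto
 have "Ev d g \<cdot> ((st (Lun G g) \<cdot> (mu one g \<cdot> (idn (g\<star>) \<otimes> io))) \<otimes> Lun G g)
   = Ev d g \<cdot> ((idn (g\<star>) \<otimes> (Lun G g \<cdot> Lun G (one \<otimes>\<^sub>o g))) \<cdot> Asc G (g\<star>) one (one \<otimes>\<^sub>o g))"
  by (simp add: ev_star_cmp ev_star_mu 1 interchange_ext 2)
 also have "... = Ev d g \<cdot> ((idn (g\<star>) \<otimes> Lun G g) \<cdot> ((idn (g\<star>) \<otimes> Lun G (one \<otimes>\<^sub>o g)) \<cdot> Asc G (g\<star>) one (one \<otimes>\<^sub>o g)))"
  by (simp add: interchange_ext)
 also have "... = Ev d g \<cdot> (Run G (g\<star>) \<otimes> Lun G g)" unfolding 3 by (simp add: interchange)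
 finally show "Ev d (Tgt G (Lun G g)) \<cdot> ((st (Lun G g) \<cdot> (mu one g \<cdot> (idn (g\<star>) \<otimes> io))) \<otimes> Lun G g)
   = Ev d (Tgt G (Lun G g)) \<cdot> (Run G (g\<star>) \<otimes> Lun G g)" by simp
qed auto

lemma star_run:
 assumes [simp]: "g : Obj G"
 shows "st (Run G g) \<cdot> (mu g one \<cdot> (io \<otimes> idn (g\<star>))) = Lun G (g\<star>)"
proof (rule ev_inj[of "Run G g"])
 have 1: "Asc G (one\<star>) (g\<star>) (g \<otimes>\<^sub>o one) \<cdot> ((io \<otimes> idn (g\<star>)) \<otimes> idn (g \<otimes>\<^sub>o one)) =
   (io \<otimes> idn (g\<star> \<otimes>\<^sub>o (g \<otimes>\<^sub>o one))) \<cdot> Asc G one (g\<star>) (g \<otimes>\<^sub>o one)"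
  using asc_nat'[of "io" "idn (g\<star>)" "idn (g \<otimes>\<^sub>o one)"] by simp
 have "Ev d g \<cdot> ((st (Run G g) \<cdot> (mu g one \<cdot> (io \<otimes> idn (g\<star>)))) \<otimes> Run G g)
   = (Ev d one \<cdot> (io \<otimes> idn one)) \<cdot> ((idn one \<otimes> rho g one) \<cdot> Asc G one (g\<star>) (g \<otimes>\<^sub>o one))"
  by (simp add: ev_star_cmp ev_star_mu 1 interchange_ext assoc del: star_iota(4))
 also have "... = rho g one \<cdot> (Lun G (g\<star> \<otimes>\<^sub>o (g \<otimes>\<^sub>o one)) \<cdot> Asc G one (g\<star>) (g \<otimes>\<^sub>o one))"
  using ext2[OF lun_nat'[of "rho g one" one], of "Asc G one (g\<star>) (g \<otimes>\<^sub>o one)"] by simp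
 also have "... = Ev d g \<cdot> (Lun G (g\<star>) \<otimes> Run G g)" by (simp add: lun_asc rho_unt assoc interchange)
 finally show "Ev d (Tgt G (Run G g)) \<cdot> ((st (Run G g) \<cdot> (mu g one \<cdot> (io \<otimes> idn (g\<star>)))) \<otimes> Run G g)
   = Ev d (Tgt G (Run G g)) \<cdot> (Lun G (g\<star>) \<otimes> Run G g)" by simp
qed auto

lemma star_asc:
 assumes [simp]: "g : Obj G" "h : Obj G" "k : Obj G"
 shows "st (Asc G g h k) \<cdot> (mu (g \<otimes>\<^sub>o h) k \<cdot> (idn (k\<star>) \<otimes> mu g h)) =
  mu g (h \<otimes>\<^sub>o k) \<cdot> ((mu h k \<otimes> idn (g\<star>)) \<cdot> iv (Asc G (k\<star>) (h\<star>) (g\<star>)))"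
proof (rule ev_inj[of "Asc G g h k"])
 let ?K = "k\<star>" and ?H = "h\<star>" and ?G = "g\<star>" and ?l = "(g \<otimes>\<^sub>o h) \<otimes>\<^sub>o k" and ?r = "g \<otimes>\<^sub>o (h \<otimes>\<^sub>o k)" and ?A = "Asc G g h k"
 let ?m = "rho h k \<cdot> ((idn ?H \<otimes> (rho g (h \<otimes>\<^sub>o k) \<cdot> (idn ?G \<otimes> ?A))) \<cdot> Asc G ?H ?G ?l)"
 have 1: "Asc G ?K ((g \<otimes>\<^sub>o h)\<star>) ?l \<cdot> ((idn ?K \<otimes> mu g h) \<otimes> idn ?l) = (idn ?K \<otimes> (mu g h \<otimes> idn ?l)) \<cdot> Asc G ?K (?H \<otimes>\<^sub>o ?G) ?l"
  using asc_nat'[of "idn ?K" "mu g h" "idn ?l"] by simp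
 have L: "Ev d ?r \<cdot> ((st ?A \<cdot> (mu (g \<otimes>\<^sub>o h) k \<cdot> (idn ?K \<otimes> mu g h))) \<otimes> ?A)
   = Ev d k \<cdot> ((idn ?K \<otimes> ?m) \<cdot> Asc G ?K (?H \<otimes>\<^sub>o ?G) ?l)"
  by (simp add: ev_star_cmp ev_star_mu 1 interchange_ext rho_mu)
 let ?i = "iv (Asc G ?K ?H ?G)"
 have 2: "Asc G ((h \<otimes>\<^sub>o k)\<star>) ?G ?r \<cdot> ((mu h k \<otimes> idn ?G) \<otimes> idn ?r) = (mu h k \<otimes> idn (?G \<otimes>\<^sub>o ?r)) \<cdot> Asc G (?K \<otimes>\<^sub>o ?H) ?G ?r"
  using asc_nat'[of "mu h k" "idn ?G" "idn ?r"] by simp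
 have 3: "Asc G ?K ?H (h \<otimes>\<^sub>o k) \<cdot> (idn (?K \<otimes>\<^sub>o ?H) \<otimes> rho g (h \<otimes>\<^sub>o k)) = (idn ?K \<otimes> (idn ?H \<otimes> rho g (h \<otimes>\<^sub>o k))) \<cdot> Asc G ?K ?H (?G \<otimes>\<^sub>o ?r)"
  using asc_nat'[of "idn ?K" "idn ?H" "rho g (h \<otimes>\<^sub>o k)" ?K ?H "h \<otimes>\<^sub>o k"] by simp
 have 4: "Asc G ?K ?H (?G \<otimes>\<^sub>o ?r) \<cdot> (Asc G (?K \<otimes>\<^sub>o ?H) ?G ?r \<cdot> (?i \<otimes> ?A)) = (idn ?K \<otimes> ((idn ?H \<otimes> (idn ?G \<otimes> ?A)) \<cdot> Asc G ?H ?G ?l)) \<cdot> Asc G ?K (?H \<otimes>\<^sub>o ?G) ?l"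
 proof -
  have 5: "Asc G ?H ?G ?r \<cdot> (idn (?H \<otimes>\<^sub>o ?G) \<otimes> ?A) = (idn ?H \<otimes> (idn ?G \<otimes> ?A)) \<cdot> Asc G ?H ?G ?l"
   using asc_nat'[of "idn ?H" "idn ?G" ?A ?H ?G ?r] by simp
  have 6: "Asc G ?K (?H \<otimes>\<^sub>o ?G) ?r \<cdot> (idn (?K \<otimes>\<^sub>o (?H \<otimes>\<^sub>o ?G)) \<otimes> ?A) = (idn ?K \<otimes> (idn (?H \<otimes>\<^sub>o ?G) \<otimes> ?A)) \<cdot> Asc G ?K (?H \<otimes>\<^sub>o ?G) ?l"
   using asc_nat'[of "idn ?K" "idn (?H \<otimes>\<^sub>o ?G)" ?A ?K "?H \<otimes>\<^sub>o ?G" ?r] by simp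
  have "Asc G ?K ?H (?G \<otimes>\<^sub>o ?r) \<cdot> (Asc G (?K \<otimes>\<^sub>o ?H) ?G ?r \<cdot> (?i \<otimes> ?A)) = (Asc G ?K ?H (?G \<otimes>\<^sub>o ?r) \<cdot> Asc G (?K \<otimes>\<^sub>o ?H) ?G ?r) \<cdot> (?i \<otimes> ?A)"
   by (simp add: assoc)
  also have "... = (idn ?K \<otimes> Asc G ?H ?G ?r) \<cdot> (Asc G ?K (?H \<otimes>\<^sub>o ?G) ?r \<cdot> (idn (?K \<otimes>\<^sub>o (?H \<otimes>\<^sub>o ?G)) \<otimes> ?A))"
   by (subst pentagon') (simp_all add: assoc interchange)
  also have "... = (idn ?K \<otimes> (Asc G ?H ?G ?r \<cdot> (idn (?H \<otimes>\<^sub>o ?G) \<otimes> ?A))) \<cdot> Asc G ?K (?H \<otimes>\<^sub>o ?G) ?l"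
   unfolding 6 by (simp add: interchange_ext)
  finally show ?thesis unfolding 5 .
 qed
 have "Ev d ?r \<cdot> ((mu g (h \<otimes>\<^sub>o k) \<cdot> ((mu h k \<otimes> idn ?G) \<cdot> ?i)) \<otimes> ?A)
   = Ev d (h \<otimes>\<^sub>o k) \<cdot> ((idn ((h \<otimes>\<^sub>o k)\<star>) \<otimes> rho g (h \<otimes>\<^sub>o k)) \<cdot> (Asc G ((h \<otimes>\<^sub>o k)\<star>) ?G ?r \<cdot> (((mu h k \<otimes> idn ?G) \<otimes> idn ?r) \<cdot> (?i \<otimes> ?A))))"
  by (simp add: ev_star_mu interchange)
 also have "... = Ev d (h \<otimes>\<^sub>o k) \<cdot> ((idn ((h \<otimes>\<^sub>o k)\<star>) \<otimes> rho g (h \<otimes>\<^sub>o k)) \<cdot> ((mu h k \<otimes> idn (?G \<otimes>\<^sub>o ?r)) \<cdot> (Asc G (?K \<otimes>\<^sub>o ?H) ?G ?r \<cdot> (?i \<otimes> ?A))))"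
  by (subst ext2[OF 2]) simp_all
 also have "... = (Ev d (h \<otimes>\<^sub>o k) \<cdot> (mu h k \<otimes> rho g (h \<otimes>\<^sub>o k))) \<cdot> (Asc G (?K \<otimes>\<^sub>o ?H) ?G ?r \<cdot> (?i \<otimes> ?A))"
  by (simp add: interchange_ext assoc)
 also have "Ev d (h \<otimes>\<^sub>o k) \<cdot> (mu h k \<otimes> rho g (h \<otimes>\<^sub>o k)) = Ev d k \<cdot> ((idn ?K \<otimes> rho h k) \<cdot> (Asc G ?K ?H (h \<otimes>\<^sub>o k) \<cdot> (idn (?K \<otimes>\<^sub>o ?H) \<otimes> rho g (h \<otimes>\<^sub>o k))))"
  using ev_star_mu[of h k "idn (?K \<otimes>\<^sub>o ?H)" "rho g (h \<otimes>\<^sub>o k)"] by simp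
 also have "(...) \<cdot> (Asc G (?K \<otimes>\<^sub>o ?H) ?G ?r \<cdot> (?i \<otimes> ?A)) = Ev d k \<cdot> ((idn ?K \<otimes> ?m) \<cdot> Asc G ?K (?H \<otimes>\<^sub>o ?G) ?l)"
  unfolding 3 by (simp add: assoc 4 interchange_ext interchange)
 finally show "Ev d (Tgt G ?A) \<cdot> ((st ?A \<cdot> (mu (g \<otimes>\<^sub>o h) k \<cdot> (idn ?K \<otimes> mu g h))) \<otimes> ?A) =
   Ev d (Tgt G ?A) \<cdot> ((mu g (h \<otimes>\<^sub>o k) \<cdot> ((mu h k \<otimes> idn ?G) \<cdot> ?i)) \<otimes> ?A)" using L by simp
qed auto

end

section \<open>Left translation\<close>

text \<open>
 Since \<open>g \<mapsto> g\<star>\<close> reverses tensor products, \<open>x \<mapsto> g\<star> \<otimes> x\<close> is a right action, whose coherence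
 isomorphisms are built from the inverses of those of the inverse functor.
\<close>

definition left_transl :: "('g, 'a, 'x) moncat_scheme => ('g, 'a) duality => ('g, 'a) transl" where
 "left_transl G d = \<lparr>TO = (\<lambda>g x. Dual d g \<otimes>\<^sub>o\<^sub>G x), TB = (\<lambda>g b. Idn G (Dual d g) \<otimes>\<^sub>G b),
   TN = (\<lambda>a x. star_arr G d a \<otimes>\<^sub>G Idn G x),
   TA = (\<lambda>g h x. Asc G (Dual d h) (Dual d g) x \<cdot>\<^sub>G (inv_arr G (star_mu G d g h) \<otimes>\<^sub>G Idn G x)),
   TU = (\<lambda>x. Lun G x \<cdot>\<^sub>G (inv_arr G (star_iota G d) \<otimes>\<^sub>G Idn G x))\<rparr>"

lemma left_transl_simps [simp]:
 "TO (left_transl G d) g x = Dual d g \<otimes>\<^sub>o\<^sub>G x" "TB (left_transl G d) g b = Idn G (Dual d g) \<otimes>\<^sub>G b"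
 "TN (left_transl G d) a x = star_arr G d a \<otimes>\<^sub>G Idn G x"
 "TA (left_transl G d) g h x = Asc G (Dual d h) (Dual d g) x \<cdot>\<^sub>G (inv_arr G (star_mu G d g h) \<otimes>\<^sub>G Idn G x)"
 "TU (left_transl G d) x = Lun G x \<cdot>\<^sub>G (inv_arr G (star_iota G d) \<otimes>\<^sub>G Idn G x)"
 by (simp_all add: left_transl_def)

context left_dual
begin

abbreviation mi where "mi g h \<equiv> iv (mu g h)"
abbreviation ii where "ii \<equiv> iv (io)"

lemma mi_nat:
 assumes [simp]: "a : Arr G" "b : Arr G"
 shows "(st b \<otimes> st a) \<cdot> mi (Src G a) (Src G b) = mi (Tgt G a) (Tgt G b) \<cdot> st (a \<otimes> b)"
 by (rule iso_square[symmetric]) (use star_mu_nat[OF assms] in auto)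

lemma mi_asc:
 assumes [simp]: "g : Obj G" "h : Obj G" "k : Obj G"
 shows "(idn (k\<star>) \<otimes> mi g h) \<cdot> mi (g \<otimes>\<^sub>o h) k =
  Asc G (k\<star>) (h\<star>) (g\<star>) \<cdot> ((mi h k \<otimes> idn (g\<star>)) \<cdot> (mi g (h \<otimes>\<^sub>o k) \<cdot> st (Asc G g h k)))"
proof -
 let ?s = "st (Asc G g h k)" and ?l = "mu (g \<otimes>\<^sub>o h) k \<cdot> (idn (k\<star>) \<otimes> mu g h)"
 let ?r = "(mu g (h \<otimes>\<^sub>o k) \<cdot> (mu h k \<otimes> idn (g\<star>))) \<cdot> iv (Asc G (k\<star>) (h\<star>) (g\<star>))"
 have i: "iv (idn (k\<star>) \<otimes> mu g h) = idn (k\<star>) \<otimes> mi g h"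
  "iv (mu h k \<otimes> idn (g\<star>)) = mi h k \<otimes> idn (g\<star>)" by (simp_all add: inv_ten)
 have "iv ?l = iv (?s \<cdot> ?l) \<cdot> ?s" by (simp add: inv_cmp assoc)
 also have "?s \<cdot> ?l = ?r" using star_asc[OF assms] by (simp add: assoc)
 finally show ?thesis by (simp add: inv_cmp i assoc)
qed

lemma mi_lun:
 assumes [simp]: "g : Obj G"
 shows "Run G (g\<star>) \<cdot> ((idn (g\<star>) \<otimes> ii) \<cdot> mi one g) = st (Lun G g)"
  "Lun G (g\<star>) \<cdot> ((ii \<otimes> idn (g\<star>)) \<cdot> mi g one) = st (Run G g)"
proof -
 have e: "mu one g \<cdot> ((idn (g\<star>) \<otimes> io) \<cdot> ((idn (g\<star>) \<otimes> ii) \<cdot> mi one g)) = idn ((one \<otimes>\<^sub>o g)\<star>)"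
  "mu g one \<cdot> ((io \<otimes> idn (g\<star>)) \<cdot> ((ii \<otimes> idn (g\<star>)) \<cdot> mi g one)) = idn ((g \<otimes>\<^sub>o one)\<star>)"
  by (simp_all add: interchange_ext)
 show "Run G (g\<star>) \<cdot> ((idn (g\<star>) \<otimes> ii) \<cdot> mi one g) = st (Lun G g)"
  unfolding star_lun[OF assms, symmetric] by (simp add: assoc e)
 show "Lun G (g\<star>) \<cdot> ((ii \<otimes> idn (g\<star>)) \<cdot> mi g one) = st (Run G g)"
  unfolding star_run[OF assms, symmetric] by (simp add: assoc e)
qed

lemma translation_left: "translation G (left_transl G d)"
proof
 let ?t = "left_transl G d"
 show "TB ?t h (TB ?t g b) \<cdot> TA ?t g h (Src G b) = TA ?t g h (Tgt G b) \<cdot> TB ?t (g \<otimes>\<^sub>o h) b"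
  if [simp]: "g : Obj G" "h : Obj G" "b : Arr G" for g h b
 proof -
  have "Asc G (h\<star>) (g\<star>) (Tgt G b) \<cdot> (idn (h\<star> \<otimes>\<^sub>o g\<star>) \<otimes> b) = (idn (h\<star>) \<otimes> (idn (g\<star>) \<otimes> b)) \<cdot> Asc G (h\<star>) (g\<star>) (Src G b)"
   using asc_nat'[of "idn (h\<star>)" "idn (g\<star>)" b "h\<star>" "g\<star>" "Tgt G b"] by simp
  from ext2[OF this, of "mi g h \<otimes> idn (Src G b)"] show ?thesis by (simp add: assoc interchange)
 qed
 show "TN ?t b (TO ?t (Tgt G a) x) \<cdot> (TB ?t (Src G b) (TN ?t a x) \<cdot> TA ?t (Src G a) (Src G b) x) =
   TA ?t (Tgt G a) (Tgt G b) x \<cdot> TN ?t (a \<otimes> b) x"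
  if [simp]: "a : Arr G" "b : Arr G" "x : Obj G" for a b x
 proof -
  let ?a = "st a" and ?b = "st b"
  have "Asc G ((Tgt G b)\<star>) ((Tgt G a)\<star>) x \<cdot> ((?b \<otimes> ?a) \<otimes> idn x) = (?b \<otimes> (?a \<otimes> idn x)) \<cdot> Asc G ((Src G b)\<star>) ((Src G a)\<star>) x"
   using asc_nat'[of ?b ?a "idn x"] by simp
  from ext2[OF this, of "mi (Src G a) (Src G b) \<otimes> idn x"] show ?thesis
   by (simp add: assoc interchange interchange_ext mi_nat)
 qed
 show "TB ?t k (TA ?t g h x) \<cdot> TA ?t (g \<otimes>\<^sub>o h) k x = TA ?t h k (TO ?t g x) \<cdot> (TA ?t g (h \<otimes>\<^sub>o k) x \<cdot> TN ?t (Asc G g h k) x)"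
  if [simp]: "g : Obj G" "h : Obj G" "k : Obj G" "x : Obj G" for g h k x
 proof -
  let ?G = "g\<star>" and ?H = "h\<star>" and ?K = "k\<star>" and ?s = "st (Asc G g h k)"
  have 1: "Asc G ?K (?H \<otimes>\<^sub>o ?G) x \<cdot> ((idn ?K \<otimes> mi g h) \<otimes> idn x) = (idn ?K \<otimes> (mi g h \<otimes> idn x)) \<cdot> Asc G ?K ((g \<otimes>\<^sub>o h)\<star>) x"
   using asc_nat'[of "idn ?K" "mi g h" "idn x"] by simp
  have 2: "Asc G (?K \<otimes>\<^sub>o ?H) ?G x \<cdot> ((mi h k \<otimes> idn ?G) \<otimes> idn x) = (mi h k \<otimes> idn (?G \<otimes>\<^sub>o x)) \<cdot> Asc G ((h \<otimes>\<^sub>o k)\<star>) ?G x"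
   using asc_nat'[of "mi h k" "idn ?G" "idn x"] by simp
  have "TB ?t k (TA ?t g h x) \<cdot> TA ?t (g \<otimes>\<^sub>o h) k x = (idn ?K \<otimes> Asc G ?H ?G x) \<cdot>
    ((idn ?K \<otimes> (mi g h \<otimes> idn x)) \<cdot> (Asc G ?K ((g \<otimes>\<^sub>o h)\<star>) x \<cdot> (mi (g \<otimes>\<^sub>o h) k \<otimes> idn x)))"
   by (simp add: assoc interchange_ext)
  also have "... = (idn ?K \<otimes> Asc G ?H ?G x) \<cdot> (Asc G ?K (?H \<otimes>\<^sub>o ?G) x \<cdot> (((idn ?K \<otimes> mi g h) \<cdot> mi (g \<otimes>\<^sub>o h) k) \<otimes> idn x))"
   by (subst ext2[OF 1[symmetric]]) (simp_all add: interchange)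
  also have "... = (idn ?K \<otimes> Asc G ?H ?G x) \<cdot> (Asc G ?K (?H \<otimes>\<^sub>o ?G) x \<cdot> ((Asc G ?K ?H ?G \<otimes> idn x) \<cdot>
    (((mi h k \<otimes> idn ?G) \<otimes> idn x) \<cdot> ((mi g (h \<otimes>\<^sub>o k) \<cdot> ?s) \<otimes> idn x))))"
   unfolding mi_asc[OF that(1-3)] by (simp add: interchange)
  also have "... = (Asc G ?K ?H (?G \<otimes>\<^sub>o x) \<cdot> Asc G (?K \<otimes>\<^sub>o ?H) ?G x) \<cdot> (((mi h k \<otimes> idn ?G) \<otimes> idn x) \<cdot> ((mi g (h \<otimes>\<^sub>o k) \<cdot> ?s) \<otimes> idn x))"
   by (subst pentagon') (simp_all add: assoc)
  also have "... = Asc G ?K ?H (?G \<otimes>\<^sub>o x) \<cdot> ((mi h k \<otimes> idn (?G \<otimes>\<^sub>o x)) \<cdot> (Asc G ((h \<otimes>\<^sub>o k)\<star>) ?G x \<cdot> ((mi g (h \<otimes>\<^sub>o k) \<cdot> ?s) \<otimes> idn x)))"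
   by (subst ext2[OF 2, symmetric]) (simp_all add: assoc)
  finally show ?thesis by (simp add: assoc interchange)
 qed
 show "b \<cdot> TU ?t (Src G b) = TU ?t (Tgt G b) \<cdot> TB ?t one b" if [simp]: "b : Arr G" for b
 proof -
  have "Lun G (Tgt G b) \<cdot> ((idn one \<otimes> b) \<cdot> (ii \<otimes> idn (Src G b))) = b \<cdot> (Lun G (Src G b) \<cdot> (ii \<otimes> idn (Src G b)))"
   by (rule ext2[OF lun_nat']) simp_all
  then show ?thesis by (simp add: assoc interchange)
 qed
 show "TB ?t g (TU ?t x) \<cdot> TA ?t one g x = TN ?t (Lun G g) x" if [simp]: "g : Obj G" "x : Obj G" for g x
 proof -
  have 1: "Asc G (g\<star>) one x \<cdot> ((idn (g\<star>) \<otimes> ii) \<otimes> idn x) = (idn (g\<star>) \<otimes> (ii \<otimes> idn x)) \<cdot> Asc G (g\<star>) (one\<star>) x"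
   using asc_nat'[of "idn (g\<star>)" ii "idn x"] by simp
  have "TB ?t g (TU ?t x) \<cdot> TA ?t one g x = (idn (g\<star>) \<otimes> Lun G x) \<cdot> ((idn (g\<star>) \<otimes> (ii \<otimes> idn x)) \<cdot> (Asc G (g\<star>) (one\<star>) x \<cdot> (mi one g \<otimes> idn x)))"
   by (simp add: assoc interchange_ext)
  also have "... = (idn (g\<star>) \<otimes> Lun G x) \<cdot> (Asc G (g\<star>) one x \<cdot> (((idn (g\<star>) \<otimes> ii) \<otimes> idn x) \<cdot> (mi one g \<otimes> idn x)))"
   by (subst ext2[OF 1[symmetric]]) simp_all
  also have "... = (Run G (g\<star>) \<otimes> idn x) \<cdot> (((idn (g\<star>) \<otimes> ii) \<otimes> idn x) \<cdot> (mi one g \<otimes> idn x))"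
   by (subst ext1[OF triangle]) simp_all
  also have "... = st (Lun G g) \<otimes> idn x" by (simp add: interchange mi_lun)
  finally show ?thesis by simp
 qed
 show "TU ?t (TO ?t g x) \<cdot> TA ?t g one x = TN ?t (Run G g) x" if [simp]: "g : Obj G" "x : Obj G" for g x
 proof -
  have 1: "Asc G one (g\<star>) x \<cdot> ((ii \<otimes> idn (g\<star>)) \<otimes> idn x) = (ii \<otimes> idn (g\<star> \<otimes>\<^sub>o x)) \<cdot> Asc G (one\<star>) (g\<star>) x"
   using asc_nat'[of ii "idn (g\<star>)" "idn x"] by simp
  have "TU ?t (TO ?t g x) \<cdot> TA ?t g one x = Lun G (g\<star> \<otimes>\<^sub>o x) \<cdot> ((ii \<otimes> idn (g\<star> \<otimes>\<^sub>o x)) \<cdot> (Asc G (one\<star>) (g\<star>) x \<cdot> (mi g one \<otimes> idn x)))"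
   by (simp add: assoc)
  also have "... = Lun G (g\<star> \<otimes>\<^sub>o x) \<cdot> (Asc G one (g\<star>) x \<cdot> (((ii \<otimes> idn (g\<star>)) \<otimes> idn x) \<cdot> (mi g one \<otimes> idn x)))"
   by (subst ext2[OF 1[symmetric]]) simp_all
  also have "... = (Lun G (g\<star>) \<otimes> idn x) \<cdot> (((ii \<otimes> idn (g\<star>)) \<otimes> idn x) \<cdot> (mi g one \<otimes> idn x))"
   by (subst ext1[OF lun_asc]) simp_all
  also have "... = st (Run G g) \<otimes> idn x" by (simp add: interchange mi_lun)
  finally show ?thesis by simp
 qed
qed (auto simp: interchange star_cmp)

text \<open>
 Every object is isomorphic to some \<open>g\<star>\<close>, namely with \<open>g\<close> an inverse of it, and \<open>a \<mapsto> a\<star>\<close> is bijective on arrows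
 because \<open>a\<star>\<close> and \<open>a\<close> determine each other through the evaluations.
\<close>

lemma torsor_left: "torsor G (left_transl G d)"
proof (rule torsor.intro[OF translation_left], unfold_locales)
 let ?t = "left_transl G d"
 show "\<exists>g \<in> Obj G. homs G (TO ?t g one) x \<noteq> {}" if x [simp]: "x : Obj G" for x
 proof -
  obtain g v w where g [simp]: "g : Obj G" and "v : isos G (x \<otimes>\<^sub>o g) one" and "w : isos G (g \<otimes>\<^sub>o x) one"
   by (rule obtain_inverse[OF x])
  then have [simp]: "v : Arr G" "Src G v = x \<otimes>\<^sub>o g" "Tgt G v = one" by (auto simp: isos_iff)
  have "iv (td x g v) \<cdot> Run G (g\<star>) : homs G (TO ?t g one) x" by (simp add: homs_iff)
  then show ?thesis using g by blast
 qed
 show "\<exists>a \<in> homs G g h. TN ?t a one = b" if gh: "g : Obj G" "h : Obj G" "b : homs G (TO ?t g one) (TO ?t h one)" for g h b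
 proof -
  note [simp] = gh(1,2)
  obtain s where s [simp]: "s : Arr G" "Src G s = g\<star>" "Tgt G s = h\<star>" and sb: "s \<otimes> idn one = b"
   by (rule ten_right_surj[of b "g\<star>" one "h\<star>"]) (use gh in "auto simp: homs_iff")
  obtain a where a [simp]: "a : Arr G" "Src G a = g" "Tgt G a = h"
   and e: "idn (g\<star>) \<otimes> a = iv (s \<otimes> idn h) \<cdot> (iv (Ev d h) \<cdot> Ev d g)"
   by (rule ten_left_surj[of "iv (s \<otimes> idn h) \<cdot> (iv (Ev d h) \<cdot> Ev d g)" "g\<star>" g h]) auto
  have "s \<otimes> a = (s \<otimes> idn h) \<cdot> (idn (g\<star>) \<otimes> a)" by (simp add: interchange)
  then have "Ev d h \<cdot> (s \<otimes> a) = Ev d g" unfolding e by simp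
  then have "st a = s" by (intro star_arr_eqI) simp_all
  then show ?thesis using sb by (intro bexI[of _ a]) (auto simp: homs_iff)
 qed
 show "a = a'" if "a : homs G g h" "a' : homs G g h" "TN ?t a one = TN ?t a' one" for a a' g h
 proof -
  have [simp]: "a : Arr G" "Src G a = g" "Tgt G a = h" "a' : Arr G" "Src G a' = g" "Tgt G a' = h" using that by (auto simp: homs_iff)
  have s: "st a = st a'" by (rule ten_unt_inj) (use that(3) in auto)
  have [simp]: "g : Obj G" "h : Obj G" using src_in[of a] tgt_in[of a] by auto
  have "Ev d h \<cdot> (st a \<otimes> a) = Ev d h \<cdot> (st a \<otimes> a')" using s star_arr(4)[of a' h] star_arr(4)[of a h] by simp
  then have "st a \<otimes> a = st a \<otimes> a'" by (rule iso_cancel_left) auto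
  then have "(iv (st a) \<otimes> idn h) \<cdot> (st a \<otimes> a) = (iv (st a) \<otimes> idn h) \<cdot> (st a \<otimes> a')"
   by simp
  then have "idn (g\<star>) \<otimes> a = idn (g\<star>) \<otimes> a'" by (simp add: interchange)
  then show ?thesis by (rule ten_left_inj) auto
 qed
qed

end

section \<open>The regular algebras\<close>

text \<open>
 The associator makes left and right translations commute. For the compatibilities it enters as
 a coherence isomorphism or its inverse.
\<close>

locale tannaka_dual = tannaka T G + L: left_dual G d
 for T :: "('k :: {alg_closed_field, field_char_0}, 'v) vec_tensor" and G :: "('g, 'a, 'x) moncat_scheme"
  and d :: "('g, 'a) duality"
begin

sublocale left: torsor G "left_transl G d" by (rule L.torsor_left)
sublocale right: torsor G "right_transl G" by (rule G.torsor_right)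

lemma commuting_left_right:
 "commuting_torsors T G (left_transl G d) (right_transl G) (\<lambda>g h x. inv_arr G (Asc G (Dual d h) x g))"
proof unfold_locales
 let ?s = "left_transl G d" and ?t = "right_transl G" and ?c = "\<lambda>g h x. inv_arr G (Asc G (Dual d h) x g)"
 have nat: "inv_arr G (Asc G x y z) \<cdot>\<^sub>G (e \<otimes>\<^sub>G (f \<otimes>\<^sub>G k)) = ((e \<otimes>\<^sub>G f) \<otimes>\<^sub>G k) \<cdot>\<^sub>G inv_arr G (Asc G x' y' z')"
  if "e : homs G x' x" "f : homs G y' y" "k : homs G z' z" for e f k x y z x' y' z'
  using G.inv_asc_nat[of e f k x y z] that by (auto simp: homs_iff)
 show "TB ?t g (TB ?s h b) \<cdot>\<^sub>G ?c g h (Src G b) = ?c g h (Tgt G b) \<cdot>\<^sub>G TB ?s h (TB ?t g b)"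
  if "g : Obj G" "h : Obj G" "b : Arr G" for g h b
  using nat[of "Idn G (Dual d h)" "Dual d h" "Dual d h" b "Src G b" "Tgt G b" "Idn G g" g g] that by (simp add: homs_iff)
 show "TB ?t g (TN ?s a x) \<cdot>\<^sub>G ?c g (Src G a) x = ?c g (Tgt G a) x \<cdot>\<^sub>G TN ?s a (TO ?t g x)"
  if "g : Obj G" "a : Arr G" "x : Obj G" for g a x
  using nat[of "star_arr G d a" "Dual d (Src G a)" "Dual d (Tgt G a)" "Idn G x" x x "Idn G g" g g] that by (simp add: homs_iff)
 show "TN ?t a (TO ?s h x) \<cdot>\<^sub>G ?c (Src G a) h x = ?c (Tgt G a) h x \<cdot>\<^sub>G TB ?s h (TN ?t a x)"
  if "a : Arr G" "h : Obj G" "x : Obj G" for a h x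
  using nat[of "Idn G (Dual d h)" "Dual d h" "Dual d h" "Idn G x" x x a "Src G a" "Tgt G a"] that by (simp add: homs_iff)
 show "TB ?t g (TA ?s h k x) \<cdot>\<^sub>G ?c g (h \<otimes>\<^sub>o\<^sub>G k) x =
   ?c g k (TO ?s h x) \<cdot>\<^sub>G (TB ?s k (?c g h x) \<cdot>\<^sub>G TA ?s h k (TO ?t g x))"
  if [simp]: "g : Obj G" "h : Obj G" "k : Obj G" "x : Obj G" for g h k x
 proof -
  let ?H = "Dual d h" and ?K = "Dual d k" and ?m = "inv_arr G (star_mu G d h k)"
  have 1: "((?m \<otimes>\<^sub>G Idn G x) \<otimes>\<^sub>G Idn G g) \<cdot>\<^sub>G inv_arr G (Asc G (Dual d (h \<otimes>\<^sub>o\<^sub>G k)) x g) =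
    inv_arr G (Asc G (?K \<otimes>\<^sub>o\<^sub>G ?H) x g) \<cdot>\<^sub>G (?m \<otimes>\<^sub>G Idn G (x \<otimes>\<^sub>o\<^sub>G g))"
   using nat[of ?m "Dual d (h \<otimes>\<^sub>o\<^sub>G k)" "?K \<otimes>\<^sub>o\<^sub>G ?H" "Idn G x" x x "Idn G g" g g] by (simp add: homs_iff)
  have 2: "(Asc G ?K ?H x \<otimes>\<^sub>G Idn G g) \<cdot>\<^sub>G inv_arr G (Asc G (?K \<otimes>\<^sub>o\<^sub>G ?H) x g) =
    inv_arr G (Asc G ?K (?H \<otimes>\<^sub>o\<^sub>G x) g) \<cdot>\<^sub>G ((Idn G ?K \<otimes>\<^sub>G inv_arr G (Asc G ?H x g)) \<cdot>\<^sub>G Asc G ?K ?H (x \<otimes>\<^sub>o\<^sub>G g))"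
   by (rule G.mixed_pentagon(1)) simp_all
  have "TB ?t g (TA ?s h k x) \<cdot>\<^sub>G ?c g (h \<otimes>\<^sub>o\<^sub>G k) x = (Asc G ?K ?H x \<otimes>\<^sub>G Idn G g) \<cdot>\<^sub>G
    (((?m \<otimes>\<^sub>G Idn G x) \<otimes>\<^sub>G Idn G g) \<cdot>\<^sub>G inv_arr G (Asc G (Dual d (h \<otimes>\<^sub>o\<^sub>G k)) x g))"
   by (simp add: G.interchange_ext)
  also have "... = ((Asc G ?K ?H x \<otimes>\<^sub>G Idn G g) \<cdot>\<^sub>G inv_arr G (Asc G (?K \<otimes>\<^sub>o\<^sub>G ?H) x g)) \<cdot>\<^sub>G (?m \<otimes>\<^sub>G Idn G (x \<otimes>\<^sub>o\<^sub>G g))"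
   unfolding 1 by (simp add: G.assoc)
  finally show ?thesis unfolding 2 by (simp add: G.assoc)
 qed
 show "TB ?t g (TU ?s x) \<cdot>\<^sub>G ?c g (Unt G) x = TU ?s (TO ?t g x)" if [simp]: "g : Obj G" "x : Obj G" for g x
 proof -
  let ?i = "inv_arr G (star_iota G d)"
  have "((?i \<otimes>\<^sub>G Idn G x) \<otimes>\<^sub>G Idn G g) \<cdot>\<^sub>G inv_arr G (Asc G (Dual d (Unt G)) x g) =
    inv_arr G (Asc G (Unt G) x g) \<cdot>\<^sub>G (?i \<otimes>\<^sub>G Idn G (x \<otimes>\<^sub>o\<^sub>G g))"
   using nat[of ?i "Dual d (Unt G)" "Unt G" "Idn G x" x x "Idn G g" g g] by (simp add: homs_iff)
  then have "TB ?t g (TU ?s x) \<cdot>\<^sub>G ?c g (Unt G) x = ((Lun G x \<otimes>\<^sub>G Idn G g) \<cdot>\<^sub>G inv_arr G (Asc G (Unt G) x g)) \<cdot>\<^sub>G (?i \<otimes>\<^sub>G Idn G (x \<otimes>\<^sub>o\<^sub>G g))"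
   by (simp add: G.assoc flip: G.interchange_ext[of _ _ "Idn G g" "Idn G g", simplified])
  then show ?thesis by (simp add: G.inv_triangle)
 qed
qed (simp_all add: G.inv_pentagon G.inv_triangle)

lemma commuting_right_left:
 "commuting_torsors T G (right_transl G) (left_transl G d) (\<lambda>g h x. Asc G (Dual d g) x h)"
proof unfold_locales
 let ?s = "right_transl G" and ?t = "left_transl G d" and ?c = "\<lambda>g h x. Asc G (Dual d g) x h"
 have nat: "(e \<otimes>\<^sub>G (f \<otimes>\<^sub>G k)) \<cdot>\<^sub>G Asc G x' y' z' = Asc G x y z \<cdot>\<^sub>G ((e \<otimes>\<^sub>G f) \<otimes>\<^sub>G k)"
  if "e : homs G x' x" "f : homs G y' y" "k : homs G z' z" for e f k x y z x' y' z'
  using G.asc_nat[OF that] by simp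
 show "TB ?t g (TB ?s h b) \<cdot>\<^sub>G ?c g h (Src G b) = ?c g h (Tgt G b) \<cdot>\<^sub>G TB ?s h (TB ?t g b)"
  if "g : Obj G" "h : Obj G" "b : Arr G" for g h b
  using nat[of "Idn G (Dual d g)" "Dual d g" "Dual d g" b "Src G b" "Tgt G b" "Idn G h" h h] that by (simp add: homs_iff)
 show "TB ?t g (TN ?s a x) \<cdot>\<^sub>G ?c g (Src G a) x = ?c g (Tgt G a) x \<cdot>\<^sub>G TN ?s a (TO ?t g x)"
  if "g : Obj G" "a : Arr G" "x : Obj G" for g a x
  using nat[of "Idn G (Dual d g)" "Dual d g" "Dual d g" "Idn G x" x x a "Src G a" "Tgt G a"] that by (simp add: homs_iff)
 show "TN ?t a (TO ?s h x) \<cdot>\<^sub>G ?c (Src G a) h x = ?c (Tgt G a) h x \<cdot>\<^sub>G TB ?s h (TN ?t a x)"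
  if "a : Arr G" "h : Obj G" "x : Obj G" for a h x
  using nat[of "star_arr G d a" "Dual d (Src G a)" "Dual d (Tgt G a)" "Idn G x" x x "Idn G h" h h] that by (simp add: homs_iff)
 show "TB ?t g (TA ?s h k x) \<cdot>\<^sub>G ?c g (h \<otimes>\<^sub>o\<^sub>G k) x =
   ?c g k (TO ?s h x) \<cdot>\<^sub>G (TB ?s k (?c g h x) \<cdot>\<^sub>G TA ?s h k (TO ?t g x))"
  if "g : Obj G" "h : Obj G" "k : Obj G" "x : Obj G" for g h k x
  using that by (simp add: G.mixed_pentagon(2))
 show "TA ?t g k (TO ?s h x) \<cdot>\<^sub>G ?c (g \<otimes>\<^sub>o\<^sub>G k) h x =
   TB ?t k (?c g h x) \<cdot>\<^sub>G (?c k h (TO ?t g x) \<cdot>\<^sub>G TB ?s h (TA ?t g k x))"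
  if [simp]: "g : Obj G" "k : Obj G" "h : Obj G" "x : Obj G" for g k h x
 proof -
  let ?G = "Dual d g" and ?K = "Dual d k" and ?m = "inv_arr G (star_mu G d g k)"
  have 1: "(?m \<otimes>\<^sub>G Idn G (x \<otimes>\<^sub>o\<^sub>G h)) \<cdot>\<^sub>G Asc G (Dual d (g \<otimes>\<^sub>o\<^sub>G k)) x h =
    Asc G (?K \<otimes>\<^sub>o\<^sub>G ?G) x h \<cdot>\<^sub>G ((?m \<otimes>\<^sub>G Idn G x) \<otimes>\<^sub>G Idn G h)"
   using nat[of ?m "Dual d (g \<otimes>\<^sub>o\<^sub>G k)" "?K \<otimes>\<^sub>o\<^sub>G ?G" "Idn G x" x x "Idn G h" h h] by (simp add: homs_iff)
  have "TA ?t g k (TO ?s h x) \<cdot>\<^sub>G ?c (g \<otimes>\<^sub>o\<^sub>G k) h x =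
    (Asc G ?K ?G (x \<otimes>\<^sub>o\<^sub>G h) \<cdot>\<^sub>G Asc G (?K \<otimes>\<^sub>o\<^sub>G ?G) x h) \<cdot>\<^sub>G ((?m \<otimes>\<^sub>G Idn G x) \<otimes>\<^sub>G Idn G h)"
   by (simp add: G.assoc 1)
  also have "... = (Idn G ?K \<otimes>\<^sub>G Asc G ?G x h) \<cdot>\<^sub>G (Asc G ?K (?G \<otimes>\<^sub>o\<^sub>G x) h \<cdot>\<^sub>G
    ((Asc G ?K ?G x \<otimes>\<^sub>G Idn G h) \<cdot>\<^sub>G ((?m \<otimes>\<^sub>G Idn G x) \<otimes>\<^sub>G Idn G h)))"
   by (subst G.pentagon') (simp_all add: G.assoc)
  finally show ?thesis by (simp add: G.interchange)
 qed
 show "TU ?t (TO ?s h x) \<cdot>\<^sub>G ?c (Unt G) h x = TB ?s h (TU ?t x)" if [simp]: "h : Obj G" "x : Obj G" for h x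
 proof -
  let ?i = "inv_arr G (star_iota G d)"
  have "(?i \<otimes>\<^sub>G Idn G (x \<otimes>\<^sub>o\<^sub>G h)) \<cdot>\<^sub>G Asc G (Dual d (Unt G)) x h = Asc G (Unt G) x h \<cdot>\<^sub>G ((?i \<otimes>\<^sub>G Idn G x) \<otimes>\<^sub>G Idn G h)"
   using nat[of ?i "Dual d (Unt G)" "Unt G" "Idn G x" x x "Idn G h" h h] by (simp add: homs_iff)
  then have "TU ?t (TO ?s h x) \<cdot>\<^sub>G ?c (Unt G) h x = (Lun G (x \<otimes>\<^sub>o\<^sub>G h) \<cdot>\<^sub>G Asc G (Unt G) x h) \<cdot>\<^sub>G ((?i \<otimes>\<^sub>G Idn G x) \<otimes>\<^sub>G Idn G h)"
   by (simp add: G.assoc)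
  then show ?thesis by (simp add: G.lun_asc G.interchange)
 qed
qed (simp_all add: G.run_asc)

end

lemma trans_tl:
 "rtransO G = tlO G (right_transl G)" "rtransA G D = tlA G D (right_transl G)"
 "ltransO G d = tlO G (left_transl G d)" "ltransA G d D = tlA G D (left_transl G d)"
 by (simp_all add: fun_eq_iff rtransO_def ltransO_def tlO_def rtransA_def ltransA_def tlA_def)

text \<open>
 Right translation \<open>F(h \<otimes> g)\<close> and left translation \<open>F(g\<star> \<otimes> h)\<close> of a functor are precomposition with
 the corresponding translations of the 2-group.
\<close>

lemma regular_reg_algebra:
 "right_regular G D = reg_algebra G D (right_transl G)" "left_regular G d D = reg_algebra G D (left_transl G d)"
proof -
 have "TA (right_transl G) g h = (\<lambda>x. inv_arr G (Asc G x g h))"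
  "TA (left_transl G d) g h = (\<lambda>x. Asc G (Dual d h) (Dual d g) x \<cdot>\<^sub>G (inv_arr G (star_mu G d g h) \<otimes>\<^sub>G Idn G x))"
  "TU (left_transl G d) = (\<lambda>x. Lun G x \<cdot>\<^sub>G (inv_arr G (star_iota G d) \<otimes>\<^sub>G Idn G x))" for g h
  by (simp_all add: fun_eq_iff)
 then show "right_regular G D = reg_algebra G D (right_transl G)" "left_regular G d D = reg_algebra G D (left_transl G d)"
  by (simp_all add: right_regular_def left_regular_def reg_algebra_def tlAsc_def[abs_def] tlUnt_def[abs_def] trans_tl)
qed

theorem proposition3p40:
 fixes G :: "('g, 'a) moncat"
  and d :: "('g, 'a) duality"
  and T :: "('k :: {alg_closed_field, field_char_0}, 'v) vec_tensor"
 assumes "finite_two_group G"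
  and "left_duality G d"
  and "is_vec_tensor T"
 shows "two_group_equivalence G (Aut_E3 G (left_regular G d (Vec T)))
      (right_translation G d (Vec T)) \<and>
     two_group_equivalence G (Aut_E3 G (right_regular G (Vec T)))
      (left_translation G d (Vec T))"
proof -
 interpret finite_two_group G by fact
 interpret tannaka_dual T G d by unfold_locales (use assms in auto)
 interpret LR: commuting_torsors T G "left_transl G d" "right_transl G" "\<lambda>g h x. inv_arr G (Asc G (Dual d h) x g)"
  by (rule commuting_left_right)
 interpret RL: commuting_torsors T G "right_transl G" "left_transl G d" "\<lambda>g h x. Asc G (Dual d g) x h"
  by (rule commuting_right_left)
 have "LR.trf = right_translation G d (Vec T)"
  by (simp add: LR.trf_def LR.cstr_def[abs_def] right_translation_def regular_reg_algebra trans_tl)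
 moreover have "RL.trf = left_translation G d (Vec T)"
  by (simp add: RL.trf_def RL.cstr_def[abs_def] left_translation_def regular_reg_algebra trans_tl)
 ultimately show ?thesis
  using LR.trf_equivalence RL.trf_equivalence
  by (simp add: regular_reg_algebra)
qed

end
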